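(* Let $(R,\mathfrak m)$ be a Noetherian local ring of dimension $d\geq 1$ with infinite residue field, let $s\ge 1$, and let $I_1,\ldots,I_s$ be $\mathfrak m$-primary ideals of $R$ with $\operatorname{grade}(I_1\cdots I_s)\geq 1$; write $\mathbf I=(I_1,\ldots,I_s)$. Let $\mathcal F=\{\mathcal F(\mathbf n)\}_{\mathbf n\in\mathbb Z^s}$ be an $\mathbf I$-admissible filtration of ideals in $R$ and let $\mathcal A=\{x_{ij}\in I_i : j=1,\ldots,d;\ i=1,\ldots,s\}$ be a complete reduction of $\mathcal F$. Then: (1) for all $\mathbf m\in\operatorname{reg}(G(\mathcal F))$, we have $\mathbf m+(d-1)\mathbf e\in\mathcal R_{\mathcal A}(\mathcal F)$; (2) if $\mathbf r\in\mathcal R_{\mathcal A}(\mathcal F)$, then $[H^d_{G(\mathcal F)_{++}}(G(\mathcal F))]_{\mathbf n}=0$ for all $\mathbf n\geq\mathbf r-(d-1)\mathbf e$, and hence $\mathbf r\in\operatorname{reg}^d(G(\mathcal F))$.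
   Context: Notation: $\mathbb N$ includes $0$; $\mathbf e=(1,\ldots,1)$, $\mathbf 0=(0,\ldots,0)$, and $\mathbf e_i\in\mathbb Z^s$ is the $i$-th standard basis vector. For $\mathbf m,\mathbf n\in\mathbb Z^s$, $\mathbf m\ge\mathbf n$ means $m_i\ge n_i$ for all $i$. For $\mathbf n\in\mathbb Z^s$, $\mathbf n^+=(\max\{0,n_1\},\ldots,\max\{0,n_s\})$ and $\mathbf I^{\mathbf n}=I_1^{n_1}\cdots I_s^{n_s}$, where $I_i^{n_i}=R$ if $n_i\le 0$. For $\mathbf p\in\mathbb N^s$, $|\mathbf p|=p_1+\cdots+p_s$. For an $\mathbb N^s$-graded ring $S=\bigoplus_{\mathbf n\ge\mathbf 0}S_{\mathbf n}$, $S_{++}=\bigoplus_{\mathbf n\ge\mathbf e}S_{\mathbf n}$. A $\mathbb Z^s$-graded $\mathbf I$-filtration is a family of ideals $\mathcal F=\{\mathcal F(\mathbf n)\}_{\mathbf n\in\mathbb Z^s}$ of $R$ with $\mathbf I^{\mathbf n}\subseteq\mathcal F(\mathbf n)$, $\mathcal F(\mathbf n)\mathcal F(\mathbf m)\subseteq\mathcal F(\mathbf n+\mathbf m)$, and $\mathcal F(\mathbf m)\subseteq\mathcal F(\mathbf n)$ whenever $\mathbf m\ge\mathbf n$. With indeterminates $t_1,\dots,t_s$ and $\mathbf t^{\mathbf n}=t_1^{n_1}\cdots t_s^{n_s}$, put $\mathcal R'(\mathcal F)=\bigoplus_{\mathbf n\in\mathbb Z^s}\mathcal F(\mathbf n)\mathbf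 t^{\mathbf n}$ and $\mathcal R'(\mathbf I)=\bigoplus_{\mathbf n\in\mathbb Z^s}\mathbf I^{\mathbf n}\mathbf t^{\mathbf n}$. $\mathcal F$ is $\mathbf I$-admissible if $\mathcal F(\mathbf n)=\mathcal F(\mathbf n^+)$ for all $\mathbf n\in\mathbb Z^s$ and $\mathcal R'(\mathcal F)$ is a finite $\mathcal R'(\mathbf I)$-module. Associated multigraded rings: $G(\mathcal F)=\bigoplus_{\mathbf n\in\mathbb N^s}\mathcal F(\mathbf n)/\mathcal F(\mathbf n+\mathbf e)$ and $G(\mathbf I)=\bigoplus_{\mathbf n\in\mathbb N^s}\mathbf I^{\mathbf n}/\mathbf I^{\mathbf n+\mathbf e}$; $G(\mathcal F)$ is also regarded as a (finitely generated) graded $G(\mathbf I)$-module. Regularity: let $S$ be a standard Noetherian $\mathbb N^s$-graded ring over a local ring $S_{\mathbf 0}$ and $M$ a finitely generated $\mathbb Z^s$-graded $S$-module. For $\mathbf m\in\mathbb Z^s$, $M$ is $\mathbf m$-regular if for all $\mathbf n\in\mathbb N^s$: (i) $[H^0_{S_{++}}(M)]_{\mathbf n+\mathbf m+\mathbf e_j}=0$ for all $j=1,\ldots,s$; (ii) $[H^i_{S_{++}}(M)]_{\mathbf n+\mathbf m-\mathbf p}=0$ for all $i\ge1$ and $\mathbf p\in\mathbb N^s$ with $|\mathbf p|=i-1$. Set $\operatorname{reg}(M)=\{\mathbf m\in\mathbb Z^s\mid M\text{ is }\mathbf m\text{-regular}\}$. For an integer $k\ge1$, $\operatorname{reg}^k(M)$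 is the set of $\mathbf m\in\mathbb Z^s$ such that $[H^i_{S_{++}}(M)]_{\mathbf n+\mathbf m-\mathbf p}=0$ for all $i\ge k$ and all $\mathbf n,\mathbf p\in\mathbb N^s$ with $|\mathbf p|=i-1$. For $\operatorname{reg}(G(\mathcal F))$ and $\operatorname{reg}^d(G(\mathcal F))$ take $S=G(\mathbf I)$. Complete reductions: a set $\mathcal A=\{x_{ij}\in I_i\mid j=1,\ldots,d;\ i=1,\ldots,s\}$ is a complete reduction of $\mathcal F$ if, with $y_j=x_{1j}\cdots x_{sj}$ for $j=1,\ldots,d$, there is $\mathbf m\in\mathbb N^s$ such that $(y_1,\ldots,y_d)\mathcal F(\mathbf n)=\mathcal F(\mathbf n+\mathbf e)$ for all $\mathbf n\ge\mathbf m$. A vector $\mathbf r\in\mathbb N^s$ is a complete reduction vector of $\mathcal F$ with respect to $\mathcal A$ if $(y_1,\ldots,y_d)\mathcal F(\mathbf n)=\mathcal F(\mathbf n+\mathbf e)$ for all $\mathbf n\ge\mathbf r$. $\mathcal R_{\mathcal A}(\mathcal F)\subseteq\mathbb N^s$ denotes the set of all such vectors. *)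

theory Defs
  imports "HOL-Algebra.Ring_Divisibility" "HOL-Algebra.Ideal_Product" "HOL-Algebra.Module"
    "HOL-Library.Function_Algebras" "HOL-Library.Extended_Nat"
begin

text \<open>
  Multi-indices in $\mathbb{Z}^s$ are functions of type \<open>'s \<Rightarrow> int\<close> for a type \<open>'s\<close> of class
  \<open>finite\<close> (so \<open>s = CARD('s) \<ge> 1\<close>), with the pointwise order and the pointwise operations of
  \<open>Function_Algebras\<close>.  In particular \<open>0\<close> and \<open>1\<close> are the vectors $(0,\ldots,0)$ and
  $(1,\ldots,1)$, and $\mathbb{N}^s$ is \<open>{n. 0 \<le> n}\<close>.
\<close>

definition unit_index :: "'s \<Rightarrow> 's \<Rightarrow> int" where
  "unit_index j = (\<lambda>k. if k = j then 1 else 0)"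


section \<open>Local rings, dimension, grade, primary ideals\<close>

definition local_ring :: "('a, 'b) ring_scheme \<Rightarrow> 'a set \<Rightarrow> bool" where
  "local_ring R m \<longleftrightarrow>
     cring R \<and> maximalideal m R \<and> (\<forall>m'. maximalideal m' R \<longrightarrow> m' = m)"

definition krull_dim :: "('a, 'b) ring_scheme \<Rightarrow> enat" where
  "krull_dim R = Sup {enat k | k. \<exists>P :: nat \<Rightarrow> 'a set.
     (\<forall>i\<le>k. primeideal (P i) R) \<and> (\<forall>i<k. P i \<subset> P (Suc i))}"

definition ideal_radical :: "('a, 'b) ring_scheme \<Rightarrow> 'a set \<Rightarrow> 'a set" where
  "ideal_radical R J = {a \<in> carrier R. \<exists>k::nat. a [^]\<^bsub>R\<^esub> k \<in> J}"

definition primary_to :: "('a, 'b) ring_scheme \<Rightarrow> 'a set \<Rightarrow> 'a set \<Rightarrow> bool" where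
  "primary_to R m J \<longleftrightarrow>
     ideal J R \<and> J \<noteq> carrier R \<and>
     (\<forall>a\<in>carrier R. \<forall>b\<in>carrier R. a \<otimes>\<^bsub>R\<^esub> b \<in> J \<longrightarrow> a \<in> J \<or> b \<in> ideal_radical R J) \<and>
     ideal_radical R J = m"

definition regular_sequence :: "('a, 'b) ring_scheme \<Rightarrow> 'a list \<Rightarrow> bool" where
  "regular_sequence R xs \<longleftrightarrow>
     set xs \<subseteq> carrier R \<and> Idl\<^bsub>R\<^esub> (set xs) \<noteq> carrier R \<and>
     (\<forall>i<length xs. \<forall>a\<in>carrier R.
        xs ! i \<otimes>\<^bsub>R\<^esub> a \<in> Idl\<^bsub>R\<^esub> (set (take i xs)) \<longrightarrow> a \<in> Idl\<^bsub>R\<^esub> (set (take i xs)))"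

definition grade :: "('a, 'b) ring_scheme \<Rightarrow> 'a set \<Rightarrow> enat" where
  "grade R J = Sup {enat (length xs) | xs. regular_sequence R xs \<and> set xs \<subseteq> J}"


section \<open>Filtrations of ideals\<close>

text \<open>The ideal $I_1^{n_1}\cdots I_s^{n_s}$, where $I_i^{n_i} = R$ for $n_i \le 0$.\<close>

definition multi_power ::
    "('a, 'b) ring_scheme \<Rightarrow> ('s::finite \<Rightarrow> 'a set) \<Rightarrow> ('s \<Rightarrow> int) \<Rightarrow> 'a set" where
  "multi_power R I n =
     (\<Otimes>\<^bsub>ideals_set R\<^esub> i\<in>UNIV. I i [^]\<^bsub>ideals_set R\<^esub> nat (n i))"

definition multi_filtration ::
    "('a, 'b) ring_scheme \<Rightarrow> ('s::finite \<Rightarrow> 'a set) \<Rightarrow> (('s \<Rightarrow> int) \<Rightarrow> 'a set) \<Rightarrow> bool" where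
  "multi_filtration R I F \<longleftrightarrow>
     (\<forall>n. ideal (F n) R) \<and>
     (\<forall>n. multi_power R I n \<subseteq> F n) \<and>
     (\<forall>n m. F n \<cdot>\<^bsub>R\<^esub> F m \<subseteq> F (n + m)) \<and>
     (\<forall>n m. n \<le> m \<longrightarrow> F m \<subseteq> F n)"

text \<open>
  The extended multi-Rees object $\bigoplus_{n \in \mathbb{Z}^s} F(n) t^n$: a polynomial
  $\sum_n u_n t^n$ is represented by its coefficient function \<open>u\<close>.  The convolution product
  serves both as the ring multiplication and as the scalar multiplication, so that the record is at
  the same time a ring, a module over itself, and (for an \<open>I\<close>-filtration \<open>F\<close>) a module over
  \<open>ext_rees R (multi_power R I)\<close>.
\<close>

definition rees_mult ::
    "('a, 'b) ring_scheme \<Rightarrow> (('s \<Rightarrow> int) \<Rightarrow> 'a) \<Rightarrow> (('s \<Rightarrow> int) \<Rightarrow> 'a) \<Rightarrow> ('s \<Rightarrow> int) \<Rightarrow> 'a"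
  where
  "rees_mult R u v = (\<lambda>n. \<Oplus>\<^bsub>R\<^esub> a\<in>{a. u a \<noteq> \<zero>\<^bsub>R\<^esub>}. u a \<otimes>\<^bsub>R\<^esub> v (n - a))"

definition ext_rees ::
    "('a, 'b) ring_scheme \<Rightarrow> (('s \<Rightarrow> int) \<Rightarrow> 'a set)
       \<Rightarrow> (('s \<Rightarrow> int) \<Rightarrow> 'a, ('s \<Rightarrow> int) \<Rightarrow> 'a) module" where
  "ext_rees R F =
     \<lparr>carrier = {u. (\<forall>n. u n \<in> F n) \<and> finite {n. u n \<noteq> \<zero>\<^bsub>R\<^esub>}},
      mult = rees_mult R,
      one = (\<lambda>n. if n = 0 then \<one>\<^bsub>R\<^esub> else \<zero>\<^bsub>R\<^esub>),
      zero = (\<lambda>n. \<zero>\<^bsub>R\<^esub>),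
      add = (\<lambda>u v n. u n \<oplus>\<^bsub>R\<^esub> v n),
      smult = rees_mult R\<rparr>"

definition finite_module ::
    "('g, 'b) ring_scheme \<Rightarrow> ('g, 'm, 'c) module_scheme \<Rightarrow> bool" where
  "finite_module S M \<longleftrightarrow>
     (\<exists>X. finite X \<and> X \<subseteq> carrier M \<and>
        (\<forall>u\<in>carrier M. \<exists>c\<in>X \<rightarrow> carrier S. u = (\<Oplus>\<^bsub>M\<^esub> x\<in>X. c x \<odot>\<^bsub>M\<^esub> x)))"

definition admissible_filtration ::
    "('a, 'b) ring_scheme \<Rightarrow> ('s::finite \<Rightarrow> 'a set) \<Rightarrow> (('s \<Rightarrow> int) \<Rightarrow> 'a set) \<Rightarrow> bool" where
  "admissible_filtration R I F \<longleftrightarrow>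
     multi_filtration R I F \<and>
     (\<forall>n. F n = F (\<lambda>i. max 0 (n i))) \<and>
     finite_module (ext_rees R (multi_power R I)) (ext_rees R F)"


section \<open>Complete reductions\<close>

text \<open>The ideal $(y_1,\ldots,y_d)$ with $y_j = x_{1j}\cdots x_{sj}$.\<close>

definition reduction_ideal ::
    "('a, 'b) ring_scheme \<Rightarrow> nat \<Rightarrow> ('s::finite \<Rightarrow> nat \<Rightarrow> 'a) \<Rightarrow> 'a set" where
  "reduction_ideal R d x = Idl\<^bsub>R\<^esub> ((\<lambda>j. \<Otimes>\<^bsub>R\<^esub> i\<in>UNIV. x i j) ` {1..d})"

definition reduction_vectors ::
    "('a, 'b) ring_scheme \<Rightarrow> nat \<Rightarrow> ('s::finite \<Rightarrow> nat \<Rightarrow> 'a) \<Rightarrow> (('s \<Rightarrow> int) \<Rightarrow> 'a set)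
       \<Rightarrow> ('s \<Rightarrow> int) set" where
  "reduction_vectors R d x F =
     {r. 0 \<le> r \<and> (\<forall>n\<ge>r. reduction_ideal R d x \<cdot>\<^bsub>R\<^esub> F n = F (n + 1))}"

definition complete_reduction ::
    "('a, 'b) ring_scheme \<Rightarrow> ('s::finite \<Rightarrow> 'a set) \<Rightarrow> nat \<Rightarrow> ('s \<Rightarrow> nat \<Rightarrow> 'a)
       \<Rightarrow> (('s \<Rightarrow> int) \<Rightarrow> 'a set) \<Rightarrow> bool" where
  "complete_reduction R I d x F \<longleftrightarrow>
     (\<forall>i. \<forall>j\<in>{1..d}. x i j \<in> I i) \<and>
     (\<exists>m. 0 \<le> m \<and> (\<forall>n\<ge>m. reduction_ideal R d x \<cdot>\<^bsub>R\<^esub> F n = F (n + 1)))"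


section \<open>Associated multigraded rings\<close>

text \<open>
  An element of $\bigoplus_{n \in \mathbb{N}^s} F(n)/F(n+e)$ is the family \<open>u\<close> of its components,
  \<open>u n\<close> being a coset of \<open>F (n + 1)\<close> in \<open>F n\<close>.  The product of the cosets $x + F(a+e)$ and
  $y + F(b+e)$ is $xy + F(a+b+e)$, and the same rule describes the action of $x + I^{a+e}$ on
  $y + F(b+e)$.  Hence \<open>gr_mult R F\<close> gives both the ring multiplication of \<open>assoc_graded R F\<close>
  and its structure as a module over itself and over \<open>assoc_graded R (multi_power R I)\<close>.
\<close>

definition gr_mult ::
    "('a, 'b) ring_scheme \<Rightarrow> (('s::finite \<Rightarrow> int) \<Rightarrow> 'a set) \<Rightarrow> (('s \<Rightarrow> int) \<Rightarrow> 'a set)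
       \<Rightarrow> (('s \<Rightarrow> int) \<Rightarrow> 'a set) \<Rightarrow> ('s \<Rightarrow> int) \<Rightarrow> 'a set" where
  "gr_mult R F u v =
     (\<lambda>n\<in>{0..}. \<Oplus>\<^bsub>R Quot F (n + 1)\<^esub> a\<in>{0..n}.
        (\<Union>x\<in>u a. \<Union>y\<in>v (n - a). F (n + 1) +>\<^bsub>R\<^esub> (x \<otimes>\<^bsub>R\<^esub> y)))"

definition assoc_graded ::
    "('a, 'b) ring_scheme \<Rightarrow> (('s::finite \<Rightarrow> int) \<Rightarrow> 'a set)
       \<Rightarrow> (('s \<Rightarrow> int) \<Rightarrow> 'a set, ('s \<Rightarrow> int) \<Rightarrow> 'a set) module" where
  "assoc_graded R F =
     \<lparr>carrier = {u \<in> (\<Pi>\<^sub>E n\<in>{0..}. (\<lambda>x. F (n + 1) +>\<^bsub>R\<^esub> x) ` F n).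
                    finite {n \<in> {0..}. u n \<noteq> F (n + 1)}},
      mult = gr_mult R F,
      one = (\<lambda>n\<in>{0..}. if n = 0 then F (n + 1) +>\<^bsub>R\<^esub> \<one>\<^bsub>R\<^esub> else F (n + 1)),
      zero = (\<lambda>n\<in>{0..}. F (n + 1)),
      add = (\<lambda>u v. \<lambda>n\<in>{0..}. u n <+>\<^bsub>R\<^esub> v n),
      smult = gr_mult R F\<rparr>"

text \<open>The component of degree \<open>n \<in> \<int>\<^sup>s\<close>; it is zero unless \<open>0 \<le> n\<close>.\<close>

definition gr_component ::
    "('a, 'b) ring_scheme \<Rightarrow> (('s::finite \<Rightarrow> int) \<Rightarrow> 'a set) \<Rightarrow> ('s \<Rightarrow> int)
       \<Rightarrow> (('s \<Rightarrow> int) \<Rightarrow> 'a set) set" where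
  "gr_component R F n =
     {u \<in> carrier (assoc_graded R F). \<forall>k\<in>{0..}. k \<noteq> n \<longrightarrow> u k = F (k + 1)}"


section \<open>Multigraded local cohomology\<close>

text \<open>
  A multigraded ring is given by a ring \<open>S\<close> and the family \<open>gS\<close> of its homogeneous components, a
  multigraded \<open>S\<close>-module by a module \<open>M\<close> and the family \<open>gM\<close> of its components.

  Local cohomology with support in a finitely generated homogeneous ideal \<open>J\<close> is the cohomology of
  the extended Cech complex
  \[ 0 \to M \to \bigoplus_i M_{f_i} \to \bigoplus_{i<j} M_{f_i f_j} \to \cdots \to
       M_{f_1 \cdots f_r} \to 0 \]
  on homogeneous generators $f_1,\ldots,f_r$ of \<open>J\<close>.  The terms are graded and the differentials
  have degree zero, so the degree \<open>n\<close> component of the cohomology is the cohomology of the degree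
  \<open>n\<close> strand of the complex.
\<close>

text \<open>The class $x/t$ in $T^{-1}M$, as a set of pairs.\<close>

definition fraction ::
    "('g, 'b) ring_scheme \<Rightarrow> ('g, 'm, 'c) module_scheme \<Rightarrow> 'g set \<Rightarrow> 'm \<Rightarrow> 'g \<Rightarrow> ('m \<times> 'g) set"
  where
  "fraction S M T x t =
     {(x', t'). x' \<in> carrier M \<and> t' \<in> T \<and>
        (\<exists>w\<in>T. (w \<otimes>\<^bsub>S\<^esub> t') \<odot>\<^bsub>M\<^esub> x = (w \<otimes>\<^bsub>S\<^esub> t) \<odot>\<^bsub>M\<^esub> x')}"

text \<open>The fields \<open>mult\<close> and \<open>one\<close> of a module record carry no meaning.\<close>

definition localization ::
    "('g, 'b) ring_scheme \<Rightarrow> ('g, 'm, 'c) module_scheme \<Rightarrow> 'g set \<Rightarrow> ('g, ('m \<times> 'g) set) module"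
  where
  "localization S M T =
     \<lparr>carrier = {fraction S M T x t | x t. x \<in> carrier M \<and> t \<in> T},
      mult = undefined,
      one = undefined,
      zero = fraction S M T \<zero>\<^bsub>M\<^esub> \<one>\<^bsub>S\<^esub>,
      add = (\<lambda>A B. \<Union>(x, t)\<in>A. \<Union>(y, w)\<in>B.
               fraction S M T ((w \<odot>\<^bsub>M\<^esub> x) \<oplus>\<^bsub>M\<^esub> (t \<odot>\<^bsub>M\<^esub> y)) (t \<otimes>\<^bsub>S\<^esub> w)),
      smult = (\<lambda>a A. \<Union>(x, t)\<in>A. fraction S M T (a \<odot>\<^bsub>M\<^esub> x) t)\<rparr>"

definition localization_component ::
    "('g, 'b) ring_scheme \<Rightarrow> (('s \<Rightarrow> int) \<Rightarrow> 'g set) \<Rightarrow> ('g, 'm, 'c) module_scheme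
       \<Rightarrow> (('s \<Rightarrow> int) \<Rightarrow> 'm set) \<Rightarrow> 'g set \<Rightarrow> ('s \<Rightarrow> int) \<Rightarrow> ('m \<times> 'g) set set" where
  "localization_component S gS M gM T n =
     {fraction S M T x t | x t a. t \<in> T \<and> t \<in> gS a \<and> x \<in> gM (n + a)}"

text \<open>The canonical map $T'^{-1}M \to T^{-1}M$ for $T' \subseteq T$.\<close>

definition localization_map ::
    "('g, 'b) ring_scheme \<Rightarrow> ('g, 'm, 'c) module_scheme \<Rightarrow> 'g set \<Rightarrow> ('m \<times> 'g) set \<Rightarrow> ('m \<times> 'g) set"
  where
  "localization_map S M T A = (\<Union>(x, t)\<in>A. fraction S M T x t)"

text \<open>
  The multiplicative set generated by the \<open>f\<^sub>i\<close> with \<open>i \<in> \<sigma>\<close>.  Inverting it is the same as inverting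
  the single element $\prod_{i\in\sigma} f_i$, and the sets are nested along inclusions.
\<close>

definition mult_set :: "('g, 'b) ring_scheme \<Rightarrow> 'g list \<Rightarrow> nat set \<Rightarrow> 'g set" where
  "mult_set S fs \<sigma> = {\<Otimes>\<^bsub>S\<^esub> i\<in>\<sigma>. fs ! i [^]\<^bsub>S\<^esub> a i | a :: nat \<Rightarrow> nat. True}"

definition cech_faces :: "'g list \<Rightarrow> nat \<Rightarrow> nat set set" where
  "cech_faces fs i = {\<sigma>. \<sigma> \<subseteq> {..<length fs} \<and> card \<sigma> = i}"

definition cech_cochains ::
    "('g, 'b) ring_scheme \<Rightarrow> (('s \<Rightarrow> int) \<Rightarrow> 'g set) \<Rightarrow> ('g, 'm, 'c) module_scheme
       \<Rightarrow> (('s \<Rightarrow> int) \<Rightarrow> 'm set) \<Rightarrow> 'g list \<Rightarrow> nat \<Rightarrow> ('s \<Rightarrow> int)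
       \<Rightarrow> (nat set \<Rightarrow> ('m \<times> 'g) set) monoid" where
  "cech_cochains S gS M gM fs i n =
     \<lparr>carrier = (\<Pi>\<^sub>E \<sigma>\<in>cech_faces fs i. localization_component S gS M gM (mult_set S fs \<sigma>) n),
      mult = (\<lambda>c c'. \<lambda>\<sigma>\<in>cech_faces fs i. c \<sigma> \<oplus>\<^bsub>localization S M (mult_set S fs \<sigma>)\<^esub> c' \<sigma>),
      one = (\<lambda>\<sigma>\<in>cech_faces fs i. \<zero>\<^bsub>localization S M (mult_set S fs \<sigma>)\<^esub>)\<rparr>"

definition cech_diff ::
    "('g, 'b) ring_scheme \<Rightarrow> ('g, 'm, 'c) module_scheme \<Rightarrow> 'g list \<Rightarrow> nat
       \<Rightarrow> (nat set \<Rightarrow> ('m \<times> 'g) set) \<Rightarrow> nat set \<Rightarrow> ('m \<times> 'g) set" where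
  "cech_diff S M fs i c =
     (\<lambda>\<tau>\<in>cech_faces fs (Suc i).
        let L = localization S M (mult_set S fs \<tau>) in
        \<Oplus>\<^bsub>L\<^esub> j\<in>\<tau>.
          let z = localization_map S M (mult_set S fs \<tau>) (c (\<tau> - {j})) in
          if even (card {k \<in> \<tau>. k < j}) then z else \<ominus>\<^bsub>L\<^esub> z)"

definition cech_cocycles ::
    "('g, 'b) ring_scheme \<Rightarrow> (('s \<Rightarrow> int) \<Rightarrow> 'g set) \<Rightarrow> ('g, 'm, 'c) module_scheme
       \<Rightarrow> (('s \<Rightarrow> int) \<Rightarrow> 'm set) \<Rightarrow> 'g list \<Rightarrow> nat \<Rightarrow> ('s \<Rightarrow> int)
       \<Rightarrow> (nat set \<Rightarrow> ('m \<times> 'g) set) set" where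
  "cech_cocycles S gS M gM fs i n =
     {c \<in> carrier (cech_cochains S gS M gM fs i n).
        cech_diff S M fs i c = \<one>\<^bsub>cech_cochains S gS M gM fs (Suc i) n\<^esub>}"

definition cech_coboundaries ::
    "('g, 'b) ring_scheme \<Rightarrow> (('s \<Rightarrow> int) \<Rightarrow> 'g set) \<Rightarrow> ('g, 'm, 'c) module_scheme
       \<Rightarrow> (('s \<Rightarrow> int) \<Rightarrow> 'm set) \<Rightarrow> 'g list \<Rightarrow> nat \<Rightarrow> ('s \<Rightarrow> int)
       \<Rightarrow> (nat set \<Rightarrow> ('m \<times> 'g) set) set" where
  "cech_coboundaries S gS M gM fs i n =
     (case i of
        0 \<Rightarrow> {\<one>\<^bsub>cech_cochains S gS M gM fs 0 n\<^esub>}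
      | Suc k \<Rightarrow> cech_diff S M fs k ` carrier (cech_cochains S gS M gM fs k n))"

definition cech_cohomology ::
    "('g, 'b) ring_scheme \<Rightarrow> (('s \<Rightarrow> int) \<Rightarrow> 'g set) \<Rightarrow> ('g, 'm, 'c) module_scheme
       \<Rightarrow> (('s \<Rightarrow> int) \<Rightarrow> 'm set) \<Rightarrow> 'g list \<Rightarrow> nat \<Rightarrow> ('s \<Rightarrow> int)
       \<Rightarrow> (nat set \<Rightarrow> ('m \<times> 'g) set) set monoid" where
  "cech_cohomology S gS M gM fs i n =
     (cech_cochains S gS M gM fs i n)\<lparr>carrier := cech_cocycles S gS M gM fs i n\<rparr>
       Mod cech_coboundaries S gS M gM fs i n"

definition homogeneous_generators ::
    "('g, 'b) ring_scheme \<Rightarrow> (('s \<Rightarrow> int) \<Rightarrow> 'g set) \<Rightarrow> 'g set \<Rightarrow> 'g list \<Rightarrow> bool" where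
  "homogeneous_generators S gS J fs \<longleftrightarrow> set fs \<subseteq> (\<Union>a. gS a) \<and> Idl\<^bsub>S\<^esub> (set fs) = J"

text \<open>
  The degree \<open>n\<close> component of $H^i_J(M)$.  Up to isomorphism it does not depend on the chosen
  generators; a finite list of homogeneous generators exists whenever \<open>S\<close> is Noetherian and \<open>J\<close> is
  homogeneous.
\<close>

definition local_cohomology ::
    "('g, 'b) ring_scheme \<Rightarrow> (('s \<Rightarrow> int) \<Rightarrow> 'g set) \<Rightarrow> 'g set \<Rightarrow> ('g, 'm, 'c) module_scheme
       \<Rightarrow> (('s \<Rightarrow> int) \<Rightarrow> 'm set) \<Rightarrow> nat \<Rightarrow> ('s \<Rightarrow> int)
       \<Rightarrow> (nat set \<Rightarrow> ('m \<times> 'g) set) set monoid" where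
  "local_cohomology S gS J M gM i n =
     cech_cohomology S gS M gM (SOME fs. homogeneous_generators S gS J fs) i n"

text \<open>The ideal $S_{++} = \bigoplus_{n \ge e} S_n$.\<close>

definition irrelevant_ideal ::
    "('g, 'b) ring_scheme \<Rightarrow> (('s \<Rightarrow> int) \<Rightarrow> 'g set) \<Rightarrow> 'g set" where
  "irrelevant_ideal S gS =
     {\<Oplus>\<^bsub>S\<^esub> n\<in>A. u n | A u. finite A \<and> A \<subseteq> {1..} \<and> (\<forall>n\<in>A. u n \<in> gS n)}"

text \<open>$[H^i_{S_{++}}(M)]_n = 0$\<close>

definition lc_vanishes ::
    "('g, 'b) ring_scheme \<Rightarrow> (('s \<Rightarrow> int) \<Rightarrow> 'g set) \<Rightarrow> ('g, 'm, 'c) module_scheme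
       \<Rightarrow> (('s \<Rightarrow> int) \<Rightarrow> 'm set) \<Rightarrow> nat \<Rightarrow> ('s \<Rightarrow> int) \<Rightarrow> bool" where
  "lc_vanishes S gS M gM i n \<longleftrightarrow>
     (let H = local_cohomology S gS (irrelevant_ideal S gS) M gM i n in carrier H = {\<one>\<^bsub>H\<^esub>})"


section \<open>Regularity\<close>

definition reg ::
    "('g, 'b) ring_scheme \<Rightarrow> (('s::finite \<Rightarrow> int) \<Rightarrow> 'g set) \<Rightarrow> ('g, 'm, 'c) module_scheme
       \<Rightarrow> (('s \<Rightarrow> int) \<Rightarrow> 'm set) \<Rightarrow> ('s \<Rightarrow> int) set" where
  "reg S gS M gM =
     {m. \<forall>n\<ge>0.
        (\<forall>j. lc_vanishes S gS M gM 0 (n + m + unit_index j)) \<and>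
        (\<forall>i\<ge>1. \<forall>p\<ge>0. (\<Sum>k\<in>UNIV. p k) = int i - 1 \<longrightarrow> lc_vanishes S gS M gM i (n + m - p))}"

definition reg_from ::
    "nat \<Rightarrow> ('g, 'b) ring_scheme \<Rightarrow> (('s::finite \<Rightarrow> int) \<Rightarrow> 'g set) \<Rightarrow> ('g, 'm, 'c) module_scheme
       \<Rightarrow> (('s \<Rightarrow> int) \<Rightarrow> 'm set) \<Rightarrow> ('s \<Rightarrow> int) set" where
  "reg_from k S gS M gM =
     {m. \<forall>i\<ge>k. \<forall>n\<ge>0. \<forall>p\<ge>0. (\<Sum>l\<in>UNIV. p l) = int i - 1
            \<longrightarrow> lc_vanishes S gS M gM i (n + m - p)}"

end

theory Submission
  imports Defs
begin

text \<open>
  Let $S$ be $G(I)$ or $G(F)$, $M = G(F)$, $f$ a list of homogeneous generators of $S_{++}$, and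
  $y_1,\ldots,y_d$ the classes of the products $x_{1j}\cdots x_{sj}$ in degree $e$.  As $(y)M$ agrees with $M$
  in large degrees, a graded form of Nakayama's lemma shows that inverting any $f_i$ makes $(y)$
  act as the unit ideal on $M$, while $(y) \subseteq (f)$.

  For (1), consider the double complex formed by the Cech complex on $f$ and the Koszul complex on $y$.
  The Koszul directions are exact once some $f_i$ is inverted.  If $H^i(M)$ vanishes in degree $\nu - ie$ for
  all $i \le d$, a staircase argument makes the Koszul complex of $M$ exact at its last place in
  degree $\nu$, that is, $M_\nu = (y) M_{\nu - e}$.  Hence $F(n + e) = (y) F(n) + F(n + 2e)$ for all
  $n \ge m + (d - 1)e$; iterating reaches degrees where $F(k + e) = (y) F(k)$ is known.

  For (2), the same argument with the Cech complexes on $f$ and on $y$ reduces the vanishing to the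
  complex on $y$, which has length $d$, and whose last cohomology vanishes because every element of $M$
  of large enough degree lies in $(y_1^k,\ldots,y_d^k) M$ by the pigeonhole principle.
\<close>

text \<open>\<open>lc_vanishes\<close> evaluates the Cech complex on one list picked by
  \<open>SOME\<close>, so \<open>f\<close> cannot simply be exchanged for \<open>y\<close>. Instead
  both lists span a single cube, whose directions may be split into two sets at will. Localisation
  and multiplication enter it through the same two axioms, so contraction is argued once, with
  powers of elements in place of localised complexes. The cochains of all faces live in one abelian
  group; a place in a complex is a support condition.

  Admissibility enters through a box \<open>N\<close>: with \<open>t = inf n N\<close>, the ideal
  \<open>F n\<close> equals \<open>I^(n - t) F t\<close>. Finite generation of $G(F)$ and of the
  irrelevant ideal is read off from it.

  In (1) it must also be shown that \<open>m + (d - 1)e\<close> has no negative entry. Otherwise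
  some \<open>F (n + 1)\<close> would be zero by Nakayama's lemma over the local ring, against the
  nonzerodivisor that the grade provides.

  Regularity is taken over $G(I)$ but the vanishing in (2) over $G(F)$; hence a pair of filtrations
  \<open>E\<close>, \<open>F\<close> with \<open>E\<close> acting on \<open>F\<close>, used once for
  the powers of \<open>I\<close> and once for \<open>E = F\<close>.\<close>

definition additive_map :: "('a, 'b) ring_scheme \<Rightarrow> ('c, 'd) ring_scheme \<Rightarrow> ('a \<Rightarrow> 'c) \<Rightarrow> bool" where
  "additive_map G H f \<longleftrightarrow> f \<in> carrier G \<rightarrow> carrier H \<and>
     (\<forall>x\<in>carrier G. \<forall>y\<in>carrier G. f (x \<oplus>\<^bsub>G\<^esub> y) = f x \<oplus>\<^bsub>H\<^esub> f y)"

lemma additive_map_closed: "additive_map G H f \<Longrightarrow> x \<in> carrier G \<Longrightarrow> f x \<in> carrier H"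
  by (auto simp: additive_map_def)

lemma additive_map_add:
  "additive_map G H f \<Longrightarrow> x \<in> carrier G \<Longrightarrow> y \<in> carrier G \<Longrightarrow> f (x \<oplus>\<^bsub>G\<^esub> y) = f x \<oplus>\<^bsub>H\<^esub> f y"
  by (auto simp: additive_map_def)

lemma additive_map_zero:
  assumes "abelian_group G" "abelian_group H" "additive_map G H f"
  shows "f \<zero>\<^bsub>G\<^esub> = \<zero>\<^bsub>H\<^esub>"
proof -
  interpret G: abelian_group G by fact
  interpret H: abelian_group H by fact
  have "f \<zero>\<^bsub>G\<^esub> \<oplus>\<^bsub>H\<^esub> f \<zero>\<^bsub>G\<^esub> = f \<zero>\<^bsub>G\<^esub>"
    by (simp flip: additive_map_add[OF assms(3)])
  moreover have "f \<zero>\<^bsub>G\<^esub> \<in> carrier H"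
    using assms(3) additive_map_closed by fastforce
  ultimately show ?thesis by (simp add: H.add.l_cancel_one)
qed

lemma additive_map_neg:
  assumes "abelian_group G" "abelian_group H" "additive_map G H f" "x \<in> carrier G"
  shows "f (\<ominus>\<^bsub>G\<^esub> x) = \<ominus>\<^bsub>H\<^esub> f x"
proof -
  interpret G: abelian_group G by fact
  interpret H: abelian_group H by fact
  have "f (\<ominus>\<^bsub>G\<^esub> x) \<oplus>\<^bsub>H\<^esub> f x = f (\<ominus>\<^bsub>G\<^esub> x \<oplus>\<^bsub>G\<^esub> x)"
    using assms by (simp add: additive_map_add)
  also have "\<dots> = \<zero>\<^bsub>H\<^esub>" using assms by (simp add: G.l_neg additive_map_zero)
  finally show ?thesis
    using H.minus_equality[of "f (\<ominus>\<^bsub>G\<^esub> x)" "f x"] assms additive_map_closed[OF assms(3)] by simp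
qed

lemma additive_map_minus:
  assumes "abelian_group G" "abelian_group H" "additive_map G H f" "x \<in> carrier G" "y \<in> carrier G"
  shows "f (x \<ominus>\<^bsub>G\<^esub> y) = f x \<ominus>\<^bsub>H\<^esub> f y"
  using assms by (simp add: a_minus_def additive_map_add additive_map_neg abelian_group.a_inv_closed)

lemma additive_map_finsum:
  assumes "abelian_group G" "abelian_group H" "additive_map G H f" "g \<in> A \<rightarrow> carrier G"
  shows "f (\<Oplus>\<^bsub>G\<^esub> i\<in>A. g i) = (\<Oplus>\<^bsub>H\<^esub> i\<in>A. f (g i))"
proof -
  interpret G: abelian_group G by fact
  interpret H: abelian_group H by fact
  have z: "f \<zero>\<^bsub>G\<^esub> = \<zero>\<^bsub>H\<^esub>" using assms(1-3) by (rule additive_map_zero)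
  show ?thesis using assms(4)
  proof (induction A rule: infinite_finite_induct)
    case (insert x A)
    moreover have "f (\<Oplus>\<^bsub>G\<^esub> i\<in>insert x A. g i) = f (g x \<oplus>\<^bsub>G\<^esub> (\<Oplus>\<^bsub>G\<^esub> i\<in>A. g i))"
      using insert by (subst G.finsum_insert) auto
    moreover have "(\<Oplus>\<^bsub>H\<^esub> i\<in>insert x A. f (g i)) = f (g x) \<oplus>\<^bsub>H\<^esub> (\<Oplus>\<^bsub>H\<^esub> i\<in>A. f (g i))"
      using insert additive_map_closed[OF assms(3)] by (subst H.finsum_insert) auto
    moreover have "(\<Oplus>\<^bsub>G\<^esub> i\<in>A. g i) \<in> carrier G" using insert by auto
    ultimately show ?case using additive_map_add[OF assms(3)] by auto
  qed (simp_all add: z)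
qed

text \<open>Bare closure conditions make it serve homogeneous components, cochain groups and ideals
  alike; a sum over an infinite set is \<open>\<zero>\<close> and causes no exception.\<close>

lemma (in abelian_group) subgroup_finsum_closed:
  assumes "\<zero> \<in> U" "\<And>x y. x \<in> U \<Longrightarrow> y \<in> U \<Longrightarrow> x \<oplus> y \<in> U" "U \<subseteq> carrier G" "\<And>i. i \<in> A \<Longrightarrow> g i \<in> U"
  shows "(\<Oplus>i\<in>A. g i) \<in> U"
  using assms(4)
proof (induction A rule: infinite_finite_induct)
  case (insert x A)
  then have "g x \<in> U" "(\<Oplus>i\<in>A. g i) \<in> U" "g \<in> A \<rightarrow> carrier G" "g x \<in> carrier G"
    using assms(3) by (auto simp: Pi_iff)
  then show ?case using insert(1,2) assms(2) by (simp add: finsum_insert)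
qed (simp_all add: assms(1))

lemma (in abelian_group) minus_eq_zeroD:
  assumes "x \<ominus> y = \<zero>" "x \<in> carrier G" "y \<in> carrier G"
  shows "x = y"
proof -
  have "x = (x \<ominus> y) \<oplus> y" using assms(2,3) by (simp add: a_minus_def a_assoc l_neg)
  then show ?thesis using assms by simp
qed

text \<open>
  Exactness passes from one differential to the other along an antidiagonal, so that no spectral
  sequence is needed.
\<close>

locale anticommuting_differentials = abelian_group G for G (structure) +
  fixes a b :: "'a \<Rightarrow> 'a" and C :: "int \<Rightarrow> int \<Rightarrow> 'a set"
  assumes a_map: "additive_map G G a" and b_map: "additive_map G G b"
    and aa: "z \<in> carrier G \<Longrightarrow> a (a z) = \<zero>" and bb: "z \<in> carrier G \<Longrightarrow> b (b z) = \<zero>"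
    and ab: "z \<in> carrier G \<Longrightarrow> a (b z) = \<ominus> b (a z)"
    and C_sub: "C p q \<subseteq> carrier G"
    and C_minus: "z \<in> C p q \<Longrightarrow> w \<in> C p q \<Longrightarrow> z \<ominus> w \<in> C p q"
    and C_zero: "\<zero> \<in> C p q"
    and C_neg: "C (- 1) q = {\<zero>}"
    and aC: "z \<in> C p q \<Longrightarrow> a z \<in> C (p + 1) q"
    and bC: "z \<in> C p q \<Longrightarrow> b z \<in> C p (q + 1)"
begin

definition exact_a :: "int \<Rightarrow> int \<Rightarrow> bool" where
  "exact_a p q \<longleftrightarrow> (\<forall>z\<in>C p q. a z = \<zero> \<longrightarrow> (\<exists>h\<in>C (p - 1) q. z = a h))"

definition exact_b :: "int \<Rightarrow> int \<Rightarrow> bool" where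
  "exact_b p q \<longleftrightarrow> (\<forall>z\<in>C p q. b z = \<zero> \<longrightarrow> (\<exists>h\<in>C p (q - 1). z = b h))"

text \<open>Induction along the antidiagonal towards \<open>p = - 1\<close>, where the group is
  zero. \<open>b z\<close> is an \<open>a\<close>-cycle, hence \<open>a z'\<close> with
  \<open>z'\<close> one step further on. Anticommutation gives
  \<open>a (b z') = - b (a z') = - b (b z) = 0\<close>, so the induction hypothesis corrects
  \<open>z'\<close> to a \<open>b\<close>-cycle \<open>z' - a w'\<close>. This cycle is some
  \<open>b w\<close>, and then \<open>b z = a (b w) = - b (a w)\<close>.\<close>

lemma staircase_step:
  fixes p q :: int
  assumes exa: "\<And>k. 0 \<le> k \<Longrightarrow> k \<le> i \<Longrightarrow> exact_a (i - k) (k + 1)"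
    and exb: "\<And>k. 0 \<le> k \<Longrightarrow> k \<le> i \<Longrightarrow> exact_b k (i - k)"
    and "p + q = i" "- 1 \<le> p" "0 \<le> q" "z \<in> C p q" "a (b z) = \<zero>"
  shows "\<exists>w\<in>C (p - 1) q. b (z \<ominus> a w) = \<zero>"
  using assms(3-)
proof (induction "nat (p + 1)" arbitrary: p q z)
  case 0
  then have "p = - 1" by linarith
  then have "z = \<zero>" using 0 C_neg by auto
  moreover have "a \<zero> = \<zero>" "b \<zero> = \<zero>"
    using additive_map_zero[OF _ _ a_map] additive_map_zero[OF _ _ b_map] abelian_group_axioms by auto
  ultimately have "b (z \<ominus> a \<zero>) = \<zero>" using \<open>z = \<zero>\<close> by (simp add: a_minus_def minus_equality[of "\<zero>" "\<zero>"])
  then show ?case using C_zero[of "p - 1" q] by blast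
next
  case (Suc n)
  have p: "0 \<le> p" "n = nat (p - 1 + 1)" using Suc(2) by linarith+
  have cz: "z \<in> carrier G" using C_sub Suc.prems by blast
  have "exact_a (i - q) (q + 1)" by (rule exa) (use Suc.prems p in linarith)+
  moreover have "i - q = p" using Suc.prems by linarith
  ultimately have "exact_a p (q + 1)" by simp
  moreover have "b z \<in> C p (q + 1)" using bC Suc.prems by blast
  ultimately obtain z' where z': "z' \<in> C (p - 1) (q + 1)" "b z = a z'"
    unfolding exact_a_def using Suc.prems by blast
  have cz': "z' \<in> carrier G" using C_sub z' by blast
  note cl = additive_map_closed[OF a_map] additive_map_closed[OF b_map]
  have "b (a z') = \<zero>" using bb[OF cz] z'(2) by simp
  then have "a (b z') = \<zero>" using ab[OF cz'] by simp
  then obtain w' where w': "w' \<in> C (p - 1 - 1) (q + 1)" "b (z' \<ominus> a w') = \<zero>"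
    using Suc(1)[of "p - 1" "q + 1" z'] z' Suc.prems p by auto
  have cw': "w' \<in> carrier G" using C_sub w' by blast
  have zw: "z' \<ominus> a w' \<in> C (p - 1) (q + 1)"
    using C_minus[OF z'(1)] aC[OF w'(1)] by simp
  have "\<exists>w\<in>C (p - 1) q. z' \<ominus> a w' = b w"
  \<comment> \<open>\<open>exb\<close> starts at index 0; for \<open>p = 0\<close> the corrected
    \<open>z'\<close> lies in \<open>C (- 1) (q + 1)\<close>, which is zero.\<close>
  proof (cases "p = 0")
    case True
    then have "z' \<ominus> a w' = \<zero>" using zw C_neg by auto
    moreover have "b \<zero> = \<zero>" using additive_map_zero[OF _ _ b_map] abelian_group_axioms by auto
    ultimately show ?thesis using C_zero[of "p - 1" q] by metis
  next
    case False
    have "exact_b (p - 1) (i - (p - 1))" by (rule exb) (use Suc.prems p False in linarith)+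
    moreover have "i - (p - 1) = q + 1" using Suc.prems by linarith
    ultimately have "exact_b (p - 1) (q + 1)" by simp
    then show ?thesis using zw w'(2) unfolding exact_b_def by auto
  qed
  then obtain w where w: "w \<in> C (p - 1) q" "z' \<ominus> a w' = b w" by blast
  have cw: "w \<in> carrier G" using C_sub w by blast
  have "a (z' \<ominus> a w') = a z'"
    using additive_map_minus[OF _ _ a_map] abelian_group_axioms cz' cw' aa[OF cw'] cl
    by (simp add: a_minus_def)
  then have "b z = a (b w)" using w z' by simp
  then have "b z = \<ominus> b (a w)" using ab[OF cw] by simp
  \<comment> \<open>Anticommutation turned \<open>a (b w)\<close> into
    \<open>\<ominus> b (a w)\<close>, so the witness is \<open>\<ominus> w\<close> and not
    \<open>w\<close>.\<close>
  moreover have "z \<ominus> a (\<ominus> w) = z \<oplus> a w"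
    using additive_map_neg[OF _ _ a_map] abelian_group_axioms cw cl by (simp add: a_minus_def)
  ultimately have "b (z \<ominus> a (\<ominus> w)) = \<zero>"
    using cz cw cl by (simp add: additive_map_add[OF b_map] l_neg)
  moreover have "\<ominus> w \<in> C (p - 1) q"
    using C_minus[OF C_zero w(1)] cw by (simp add: a_minus_def)
  ultimately show ?case by blast
qed

text \<open>After subtracting some \<open>a w\<close>, \<open>staircase_step\<close> at
  \<open>q = 0\<close> makes \<open>z\<close> a \<open>b\<close>-cycle. Position \<open>- 1\<close>
  of the \<open>b\<close> direction is empty, so \<open>b\<close>-exactness at \<open>(i, 0)\<close>
  forces this cycle to be zero, that is, \<open>z = a w\<close>.\<close>

theorem staircase:
  assumes exa: "\<And>k. 0 \<le> k \<Longrightarrow> k \<le> i \<Longrightarrow> exact_a (i - k) (k + 1)"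
    and exb: "\<And>k. 0 \<le> k \<Longrightarrow> k \<le> i \<Longrightarrow> exact_b k (i - k)"
    and C_neg2: "\<And>p. C p (- 1) = {\<zero>}" and "0 \<le> i"
  shows "exact_a i 0"
  unfolding exact_a_def
proof (intro ballI impI)
  fix z assume z: "z \<in> C i 0" "a z = \<zero>"
  have cz: "z \<in> carrier G" using C_sub z by blast
  have b0: "b \<zero> = \<zero>" using additive_map_zero[OF _ _ b_map] abelian_group_axioms by auto
  have "a (b z) = \<zero>" using ab[OF cz] z b0 by simp
  then obtain w where w: "w \<in> C (i - 1) 0" "b (z \<ominus> a w) = \<zero>"
    using staircase_step[OF exa exb, where p = i and q = 0 and z = z] z assms(4) by auto
  have "z \<ominus> a w \<in> C i 0" using C_minus[OF z(1)] aC[OF w(1)] by simp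
  moreover have "exact_b i 0" using exb[of i] assms(4) by simp
  ultimately have "z \<ominus> a w = b \<zero>"
    using w(2) C_neg2 unfolding exact_b_def by auto
  then have "z \<ominus> a w = \<zero>" using b0 by simp
  moreover have "a w \<in> carrier G" using C_sub w additive_map_closed[OF a_map] by blast
  ultimately have "z = a w" using cz minus_eq_zeroD by blast
  then show "\<exists>h\<in>C (i - 1) 0. z = a h" using w by blast
qed

end

section \<open>Sums of anticommuting maps of square zero\<close>

locale anticommuting_family = abelian_group G for G (structure) +
  fixes \<delta> :: "nat \<Rightarrow> 'a \<Rightarrow> 'a"
  assumes \<delta>_map: "additive_map G G (\<delta> l)"
    and \<delta>_sq: "z \<in> carrier G \<Longrightarrow> \<delta> l (\<delta> l z) = \<zero>"
    and \<delta>_anti: "z \<in> carrier G \<Longrightarrow> l \<noteq> k \<Longrightarrow> \<delta> l (\<delta> k z) = \<ominus> \<delta> k (\<delta> l z)"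
begin

text \<open>One map per direction; a set of directions yields the differential in these directions.
  Two disjoint sets yield the two anticommuting differentials of a double complex.\<close>

definition dsum :: "nat set \<Rightarrow> 'a \<Rightarrow> 'a" where
  "dsum Y z = (\<Oplus>l\<in>Y. \<delta> l z)"

lemma \<delta>_closed [simp]: "z \<in> carrier G \<Longrightarrow> \<delta> l z \<in> carrier G"
  by (rule additive_map_closed[OF \<delta>_map])

lemma dsum_closed [simp]: "z \<in> carrier G \<Longrightarrow> dsum Y z \<in> carrier G"
  unfolding dsum_def by (rule finsum_closed) simp

lemma dsum_map: "additive_map G G (dsum Y)"
  unfolding additive_map_def
proof (intro conjI ballI)
  fix x y assume xy: "x \<in> carrier G" "y \<in> carrier G"
  have "dsum Y (x \<oplus> y) = (\<Oplus>l\<in>Y. \<delta> l x \<oplus> \<delta> l y)"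
    unfolding dsum_def using xy by (simp add: additive_map_add[OF \<delta>_map])
  also have "\<dots> = dsum Y x \<oplus> dsum Y y"
    unfolding dsum_def using xy by (intro finsum_addf) auto
  finally show "dsum Y (x \<oplus> y) = dsum Y x \<oplus> dsum Y y" .
qed (rule funcsetI, rule dsum_closed)

lemma neg_finsum:
  assumes "g \<in> A \<rightarrow> carrier G"
  shows "\<ominus> (\<Oplus>i\<in>A. g i) = (\<Oplus>i\<in>A. \<ominus> g i)"
proof -
  have "additive_map G G (a_inv G)"
    unfolding additive_map_def by (intro conjI ballI funcsetI) (rule a_inv_closed minus_add; assumption)+
  from additive_map_finsum[OF abelian_group_axioms abelian_group_axioms this assms] show ?thesis .
qed

lemma \<delta>_dsum_anti:
  assumes z: "z \<in> carrier G" and "l \<notin> Y"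
  shows "\<delta> l (dsum Y z) = \<ominus> dsum Y (\<delta> l z)"
proof -
  have "\<delta> l (dsum Y z) = (\<Oplus>k\<in>Y. \<delta> l (\<delta> k z))"
    unfolding dsum_def using z abelian_group_axioms by (intro additive_map_finsum[OF _ _ \<delta>_map]) auto
  also have "\<dots> = (\<Oplus>k\<in>Y. \<ominus> \<delta> k (\<delta> l z))"
  proof (rule finsum_cong')
    fix k assume "k \<in> Y"
    then have "l \<noteq> k" using assms(2) by auto
    then show "\<delta> l (\<delta> k z) = \<ominus> \<delta> k (\<delta> l z)" using z \<delta>_anti by blast
  qed (use z in simp_all)
  also have "\<dots> = \<ominus> dsum Y (\<delta> l z)"
    unfolding dsum_def using z by (subst neg_finsum) auto
  finally show ?thesis .
qed

lemma dsum_anti: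
  assumes z: "z \<in> carrier G" and "Y \<inter> Z = {}"
  shows "dsum Y (dsum Z z) = \<ominus> dsum Z (dsum Y z)"
proof -
  have "dsum Y (dsum Z z) = (\<Oplus>l\<in>Y. \<delta> l (dsum Z z))" by (rule dsum_def)
  also have "\<dots> = (\<Oplus>l\<in>Y. \<ominus> dsum Z (\<delta> l z))"
  proof (rule finsum_cong')
    fix l assume "l \<in> Y"
    then have "l \<notin> Z" using assms(2) by blast
    then show "\<delta> l (dsum Z z) = \<ominus> dsum Z (\<delta> l z)" using z \<delta>_dsum_anti by blast
  qed (use z in simp_all)
  also have "\<dots> = \<ominus> (\<Oplus>l\<in>Y. dsum Z (\<delta> l z))"
    by (rule neg_finsum[symmetric]) (use z in simp)
  also have "(\<Oplus>l\<in>Y. dsum Z (\<delta> l z)) = dsum Z (\<Oplus>l\<in>Y. \<delta> l z)"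
    by (rule additive_map_finsum[OF abelian_group_axioms abelian_group_axioms dsum_map, symmetric])
      (use z in simp)
  also have "(\<Oplus>l\<in>Y. \<delta> l z) = dsum Y z" by (rule dsum_def[symmetric])
  finally show ?thesis .
qed

lemma dsum_insert:
  "finite Y \<Longrightarrow> l \<notin> Y \<Longrightarrow> z \<in> carrier G \<Longrightarrow> dsum (insert l Y) z = \<delta> l z \<oplus> dsum Y z"
  unfolding dsum_def by (subst finsum_insert) auto

text \<open>A new direction \<open>l\<close> squares to zero by itself, and its cross terms with the
  old directions cancel by \<open>\<delta>_dsum_anti\<close>.\<close>

lemma dsum_sq: "finite Y \<Longrightarrow> z \<in> carrier G \<Longrightarrow> dsum Y (dsum Y z) = \<zero>"
proof (induction Y rule: finite_induct)
  case empty
  show ?case by (simp add: dsum_def)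
next
  case (insert l Y)
  have "dsum (insert l Y) (dsum (insert l Y) z)
      = \<delta> l (\<delta> l z \<oplus> dsum Y z) \<oplus> dsum Y (\<delta> l z \<oplus> dsum Y z)"
    using insert by (simp add: dsum_insert)
  also have "\<dots> = \<delta> l (\<delta> l z) \<oplus> \<delta> l (dsum Y z) \<oplus> (dsum Y (\<delta> l z) \<oplus> dsum Y (dsum Y z))"
    using insert by (simp add: additive_map_add[OF \<delta>_map] additive_map_add[OF dsum_map])
  also have "\<dots> = \<zero>"
    using insert by (simp add: \<delta>_sq \<delta>_dsum_anti l_neg)
  finally show ?case .
qed

end

section \<open>Signs attached to faces\<close>

definition sgn_mult :: "('x, 'y) ring_scheme \<Rightarrow> bool \<Rightarrow> 'x \<Rightarrow> 'x" where
  "sgn_mult G b z = (if b then z else \<ominus>\<^bsub>G\<^esub> z)"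

text \<open>The sign of the alternating Cech differential. Signs are kept as Booleans, True for
  plus, because they arise as parities; a product of two signs is then their equality, as in
  \<open>sgn_mult_sgn_mult\<close>.\<close>

definition even_below :: "nat set \<Rightarrow> nat \<Rightarrow> bool" where
  "even_below \<rho> l \<longleftrightarrow> even (card {k \<in> \<rho>. k < l})"

lemma (in abelian_group) sgn_mult_closed [simp]: "z \<in> carrier G \<Longrightarrow> sgn_mult G b z \<in> carrier G"
  by (simp add: sgn_mult_def)

lemma (in abelian_group) sgn_mult_sgn_mult:
  "z \<in> carrier G \<Longrightarrow> sgn_mult G b (sgn_mult G b' z) = sgn_mult G (b = b') z"
  by (auto simp: sgn_mult_def)

lemma (in abelian_group) neg_zero [simp]: "\<ominus> \<zero> = \<zero>"
  by (rule minus_equality) auto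

lemma (in abelian_group) sgn_mult_zero [simp]: "sgn_mult G b \<zero> = \<zero>"
  by (simp add: sgn_mult_def)

lemma additive_map_sgn_mult:
  assumes "abelian_group G" "abelian_group H" "additive_map G H f" "z \<in> carrier G"
  shows "f (sgn_mult G b z) = sgn_mult H b (f z)"
  using assms by (simp add: sgn_mult_def additive_map_neg)

text \<open>Removing the smaller of two elements changes the count below the larger by one, while
  removing the larger leaves the count below the smaller alone. Hence the two orders of removal
  carry opposite signs.\<close>

lemma even_below_swap:
  assumes "finite \<rho>" "l \<in> \<rho>" "k \<in> \<rho>" "l \<noteq> k"
  shows "(even_below \<rho> l = even_below (\<rho> - {l}) k) \<noteq> (even_below \<rho> k = even_below (\<rho> - {k}) l)"
proof -
  have *: "even_below (\<rho> - {k}) l = even_below \<rho> l" "even_below (\<rho> - {l}) k = (\<not> even_below \<rho> k)"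
    if "l < k" "l \<in> \<rho>" "k \<in> \<rho>" for l k
  proof -
    have "{j \<in> \<rho> - {k}. j < l} = {j \<in> \<rho>. j < l}" using that by auto
    then show "even_below (\<rho> - {k}) l = even_below \<rho> l" by (simp add: even_below_def)
    have "{j \<in> \<rho>. j < k} = insert l {j \<in> \<rho> - {l}. j < k}" using that by auto
    then have "card {j \<in> \<rho>. j < k} = Suc (card {j \<in> \<rho> - {l}. j < k})"
      using assms(1) by simp
    then show "even_below (\<rho> - {l}) k = (\<not> even_below \<rho> k)" by (simp add: even_below_def)
  qed
  from assms(4) consider "l < k" | "k < l" by linarith
  then show ?thesis using *[of l k] *[of k l] assms(2,3) by cases auto
qed

section \<open>Cubes of modules\<close>

text \<open>
  The assumptions \<open>lift\<close> and \<open>tors\<close> say that \<open>r l \<rho>\<close> becomes bijective after inverting \<open>y l\<close>.  They hold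
  for the localisation map at \<open>y l\<close> as well as for multiplication by \<open>y l\<close>, so a cube may mix Cech and
  Koszul directions.
\<close>

locale cube = S: cring S for S :: "('g, 'w) ring_scheme" (structure) +
  fixes gS :: "('s \<Rightarrow> int) \<Rightarrow> 'g set" and X :: "nat set"
    and N :: "nat set \<Rightarrow> ('g, 'x, 'v) module_scheme"
    and D :: "('s \<Rightarrow> int) \<Rightarrow> nat set \<Rightarrow> 'x set"
    and r :: "nat \<Rightarrow> nat set \<Rightarrow> 'x \<Rightarrow> 'x"
    and y :: "nat \<Rightarrow> 'g" and \<delta> :: "nat \<Rightarrow> 's \<Rightarrow> int"
  assumes finX: "finite X"
    and gS_carr: "s \<in> gS a \<Longrightarrow> s \<in> carrier S"
    and gS_one: "\<one> \<in> gS 0"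
    and gS_mult: "s \<in> gS a \<Longrightarrow> t \<in> gS b \<Longrightarrow> s \<otimes> t \<in> gS (a + b)"
    and N_mod: "\<rho> \<subseteq> X \<Longrightarrow> module S (N \<rho>)"
    and D_sub: "\<rho> \<subseteq> X \<Longrightarrow> additive_subgroup (D n \<rho>) (N \<rho>)"
    and D_smult: "\<rho> \<subseteq> X \<Longrightarrow> s \<in> gS a \<Longrightarrow> z \<in> D n \<rho> \<Longrightarrow> s \<odot>\<^bsub>N \<rho>\<^esub> z \<in> D (n + a) \<rho>"
    and r_map: "l \<in> X \<Longrightarrow> \<rho> \<subseteq> X \<Longrightarrow> l \<notin> \<rho> \<Longrightarrow> additive_map (N \<rho>) (N (insert l \<rho>)) (r l \<rho>)"
    and r_smult: "l \<in> X \<Longrightarrow> \<rho> \<subseteq> X \<Longrightarrow> l \<notin> \<rho> \<Longrightarrow> s \<in> carrier S \<Longrightarrow> z \<in> carrier (N \<rho>) \<Longrightarrow>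
        r l \<rho> (s \<odot>\<^bsub>N \<rho>\<^esub> z) = s \<odot>\<^bsub>N (insert l \<rho>)\<^esub> r l \<rho> z"
    and r_D: "l \<in> X \<Longrightarrow> \<rho> \<subseteq> X \<Longrightarrow> l \<notin> \<rho> \<Longrightarrow> z \<in> D n \<rho> \<Longrightarrow> r l \<rho> z \<in> D n (insert l \<rho>)"
    and r_comm: "l \<in> X \<Longrightarrow> k \<in> X \<Longrightarrow> \<rho> \<subseteq> X \<Longrightarrow> l \<noteq> k \<Longrightarrow> l \<notin> \<rho> \<Longrightarrow> k \<notin> \<rho> \<Longrightarrow> z \<in> carrier (N \<rho>) \<Longrightarrow>
        r l (insert k \<rho>) (r k \<rho> z) = r k (insert l \<rho>) (r l \<rho> z)"
    and y_gS: "l \<in> X \<Longrightarrow> y l \<in> gS (\<delta> l)"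
    and lift: "l \<in> X \<Longrightarrow> \<rho> \<subseteq> X \<Longrightarrow> l \<notin> \<rho> \<Longrightarrow> z \<in> D n (insert l \<rho>) \<Longrightarrow>
        \<exists>k. \<exists>w\<in>D (n + of_nat k * \<delta> l) \<rho>. r l \<rho> w = (y l [^] k) \<odot>\<^bsub>N (insert l \<rho>)\<^esub> z"
    and tors: "l \<in> X \<Longrightarrow> \<rho> \<subseteq> X \<Longrightarrow> l \<notin> \<rho> \<Longrightarrow> z \<in> D n \<rho> \<Longrightarrow> r l \<rho> z = \<zero>\<^bsub>N (insert l \<rho>)\<^esub> \<Longrightarrow>
        \<exists>k::nat. (y l [^] k) \<odot>\<^bsub>N \<rho>\<^esub> z = \<zero>\<^bsub>N \<rho>\<^esub>"
begin

lemma N_ag: "\<rho> \<subseteq> X \<Longrightarrow> abelian_group (N \<rho>)"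
  using N_mod module_def by blast

lemma D_carr: "\<rho> \<subseteq> X \<Longrightarrow> z \<in> D n \<rho> \<Longrightarrow> z \<in> carrier (N \<rho>)"
  using D_sub[THEN additive_subgroup.a_subset] by blast

lemma D_zero: "\<rho> \<subseteq> X \<Longrightarrow> \<zero>\<^bsub>N \<rho>\<^esub> \<in> D n \<rho>"
  by (rule additive_subgroup.zero_closed[OF D_sub])

lemma D_add: "\<rho> \<subseteq> X \<Longrightarrow> z \<in> D n \<rho> \<Longrightarrow> w \<in> D n \<rho> \<Longrightarrow> z \<oplus>\<^bsub>N \<rho>\<^esub> w \<in> D n \<rho>"
  by (rule additive_subgroup.a_closed[OF D_sub])

lemma D_neg: "\<rho> \<subseteq> X \<Longrightarrow> z \<in> D n \<rho> \<Longrightarrow> \<ominus>\<^bsub>N \<rho>\<^esub> z \<in> D n \<rho>"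
  by (rule additive_subgroup.a_inv_closed[OF D_sub])

lemma D_sgn: "\<rho> \<subseteq> X \<Longrightarrow> z \<in> D n \<rho> \<Longrightarrow> sgn_mult (N \<rho>) b z \<in> D n \<rho>"
  by (simp add: sgn_mult_def D_neg)

lemma gS_pow: "s \<in> gS a \<Longrightarrow> s [^] (k::nat) \<in> gS (of_nat k * a)"
proof (induction k)
  case (Suc k)
  have e: "of_nat (Suc k) * a = of_nat k * a + a"
    by (simp only: of_nat_Suc distrib_right mult_1_left add.commute)
  show ?case unfolding e S.nat_pow_Suc by (rule gS_mult[OF Suc.IH[OF Suc.prems] Suc.prems])
qed (use gS_one in simp)

lemma D_pow: "\<rho> \<subseteq> X \<Longrightarrow> s \<in> gS a \<Longrightarrow> z \<in> D n \<rho> \<Longrightarrow>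
    (s [^] (k::nat)) \<odot>\<^bsub>N \<rho>\<^esub> z \<in> D (n + of_nat k * a) \<rho>"
  by (rule D_smult[OF _ gS_pow])

lemma res_zero: "l \<in> X \<Longrightarrow> \<rho> \<subseteq> X \<Longrightarrow> l \<notin> \<rho> \<Longrightarrow> r l \<rho> \<zero>\<^bsub>N \<rho>\<^esub> = \<zero>\<^bsub>N (insert l \<rho>)\<^esub>"
  by (intro additive_map_zero N_ag r_map) auto

text \<open>All faces are collected in one group, so that every differential is an endomorphism of
  it and the terms of all complexes considered are subsets. This is what lets the staircase argument
  work inside a single \<open>abelian_group\<close>.\<close>

definition TC :: "(nat set \<Rightarrow> 'x) ring" where
  "TC = \<lparr>carrier = (\<Pi>\<^sub>E \<rho>\<in>Pow X. carrier (N \<rho>)), mult = undefined, one = undefined,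
     zero = (\<lambda>\<rho>\<in>Pow X. \<zero>\<^bsub>N \<rho>\<^esub>), add = (\<lambda>c c'. \<lambda>\<rho>\<in>Pow X. c \<rho> \<oplus>\<^bsub>N \<rho>\<^esub> c' \<rho>)\<rparr>"

lemma TC_simps:
  "carrier TC = (\<Pi>\<^sub>E \<rho>\<in>Pow X. carrier (N \<rho>))" "\<zero>\<^bsub>TC\<^esub> = (\<lambda>\<rho>\<in>Pow X. \<zero>\<^bsub>N \<rho>\<^esub>)"
  "c \<oplus>\<^bsub>TC\<^esub> c' = (\<lambda>\<rho>\<in>Pow X. c \<rho> \<oplus>\<^bsub>N \<rho>\<^esub> c' \<rho>)"
  by (simp_all add: TC_def)

lemma TC_carr: "c \<in> carrier TC \<Longrightarrow> \<rho> \<subseteq> X \<Longrightarrow> c \<rho> \<in> carrier (N \<rho>)"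
  by (auto simp: TC_simps PiE_iff)

lemma TC_eqI:
  "c \<in> carrier TC \<Longrightarrow> c' \<in> carrier TC \<Longrightarrow> (\<And>\<rho>. \<rho> \<subseteq> X \<Longrightarrow> c \<rho> = c' \<rho>) \<Longrightarrow> c = c'"
  unfolding TC_simps by (rule PiE_ext) auto

lemma TC_group: "abelian_group TC"
proof (rule abelian_groupI)
  fix c c' c'' assume c: "c \<in> carrier TC" "c' \<in> carrier TC" "c'' \<in> carrier TC"
  show "c \<oplus>\<^bsub>TC\<^esub> c' \<oplus>\<^bsub>TC\<^esub> c'' = c \<oplus>\<^bsub>TC\<^esub> (c' \<oplus>\<^bsub>TC\<^esub> c'')"
    unfolding TC_simps
  proof (rule restrict_ext)
    fix \<rho> assume "\<rho> \<in> Pow X"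
    then have r: "\<rho> \<subseteq> X" by simp
    then interpret abelian_group "N \<rho>" by (rule N_ag)
    show "(\<lambda>\<rho>\<in>Pow X. c \<rho> \<oplus>\<^bsub>N \<rho>\<^esub> c' \<rho>) \<rho> \<oplus>\<^bsub>N \<rho>\<^esub> c'' \<rho> =
         c \<rho> \<oplus>\<^bsub>N \<rho>\<^esub> (\<lambda>\<rho>\<in>Pow X. c' \<rho> \<oplus>\<^bsub>N \<rho>\<^esub> c'' \<rho>) \<rho>"
      using r TC_carr[OF c(1) r] TC_carr[OF c(2) r] TC_carr[OF c(3) r] by (simp add: a_assoc)
  qed
next
  fix c c' assume c: "c \<in> carrier TC" "c' \<in> carrier TC"
  show "c \<oplus>\<^bsub>TC\<^esub> c' = c' \<oplus>\<^bsub>TC\<^esub> c"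
    unfolding TC_simps
  proof (rule restrict_ext)
    fix \<rho> assume "\<rho> \<in> Pow X"
    then have r: "\<rho> \<subseteq> X" by simp
    then interpret abelian_group "N \<rho>" by (rule N_ag)
    show "c \<rho> \<oplus>\<^bsub>N \<rho>\<^esub> c' \<rho> = c' \<rho> \<oplus>\<^bsub>N \<rho>\<^esub> c \<rho>"
      using TC_carr[OF c(1) r] TC_carr[OF c(2) r] by (simp add: a_comm)
  qed
  show "c \<oplus>\<^bsub>TC\<^esub> c' \<in> carrier TC"
    unfolding TC_simps
  proof (rule restrict_PiE_iff[THEN iffD2], rule ballI)
    fix \<rho> assume "\<rho> \<in> Pow X"
    then have r: "\<rho> \<subseteq> X" by simp
    then interpret abelian_group "N \<rho>" by (rule N_ag)
    show "c \<rho> \<oplus>\<^bsub>N \<rho>\<^esub> c' \<rho> \<in> carrier (N \<rho>)" using TC_carr[OF c(1) r] TC_carr[OF c(2) r] by simp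
  qed
next
  show "\<zero>\<^bsub>TC\<^esub> \<in> carrier TC"
    unfolding TC_simps using D_zero D_carr by auto
next
  fix c assume c: "c \<in> carrier TC"
  show "\<zero>\<^bsub>TC\<^esub> \<oplus>\<^bsub>TC\<^esub> c = c"
  proof (rule PiE_ext)
    fix \<rho> assume "\<rho> \<in> Pow X"
    then have r: "\<rho> \<subseteq> X" by simp
    then interpret abelian_group "N \<rho>" by (rule N_ag)
    show "(\<zero>\<^bsub>TC\<^esub> \<oplus>\<^bsub>TC\<^esub> c) \<rho> = c \<rho>" using r TC_carr[OF c r] by (simp add: TC_simps)
  next
    show "c \<in> (\<Pi>\<^sub>E \<rho>\<in>Pow X. carrier (N \<rho>))" using c by (simp add: TC_simps)
    show "\<zero>\<^bsub>TC\<^esub> \<oplus>\<^bsub>TC\<^esub> c \<in> (\<Pi>\<^sub>E \<rho>\<in>Pow X. carrier (N \<rho>))"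
      unfolding TC_simps
    proof (rule restrict_PiE_iff[THEN iffD2], rule ballI)
      fix \<rho> assume "\<rho> \<in> Pow X"
      then have r: "\<rho> \<subseteq> X" by simp
      then interpret abelian_group "N \<rho>" by (rule N_ag)
      show "(\<lambda>\<rho>\<in>Pow X. \<zero>\<^bsub>N \<rho>\<^esub>) \<rho> \<oplus>\<^bsub>N \<rho>\<^esub> c \<rho> \<in> carrier (N \<rho>)" using r TC_carr[OF c r] by simp
    qed
  qed
  let ?c = "\<lambda>\<rho>\<in>Pow X. \<ominus>\<^bsub>N \<rho>\<^esub> c \<rho>"
  have "?c \<in> carrier TC" unfolding TC_simps
  proof (rule restrict_PiE_iff[THEN iffD2], rule ballI)
    fix \<rho> assume "\<rho> \<in> Pow X"
    then have r: "\<rho> \<subseteq> X" by simp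
    then interpret abelian_group "N \<rho>" by (rule N_ag)
    show "\<ominus>\<^bsub>N \<rho>\<^esub> c \<rho> \<in> carrier (N \<rho>)" using TC_carr[OF c r] by simp
  qed
  moreover have "?c \<oplus>\<^bsub>TC\<^esub> c = \<zero>\<^bsub>TC\<^esub>"
    unfolding TC_simps
  proof (rule restrict_ext)
    fix \<rho> assume "\<rho> \<in> Pow X"
    then have r: "\<rho> \<subseteq> X" by simp
    then interpret abelian_group "N \<rho>" by (rule N_ag)
    show "?c \<rho> \<oplus>\<^bsub>N \<rho>\<^esub> c \<rho> = \<zero>\<^bsub>N \<rho>\<^esub>" using r TC_carr[OF c r] by (simp add: l_neg)
  qed
  ultimately show "\<exists>c'\<in>carrier TC. c' \<oplus>\<^bsub>TC\<^esub> c = \<zero>\<^bsub>TC\<^esub>" by blast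
qed

sublocale T: abelian_group TC by (rule TC_group)

lemma TC_ev: "\<rho> \<subseteq> X \<Longrightarrow> additive_map TC (N \<rho>) (\<lambda>c. c \<rho>)"
  unfolding additive_map_def using TC_carr by (auto simp: TC_simps)

lemma TC_ev_simps:
  assumes "\<rho> \<subseteq> X"
  shows "\<zero>\<^bsub>TC\<^esub> \<rho> = \<zero>\<^bsub>N \<rho>\<^esub>" "(c \<oplus>\<^bsub>TC\<^esub> c') \<rho> = c \<rho> \<oplus>\<^bsub>N \<rho>\<^esub> c' \<rho>"
    "c \<in> carrier TC \<Longrightarrow> (\<ominus>\<^bsub>TC\<^esub> c) \<rho> = \<ominus>\<^bsub>N \<rho>\<^esub> c \<rho>"
    "c \<in> carrier TC \<Longrightarrow> c' \<in> carrier TC \<Longrightarrow> (c \<ominus>\<^bsub>TC\<^esub> c') \<rho> = c \<rho> \<ominus>\<^bsub>N \<rho>\<^esub> c' \<rho>"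
    "g \<in> A \<rightarrow> carrier TC \<Longrightarrow> (\<Oplus>\<^bsub>TC\<^esub> i\<in>A. g i) \<rho> = (\<Oplus>\<^bsub>N \<rho>\<^esub> i\<in>A. g i \<rho>)"
  using assms additive_map_neg[OF TC_group N_ag TC_ev] additive_map_minus[OF TC_group N_ag TC_ev]
    additive_map_finsum[OF TC_group N_ag TC_ev, of \<rho> g A]
  by (simp_all add: TC_simps)

definition del :: "nat \<Rightarrow> (nat set \<Rightarrow> 'x) \<Rightarrow> nat set \<Rightarrow> 'x" where
  "del l c = (\<lambda>\<rho>\<in>Pow X. if l \<in> \<rho> then sgn_mult (N \<rho>) (even_below \<rho> l) (r l (\<rho> - {l}) (c (\<rho> - {l})))
     else \<zero>\<^bsub>N \<rho>\<^esub>)"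

lemma r_map': "\<rho> \<subseteq> X \<Longrightarrow> l \<in> \<rho> \<Longrightarrow> additive_map (N (\<rho> - {l})) (N \<rho>) (r l (\<rho> - {l}))"
  using r_map[of l "\<rho> - {l}"] by (auto simp: insert_absorb)

lemma del_eval: "\<rho> \<subseteq> X \<Longrightarrow> l \<in> \<rho> \<Longrightarrow>
    del l c \<rho> = sgn_mult (N \<rho>) (even_below \<rho> l) (r l (\<rho> - {l}) (c (\<rho> - {l})))"
  by (simp add: del_def)

lemma del_eval0: "\<rho> \<subseteq> X \<Longrightarrow> l \<notin> \<rho> \<Longrightarrow> del l c \<rho> = \<zero>\<^bsub>N \<rho>\<^esub>"
  by (simp add: del_def)

lemma del_ev_closed: "c \<in> carrier TC \<Longrightarrow> \<rho> \<subseteq> X \<Longrightarrow> del l c \<rho> \<in> carrier (N \<rho>)"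
proof (cases "l \<in> \<rho>")
  case True
  assume a: "c \<in> carrier TC" "\<rho> \<subseteq> X"
  have "c (\<rho> - {l}) \<in> carrier (N (\<rho> - {l}))" by (rule TC_carr[OF a(1)]) (use a(2) in blast)
  then have "r l (\<rho> - {l}) (c (\<rho> - {l})) \<in> carrier (N \<rho>)"
    by (rule additive_map_closed[OF r_map'[OF a(2) True]])
  then show ?thesis using a True by (simp add: del_eval abelian_group.sgn_mult_closed[OF N_ag])
next
  case False
  assume "\<rho> \<subseteq> X"
  then show ?thesis using False D_zero D_carr by (simp add: del_eval0)
qed

lemma del_closed: "c \<in> carrier TC \<Longrightarrow> del l c \<in> carrier TC"
  using del_ev_closed by (auto simp: TC_simps del_def PiE_iff)

lemma sgn_mult_add:
  assumes "abelian_group G" "z \<in> carrier G" "w \<in> carrier G"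
  shows "sgn_mult G b (z \<oplus>\<^bsub>G\<^esub> w) = sgn_mult G b z \<oplus>\<^bsub>G\<^esub> sgn_mult G b w"
  using assms abelian_group.minus_add[OF assms] by (simp add: sgn_mult_def)

lemma del_map: "additive_map TC TC (del l)"
  unfolding additive_map_def
proof (intro conjI ballI)
  show "del l \<in> carrier TC \<rightarrow> carrier TC" by (rule funcsetI) (rule del_closed)
  fix c c' assume c: "c \<in> carrier TC" "c' \<in> carrier TC"
  show "del l (c \<oplus>\<^bsub>TC\<^esub> c') = del l c \<oplus>\<^bsub>TC\<^esub> del l c'"
  proof (rule TC_eqI)
    fix \<rho> assume r: "\<rho> \<subseteq> X"
    interpret abelian_group "N \<rho>" using r by (rule N_ag)
    show "del l (c \<oplus>\<^bsub>TC\<^esub> c') \<rho> = (del l c \<oplus>\<^bsub>TC\<^esub> del l c') \<rho>"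
    proof (cases "l \<in> \<rho>")
      case True
      have r': "\<rho> - {l} \<subseteq> X" using r by auto
      note m = r_map'[OF r True]
      have cc: "c (\<rho> - {l}) \<in> carrier (N (\<rho> - {l}))" "c' (\<rho> - {l}) \<in> carrier (N (\<rho> - {l}))"
        by (rule TC_carr[OF c(1) r'] TC_carr[OF c(2) r'])+
      show ?thesis
        using r r' True cc additive_map_closed[OF m]
        by (simp add: del_eval TC_ev_simps additive_map_add[OF m] sgn_mult_add[OF N_ag])
    qed (use r in \<open>simp add: del_eval0 TC_ev_simps\<close>)
  qed (use c in \<open>simp_all add: del_closed\<close>)
qed

lemma del_del_eval:
  assumes c: "c \<in> carrier TC" and r: "\<rho> \<subseteq> X" and lk: "l \<in> \<rho>" "k \<in> \<rho>" "l \<noteq> k"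
  shows "del l (del k c) \<rho> = sgn_mult (N \<rho>) (even_below \<rho> l = even_below (\<rho> - {l}) k)
     (r l (\<rho> - {l}) (r k (\<rho> - {l} - {k}) (c (\<rho> - {l} - {k}))))"
proof -
  have s: "\<rho> - {l} \<subseteq> X" "\<rho> - {l} - {k} \<subseteq> X" "k \<in> \<rho> - {l}" using r lk by auto
  have m: "additive_map (N (\<rho> - {l})) (N \<rho>) (r l (\<rho> - {l}))" using r lk by (intro r_map')
  have m2: "additive_map (N (\<rho> - {l} - {k})) (N (\<rho> - {l})) (r k (\<rho> - {l} - {k}))"
    using s lk by (intro r_map')
  have cc: "r k (\<rho> - {l} - {k}) (c (\<rho> - {l} - {k})) \<in> carrier (N (\<rho> - {l}))"
    by (rule additive_map_closed[OF m2 TC_carr[OF c s(2)]])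
  have cc2: "r l (\<rho> - {l}) (r k (\<rho> - {l} - {k}) (c (\<rho> - {l} - {k}))) \<in> carrier (N \<rho>)"
    using additive_map_closed[OF m cc] .
  show ?thesis
    using r lk s by (simp add: del_eval additive_map_sgn_mult[OF N_ag N_ag m cc] 
        abelian_group.sgn_mult_sgn_mult[OF N_ag cc2])
qed

lemma sgn_mult_Not:
  assumes "abelian_group G" "z \<in> carrier G" "b \<noteq> b'"
  shows "sgn_mult G b z = \<ominus>\<^bsub>G\<^esub> sgn_mult G b' z"
  using assms(3) abelian_group.minus_minus[OF assms(1,2)] by (auto simp: sgn_mult_def)

text \<open>\<open>del l z\<close> vanishes on the faces without \<open>l\<close>, and a second
  application of \<open>del l\<close> reads only such faces.\<close>

lemma del_sq:
  assumes z: "z \<in> carrier TC"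
  shows "del l (del l z) = \<zero>\<^bsub>TC\<^esub>"
  proof (rule TC_eqI)
    fix \<rho> assume r: "\<rho> \<subseteq> X"
    interpret abelian_group "N \<rho>" using r by (rule N_ag)
    show "del l (del l z) \<rho> = \<zero>\<^bsub>TC\<^esub> \<rho>"
    proof (cases "l \<in> \<rho>")
      case True
      have "\<rho> - {l} \<subseteq> X" "l \<notin> \<rho> - {l}" using r by auto
      then have "del l z (\<rho> - {l}) = \<zero>\<^bsub>N (\<rho> - {l})\<^esub>" by (rule del_eval0)
      moreover have "r l (\<rho> - {l}) \<zero>\<^bsub>N (\<rho> - {l})\<^esub> = \<zero>\<^bsub>N \<rho>\<^esub>"
        using r True res_zero[of l "\<rho> - {l}"] by (auto simp: insert_absorb)
      ultimately show ?thesis using r True by (simp add: del_eval TC_ev_simps)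
    qed (use r in \<open>simp add: del_eval0 TC_ev_simps\<close>)
  qed (use z in \<open>simp_all add: del_closed\<close>)

text \<open>At a face containing both directions, either composite reads \<open>z\<close> at the
  face with \<open>l\<close> and \<open>k\<close> removed, through the same map by
  \<open>r_comm\<close>; the signs are opposite by \<open>even_below_swap\<close>. At all other
  faces both composites vanish.\<close>

lemma del_anti:
  assumes z: "z \<in> carrier TC" and lk: "l \<noteq> k"
  shows "del l (del k z) = \<ominus>\<^bsub>TC\<^esub> del k (del l z)"
  proof (rule TC_eqI)
    fix \<rho> assume r: "\<rho> \<subseteq> X"
    interpret abelian_group "N \<rho>" using r by (rule N_ag)
    have e: "(\<ominus>\<^bsub>TC\<^esub> del k (del l z)) \<rho> = \<ominus>\<^bsub>N \<rho>\<^esub> del k (del l z) \<rho>"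
      using r z by (simp add: TC_ev_simps del_closed)
    have zero: "del l (del k z) \<rho> = \<zero>\<^bsub>N \<rho>\<^esub>" if "\<not> (l \<in> \<rho> \<and> k \<in> \<rho>)" "l \<noteq> k" for l k
    proof (cases "l \<in> \<rho>")
      case True
      then have "k \<notin> \<rho> - {l}" "\<rho> - {l} \<subseteq> X" using that r by auto
      then have "del k z (\<rho> - {l}) = \<zero>\<^bsub>N (\<rho> - {l})\<^esub>" by (intro del_eval0)
      moreover have "r l (\<rho> - {l}) \<zero>\<^bsub>N (\<rho> - {l})\<^esub> = \<zero>\<^bsub>N \<rho>\<^esub>"
        using r True res_zero[of l "\<rho> - {l}"] by (auto simp: insert_absorb)
      ultimately show ?thesis using r True by (simp add: del_eval)
    qed (use r in \<open>simp add: del_eval0\<close>)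
    show "del l (del k z) \<rho> = (\<ominus>\<^bsub>TC\<^esub> del k (del l z)) \<rho>"
    proof (cases "l \<in> \<rho> \<and> k \<in> \<rho>")
      case True
      define \<sigma> where "\<sigma> = \<rho> - {l} - {k}"
      have s: "\<sigma> \<subseteq> X" "l \<notin> \<sigma>" "k \<notin> \<sigma>" "\<rho> - {l} = insert k \<sigma>" "\<rho> - {k} = insert l \<sigma>" 
        "\<rho> - {k} - {l} = \<sigma>" "l \<in> X" "k \<in> X"
        using True lk r by (auto simp: \<sigma>_def)
      have zc: "z \<sigma> \<in> carrier (N \<sigma>)" by (rule TC_carr[OF z s(1)])
      have c: "r l (insert k \<sigma>) (r k \<sigma> (z \<sigma>)) = r k (insert l \<sigma>) (r l \<sigma> (z \<sigma>))"
        by (rule r_comm) (use s lk zc in auto)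
      have "insert l (insert k \<sigma>) = \<rho>" "insert k \<sigma> \<subseteq> X" "l \<notin> insert k \<sigma>" using s True lk r by auto
      then have cc: "r l (insert k \<sigma>) (r k \<sigma> (z \<sigma>)) \<in> carrier (N \<rho>)"
        using additive_map_closed[OF r_map[of l "insert k \<sigma>"]] additive_map_closed[OF r_map[of k \<sigma>] zc] s
        by auto
      have "(even_below \<rho> l = even_below (\<rho> - {l}) k) \<noteq> (even_below \<rho> k = even_below (\<rho> - {k}) l)"
        using True lk finite_subset[OF r finX] by (intro even_below_swap) auto
      then have "sgn_mult (N \<rho>) (even_below \<rho> l = even_below (\<rho> - {l}) k) (r l (insert k \<sigma>) (r k \<sigma> (z \<sigma>)))
          = \<ominus>\<^bsub>N \<rho>\<^esub> sgn_mult (N \<rho>) (even_below \<rho> k = even_below (\<rho> - {k}) l) (r l (insert k \<sigma>) (r k \<sigma> (z \<sigma>)))"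
        using cc by (intro sgn_mult_Not[OF N_ag[OF r]])
      then show ?thesis
        unfolding e using True lk
        by (simp add: del_del_eval[OF z r, of l k] del_del_eval[OF z r, of k l] s(6) flip: \<sigma>_def) (simp add: s c)
    next
      case False
      then have "del l (del k z) \<rho> = \<zero>\<^bsub>N \<rho>\<^esub>" "del k (del l z) \<rho> = \<zero>\<^bsub>N \<rho>\<^esub>"
        using zero[of l k] zero[of k l] lk by auto
      then show ?thesis unfolding e by simp
    qed
  qed (use z in \<open>simp_all add: del_closed\<close>)

sublocale T: anticommuting_family TC del
  by (intro anticommuting_family.intro anticommuting_family_axioms.intro TC_group)
    (rule del_map del_sq del_anti; assumption)+

abbreviation d :: "nat set \<Rightarrow> (nat set \<Rightarrow> 'x) \<Rightarrow> nat set \<Rightarrow> 'x" where "d \<equiv> T.dsum"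

lemma d_eval: "c \<in> carrier TC \<Longrightarrow> \<rho> \<subseteq> X \<Longrightarrow> d Y c \<rho> = (\<Oplus>\<^bsub>N \<rho>\<^esub> l\<in>Y. del l c \<rho>)"
  unfolding T.dsum_def by (simp add: TC_ev_simps del_closed)

text \<open>The sum is cut down to the directions present in the face, which is the shape of
  \<open>cech_diff\<close>.\<close>

lemma d_eval': 
  assumes "c \<in> carrier TC" "\<rho> \<subseteq> X" "finite Y"
  shows "d Y c \<rho> = (\<Oplus>\<^bsub>N \<rho>\<^esub> l\<in>\<rho> \<inter> Y. sgn_mult (N \<rho>) (even_below \<rho> l) (r l (\<rho> - {l}) (c (\<rho> - {l}))))"
proof -
  interpret abelian_group "N \<rho>" using assms by (intro N_ag)
  have "d Y c \<rho> = (\<Oplus>\<^bsub>N \<rho>\<^esub> l\<in>\<rho> \<inter> Y. del l c \<rho>)"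
    unfolding d_eval[OF assms(1,2)]
    using assms del_ev_closed by (intro add.finprod_mono_neutral_cong_right) (auto simp: del_eval0)
  also have "\<dots> = (\<Oplus>\<^bsub>N \<rho>\<^esub> l\<in>\<rho> \<inter> Y. sgn_mult (N \<rho>) (even_below \<rho> l) (r l (\<rho> - {l}) (c (\<rho> - {l}))))"
  proof (rule finsum_cong')
    fix l assume l: "l \<in> \<rho> \<inter> Y"
    then show "del l c \<rho> = sgn_mult (N \<rho>) (even_below \<rho> l) (r l (\<rho> - {l}) (c (\<rho> - {l})))"
      using assms by (simp add: del_eval)
  next
    show "(\<lambda>l. sgn_mult (N \<rho>) (even_below \<rho> l) (r l (\<rho> - {l}) (c (\<rho> - {l})))) \<in> \<rho> \<inter> Y \<rightarrow> carrier (N \<rho>)"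
    proof (rule Pi_I)
      fix l assume "l \<in> \<rho> \<inter> Y"
      then show "sgn_mult (N \<rho>) (even_below \<rho> l) (r l (\<rho> - {l}) (c (\<rho> - {l}))) \<in> carrier (N \<rho>)"
        using del_ev_closed[OF assms(1,2), of l] del_eval[OF assms(2), of l c] by simp
    qed
  qed simp
  finally show ?thesis .
qed

lemma d_cong:
  assumes "c \<in> carrier TC" "c' \<in> carrier TC" "\<rho> \<subseteq> X"
    "\<And>l. l \<in> \<rho> \<Longrightarrow> l \<in> Y \<Longrightarrow> c (\<rho> - {l}) = c' (\<rho> - {l})"
  shows "d Y c \<rho> = d Y c' \<rho>"
  unfolding d_eval[OF assms(1,3)] d_eval[OF assms(2,3)]
proof (rule abelian_monoid.finsum_cong'[OF abelian_group.axioms(1)[OF N_ag[OF assms(3)]]])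
  fix l assume l: "l \<in> Y"
  show "del l c \<rho> = del l c' \<rho>"
    using assms l by (cases "l \<in> \<rho>") (simp_all add: del_eval del_eval0)
qed (use assms del_ev_closed in auto)

definition smu :: "'g \<Rightarrow> (nat set \<Rightarrow> 'x) \<Rightarrow> nat set \<Rightarrow> 'x" where
  "smu s c = (\<lambda>\<rho>\<in>Pow X. s \<odot>\<^bsub>N \<rho>\<^esub> c \<rho>)"

lemma smu_eval: "\<rho> \<subseteq> X \<Longrightarrow> smu s c \<rho> = s \<odot>\<^bsub>N \<rho>\<^esub> c \<rho>"
  by (simp add: smu_def)

lemma smu_closed: "s \<in> carrier S \<Longrightarrow> c \<in> carrier TC \<Longrightarrow> smu s c \<in> carrier TC"
  using TC_carr module.smult_closed[OF N_mod] by (auto simp: TC_simps smu_def PiE_iff)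

lemma smu_map: "s \<in> carrier S \<Longrightarrow> additive_map TC TC (smu s)"
  unfolding additive_map_def
proof (intro conjI ballI)
  assume s: "s \<in> carrier S"
  then show "smu s \<in> carrier TC \<rightarrow> carrier TC" by (intro funcsetI smu_closed)
  fix c c' assume c: "c \<in> carrier TC" "c' \<in> carrier TC"
  show "smu s (c \<oplus>\<^bsub>TC\<^esub> c') = smu s c \<oplus>\<^bsub>TC\<^esub> smu s c'"
    by (rule TC_eqI)
      (use s c TC_carr in \<open>simp_all add: smu_closed smu_eval TC_ev_simps module.smult_r_distr[OF N_mod]\<close>)
qed

lemma del_smu: "s \<in> carrier S \<Longrightarrow> c \<in> carrier TC \<Longrightarrow> del l (smu s c) = smu s (del l c)"
proof (rule TC_eqI)
  assume s: "s \<in> carrier S" and c: "c \<in> carrier TC"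
  fix \<rho> assume r: "\<rho> \<subseteq> X"
  show "del l (smu s c) \<rho> = smu s (del l c) \<rho>"
  proof (cases "l \<in> \<rho>")
    case True
    have r': "\<rho> - {l} \<subseteq> X" "insert l (\<rho> - {l}) = \<rho>" "l \<in> X" using r True by auto
    have cc: "c (\<rho> - {l}) \<in> carrier (N (\<rho> - {l}))" by (rule TC_carr[OF c r'(1)])
    have "r l (\<rho> - {l}) (s \<odot>\<^bsub>N (\<rho> - {l})\<^esub> c (\<rho> - {l})) = s \<odot>\<^bsub>N \<rho>\<^esub> r l (\<rho> - {l}) (c (\<rho> - {l}))"
      using r_smult[of l "\<rho> - {l}" s] r' s cc by simp
    moreover have "r l (\<rho> - {l}) (c (\<rho> - {l})) \<in> carrier (N \<rho>)"
      by (rule additive_map_closed[OF r_map'[OF r True] cc])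
    ultimately show ?thesis using r r' True s
      by (simp add: del_eval smu_eval sgn_mult_def module.smult_r_minus[OF N_mod])
  next
    case False
    then show ?thesis using r s by (simp add: del_eval0 smu_eval module.smult_r_null[OF N_mod])
  qed
qed (simp_all add: smu_closed del_closed)

lemma d_smu: "s \<in> carrier S \<Longrightarrow> c \<in> carrier TC \<Longrightarrow> d Y (smu s c) = smu s (d Y c)"
  unfolding T.dsum_def
  by (subst additive_map_finsum[OF TC_group TC_group smu_map]) (auto simp: del_smu del_closed)

text \<open>The complex in the directions \<open>Y\<close> over a fixed outer face
  \<open>\<tau>\<close>: cochains of place \<open>p\<close> live on the faces
  \<open>\<tau> \<union> \<sigma>\<close> with \<open>\<sigma> \<subseteq> Y\<close> of size
  \<open>p\<close>, and are extended by zero. The place is an integer so that \<open>p - 1\<close>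
  makes sense at the start of the complex.\<close>

definition Dz :: "nat set \<Rightarrow> nat set \<Rightarrow> int \<Rightarrow> ('s \<Rightarrow> int) \<Rightarrow> nat set \<Rightarrow> 'x set" where
  "Dz Y \<tau> p n \<rho> = (if \<rho> - Y = \<tau> \<and> int (card (\<rho> \<inter> Y)) = p then D n \<rho> else {\<zero>\<^bsub>N \<rho>\<^esub>})"

definition CC :: "nat set \<Rightarrow> nat set \<Rightarrow> int \<Rightarrow> ('s \<Rightarrow> int) \<Rightarrow> (nat set \<Rightarrow> 'x) set" where
  "CC Y \<tau> p n = {c \<in> carrier TC. \<forall>\<rho>\<subseteq>X. c \<rho> \<in> Dz Y \<tau> p n \<rho>}"

definition exact :: "nat set \<Rightarrow> nat set \<Rightarrow> int \<Rightarrow> ('s \<Rightarrow> int) \<Rightarrow> bool" where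
  "exact Y \<tau> p n \<longleftrightarrow> (\<forall>c\<in>CC Y \<tau> p n. d Y c = \<zero>\<^bsub>TC\<^esub> \<longrightarrow> (\<exists>h\<in>CC Y \<tau> (p - 1) n. c = d Y h))"

lemma Dz_zero: "\<rho> \<subseteq> X \<Longrightarrow> \<zero>\<^bsub>N \<rho>\<^esub> \<in> Dz Y \<tau> p n \<rho>"
  using D_zero by (simp add: Dz_def)

lemma Dz_D: "\<rho> \<subseteq> X \<Longrightarrow> z \<in> Dz Y \<tau> p n \<rho> \<Longrightarrow> z \<in> D n \<rho>"
  using D_zero by (simp add: Dz_def split: if_splits)

lemma Dz_add:
  assumes "\<rho> \<subseteq> X" "z \<in> Dz Y \<tau> p n \<rho>" "w \<in> Dz Y \<tau> p n \<rho>"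
  shows "z \<oplus>\<^bsub>N \<rho>\<^esub> w \<in> Dz Y \<tau> p n \<rho>"
proof -
  interpret abelian_group "N \<rho>" using assms(1) by (rule N_ag)
  show ?thesis using assms D_add by (auto simp: Dz_def split: if_splits)
qed

lemma Dz_neg:
  assumes "\<rho> \<subseteq> X" "z \<in> Dz Y \<tau> p n \<rho>"
  shows "\<ominus>\<^bsub>N \<rho>\<^esub> z \<in> Dz Y \<tau> p n \<rho>"
proof -
  interpret abelian_group "N \<rho>" using assms(1) by (rule N_ag)
  show ?thesis using assms D_neg by (auto simp: Dz_def split: if_splits)
qed

lemma Dz_smult:
  assumes "\<rho> \<subseteq> X" "z \<in> Dz Y \<tau> p n \<rho>" "s \<in> gS a"
  shows "s \<odot>\<^bsub>N \<rho>\<^esub> z \<in> Dz Y \<tau> p (n + a) \<rho>"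
proof -
  interpret module S "N \<rho>" using assms(1) by (rule N_mod)
  show ?thesis using assms D_smult gS_carr by (auto simp: Dz_def split: if_splits)
qed

lemma Dz_finsum:
  assumes "\<rho> \<subseteq> X" "\<And>i. i \<in> A \<Longrightarrow> g i \<in> Dz Y \<tau> p n \<rho>"
  shows "(\<Oplus>\<^bsub>N \<rho>\<^esub> i\<in>A. g i) \<in> Dz Y \<tau> p n \<rho>"
proof (rule abelian_group.subgroup_finsum_closed[OF N_ag[OF assms(1)]])
  show "Dz Y \<tau> p n \<rho> \<subseteq> carrier (N \<rho>)" using Dz_D D_carr assms(1) by blast
qed (use assms Dz_zero Dz_add in auto)

lemma Dz_off: "z \<in> Dz Y \<tau> p n \<rho> \<Longrightarrow> \<not> (\<rho> - Y = \<tau> \<and> int (card (\<rho> \<inter> Y)) = p) \<Longrightarrow> z = \<zero>\<^bsub>N \<rho>\<^esub>"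
  by (metis Dz_def singletonD)

lemma CC_carr: "c \<in> CC Y \<tau> p n \<Longrightarrow> c \<in> carrier TC" by (simp add: CC_def)

lemma CC_Dz: "c \<in> CC Y \<tau> p n \<Longrightarrow> \<rho> \<subseteq> X \<Longrightarrow> c \<rho> \<in> Dz Y \<tau> p n \<rho>" by (simp add: CC_def)

lemma CC_D: "c \<in> CC Y \<tau> p n \<Longrightarrow> \<rho> \<subseteq> X \<Longrightarrow> c \<rho> \<in> D n \<rho>"
  using CC_Dz Dz_D by blast

lemma CC_zero: "\<zero>\<^bsub>TC\<^esub> \<in> CC Y \<tau> p n"
  by (simp add: CC_def TC_ev_simps Dz_zero)

lemma CC_add: "c \<in> CC Y \<tau> p n \<Longrightarrow> c' \<in> CC Y \<tau> p n \<Longrightarrow> c \<oplus>\<^bsub>TC\<^esub> c' \<in> CC Y \<tau> p n"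
  by (simp add: CC_def TC_ev_simps Dz_add)

lemma CC_smu: "s \<in> gS a \<Longrightarrow> c \<in> CC Y \<tau> p n \<Longrightarrow> smu s c \<in> CC Y \<tau> p (n + a)"
  using gS_carr[of s a] by (simp add: CC_def smu_eval smu_closed Dz_smult)

lemma CC_neg: "c \<in> CC Y \<tau> p n \<Longrightarrow> \<ominus>\<^bsub>TC\<^esub> c \<in> CC Y \<tau> p n"
  by (simp add: CC_def TC_ev_simps Dz_neg)

lemma CC_minus: "c \<in> CC Y \<tau> p n \<Longrightarrow> c' \<in> CC Y \<tau> p n \<Longrightarrow> c \<ominus>\<^bsub>TC\<^esub> c' \<in> CC Y \<tau> p n"
  unfolding a_minus_def by (intro CC_add CC_neg)

lemma CC_finsum:
  assumes "\<And>i. i \<in> A \<Longrightarrow> g i \<in> CC Y \<tau> p n"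
  shows "(\<Oplus>\<^bsub>TC\<^esub> i\<in>A. g i) \<in> CC Y \<tau> p n"
proof (rule T.subgroup_finsum_closed)
  show "CC Y \<tau> p n \<subseteq> carrier TC" using CC_carr by blast
qed (use assms CC_zero CC_add in auto)

lemma del_D:
  assumes "\<rho> \<subseteq> X" "l \<in> \<rho>" "c (\<rho> - {l}) \<in> D n (\<rho> - {l})"
  shows "del l c \<rho> \<in> D n \<rho>"
proof -
  have "\<rho> - {l} \<subseteq> X" "insert l (\<rho> - {l}) = \<rho>" "l \<in> X" using assms by auto
  then have "r l (\<rho> - {l}) (c (\<rho> - {l})) \<in> D n \<rho>" using r_D[of l "\<rho> - {l}"] assms(3) by auto
  then show ?thesis using assms by (simp add: del_eval D_sgn)
qed

lemma CC_d:
  assumes c: "c \<in> CC Y \<tau> p n"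
  shows "d Y c \<in> CC Y \<tau> (p + 1) n"
  unfolding CC_def
proof (intro CollectI conjI allI impI)
  show "d Y c \<in> carrier TC" using CC_carr[OF c] by simp
  fix \<rho> assume r: "\<rho> \<subseteq> X"
  have "del l c \<rho> \<in> Dz Y \<tau> (p + 1) n \<rho>" if l: "l \<in> Y" for l
  proof (cases "l \<in> \<rho>")
    case True
    have e: "\<rho> - {l} - Y = \<rho> - Y" "(\<rho> - {l}) \<inter> Y = (\<rho> \<inter> Y) - {l}" using l by auto
    have "finite \<rho>" using finite_subset[OF r finX] .
    then have "card (\<rho> \<inter> Y) = Suc (card ((\<rho> \<inter> Y) - {l}))"
      using True l by (intro card.remove) auto
    then have e3: "int (card ((\<rho> - {l}) \<inter> Y)) = p \<longleftrightarrow> int (card (\<rho> \<inter> Y)) = p + 1"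
      unfolding e by auto
    have r': "\<rho> - {l} \<subseteq> X" "l \<in> X" using r True by auto
    show ?thesis
    proof (cases "\<rho> - Y = \<tau> \<and> int (card (\<rho> \<inter> Y)) = p + 1")
      case True': True
      then show ?thesis using del_D[of \<rho> l c n, OF r True CC_D[OF c r'(1)]] by (simp add: Dz_def)
    next
      case False
      then have "\<not> (\<rho> - {l} - Y = \<tau> \<and> int (card ((\<rho> - {l}) \<inter> Y)) = p)" using e(1) e3 by simp
      then have "c (\<rho> - {l}) = \<zero>\<^bsub>N (\<rho> - {l})\<^esub>"
        by (rule Dz_off[OF CC_Dz[OF c r'(1)]])
      moreover have "r l (\<rho> - {l}) \<zero>\<^bsub>N (\<rho> - {l})\<^esub> = \<zero>\<^bsub>N \<rho>\<^esub>"
        using r' True res_zero[of l "\<rho> - {l}"] by (auto simp: insert_absorb)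
      ultimately have "del l c \<rho> = \<zero>\<^bsub>N \<rho>\<^esub>"
        using r True by (simp add: del_eval abelian_group.sgn_mult_zero[OF N_ag])
      then show ?thesis using Dz_zero[OF r] by simp
    qed
  next
    case False
    then show ?thesis using Dz_zero[OF r] r by (simp add: del_eval0)
  qed
  then show "d Y c \<rho> \<in> Dz Y \<tau> (p + 1) n \<rho>"
    unfolding d_eval[OF CC_carr[OF c] r] by (intro Dz_finsum[OF r])
qed

end

text \<open>Turns exponents found face by face into one exponent valid on all the finitely many
  faces.\<close>

lemma uniform_bound:
  assumes "finite A" "\<And>a. a \<in> A \<Longrightarrow> \<exists>k::nat. P a k" "\<And>a k k'. a \<in> A \<Longrightarrow> P a k \<Longrightarrow> k \<le> k' \<Longrightarrow> P a k'"
  shows "\<exists>K. \<forall>a\<in>A. P a K"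
proof -
  obtain f where f: "\<And>a. a \<in> A \<Longrightarrow> P a (f a)" using assms(2) by metis
  have "P a (Max (f ` A))" if "a \<in> A" for a
    using that assms(1) by (intro assms(3)[OF that f[OF that]]) auto
  then show ?thesis by blast
qed

lemma (in abelian_group) finsum_single:
  assumes "finite A" "i \<in> A" "f i \<in> carrier G" "\<And>j. j \<in> A \<Longrightarrow> j \<noteq> i \<Longrightarrow> f j = \<zero>"
  shows "(\<Oplus>j\<in>A. f j) = f i"
proof -
  have "(\<Oplus>j\<in>A. f j) = (\<Oplus>j\<in>insert i (A - {i}). f j)"
    using assms(2) by (simp add: insert_absorb)
  also have "\<dots> = f i \<oplus> (\<Oplus>j\<in>A - {i}. f j)"
    using assms by (intro finsum_insert) auto
  also have "(\<Oplus>j\<in>A - {i}. f j) = \<zero>"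
    using assms(4) by (intro add.finprod_one_eqI) auto
  finally show ?thesis using assms(3) by simp
qed

section \<open>Exactness when a combination of the directions is invertible\<close>

context cube
begin

lemma smu_smu:
  assumes "s \<in> carrier S" "t \<in> carrier S" "c \<in> carrier TC"
  shows "smu s (smu t c) = smu (s \<otimes> t) c"
proof (rule TC_eqI)
  fix \<rho> assume r: "\<rho> \<subseteq> X"
  then interpret module S "N \<rho>" by (rule N_mod)
  show "smu s (smu t c) \<rho> = smu (s \<otimes> t) c \<rho>"
    using r assms TC_carr[OF assms(3) r] by (simp add: smu_eval smult_assoc1)
qed (use assms in \<open>simp_all add: smu_closed\<close>)

lemma smu_one: "c \<in> carrier TC \<Longrightarrow> smu \<one> c = c"
proof (rule TC_eqI)
  fix \<rho> assume c: "c \<in> carrier TC" and r: "\<rho> \<subseteq> X"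
  interpret module S "N \<rho>" using r by (rule N_mod)
  show "smu \<one> c \<rho> = c \<rho>" using r TC_carr[OF c r] by (simp add: smu_eval)
qed (simp_all add: smu_closed)

lemma d_zero: "d Y \<zero>\<^bsub>TC\<^esub> = \<zero>\<^bsub>TC\<^esub>"
  by (rule additive_map_zero[OF TC_group TC_group T.dsum_map])

lemma d_minus: "c \<in> carrier TC \<Longrightarrow> c' \<in> carrier TC \<Longrightarrow> d Y (c \<ominus>\<^bsub>TC\<^esub> c') = d Y c \<ominus>\<^bsub>TC\<^esub> d Y c'"
  by (rule additive_map_minus[OF TC_group TC_group T.dsum_map])

text \<open>Used for cochains that vanish on the faces containing \<open>l\<close>: at a face with
  \<open>l\<close>, removing any other direction keeps \<open>l\<close>, so only the
  \<open>l\<close>-term survives.\<close>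

lemma d_eval_single:
  assumes "c \<in> carrier TC" "\<rho> \<subseteq> X" "finite Y" "l \<in> Y" "l \<in> \<rho>"
    "\<And>j. j \<in> Y \<Longrightarrow> j \<in> \<rho> \<Longrightarrow> j \<noteq> l \<Longrightarrow> c (\<rho> - {j}) = \<zero>\<^bsub>N (\<rho> - {j})\<^esub>"
  shows "d Y c \<rho> = sgn_mult (N \<rho>) (even_below \<rho> l) (r l (\<rho> - {l}) (c (\<rho> - {l})))"
proof -
  interpret abelian_group "N \<rho>" using assms(2) by (rule N_ag)
  have "d Y c \<rho> = (\<Oplus>\<^bsub>N \<rho>\<^esub> j\<in>Y. del j c \<rho>)" using assms by (simp add: d_eval)
  also have "\<dots> = del l c \<rho>"
  proof (rule finsum_single)
    fix j assume j: "j \<in> Y" "j \<noteq> l"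
    show "del j c \<rho> = \<zero>\<^bsub>N \<rho>\<^esub>"
    proof (cases "j \<in> \<rho>")
      case True
      then have "c (\<rho> - {j}) = \<zero>\<^bsub>N (\<rho> - {j})\<^esub>" using assms(6) j by blast
      moreover have "r j (\<rho> - {j}) \<zero>\<^bsub>N (\<rho> - {j})\<^esub> = \<zero>\<^bsub>N \<rho>\<^esub>"
        using assms(2) True res_zero[of j "\<rho> - {j}"] by (auto simp: insert_absorb)
      ultimately show ?thesis using assms(2) True by (simp add: del_eval)
    qed (use assms(2) in \<open>simp add: del_eval0\<close>)
  qed (use assms del_ev_closed in auto)
  finally show ?thesis using assms by (simp add: del_eval)
qed

lemma lift_mono:
  assumes l: "l \<in> X" "\<rho> \<subseteq> X" "l \<notin> \<rho>" and k: "k \<le> k'" and z: "z \<in> carrier (N (insert l \<rho>))"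
    and w: "w \<in> D (n + of_nat k * \<delta> l) \<rho>" "r l \<rho> w = (y l [^] k) \<odot>\<^bsub>N (insert l \<rho>)\<^esub> z"
  shows "\<exists>w\<in>D (n + of_nat k' * \<delta> l) \<rho>. r l \<rho> w = (y l [^] k') \<odot>\<^bsub>N (insert l \<rho>)\<^esub> z"
proof
  let ?w = "(y l [^] (k' - k)) \<odot>\<^bsub>N \<rho>\<^esub> w"
  have yc: "y l \<in> carrier S" using gS_carr y_gS l by blast
  have "?w \<in> D (n + of_nat k * \<delta> l + of_nat (k' - k) * \<delta> l) \<rho>"
    by (rule D_pow[OF l(2) y_gS[OF l(1)] w(1)])
  moreover have "n + of_nat k * \<delta> l + of_nat (k' - k) * \<delta> l = n + of_nat k' * \<delta> l"
  proof -
    have "of_nat k * \<delta> l + of_nat (k' - k) * \<delta> l = of_nat (k + (k' - k)) * \<delta> l"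
      by (simp only: of_nat_add distrib_right)
    then show ?thesis using k by (simp only: add.assoc le_add_diff_inverse)
  qed
  ultimately show "?w \<in> D (n + of_nat k' * \<delta> l) \<rho>" by simp
  interpret module S "N (insert l \<rho>)" using l by (intro N_mod) auto
  have "r l \<rho> ?w = (y l [^] (k' - k)) \<odot>\<^bsub>N (insert l \<rho>)\<^esub> r l \<rho> w"
    by (rule r_smult[OF l]) (use yc D_carr[OF l(2) w(1)] in auto)
  also have "\<dots> = (y l [^] k') \<odot>\<^bsub>N (insert l \<rho>)\<^esub> z"
    unfolding w(2) using yc z k by (simp add: S.nat_pow_mult flip: smult_assoc1)
  finally show "r l \<rho> ?w = (y l [^] k') \<odot>\<^bsub>N (insert l \<rho>)\<^esub> z" .
qed

text \<open>
  A cocycle becomes a coboundary after multiplication by a power of \<open>y l\<close>, because the complex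
  localised at \<open>y l\<close> is contractible.
\<close>

lemma power_coboundary:
  assumes Y: "Y \<subseteq> X" and l: "l \<in> Y" and c: "c \<in> CC Y \<tau> p n" and dc: "d Y c = \<zero>\<^bsub>TC\<^esub>"
  shows "\<exists>k. \<exists>h\<in>CC Y \<tau> (p - 1) (n + of_nat k * \<delta> l). smu (y l [^] k) c = d Y h"
proof -
  have lX: "l \<in> X" using Y l by blast
  have finY: "finite Y" using finite_subset[OF Y finX] .
  have yg: "y l \<in> gS (\<delta> l)" by (rule y_gS[OF lX])
  have yc: "y l \<in> carrier S" by (rule gS_carr[OF yg])
  have ypc: "y l [^] (k::nat) \<in> carrier S" for k using yc by simp
  have cT: "c \<in> carrier TC" using c by (rule CC_carr)
  let ?A = "{\<rho>. \<rho> \<subseteq> X \<and> l \<notin> \<rho>}"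
  have finA: "finite ?A" using finX by simp
  \<comment> \<open>After multiplication by a power of \<open>y l\<close> the values of
    \<open>c\<close> on the faces with \<open>l\<close> lift to the faces without \<open>l\<close>;
    \<open>K\<close> is one exponent for all of them.\<close>
  have "\<exists>K. \<forall>\<rho>\<in>?A. \<exists>w\<in>D (n + of_nat K * \<delta> l) \<rho>.
      r l \<rho> w = (y l [^] K) \<odot>\<^bsub>N (insert l \<rho>)\<^esub> c (insert l \<rho>)"
  proof (rule uniform_bound[OF finA])
    fix \<rho> assume "\<rho> \<in> ?A"
    then have a: "\<rho> \<subseteq> X" "l \<notin> \<rho>" "insert l \<rho> \<subseteq> X" using lX by auto
    show "\<exists>k. \<exists>w\<in>D (n + of_nat k * \<delta> l) \<rho>. r l \<rho> w = (y l [^] k) \<odot>\<^bsub>N (insert l \<rho>)\<^esub> c (insert l \<rho>)"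
      by (rule lift[OF lX a(1,2) CC_D[OF c a(3)]])
    fix k k' :: nat
    assume "\<exists>w\<in>D (n + of_nat k * \<delta> l) \<rho>. r l \<rho> w = (y l [^] k) \<odot>\<^bsub>N (insert l \<rho>)\<^esub> c (insert l \<rho>)" "k \<le> k'"
    then show "\<exists>w\<in>D (n + of_nat k' * \<delta> l) \<rho>. r l \<rho> w = (y l [^] k') \<odot>\<^bsub>N (insert l \<rho>)\<^esub> c (insert l \<rho>)"
      using lift_mono[OF lX a(1,2) _ TC_carr[OF cT a(3)]] by blast
  qed
  then obtain K where K: "\<forall>\<rho>\<in>?A. \<exists>w\<in>D (n + of_nat K * \<delta> l) \<rho>.
      r l \<rho> w = (y l [^] K) \<odot>\<^bsub>N (insert l \<rho>)\<^esub> c (insert l \<rho>)" by blast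
  define n1 where "n1 = n + of_nat K * \<delta> l"
  obtain w where w: "\<And>\<rho>. \<rho> \<subseteq> X \<Longrightarrow> l \<notin> \<rho> \<Longrightarrow> w \<rho> \<in> D n1 \<rho>"
    "\<And>\<rho>. \<rho> \<subseteq> X \<Longrightarrow> l \<notin> \<rho> \<Longrightarrow> r l \<rho> (w \<rho>) = (y l [^] K) \<odot>\<^bsub>N (insert l \<rho>)\<^esub> c (insert l \<rho>)"
  proof -
    have "\<forall>\<rho>. \<exists>w. \<rho> \<subseteq> X \<longrightarrow> l \<notin> \<rho> \<longrightarrow>
        w \<in> D n1 \<rho> \<and> r l \<rho> w = (y l [^] K) \<odot>\<^bsub>N (insert l \<rho>)\<^esub> c (insert l \<rho>)"
      using K unfolding n1_def by blast
    from choice[OF this] obtain w where "\<forall>\<rho>. \<rho> \<subseteq> X \<longrightarrow> l \<notin> \<rho> \<longrightarrow>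
        w \<rho> \<in> D n1 \<rho> \<and> r l \<rho> (w \<rho>) = (y l [^] K) \<odot>\<^bsub>N (insert l \<rho>)\<^esub> c (insert l \<rho>)" by blast
    then show thesis using that[of w] by simp
  qed
  \<comment> \<open>The contraction in direction \<open>l\<close>: the lifted value at
    \<open>insert l \<rho>\<close> is placed at \<open>\<rho>\<close>. It carries the sign that the
    differential will apply, so the two signs cancel in \<open>d Y h\<close>.\<close>
  define h where "h = (\<lambda>\<rho>\<in>Pow X. if l \<notin> \<rho> \<and> \<rho> - Y = \<tau> \<and> int (card (\<rho> \<inter> Y)) = p - 1
      then sgn_mult (N \<rho>) (even_below (insert l \<rho>) l) (w \<rho>) else \<zero>\<^bsub>N \<rho>\<^esub>)"
  have hD: "h \<rho> \<in> Dz Y \<tau> (p - 1) n1 \<rho>" if "\<rho> \<subseteq> X" for \<rho>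
    using that w(1)[OF that] D_zero by (simp add: h_def Dz_def D_sgn)
  have hT: "h \<in> carrier TC"
    unfolding TC_simps
  proof (rule PiE_I)
    fix \<rho> assume "\<rho> \<in> Pow X"
    then show "h \<rho> \<in> carrier (N \<rho>)" using D_carr[OF _ Dz_D[OF _ hD]] by blast
  qed (simp add: h_def)
  have h: "h \<in> CC Y \<tau> (p - 1) n1" using hT hD by (simp add: CC_def)
  define c1 where "c1 = smu (y l [^] K) c \<ominus>\<^bsub>TC\<^esub> d Y h"
  have sc: "smu (y l [^] K) c \<in> CC Y \<tau> p n1"
    unfolding n1_def by (rule CC_smu[OF gS_pow[OF yg] c])
  have dh: "d Y h \<in> CC Y \<tau> p n1" using CC_d[OF h] by simp
  have c1: "c1 \<in> CC Y \<tau> p n1" unfolding c1_def by (rule CC_minus[OF sc dh])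
  have c1T: "c1 \<in> carrier TC" using c1 by (rule CC_carr)
  have dc1: "d Y c1 = \<zero>\<^bsub>TC\<^esub>"
  proof -
    have "d Y (smu (y l [^] K) c) = \<zero>\<^bsub>TC\<^esub>"
      unfolding d_smu[OF ypc cT] dc by (rule additive_map_zero[OF TC_group TC_group smu_map[OF ypc]])
    then show ?thesis unfolding c1_def d_minus[OF CC_carr[OF sc] CC_carr[OF dh]]
      using T.dsum_sq[OF finY hT] by (simp add: a_minus_def)
  qed
  \<comment> \<open>On a face with \<open>l\<close> only the \<open>l\<close>-term of
    \<open>d Y h\<close> is nonzero, and it reproduces \<open>smu (y l [^] K) c\<close>.\<close>
  have c1l: "c1 \<rho> = \<zero>\<^bsub>N \<rho>\<^esub>" if r: "\<rho> \<subseteq> X" and lr: "l \<in> \<rho>" for \<rho>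
  proof (cases "\<rho> - Y = \<tau> \<and> int (card (\<rho> \<inter> Y)) = p")
    case True
    interpret abelian_group "N \<rho>" using r by (rule N_ag)
    let ?\<sigma> = "\<rho> - {l}"
    have s: "?\<sigma> \<subseteq> X" "l \<notin> ?\<sigma>" "insert l ?\<sigma> = \<rho>" using r lr by auto
    have s2: "?\<sigma> - Y = \<tau>" "?\<sigma> \<inter> Y = (\<rho> \<inter> Y) - {l}" using True l by auto
    have "finite \<rho>" using finite_subset[OF r finX] .
    then have "card (\<rho> \<inter> Y) = Suc (card ((\<rho> \<inter> Y) - {l}))" using lr l by (intro card.remove) auto
    then have s3: "int (card (?\<sigma> \<inter> Y)) = p - 1" unfolding s2 using True by auto
    have "d Y h \<rho> = sgn_mult (N \<rho>) (even_below \<rho> l) (r l ?\<sigma> (h ?\<sigma>))"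
    proof (rule d_eval_single[OF hT r finY l lr])
      fix j assume "j \<in> Y" "j \<in> \<rho>" "j \<noteq> l"
      then have "\<rho> - {j} \<subseteq> X" "l \<in> \<rho> - {j}" using r lr by auto
      then show "h (\<rho> - {j}) = \<zero>\<^bsub>N (\<rho> - {j})\<^esub>" by (simp add: h_def)
    qed
    also have "h ?\<sigma> = sgn_mult (N ?\<sigma>) (even_below \<rho> l) (w ?\<sigma>)"
      using s s2 s3 by (simp add: h_def)
    also have "r l ?\<sigma> \<dots> = sgn_mult (N \<rho>) (even_below \<rho> l) (r l ?\<sigma> (w ?\<sigma>))"
      by (rule additive_map_sgn_mult[OF N_ag[OF s(1)] N_ag[OF r] r_map'[OF r lr] D_carr[OF s(1) w(1)[OF s(1,2)]]])
    also have "r l ?\<sigma> (w ?\<sigma>) = (y l [^] K) \<odot>\<^bsub>N \<rho>\<^esub> c \<rho>"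
      using w(2)[OF s(1,2)] unfolding s(3) .
    also have "\<dots> = smu (y l [^] K) c \<rho>" using r by (simp add: smu_eval)
    finally have "d Y h \<rho> = smu (y l [^] K) c \<rho>"
      using TC_carr[OF CC_carr[OF sc] r] by (simp add: sgn_mult_def split: if_splits)
    then show ?thesis
      using r TC_carr[OF CC_carr[OF sc] r]
      by (simp add: c1_def TC_ev_simps CC_carr[OF sc] CC_carr[OF dh] a_minus_def r_neg)
  next
    case False
    then show ?thesis using Dz_off[OF CC_Dz[OF c1 r]] by blast
  qed
  \<comment> \<open>Now \<open>c1\<close> is supported on faces without \<open>l\<close>. Its
    cocycle condition, read at \<open>insert l \<rho>\<close>, says that \<open>c1 \<rho>\<close>
    dies under \<open>r l \<rho>\<close>, so a power of \<open>y l\<close> kills it.\<close>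
  have c1n: "\<exists>k::nat. (y l [^] k) \<odot>\<^bsub>N \<rho>\<^esub> c1 \<rho> = \<zero>\<^bsub>N \<rho>\<^esub>" if r: "\<rho> \<subseteq> X" and lr: "l \<notin> \<rho>" for \<rho>
  proof (rule tors[OF lX r lr CC_D[OF c1 r]])
    let ?\<rho> = "insert l \<rho>"
    have s: "?\<rho> \<subseteq> X" "l \<in> ?\<rho>" "?\<rho> - {l} = \<rho>" using lX r lr by auto
    interpret abelian_group "N ?\<rho>" using s(1) by (rule N_ag)
    have "\<zero>\<^bsub>N ?\<rho>\<^esub> = d Y c1 ?\<rho>" using dc1 s by (simp add: TC_ev_simps)
    also have "\<dots> = sgn_mult (N ?\<rho>) (even_below ?\<rho> l) (r l (?\<rho> - {l}) (c1 (?\<rho> - {l})))"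
    proof (rule d_eval_single[OF c1T s(1) finY l s(2)])
      fix j assume "j \<in> Y" "j \<in> ?\<rho>" "j \<noteq> l"
      then have "?\<rho> - {j} \<subseteq> X" "l \<in> ?\<rho> - {j}" using s(1) by auto
      then show "c1 (?\<rho> - {j}) = \<zero>\<^bsub>N (?\<rho> - {j})\<^esub>" by (rule c1l)
    qed
    finally have z: "sgn_mult (N ?\<rho>) (even_below ?\<rho> l) (r l \<rho> (c1 \<rho>)) = \<zero>\<^bsub>N ?\<rho>\<^esub>"
      unfolding s(3) by simp
    have "r l \<rho> (c1 \<rho>) \<in> carrier (N ?\<rho>)"
      by (rule additive_map_closed[OF r_map[OF lX r lr] TC_carr[OF c1T r]])
    then have "r l \<rho> (c1 \<rho>) = sgn_mult (N ?\<rho>) (even_below ?\<rho> l) (sgn_mult (N ?\<rho>) (even_below ?\<rho> l) (r l \<rho> (c1 \<rho>)))"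
      by (simp add: sgn_mult_def)
    then show "r l \<rho> (c1 \<rho>) = \<zero>\<^bsub>N ?\<rho>\<^esub>" unfolding z by simp
  qed
  have "\<exists>K::nat. \<forall>\<rho>\<in>Pow X. (y l [^] K) \<odot>\<^bsub>N \<rho>\<^esub> c1 \<rho> = \<zero>\<^bsub>N \<rho>\<^esub>"
  proof (rule uniform_bound)
    fix \<rho> assume "\<rho> \<in> Pow X"
    then have r: "\<rho> \<subseteq> X" by simp
    interpret module S "N \<rho>" using r by (rule N_mod)
    show "\<exists>k::nat. (y l [^] k) \<odot>\<^bsub>N \<rho>\<^esub> c1 \<rho> = \<zero>\<^bsub>N \<rho>\<^esub>"
    proof (cases "l \<in> \<rho>")
      case True
      then show ?thesis using c1l[OF r] ypc by simp
    qed (use c1n[OF r] in blast)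
    fix k k' :: nat
    assume k: "(y l [^] k) \<odot>\<^bsub>N \<rho>\<^esub> c1 \<rho> = \<zero>\<^bsub>N \<rho>\<^esub>" "k \<le> k'"
    have "(y l [^] k') \<odot>\<^bsub>N \<rho>\<^esub> c1 \<rho> = (y l [^] (k' - k)) \<odot>\<^bsub>N \<rho>\<^esub> ((y l [^] k) \<odot>\<^bsub>N \<rho>\<^esub> c1 \<rho>)"
      using yc TC_carr[OF c1T r] k(2) by (simp add: S.nat_pow_mult flip: smult_assoc1)
    then show "(y l [^] k') \<odot>\<^bsub>N \<rho>\<^esub> c1 \<rho> = \<zero>\<^bsub>N \<rho>\<^esub>" using k(1) ypc by simp
  qed (simp add: finX)
  then obtain K2 :: nat where K2: "\<And>\<rho>. \<rho> \<subseteq> X \<Longrightarrow> (y l [^] K2) \<odot>\<^bsub>N \<rho>\<^esub> c1 \<rho> = \<zero>\<^bsub>N \<rho>\<^esub>" by blast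
  have "smu (y l [^] K2) c1 = \<zero>\<^bsub>TC\<^esub>"
    by (rule TC_eqI) (simp_all add: smu_closed[OF ypc c1T] smu_eval K2 TC_ev_simps)
  then have "smu (y l [^] K2) (smu (y l [^] K) c) \<ominus>\<^bsub>TC\<^esub> smu (y l [^] K2) (d Y h) = \<zero>\<^bsub>TC\<^esub>"
    unfolding c1_def
    using additive_map_minus[OF TC_group TC_group smu_map[OF ypc] CC_carr[OF sc] CC_carr[OF dh]] by simp
  then have "smu (y l [^] K2) (smu (y l [^] K) c) = smu (y l [^] K2) (d Y h)"
    by (rule T.minus_eq_zeroD) (rule smu_closed[OF ypc] CC_carr[OF sc] CC_carr[OF dh])+
  \<comment> \<open>\<open>K\<close> lifts the values and \<open>K2\<close> kills the remaining
    torsion; the required exponent is their sum.\<close>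
  then have "smu (y l [^] (K2 + K)) c = d Y (smu (y l [^] K2) h)"
    using yc cT hT by (simp add: smu_smu d_smu S.nat_pow_mult)
  moreover have "smu (y l [^] K2) h \<in> CC Y \<tau> (p - 1) (n1 + of_nat K2 * \<delta> l)"
    by (rule CC_smu[OF gS_pow[OF yg] h])
  moreover have "n1 + of_nat K2 * \<delta> l = n + of_nat (K2 + K) * \<delta> l"
    unfolding n1_def by (simp only: of_nat_add distrib_right add.assoc add.commute[of "of_nat K2 * \<delta> l"])
  ultimately show ?thesis by metis
qed

text \<open>Induction on the sum of the exponents. If some exponent is 0, then \<open>c\<close>
  itself is a coboundary. Otherwise \<open>y l c\<close> needs a smaller exponent in direction
  \<open>l\<close>, so it is a coboundary for every \<open>l\<close>; the relation then makes
  \<open>u c\<close> a coboundary, and \<open>u\<close> can be divided out on the faces over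
  \<open>\<tau>\<close>.\<close>

lemma exact_of_power_coboundaries:
  assumes Y: "Y \<subseteq> X" and u: "u \<in> gS b" and \<beta>: "\<And>l. l \<in> Y \<Longrightarrow> \<beta> l \<in> gS (b - \<delta> l)"
    and rel: "\<And>\<rho> z. \<rho> \<subseteq> X \<Longrightarrow> \<rho> - Y = \<tau> \<Longrightarrow> z \<in> carrier (N \<rho>) \<Longrightarrow>
      u \<odot>\<^bsub>N \<rho>\<^esub> z = (\<Oplus>\<^bsub>N \<rho>\<^esub> l\<in>Y. (\<beta> l \<otimes> y l) \<odot>\<^bsub>N \<rho>\<^esub> z)"
    and inj: "\<And>\<rho> z. \<rho> \<subseteq> X \<Longrightarrow> \<rho> - Y = \<tau> \<Longrightarrow> z \<in> carrier (N \<rho>) \<Longrightarrow> u \<odot>\<^bsub>N \<rho>\<^esub> z = \<zero>\<^bsub>N \<rho>\<^esub> \<Longrightarrow>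
      z = \<zero>\<^bsub>N \<rho>\<^esub>"
    and surj: "\<And>\<rho> n z. \<rho> \<subseteq> X \<Longrightarrow> \<rho> - Y = \<tau> \<Longrightarrow> z \<in> D (n + b) \<rho> \<Longrightarrow> \<exists>z'\<in>D n \<rho>. u \<odot>\<^bsub>N \<rho>\<^esub> z' = z"
    and c: "c \<in> CC Y \<tau> p n" and dc: "d Y c = \<zero>\<^bsub>TC\<^esub>"
    and pw: "\<And>l. l \<in> Y \<Longrightarrow> \<exists>h\<in>CC Y \<tau> (p - 1) (n + of_nat (k l) * \<delta> l). smu (y l [^] (k l)) c = d Y h"
  shows "\<exists>h\<in>CC Y \<tau> (p - 1) n. c = d Y h"
  using c dc pw
proof (induction "\<Sum>l\<in>Y. k l" arbitrary: c n k rule: less_induct)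
  case less
  note c = less.prems(1) and dc = less.prems(2) and pw = less.prems(3)
  have finY: "finite Y" using finite_subset[OF Y finX] .
  have yg: "y l \<in> gS (\<delta> l)" if "l \<in> Y" for l using y_gS Y that by blast
  have yc: "y l \<in> carrier S" if "l \<in> Y" for l using gS_carr yg that by blast
  have \<beta>c: "\<beta> l \<in> carrier S" if "l \<in> Y" for l using gS_carr \<beta> that by blast
  have uc: "u \<in> carrier S" by (rule gS_carr[OF u])
  have cT: "c \<in> carrier TC" using c by (rule CC_carr)
  show ?case
  proof (cases "\<exists>l\<in>Y. k l = 0")
    case True
    then obtain l where l: "l \<in> Y" "k l = 0" by blast
    then obtain h where "h \<in> CC Y \<tau> (p - 1) (n + of_nat 0 * \<delta> l)" "smu (y l [^] (0::nat)) c = d Y h"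
      using pw[OF l(1)] by auto
    then show ?thesis using smu_one[OF cT] by auto
  next
    case False
    have "\<exists>h\<in>CC Y \<tau> (p - 1) (n + \<delta> l). smu (y l) c = d Y h" if l: "l \<in> Y" for l
    proof (rule less.hyps)
      have kl: "k l > 0" using False l by auto
      \<comment> \<open>One factor of \<open>y l\<close> is already present in
        \<open>smu (y l) c\<close>; the exponents in the other directions stay the same.\<close>
      let ?k = "k(l := k l - 1)"
      show "(\<Sum>j\<in>Y. ?k j) < (\<Sum>j\<in>Y. k j)"
        by (rule sum_strict_mono_ex1) (use finY l kl in \<open>auto intro!: bexI[of _ l]\<close>)
      show "smu (y l) c \<in> CC Y \<tau> p (n + \<delta> l)" by (rule CC_smu[OF yg[OF l] c])
      show "d Y (smu (y l) c) = \<zero>\<^bsub>TC\<^esub>"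
        unfolding d_smu[OF yc[OF l] cT] dc
        by (rule additive_map_zero[OF TC_group TC_group smu_map[OF yc[OF l]]])
      fix j assume j: "j \<in> Y"
      show "\<exists>h\<in>CC Y \<tau> (p - 1) (n + \<delta> l + of_nat (?k j) * \<delta> j). smu (y j [^] ?k j) (smu (y l) c) = d Y h"
      proof (cases "j = l")
        case True
        obtain h where h: "h \<in> CC Y \<tau> (p - 1) (n + of_nat (k l) * \<delta> l)" "smu (y l [^] k l) c = d Y h"
          using pw[OF l] by blast
        have kk: "Suc (k l - 1) = k l" using kl by simp
        have "\<delta> l + of_nat (k l - 1) * \<delta> l = of_nat (Suc (k l - 1)) * \<delta> l"
          by (simp only: of_nat_Suc distrib_right mult_1_left)
        then have e: "n + \<delta> l + of_nat (k l - 1) * \<delta> l = n + of_nat (k l) * \<delta> l"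
          by (simp only: add.assoc kk)
        have "smu (y l [^] (k l - 1)) (smu (y l) c) = smu (y l [^] k l) c"
          using kl yc[OF l] cT by (simp add: smu_smu flip: S.nat_pow_Suc)
        moreover have "h \<in> CC Y \<tau> (p - 1) (n + \<delta> l + of_nat (k l - 1) * \<delta> l)" unfolding e by (rule h(1))
        ultimately show ?thesis unfolding True fun_upd_same using h(2) by metis
      next
        case False
        obtain h where h: "h \<in> CC Y \<tau> (p - 1) (n + of_nat (k j) * \<delta> j)" "smu (y j [^] k j) c = d Y h"
          using pw[OF j] by blast
        have "smu (y j [^] k j) (smu (y l) c) = smu (y l) (smu (y j [^] k j) c)"
          using yc[OF l] yc[OF j] cT by (simp add: smu_smu S.m_comm)
        also have "\<dots> = d Y (smu (y l) h)" unfolding h(2) using d_smu[OF yc[OF l] CC_carr[OF h(1)]] by simp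
        finally have "smu (y j [^] k j) (smu (y l) c) = d Y (smu (y l) h)" .
        moreover have "smu (y l) h \<in> CC Y \<tau> (p - 1) (n + of_nat (k j) * \<delta> j + \<delta> l)"
          by (rule CC_smu[OF yg[OF l] h(1)])
        moreover have e: "n + of_nat (k j) * \<delta> j + \<delta> l = n + \<delta> l + of_nat (k j) * \<delta> j"
          by (simp only: add.assoc add.commute[of "\<delta> l"])
        moreover have "(k(l := k l - 1)) j = k j" using False by simp
        ultimately show ?thesis by metis
      qed
    qed
    then obtain H where H: "\<And>l. l \<in> Y \<Longrightarrow> H l \<in> CC Y \<tau> (p - 1) (n + \<delta> l)"
      "\<And>l. l \<in> Y \<Longrightarrow> smu (y l) c = d Y (H l)" by metis
    \<comment> \<open>Each \<open>y l c\<close> is \<open>d Y (H l)\<close>, so by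
      \<open>rel\<close> this \<open>h\<close> satisfies \<open>d Y h = u c\<close> on the faces
      over \<open>\<tau>\<close>.\<close>
    define h where "h = (\<Oplus>\<^bsub>TC\<^esub> l\<in>Y. smu (\<beta> l) (H l))"
    have bH: "smu (\<beta> l) (H l) \<in> CC Y \<tau> (p - 1) (n + b)" if "l \<in> Y" for l
      using CC_smu[OF \<beta>[OF that] H(1)[OF that]] by simp
    have h: "h \<in> CC Y \<tau> (p - 1) (n + b)" unfolding h_def by (rule CC_finsum[OF bH])
    have HT: "H l \<in> carrier TC" if "l \<in> Y" for l using CC_carr[OF H(1)[OF that]] .
    have "d Y h = (\<Oplus>\<^bsub>TC\<^esub> l\<in>Y. d Y (smu (\<beta> l) (H l)))"
      unfolding h_def by (rule additive_map_finsum[OF TC_group TC_group T.dsum_map]) (use CC_carr[OF bH] in auto)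
    also have "\<dots> = (\<Oplus>\<^bsub>TC\<^esub> l\<in>Y. smu (\<beta> l \<otimes> y l) c)"
    proof (rule T.finsum_cong')
      fix l assume l: "l \<in> Y"
      show "d Y (smu (\<beta> l) (H l)) = smu (\<beta> l \<otimes> y l) c"
        using l d_smu[OF \<beta>c[OF l] HT[OF l]] H(2)[OF l] smu_smu[OF \<beta>c[OF l] yc[OF l] cT] by simp
    qed (use smu_closed[OF _ cT] \<beta>c yc in auto)
    finally have dh: "d Y h = (\<Oplus>\<^bsub>TC\<^esub> l\<in>Y. smu (\<beta> l \<otimes> y l) c)" .
    have dhu: "d Y h \<rho> = u \<odot>\<^bsub>N \<rho>\<^esub> c \<rho>" if r: "\<rho> \<subseteq> X" "\<rho> - Y = \<tau>" for \<rho>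
    proof -
      have "(\<lambda>l. smu (\<beta> l \<otimes> y l) c) \<in> Y \<rightarrow> carrier TC" using smu_closed[OF _ cT] \<beta>c yc by auto
      then have "d Y h \<rho> = (\<Oplus>\<^bsub>N \<rho>\<^esub> l\<in>Y. smu (\<beta> l \<otimes> y l) c \<rho>)" unfolding dh using r by (simp add: TC_ev_simps)
      also have "\<dots> = (\<Oplus>\<^bsub>N \<rho>\<^esub> l\<in>Y. (\<beta> l \<otimes> y l) \<odot>\<^bsub>N \<rho>\<^esub> c \<rho>)" using r by (simp add: smu_eval)
      also have "\<dots> = u \<odot>\<^bsub>N \<rho>\<^esub> c \<rho>" using rel[OF r TC_carr[OF cT r(1)]] by simp
      finally show ?thesis .
    qed
    let ?on = "\<lambda>\<rho>. \<rho> - Y = \<tau> \<and> int (card (\<rho> \<inter> Y)) = p - 1"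
    \<comment> \<open>Division by \<open>u\<close> brings \<open>h\<close> back from degree
      \<open>n + b\<close> to degree \<open>n\<close>; the choice is made face by face, and
      \<open>inj\<close> later shows that the result has the right differential.\<close>
    have "\<exists>z\<in>D n \<rho>. u \<odot>\<^bsub>N \<rho>\<^esub> z = h \<rho>" if "\<rho> \<subseteq> X" "\<rho> - Y = \<tau>" for \<rho>
      using surj[OF that CC_D[OF h that(1)]] .
    then obtain g where g: "\<And>\<rho>. \<rho> \<subseteq> X \<Longrightarrow> \<rho> - Y = \<tau> \<Longrightarrow> g \<rho> \<in> D n \<rho>"
      "\<And>\<rho>. \<rho> \<subseteq> X \<Longrightarrow> \<rho> - Y = \<tau> \<Longrightarrow> u \<odot>\<^bsub>N \<rho>\<^esub> g \<rho> = h \<rho>" by metis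
    define h' where "h' = (\<lambda>\<rho>\<in>Pow X. if ?on \<rho> then g \<rho> else \<zero>\<^bsub>N \<rho>\<^esub>)"
    have h'D: "h' \<rho> \<in> Dz Y \<tau> (p - 1) n \<rho>" if "\<rho> \<subseteq> X" for \<rho>
      using that g(1)[OF that] by (simp add: h'_def Dz_def)
    have h'T: "h' \<in> carrier TC"
      unfolding TC_simps
    proof (rule PiE_I)
      fix \<rho> assume "\<rho> \<in> Pow X"
      then show "h' \<rho> \<in> carrier (N \<rho>)" using D_carr[OF _ Dz_D[OF _ h'D]] by blast
    qed (simp add: h'_def)
    have h': "h' \<in> CC Y \<tau> (p - 1) n" using h'T h'D by (simp add: CC_def)
    have uh: "smu u h' = h"
    proof (rule TC_eqI)
      fix \<rho> assume r: "\<rho> \<subseteq> X"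
      interpret module S "N \<rho>" using r by (rule N_mod)
      show "smu u h' \<rho> = h \<rho>"
      proof (cases "?on \<rho>")
        case True
        then show ?thesis using r g(2)[OF r] by (simp add: smu_eval h'_def)
      next
        case False
        then have "h \<rho> = \<zero>\<^bsub>N \<rho>\<^esub>" by (rule Dz_off[OF CC_Dz[OF h r]])
        moreover have "h' \<rho> = \<zero>\<^bsub>N \<rho>\<^esub>" unfolding h'_def using False r by auto
        ultimately show ?thesis using r uc by (simp add: smu_eval)
      qed
    qed (use h'T CC_carr[OF h] uc in \<open>simp_all add: smu_closed\<close>)
    have dh': "d Y h' \<in> CC Y \<tau> p n" using CC_d[OF h'] by simp
    have "c = d Y h'"
    proof (rule TC_eqI[OF cT CC_carr[OF dh']])
      fix \<rho> assume r: "\<rho> \<subseteq> X"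
      interpret module S "N \<rho>" using r by (rule N_mod)
      show "c \<rho> = d Y h' \<rho>"
      proof (cases "\<rho> - Y = \<tau>")
        case True
        have cl: "c \<rho> \<in> carrier (N \<rho>)" "d Y h' \<rho> \<in> carrier (N \<rho>)"
          using TC_carr[OF cT r] TC_carr[OF CC_carr[OF dh'] r] by auto
        have "u \<odot>\<^bsub>N \<rho>\<^esub> d Y h' \<rho> = smu u (d Y h') \<rho>" using r by (simp add: smu_eval)
        also have "\<dots> = u \<odot>\<^bsub>N \<rho>\<^esub> c \<rho>"
          using dhu[OF r True] d_smu[OF uc h'T] uh by simp
        finally have "u \<odot>\<^bsub>N \<rho>\<^esub> (c \<rho> \<ominus>\<^bsub>N \<rho>\<^esub> d Y h' \<rho>) = \<zero>\<^bsub>N \<rho>\<^esub>"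
          using cl uc by (simp add: a_minus_def smult_r_distr smult_r_minus M.r_neg)
        then have "c \<rho> \<ominus>\<^bsub>N \<rho>\<^esub> d Y h' \<rho> = \<zero>\<^bsub>N \<rho>\<^esub>" using inj[OF r True] cl by simp
        then show ?thesis using M.minus_eq_zeroD cl by blast
      next
        case False
        then show ?thesis using Dz_off[OF CC_Dz[OF c r]] Dz_off[OF CC_Dz[OF dh' r]] by simp
      qed
    qed
    then show ?thesis using h' by blast
  qed
qed

text \<open>Contraction in a single direction costs a power of \<open>y l\<close>; the relation for
  the unit \<open>u\<close> trades all these powers away. The place \<open>p\<close> is arbitrary,
  as the staircase passes through many places.\<close>

theorem exactI:
  assumes Y: "Y \<subseteq> X" and u: "u \<in> gS b" and \<beta>: "\<And>l. l \<in> Y \<Longrightarrow> \<beta> l \<in> gS (b - \<delta> l)"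
    and rel: "\<And>\<rho> z. \<rho> \<subseteq> X \<Longrightarrow> \<rho> - Y = \<tau> \<Longrightarrow> z \<in> carrier (N \<rho>) \<Longrightarrow>
      u \<odot>\<^bsub>N \<rho>\<^esub> z = (\<Oplus>\<^bsub>N \<rho>\<^esub> l\<in>Y. (\<beta> l \<otimes> y l) \<odot>\<^bsub>N \<rho>\<^esub> z)"
    and inj: "\<And>\<rho> z. \<rho> \<subseteq> X \<Longrightarrow> \<rho> - Y = \<tau> \<Longrightarrow> z \<in> carrier (N \<rho>) \<Longrightarrow> u \<odot>\<^bsub>N \<rho>\<^esub> z = \<zero>\<^bsub>N \<rho>\<^esub> \<Longrightarrow>
      z = \<zero>\<^bsub>N \<rho>\<^esub>"
    and surj: "\<And>\<rho> n z. \<rho> \<subseteq> X \<Longrightarrow> \<rho> - Y = \<tau> \<Longrightarrow> z \<in> D (n + b) \<rho> \<Longrightarrow> \<exists>z'\<in>D n \<rho>. u \<odot>\<^bsub>N \<rho>\<^esub> z' = z"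
  shows "exact Y \<tau> p n"
  unfolding exact_def
proof (intro ballI impI)
  fix c assume c: "c \<in> CC Y \<tau> p n" "d Y c = \<zero>\<^bsub>TC\<^esub>"
  have "\<forall>l\<in>Y. \<exists>k. \<exists>h\<in>CC Y \<tau> (p - 1) (n + of_nat k * \<delta> l). smu (y l [^] k) c = d Y h"
    using power_coboundary[OF Y _ c] by blast
  then obtain k where k: "\<And>l. l \<in> Y \<Longrightarrow> \<exists>h\<in>CC Y \<tau> (p - 1) (n + of_nat (k l) * \<delta> l). smu (y l [^] k l) c = d Y h"
    by metis
  show "\<exists>h\<in>CC Y \<tau> (p - 1) n. c = d Y h"
    by (rule exact_of_power_coboundaries[OF Y u \<beta> rel inj surj c k]) 
qed

section \<open>The double complex of a cube\<close>

definition res :: "nat set \<Rightarrow> nat set \<Rightarrow> (nat set \<Rightarrow> 'x) \<Rightarrow> nat set \<Rightarrow> 'x" where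
  "res Y \<tau> c = (\<lambda>\<rho>\<in>Pow X. if \<rho> - Y = \<tau> then c \<rho> else \<zero>\<^bsub>N \<rho>\<^esub>)"

text \<open>An entry of the double complex: all outer faces of size \<open>q\<close> at once. As
  \<open>d Y\<close> never changes \<open>\<rho> - Y\<close>, it is the product of the groups
  \<open>CC Y \<tau> p n\<close> over these outer faces, and \<open>res\<close> is the projection to
  one of them.\<close>

definition Cg :: "nat set \<Rightarrow> int \<Rightarrow> int \<Rightarrow> ('s \<Rightarrow> int) \<Rightarrow> (nat set \<Rightarrow> 'x) set" where
  "Cg Y p q n = {c \<in> carrier TC. \<forall>\<rho>\<subseteq>X. c \<rho> \<in>
     (if int (card (\<rho> \<inter> Y)) = p \<and> int (card (\<rho> - Y)) = q then D n \<rho> else {\<zero>\<^bsub>N \<rho>\<^esub>})}"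

lemma res_closed: "c \<in> carrier TC \<Longrightarrow> res Y \<tau> c \<in> carrier TC"
  unfolding TC_simps
proof (rule PiE_I)
  fix \<rho> assume c: "c \<in> (\<Pi>\<^sub>E \<rho>\<in>Pow X. carrier (N \<rho>))" and "\<rho> \<in> Pow X"
  then show "res Y \<tau> c \<rho> \<in> carrier (N \<rho>)"
    using D_carr[OF _ D_zero] by (auto simp: res_def PiE_iff)
qed (simp add: res_def)

lemma res_CC:
  assumes "c \<in> Cg Y p (int (card \<tau>)) n"
  shows "res Y \<tau> c \<in> CC Y \<tau> p n"
  unfolding CC_def
proof (intro CollectI conjI allI impI)
  show "res Y \<tau> c \<in> carrier TC" using assms by (simp add: res_closed Cg_def)
  fix \<rho> assume r: "\<rho> \<subseteq> X"
  then have "c \<rho> \<in> (if int (card (\<rho> \<inter> Y)) = p \<and> int (card (\<rho> - Y)) = int (card \<tau>) then D n \<rho> else {\<zero>\<^bsub>N \<rho>\<^esub>})"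
    using assms unfolding Cg_def by blast
  then show "res Y \<tau> c \<rho> \<in> Dz Y \<tau> p n \<rho>" using r by (auto simp: res_def Dz_def)
qed

lemma d_res:
  assumes "c \<in> carrier TC" "\<rho> \<subseteq> X"
  shows "d Y (res Y \<tau> c) \<rho> = (if \<rho> - Y = \<tau> then d Y c \<rho> else \<zero>\<^bsub>N \<rho>\<^esub>)"
proof -
  have e: "\<rho> - {l} - Y = \<rho> - Y" "\<rho> - {l} \<subseteq> X" if "l \<in> Y" for l using that assms by auto
  show ?thesis
  proof (cases "\<rho> - Y = \<tau>")
    case True
    have "d Y (res Y \<tau> c) \<rho> = d Y c \<rho>"
      by (rule d_cong[OF res_closed[OF assms(1)] assms]) (use e True in \<open>simp add: res_def\<close>)
    then show ?thesis using True by simp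
  next
    case False
    have "d Y (res Y \<tau> c) \<rho> = d Y \<zero>\<^bsub>TC\<^esub> \<rho>"
      by (rule d_cong[OF res_closed[OF assms(1)] _ assms(2)]) (use e False in \<open>simp_all add: res_def TC_ev_simps\<close>)
    then show ?thesis using False assms by (simp add: d_zero TC_ev_simps)
  qed
qed

lemma Cg_carr: "c \<in> Cg Y p q n \<Longrightarrow> c \<in> carrier TC" by (simp add: Cg_def)

lemma Cg_val: "c \<in> Cg Y p q n \<Longrightarrow> \<rho> \<subseteq> X \<Longrightarrow>
    c \<rho> \<in> (if int (card (\<rho> \<inter> Y)) = p \<and> int (card (\<rho> - Y)) = q then D n \<rho> else {\<zero>\<^bsub>N \<rho>\<^esub>})"
  unfolding Cg_def by blast

lemma Cg_off: "c \<in> Cg Y p q n \<Longrightarrow> \<rho> \<subseteq> X \<Longrightarrow> int (card (\<rho> - Y)) \<noteq> q \<Longrightarrow> c \<rho> = \<zero>\<^bsub>N \<rho>\<^esub>"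
  unfolding Cg_def by (auto split: if_splits)

lemma Cg_d: 
  assumes c: "c \<in> Cg Y p q n"
  shows "d Y c \<in> Cg Y (p + 1) q n"
  unfolding Cg_def
proof (intro CollectI conjI allI impI)
  have cT: "c \<in> carrier TC" by (rule Cg_carr[OF c])
  show "d Y c \<in> carrier TC" using cT by simp
  fix \<rho> assume r: "\<rho> \<subseteq> X"
  show "d Y c \<rho> \<in> (if int (card (\<rho> \<inter> Y)) = p + 1 \<and> int (card (\<rho> - Y)) = q then D n \<rho> else {\<zero>\<^bsub>N \<rho>\<^esub>})"
  proof (cases "int (card (\<rho> - Y)) = q")
    case True
    have "res Y (\<rho> - Y) c \<in> CC Y (\<rho> - Y) p n" using c True by (intro res_CC) simp
    then have "d Y (res Y (\<rho> - Y) c) \<rho> \<in> Dz Y (\<rho> - Y) (p + 1) n \<rho>" by (rule CC_Dz[OF CC_d r])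
    then show ?thesis using True r cT by (simp add: d_res Dz_def)
  next
    case False
    have "d Y c \<rho> = d Y \<zero>\<^bsub>TC\<^esub> \<rho>"
    proof (rule d_cong[OF cT _ r])
      fix l assume l: "l \<in> \<rho>" "l \<in> Y"
      have "\<rho> - {l} - Y = \<rho> - Y" "\<rho> - {l} \<subseteq> X" using l r by auto
      then show "c (\<rho> - {l}) = \<zero>\<^bsub>TC\<^esub> (\<rho> - {l})"
        using Cg_off[OF c, of "\<rho> - {l}"] False by (simp add: TC_ev_simps)
    qed simp
    then show ?thesis using False r by (simp add: d_zero TC_ev_simps)
  qed
qed

text \<open>Preimages are chosen for each outer face separately and glued; the differential does not
  mix different outer faces, so the glued cochain has the right image.\<close>

lemma Cg_exact:
  assumes ex: "\<And>\<tau>. \<tau> \<subseteq> X - Y \<Longrightarrow> int (card \<tau>) = q \<Longrightarrow> exact Y \<tau> p n"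
    and c: "c \<in> Cg Y p q n" and dc: "d Y c = \<zero>\<^bsub>TC\<^esub>"
  shows "\<exists>h\<in>Cg Y (p - 1) q n. c = d Y h"
proof -
  have cT: "c \<in> carrier TC" by (rule Cg_carr[OF c])
  have "\<exists>h\<in>CC Y \<tau> (p - 1) n. res Y \<tau> c = d Y h" if t: "\<tau> \<subseteq> X - Y" "int (card \<tau>) = q" for \<tau>
  proof -
    have "d Y (res Y \<tau> c) = \<zero>\<^bsub>TC\<^esub>"
      by (rule TC_eqI) (use cT in \<open>simp_all add: res_closed d_res dc TC_ev_simps\<close>)
    then show ?thesis using ex[OF t] res_CC[of c Y p \<tau> n] c t(2) unfolding exact_def by blast
  qed
  then obtain H where H: "\<And>\<tau>. \<tau> \<subseteq> X - Y \<Longrightarrow> int (card \<tau>) = q \<Longrightarrow> H \<tau> \<in> CC Y \<tau> (p - 1) n"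
    "\<And>\<tau>. \<tau> \<subseteq> X - Y \<Longrightarrow> int (card \<tau>) = q \<Longrightarrow> res Y \<tau> c = d Y (H \<tau>)" by metis
  define h where "h = (\<lambda>\<rho>\<in>Pow X. if int (card (\<rho> - Y)) = q then H (\<rho> - Y) \<rho> else \<zero>\<^bsub>N \<rho>\<^esub>)"
  have HD: "H (\<rho> - Y) \<rho> \<in> Dz Y (\<rho> - Y) (p - 1) n \<rho>" if "\<rho> \<subseteq> X" "int (card (\<rho> - Y)) = q" for \<rho>
    by (rule CC_Dz[OF H(1) that(1)]) (use that in auto)
  have hT: "h \<in> carrier TC"
    unfolding TC_simps
  proof (rule PiE_I)
    fix \<rho> assume "\<rho> \<in> Pow X"
    then show "h \<rho> \<in> carrier (N \<rho>)"
      using D_carr[OF _ Dz_D[OF _ HD]] D_carr[OF _ D_zero] by (simp add: h_def)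
  qed (simp add: h_def)
  have h: "h \<in> Cg Y (p - 1) q n"
    unfolding Cg_def
  proof (intro CollectI conjI allI impI hT)
    fix \<rho> assume r: "\<rho> \<subseteq> X"
    show "h \<rho> \<in> (if int (card (\<rho> \<inter> Y)) = p - 1 \<and> int (card (\<rho> - Y)) = q then D n \<rho> else {\<zero>\<^bsub>N \<rho>\<^esub>})"
    proof (cases "int (card (\<rho> - Y)) = q")
      case True
      then show ?thesis using HD[OF r True] r by (simp add: h_def Dz_def)
    qed (use r in \<open>simp add: h_def\<close>)
  qed
  have "c = d Y h"
  proof (rule TC_eqI[OF cT])
    show "d Y h \<in> carrier TC" using hT by simp
    fix \<rho> assume r: "\<rho> \<subseteq> X"
    show "c \<rho> = d Y h \<rho>"
    proof (cases "int (card (\<rho> - Y)) = q")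
      case True
      let ?\<tau> = "\<rho> - Y"
      have t: "?\<tau> \<subseteq> X - Y" using r by auto
      have "c \<rho> = res Y ?\<tau> c \<rho>" using r by (simp add: res_def)
      also have "\<dots> = d Y (H ?\<tau>) \<rho>" using H(2)[OF t True] by simp
      also have "\<dots> = d Y h \<rho>"
      proof (rule d_cong[OF CC_carr[OF H(1)[OF t True]] hT r])
        fix l assume l: "l \<in> \<rho>" "l \<in> Y"
        have "\<rho> - {l} - Y = \<rho> - Y" "\<rho> - {l} \<subseteq> X" using l r by auto
        then show "H ?\<tau> (\<rho> - {l}) = h (\<rho> - {l})" using True by (simp add: h_def)
      qed
      finally show ?thesis .
    next
      case False
      then show ?thesis using Cg_off[OF c r False] Cg_off[OF Cg_d[OF h] r False] by simp
    qed
  qed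
  then show ?thesis using h by blast
qed

lemma Cg_neg: "p < 0 \<Longrightarrow> Cg Y p q n = {\<zero>\<^bsub>TC\<^esub>}"
proof -
  assume p: "p < 0"
  have "c = \<zero>\<^bsub>TC\<^esub>" if "c \<in> Cg Y p q n" for c
    by (rule TC_eqI) (use that p in \<open>auto simp: Cg_def TC_ev_simps\<close>)
  moreover have "\<zero>\<^bsub>TC\<^esub> \<in> Cg Y p q n" using D_zero by (simp add: Cg_def TC_ev_simps)
  ultimately show ?thesis by blast
qed

lemma Cg_minus:
  assumes "z \<in> Cg Y p q n" "w \<in> Cg Y p q n"
  shows "z \<ominus>\<^bsub>TC\<^esub> w \<in> Cg Y p q n"
  unfolding Cg_def
proof (intro CollectI conjI allI impI)
  have zw: "z \<in> carrier TC" "w \<in> carrier TC" using assms Cg_carr by auto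
  show "z \<ominus>\<^bsub>TC\<^esub> w \<in> carrier TC" using zw by (rule T.minus_closed)
  fix \<rho> assume r: "\<rho> \<subseteq> X"
  interpret abelian_group "N \<rho>" using r by (rule N_ag)
  show "(z \<ominus>\<^bsub>TC\<^esub> w) \<rho> \<in> (if int (card (\<rho> \<inter> Y)) = p \<and> int (card (\<rho> - Y)) = q then D n \<rho> else {\<zero>\<^bsub>N \<rho>\<^esub>})"
  proof (cases "int (card (\<rho> \<inter> Y)) = p \<and> int (card (\<rho> - Y)) = q")
    note zv = Cg_val[OF assms(1) r] and wv = Cg_val[OF assms(2) r]
    case True
    then have "z \<rho> \<in> D n \<rho>" "w \<rho> \<in> D n \<rho>" using zv wv by simp_all
    then show ?thesis using True r zw by (simp add: TC_ev_simps a_minus_def D_add D_neg)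
  next
    note zv = Cg_val[OF assms(1) r] and wv = Cg_val[OF assms(2) r]
    case False
    then have "z \<rho> = \<zero>\<^bsub>N \<rho>\<^esub>" "w \<rho> = \<zero>\<^bsub>N \<rho>\<^esub>"
      using zv wv by (metis singletonD)+
    then have "(z \<ominus>\<^bsub>TC\<^esub> w) \<rho> = \<zero>\<^bsub>N \<rho>\<^esub>" using r zw by (simp add: TC_ev_simps a_minus_def)
    then show ?thesis using False by (simp only: if_False singleton_iff simp_thms)
  qed
qed

text \<open>
  Here \<open>A\<close> and \<open>B\<close> index the two differentials of the double complex; \<open>exact A \<tau> p n\<close> concerns
  the \<open>A\<close>-complex over the face \<open>\<tau> \<subseteq> B\<close>.
\<close>

theorem exact_transfer:
  assumes X: "X = A \<union> B" and AB: "A \<inter> B = {}" and i: "0 \<le> i"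
    and exA: "\<And>\<tau>. \<tau> \<subseteq> B \<Longrightarrow> \<tau> \<noteq> {} \<Longrightarrow> exact A \<tau> (i + 1 - int (card \<tau>)) n"
    and exB: "\<And>\<sigma>. \<sigma> \<subseteq> A \<Longrightarrow> exact B \<sigma> (i - int (card \<sigma>)) n"
  shows "exact A {} i n"
proof -
  have fin: "finite A" "finite B" using finX X by auto
  \<comment> \<open>Exchanging the two sets of directions exchanges the two indices of the double
    complex, so every fact about \<open>d A\<close> also serves for \<open>d B\<close>.\<close>
  have sw: "Cg B q p n = Cg A p q n" for p q
  proof -
    have "\<rho> \<inter> B = \<rho> - A" "\<rho> - B = \<rho> \<inter> A" if "\<rho> \<subseteq> X" for \<rho> using that X AB by auto
    then show ?thesis unfolding Cg_def by auto
  qed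
  interpret dc: anticommuting_differentials TC "d A" "d B" "\<lambda>p q. Cg A p q n"
  proof
    show "additive_map TC TC (d A)" "additive_map TC TC (d B)" by (rule T.dsum_map)+
    show "d A (d A z) = \<zero>\<^bsub>TC\<^esub>" "d B (d B z) = \<zero>\<^bsub>TC\<^esub>" if "z \<in> carrier TC" for z
      by (rule T.dsum_sq[OF fin(1) that] T.dsum_sq[OF fin(2) that])+
    show "d A (d B z) = \<ominus>\<^bsub>TC\<^esub> d B (d A z)" if "z \<in> carrier TC" for z by (rule T.dsum_anti[OF that AB])
    show "Cg A p q n \<subseteq> carrier TC" for p q using Cg_carr by blast
    show "z \<ominus>\<^bsub>TC\<^esub> w \<in> Cg A p q n" if "z \<in> Cg A p q n" "w \<in> Cg A p q n" for z w p q
      by (rule Cg_minus[OF that])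
    show "\<zero>\<^bsub>TC\<^esub> \<in> Cg A p q n" for p q using D_zero by (simp add: Cg_def TC_ev_simps)
    show "Cg A (- 1) q n = {\<zero>\<^bsub>TC\<^esub>}" for q by (rule Cg_neg) simp
    show "d A z \<in> Cg A (p + 1) q n" if "z \<in> Cg A p q n" for z p q by (rule Cg_d[OF that])
    show "d B z \<in> Cg A p (q + 1) n" if "z \<in> Cg A p q n" for z p q
      using Cg_d[of z B q p n] that unfolding sw .
  qed
  have "dc.exact_a i 0"
  proof (rule dc.staircase[OF _ _ _ i])
    show "Cg A p (- 1) n = {\<zero>\<^bsub>TC\<^esub>}" for p using Cg_neg[of "- 1" B p n] unfolding sw by simp
    fix k :: int assume k: "0 \<le> k" "k \<le> i"
    show "dc.exact_a (i - k) (k + 1)"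
      unfolding dc.exact_a_def
    proof (intro ballI impI)
      fix z assume z: "z \<in> Cg A (i - k) (k + 1) n" "d A z = \<zero>\<^bsub>TC\<^esub>"
      show "\<exists>h\<in>Cg A (i - k - 1) (k + 1) n. z = d A h"
      proof (rule Cg_exact[OF _ z])
        \<comment> \<open>Row \<open>k + 1\<close> consists of outer faces with at least one
          element, so exactness over the empty face is never asked for; that case is the
          conclusion.\<close>
        fix \<tau> assume t: "\<tau> \<subseteq> X - A" "int (card \<tau>) = k + 1"
        then have s: "\<tau> \<subseteq> B" "\<tau> \<noteq> {}" using X k by auto
        have e: "i + 1 - int (card \<tau>) = i - k" using t by simp
        show "exact A \<tau> (i - k) n" using exA[OF s] unfolding e .
      qed
    qed
    show "dc.exact_b k (i - k)"
      unfolding dc.exact_b_def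
    proof (intro ballI impI)
      fix z assume z: "z \<in> Cg A k (i - k) n" "d B z = \<zero>\<^bsub>TC\<^esub>"
      have "\<exists>h\<in>Cg B (i - k - 1) k n. z = d B h"
      proof (rule Cg_exact[OF _ _ z(2)])
        show "z \<in> Cg B (i - k) k n" using z(1) unfolding sw .
        fix \<sigma> assume t: "\<sigma> \<subseteq> X - B" "int (card \<sigma>) = k"
        then have "\<sigma> \<subseteq> A" using X by auto
        then show "exact B \<sigma> (i - k) n" using exB[of \<sigma>] t by simp
      qed
      then show "\<exists>h\<in>Cg A k (i - k - 1) n. z = d B h" unfolding sw .
    qed
  qed
  \<comment> \<open>Row zero has the empty set as its only outer face.\<close>
  moreover have "CC A {} p n = Cg A p 0 n" for p
  proof -
    have "int (card (\<rho> - A)) = 0 \<longleftrightarrow> \<rho> - A = {}" if "\<rho> \<subseteq> X" for \<rho>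
      using finite_subset[OF that finX] by simp
    then show ?thesis unfolding CC_def Cg_def Dz_def by (auto simp del: of_nat_eq_0_iff Diff_eq_empty_iff)
  qed
  ultimately show ?thesis unfolding exact_def dc.exact_a_def by simp
qed

end

section \<open>Localisation of modules\<close>

locale localizing = module S M for S :: "('g, 'w) ring_scheme" (structure)
    and M :: "('g, 'm, 'v) module_scheme" (structure) +
  fixes T :: "'g set"
  assumes T_carr: "T \<subseteq> carrier S" and T_one: "\<one> \<in> T"
    and T_mult: "s \<in> T \<Longrightarrow> t \<in> T \<Longrightarrow> s \<otimes> t \<in> T"
begin

abbreviation L where "L \<equiv> localization S M T"
abbreviation frac where "frac \<equiv> fraction S M T"

lemma Tc: "t \<in> T \<Longrightarrow> t \<in> carrier S" using T_carr by blast

lemmas smult_ac = smult_assoc1[symmetric] R.m_ac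

lemma frac_mem: "x \<in> carrier M \<Longrightarrow> t \<in> T \<Longrightarrow> (x, t) \<in> frac x t"
  using T_one by (auto simp: fraction_def)

lemma frac_memD: "(x', t') \<in> frac x t \<Longrightarrow>
    x' \<in> carrier M \<and> t' \<in> T \<and> (\<exists>w\<in>T. (w \<otimes> t') \<odot>\<^bsub>M\<^esub> x = (w \<otimes> t) \<odot>\<^bsub>M\<^esub> x')"
  by (simp add: fraction_def)

text \<open>Transitivity of the fraction relation. The denominator \<open>t\<close> of the middle
  fraction must join the multiplier, hence \<open>w \<otimes> v \<otimes> t\<close>.\<close>

lemma frac_subset:
  assumes x: "x \<in> carrier M" "x' \<in> carrier M" and t: "t \<in> T" "t' \<in> T" "w \<in> T"
    and e: "(w \<otimes> t') \<odot>\<^bsub>M\<^esub> x = (w \<otimes> t) \<odot>\<^bsub>M\<^esub> x'"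
  shows "frac x t \<subseteq> frac x' t'"
proof
  fix p assume p: "p \<in> frac x t"
  obtain x2 t2 where p2: "p = (x2, t2)" by (cases p)
  obtain v where v: "x2 \<in> carrier M" "t2 \<in> T" "v \<in> T" "(v \<otimes> t2) \<odot>\<^bsub>M\<^esub> x = (v \<otimes> t) \<odot>\<^bsub>M\<^esub> x2"
    using frac_memD p unfolding p2 by blast
  have c: "w \<in> carrier S" "v \<in> carrier S" "t \<in> carrier S" "t' \<in> carrier S" "t2 \<in> carrier S"
    using Tc t v by auto
  have "((w \<otimes> v \<otimes> t) \<otimes> t2) \<odot>\<^bsub>M\<^esub> x' = (v \<otimes> t2) \<odot>\<^bsub>M\<^esub> ((w \<otimes> t) \<odot>\<^bsub>M\<^esub> x')"
    using c x by (simp add: smult_ac)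
  also have "\<dots> = (w \<otimes> t') \<odot>\<^bsub>M\<^esub> ((v \<otimes> t2) \<odot>\<^bsub>M\<^esub> x)"
    unfolding e[symmetric] using c x by (simp add: smult_ac)
  also have "\<dots> = ((w \<otimes> v \<otimes> t) \<otimes> t') \<odot>\<^bsub>M\<^esub> x2"
    unfolding v(4) using c v(1) by (simp add: smult_ac)
  finally have "((w \<otimes> v \<otimes> t) \<otimes> t2) \<odot>\<^bsub>M\<^esub> x' = ((w \<otimes> v \<otimes> t) \<otimes> t') \<odot>\<^bsub>M\<^esub> x2" .
  moreover have "w \<otimes> v \<otimes> t \<in> T" using T_mult t v by blast
  ultimately show "p \<in> frac x' t'" unfolding p2 fraction_def using v by blast
qed

lemma frac_eqI:
  assumes "x \<in> carrier M" "x' \<in> carrier M" "t \<in> T" "t' \<in> T" "w \<in> T"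
    "(w \<otimes> t') \<odot>\<^bsub>M\<^esub> x = (w \<otimes> t) \<odot>\<^bsub>M\<^esub> x'"
  shows "frac x t = frac x' t'"
  using frac_subset[OF assms] frac_subset[OF assms(2,1,4,3,5) assms(6)[symmetric]] by blast

lemma frac_eqD:
  assumes "frac x t = frac x' t'" "x' \<in> carrier M" "t' \<in> T"
  shows "\<exists>w\<in>T. (w \<otimes> t') \<odot>\<^bsub>M\<^esub> x = (w \<otimes> t) \<odot>\<^bsub>M\<^esub> x'"
  using frac_mem[OF assms(2,3)] frac_memD unfolding assms(1)[symmetric] by blast

lemma frac_rep:
  assumes "(x', t') \<in> frac x t" "x \<in> carrier M" "t \<in> T"
  shows "frac x' t' = frac x t"
proof -
  obtain w where w: "x' \<in> carrier M" "t' \<in> T" "w \<in> T" "(w \<otimes> t') \<odot>\<^bsub>M\<^esub> x = (w \<otimes> t) \<odot>\<^bsub>M\<^esub> x'"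
    using frac_memD[OF assms(1)] by blast
  show ?thesis by (rule frac_eqI[OF assms(2) w(1) assms(3) w(2-4), symmetric])
qed

lemma frac_scale: "x \<in> carrier M \<Longrightarrow> t \<in> T \<Longrightarrow> w \<in> T \<Longrightarrow> frac (w \<odot>\<^bsub>M\<^esub> x) (w \<otimes> t) = frac x t"
  by (rule frac_eqI[where w = \<one>]) (auto simp: Tc T_one T_mult smult_ac)

lemma L_carr: "carrier L = {frac x t | x t. x \<in> carrier M \<and> t \<in> T}"
  and L_zero: "\<zero>\<^bsub>L\<^esub> = frac \<zero>\<^bsub>M\<^esub> \<one>"
  by (simp_all add: localization_def)

lemma frac_closed [simp]: "x \<in> carrier M \<Longrightarrow> t \<in> T \<Longrightarrow> frac x t \<in> carrier L"
  unfolding L_carr by blast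

lemma L_cases:
  assumes "A \<in> carrier L" obtains x t where "A = frac x t" "x \<in> carrier M" "t \<in> T"
  using assms unfolding L_carr by blast

lemma frac_zero: "t \<in> T \<Longrightarrow> frac \<zero>\<^bsub>M\<^esub> t = \<zero>\<^bsub>L\<^esub>"
  unfolding L_zero by (rule frac_eqI[where w = \<one>]) (auto simp: Tc T_one)

lemma frac_eq_zeroI: "x \<in> carrier M \<Longrightarrow> t \<in> T \<Longrightarrow> w \<in> T \<Longrightarrow> w \<odot>\<^bsub>M\<^esub> x = \<zero>\<^bsub>M\<^esub> \<Longrightarrow> frac x t = \<zero>\<^bsub>L\<^esub>"
  unfolding L_zero by (rule frac_eqI[where w = w]) (auto simp: Tc T_one)

lemma frac_eq_zeroD:
  assumes "frac x t = \<zero>\<^bsub>L\<^esub>" "x \<in> carrier M" "t \<in> T"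
  shows "\<exists>w\<in>T. w \<odot>\<^bsub>M\<^esub> x = \<zero>\<^bsub>M\<^esub>"
  using frac_eqD[OF assms(1)[unfolded L_zero] _ T_one] assms(2,3) Tc by auto

text \<open>\<open>localization\<close> defines its operations as unions over all representatives.
  Well-definedness means that every term of the union is the same class, so the union collapses to
  it.\<close>

lemma L_smult:
  assumes "a \<in> carrier S" "x \<in> carrier M" "t \<in> T"
  shows "a \<odot>\<^bsub>L\<^esub> frac x t = frac (a \<odot>\<^bsub>M\<^esub> x) t"
proof -
  have "frac (a \<odot>\<^bsub>M\<^esub> x') t' = frac (a \<odot>\<^bsub>M\<^esub> x) t" if r: "(x', t') \<in> frac x t" for x' t'
  proof -
    obtain w where w: "x' \<in> carrier M" "t' \<in> T" "w \<in> T" "(w \<otimes> t') \<odot>\<^bsub>M\<^esub> x = (w \<otimes> t) \<odot>\<^bsub>M\<^esub> x'"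
      using frac_memD[OF r] by blast
    have "(w \<otimes> t') \<odot>\<^bsub>M\<^esub> (a \<odot>\<^bsub>M\<^esub> x) = a \<odot>\<^bsub>M\<^esub> ((w \<otimes> t') \<odot>\<^bsub>M\<^esub> x)"
      using assms w(1-3) Tc by (simp add: smult_ac)
    also have "\<dots> = (w \<otimes> t) \<odot>\<^bsub>M\<^esub> (a \<odot>\<^bsub>M\<^esub> x')"
      unfolding w(4) using assms w(1-3) Tc by (simp add: smult_ac)
    finally show ?thesis using assms w by (intro frac_eqI[symmetric, where w = w]) auto
  qed
  then have "(\<Union>(x', t')\<in>frac x t. frac (a \<odot>\<^bsub>M\<^esub> x') t') = frac (a \<odot>\<^bsub>M\<^esub> x) t"
    using frac_mem[OF assms(2,3)] by fast
  then show ?thesis by (simp add: localization_def)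
qed

lemma L_add:
  assumes x: "x \<in> carrier M" "t \<in> T" and y: "y \<in> carrier M" "w \<in> T"
  shows "frac x t \<oplus>\<^bsub>L\<^esub> frac y w = frac ((w \<odot>\<^bsub>M\<^esub> x) \<oplus>\<^bsub>M\<^esub> (t \<odot>\<^bsub>M\<^esub> y)) (t \<otimes> w)"
proof -
  let ?f = "\<lambda>x t y w. frac ((w \<odot>\<^bsub>M\<^esub> x) \<oplus>\<^bsub>M\<^esub> (t \<odot>\<^bsub>M\<^esub> y)) (t \<otimes> w)"
  have "?f x' t' y' w' = ?f x t y w" if r: "(x', t') \<in> frac x t" "(y', w') \<in> frac y w" for x' t' y' w'
  proof -
    obtain v where v: "x' \<in> carrier M" "t' \<in> T" "v \<in> T" "(v \<otimes> t') \<odot>\<^bsub>M\<^esub> x = (v \<otimes> t) \<odot>\<^bsub>M\<^esub> x'"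
      using frac_memD[OF r(1)] by blast
    obtain u where u: "y' \<in> carrier M" "w' \<in> T" "u \<in> T" "(u \<otimes> w') \<odot>\<^bsub>M\<^esub> y = (u \<otimes> w) \<odot>\<^bsub>M\<^esub> y'"
      using frac_memD[OF r(2)] by blast
    have c: "t \<in> carrier S" "w \<in> carrier S" "t' \<in> carrier S" "w' \<in> carrier S" "v \<in> carrier S" "u \<in> carrier S"
      using Tc x y u v by auto
    have "(v \<otimes> u \<otimes> (t' \<otimes> w')) \<odot>\<^bsub>M\<^esub> (w \<odot>\<^bsub>M\<^esub> x \<oplus>\<^bsub>M\<^esub> t \<odot>\<^bsub>M\<^esub> y)
       = (u \<otimes> w' \<otimes> w) \<odot>\<^bsub>M\<^esub> ((v \<otimes> t') \<odot>\<^bsub>M\<^esub> x) \<oplus>\<^bsub>M\<^esub> (v \<otimes> t' \<otimes> t) \<odot>\<^bsub>M\<^esub> ((u \<otimes> w') \<odot>\<^bsub>M\<^esub> y)"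
      using c x y by (simp add: smult_r_distr smult_ac)
    also have "\<dots> = (u \<otimes> w' \<otimes> w) \<odot>\<^bsub>M\<^esub> ((v \<otimes> t) \<odot>\<^bsub>M\<^esub> x') \<oplus>\<^bsub>M\<^esub> (v \<otimes> t' \<otimes> t) \<odot>\<^bsub>M\<^esub> ((u \<otimes> w) \<odot>\<^bsub>M\<^esub> y')"
      unfolding v(4) u(4) ..
    also have "\<dots> = (v \<otimes> u \<otimes> (t \<otimes> w)) \<odot>\<^bsub>M\<^esub> (w' \<odot>\<^bsub>M\<^esub> x' \<oplus>\<^bsub>M\<^esub> t' \<odot>\<^bsub>M\<^esub> y')"
      using c u(1) v(1) by (simp add: smult_r_distr smult_ac)
    finally show ?thesis using c u v x y T_mult
      by (intro frac_eqI[symmetric, where w = "v \<otimes> u"]) auto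
  qed
  then have "(\<Union>(x', t')\<in>frac x t. \<Union>(y', w')\<in>frac y w. ?f x' t' y' w') = ?f x t y w"
    using frac_mem[OF x] frac_mem[OF y] by fast
  then show ?thesis by (simp add: localization_def)
qed

lemma L_add_same:
  assumes "x \<in> carrier M" "y \<in> carrier M" "t \<in> T"
  shows "frac x t \<oplus>\<^bsub>L\<^esub> frac y t = frac (x \<oplus>\<^bsub>M\<^esub> y) t"
proof -
  have "frac x t \<oplus>\<^bsub>L\<^esub> frac y t = frac (t \<odot>\<^bsub>M\<^esub> (x \<oplus>\<^bsub>M\<^esub> y)) (t \<otimes> t)"
    using assms Tc by (simp add: L_add smult_r_distr)
  then show ?thesis using assms by (simp add: frac_scale)
qed

text \<open>With a common denominator, the module laws of the localisation reduce to those of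
  \<open>M\<close> applied to numerators.\<close>

lemma L_common2:
  assumes "A \<in> carrier L" "B \<in> carrier L"
  obtains x y t where "A = frac x t" "B = frac y t" "x \<in> carrier M" "y \<in> carrier M" "t \<in> T"
proof -
  obtain x t where A: "A = frac x t" "x \<in> carrier M" "t \<in> T" using assms(1) by (rule L_cases)
  obtain y w where B: "B = frac y w" "y \<in> carrier M" "w \<in> T" using assms(2) by (rule L_cases)
  have "A = frac (w \<odot>\<^bsub>M\<^esub> x) (w \<otimes> t)" using A B by (simp add: frac_scale)
  moreover have "B = frac (t \<odot>\<^bsub>M\<^esub> y) (w \<otimes> t)"
    using frac_scale[OF B(2,3) A(3)] B(1) R.m_comm[OF Tc[OF A(3)] Tc[OF B(3)]] by simp
  ultimately show thesis using that A B T_mult Tc by simp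
qed

lemma L_common3:
  assumes "A \<in> carrier L" "B \<in> carrier L" "C \<in> carrier L"
  obtains x y z t where "A = frac x t" "B = frac y t" "C = frac z t"
    "x \<in> carrier M" "y \<in> carrier M" "z \<in> carrier M" "t \<in> T"
proof -
  obtain x y t where A: "A = frac x t" "B = frac y t" "x \<in> carrier M" "y \<in> carrier M" "t \<in> T"
    using assms(1,2) by (rule L_common2)
  obtain z w where B: "C = frac z w" "z \<in> carrier M" "w \<in> T" using assms(3) by (rule L_cases)
  have "A = frac (w \<odot>\<^bsub>M\<^esub> x) (w \<otimes> t)" "B = frac (w \<odot>\<^bsub>M\<^esub> y) (w \<otimes> t)" using A B by (simp_all add: frac_scale)
  moreover have "C = frac (t \<odot>\<^bsub>M\<^esub> z) (w \<otimes> t)"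
    using frac_scale[OF B(2,3) A(5)] B(1) R.m_comm[OF Tc[OF A(5)] Tc[OF B(3)]] by simp
  ultimately show thesis using that A B T_mult Tc by simp
qed

lemma L_group: "abelian_group L"
proof (rule abelian_groupI)
  show "A \<oplus>\<^bsub>L\<^esub> B \<in> carrier L" if AB: "A \<in> carrier L" "B \<in> carrier L" for A B
  proof -
    obtain x y t where "A = frac x t" "B = frac y t" "x \<in> carrier M" "y \<in> carrier M" "t \<in> T"
      using AB by (rule L_common2)
    then show ?thesis by (simp add: L_add_same)
  qed
  show "A \<oplus>\<^bsub>L\<^esub> B = B \<oplus>\<^bsub>L\<^esub> A" if AB: "A \<in> carrier L" "B \<in> carrier L" for A B
  proof -
    obtain x y t where "A = frac x t" "B = frac y t" "x \<in> carrier M" "y \<in> carrier M" "t \<in> T"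
      using AB by (rule L_common2)
    then show ?thesis by (simp add: L_add_same M.a_comm)
  qed
  show "A \<oplus>\<^bsub>L\<^esub> B \<oplus>\<^bsub>L\<^esub> C = A \<oplus>\<^bsub>L\<^esub> (B \<oplus>\<^bsub>L\<^esub> C)"
    if AB: "A \<in> carrier L" "B \<in> carrier L" "C \<in> carrier L" for A B C
  proof -
    obtain x y z t where "A = frac x t" "B = frac y t" "C = frac z t"
      "x \<in> carrier M" "y \<in> carrier M" "z \<in> carrier M" "t \<in> T"
      using AB by (rule L_common3)
    then show ?thesis by (simp add: L_add_same M.a_assoc)
  qed
  show z: "\<zero>\<^bsub>L\<^esub> \<in> carrier L" unfolding L_zero using T_one by simp
  show "\<zero>\<^bsub>L\<^esub> \<oplus>\<^bsub>L\<^esub> A = A" if A: "A \<in> carrier L" for A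
  proof -
    obtain x t where "A = frac x t" "x \<in> carrier M" "t \<in> T" using A by (rule L_cases)
    then show ?thesis by (simp add: L_add_same flip: frac_zero[of t])
  qed
  show "\<exists>B\<in>carrier L. B \<oplus>\<^bsub>L\<^esub> A = \<zero>\<^bsub>L\<^esub>" if A: "A \<in> carrier L" for A
  proof -
    obtain x t where "A = frac x t" "x \<in> carrier M" "t \<in> T" using A by (rule L_cases)
    then show ?thesis
      by (intro bexI[of _ "frac (\<ominus>\<^bsub>M\<^esub> x) t"]) (simp_all add: L_add_same M.l_neg frac_zero)
  qed
qed

lemma L_module: "module S L"
proof (rule moduleI)
  show "cring S" by (rule R.is_cring)
  show "abelian_group L" by (rule L_group)
  show "a \<odot>\<^bsub>L\<^esub> A \<in> carrier L" if a: "a \<in> carrier S" and A: "A \<in> carrier L" for a A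
  proof -
    obtain x t where "A = frac x t" "x \<in> carrier M" "t \<in> T" using A by (rule L_cases)
    then show ?thesis using a by (simp add: L_smult)
  qed
  show "(a \<oplus> b) \<odot>\<^bsub>L\<^esub> A = a \<odot>\<^bsub>L\<^esub> A \<oplus>\<^bsub>L\<^esub> b \<odot>\<^bsub>L\<^esub> A"
    if a: "a \<in> carrier S" "b \<in> carrier S" and A: "A \<in> carrier L" for a b A
  proof -
    obtain x t where "A = frac x t" "x \<in> carrier M" "t \<in> T" using A by (rule L_cases)
    then show ?thesis using a by (simp add: L_smult L_add_same smult_l_distr)
  qed
  show "a \<odot>\<^bsub>L\<^esub> (A \<oplus>\<^bsub>L\<^esub> B) = a \<odot>\<^bsub>L\<^esub> A \<oplus>\<^bsub>L\<^esub> a \<odot>\<^bsub>L\<^esub> B"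
    if a: "a \<in> carrier S" and AB: "A \<in> carrier L" "B \<in> carrier L" for a A B
  proof -
    obtain x y t where "A = frac x t" "B = frac y t" "x \<in> carrier M" "y \<in> carrier M" "t \<in> T"
      using AB by (rule L_common2)
    then show ?thesis using a by (simp add: L_smult L_add_same smult_r_distr)
  qed
  show "(a \<otimes> b) \<odot>\<^bsub>L\<^esub> A = a \<odot>\<^bsub>L\<^esub> (b \<odot>\<^bsub>L\<^esub> A)"
    if a: "a \<in> carrier S" "b \<in> carrier S" and A: "A \<in> carrier L" for a b A
  proof -
    obtain x t where "A = frac x t" "x \<in> carrier M" "t \<in> T" using A by (rule L_cases)
    then show ?thesis using a by (simp add: L_smult smult_assoc1)
  qed
  show "\<one> \<odot>\<^bsub>L\<^esub> A = A" if A: "A \<in> carrier L" for A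
  proof -
    obtain x t where "A = frac x t" "x \<in> carrier M" "t \<in> T" using A by (rule L_cases)
    then show ?thesis by (simp add: L_smult)
  qed
qed

lemma frac_map: "t \<in> T \<Longrightarrow> additive_map M L (\<lambda>x. frac x t)"
  unfolding additive_map_def by (auto simp: L_add_same)

end

text \<open>A representative over \<open>T'\<close> is also one over \<open>T\<close>, because its
  multiplier lies in \<open>T\<close>; so the union defining the map has only one value.\<close>

lemma localization_map_frac:
  assumes "localizing S M T" "localizing S M T'" "T' \<subseteq> T" "x \<in> carrier M" "t \<in> T'"
  shows "localization_map S M T (fraction S M T' x t) = fraction S M T x t"
proof -
  interpret T: localizing S M T by fact
  interpret T': localizing S M T' by fact
  have t: "t \<in> T" using assms by blast
  have "T.frac x' t' = T.frac x t" if r: "(x', t') \<in> T'.frac x t" for x' t'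
  proof -
    have "(x', t') \<in> T.frac x t" using T'.frac_memD[OF r] assms(3) unfolding fraction_def by blast
    then show ?thesis using assms(4) t by (rule T.frac_rep)
  qed
  then show ?thesis
    unfolding localization_map_def using T'.frac_mem[OF assms(4,5)] by fast
qed

text \<open>Directness of the grading enters as \<open>gS_disj\<close>. It decides the case of a
  denominator that has two different degrees: such a denominator is zero.\<close>

locale graded_module = module S M for S :: "('g, 'w) ring_scheme" (structure)
    and M :: "('g, 'm, 'v) module_scheme" (structure) +
  fixes gS :: "('s \<Rightarrow> int) \<Rightarrow> 'g set" and gM :: "('s \<Rightarrow> int) \<Rightarrow> 'm set"
  assumes gS_sub: "additive_subgroup (gS a) S"
    and gS_one: "\<one> \<in> gS 0"
    and gS_mult: "s \<in> gS a \<Longrightarrow> t \<in> gS b \<Longrightarrow> s \<otimes> t \<in> gS (a + b)"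
    and gS_disj: "s \<in> gS a \<Longrightarrow> s \<in> gS b \<Longrightarrow> a \<noteq> b \<Longrightarrow> s = \<zero>"
    and gM_sub: "additive_subgroup (gM a) M"
    and gM_smult: "s \<in> gS a \<Longrightarrow> x \<in> gM n \<Longrightarrow> s \<odot>\<^bsub>M\<^esub> x \<in> gM (n + a)"
begin

lemma gSc: "s \<in> gS a \<Longrightarrow> s \<in> carrier S" using additive_subgroup.a_subset[OF gS_sub] by blast
lemma gMc: "x \<in> gM a \<Longrightarrow> x \<in> carrier M" using additive_subgroup.a_subset[OF gM_sub] by blast
lemma gS_zero: "\<zero> \<in> gS a" by (rule additive_subgroup.zero_closed[OF gS_sub])
lemma gM_zero: "\<zero>\<^bsub>M\<^esub> \<in> gM a" by (rule additive_subgroup.zero_closed[OF gM_sub])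
lemma gS_add: "s \<in> gS a \<Longrightarrow> t \<in> gS a \<Longrightarrow> s \<oplus> t \<in> gS a" by (rule additive_subgroup.a_closed[OF gS_sub])
lemma gM_add: "x \<in> gM a \<Longrightarrow> y \<in> gM a \<Longrightarrow> x \<oplus>\<^bsub>M\<^esub> y \<in> gM a" by (rule additive_subgroup.a_closed[OF gM_sub])
lemma gS_neg: "s \<in> gS a \<Longrightarrow> \<ominus> s \<in> gS a"
  by (rule additive_subgroup.a_inv_closed[OF gS_sub])
lemma gM_neg: "x \<in> gM a \<Longrightarrow> \<ominus>\<^bsub>M\<^esub> x \<in> gM a"
  by (rule additive_subgroup.a_inv_closed[OF gM_sub])

lemma gS_pow: "s \<in> gS a \<Longrightarrow> s [^] (k::nat) \<in> gS (of_nat k * a)"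
proof (induction k)
  case (Suc k)
  have e: "of_nat (Suc k) * a = of_nat k * a + a"
    by (simp only: of_nat_Suc distrib_right mult_1_left add.commute)
  show ?case unfolding e R.nat_pow_Suc by (rule gS_mult[OF Suc.IH[OF Suc.prems] Suc.prems])
qed (use gS_one in simp)

lemma gS_finsum: "(\<And>i. i \<in> A \<Longrightarrow> f i \<in> gS a) \<Longrightarrow> (\<Oplus>i\<in>A. f i) \<in> gS a"
  by (rule R.subgroup_finsum_closed) (use gS_zero gS_add gSc in auto)

end

locale graded_localizing = graded_module S M gS gM + localizing S M T
  for S :: "('g, 'w) ring_scheme" (structure) and M :: "('g, 'm, 'v) module_scheme" (structure)
    and gS :: "('s \<Rightarrow> int) \<Rightarrow> 'g set" and gM :: "('s \<Rightarrow> int) \<Rightarrow> 'm set" and T :: "'g set" +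
  assumes T_hom: "t \<in> T \<Longrightarrow> \<exists>a. t \<in> gS a"
begin

abbreviation gL where "gL \<equiv> localization_component S gS M gM T"

lemma gL_I: "t \<in> T \<Longrightarrow> t \<in> gS a \<Longrightarrow> x \<in> gM (n + a) \<Longrightarrow> frac x t \<in> gL n"
  unfolding localization_component_def by blast

lemma gL_E:
  assumes "A \<in> gL n" obtains x t a where "A = frac x t" "t \<in> T" "t \<in> gS a" "x \<in> gM (n + a)"
  using assms unfolding localization_component_def by blast

lemma gL_carr: "A \<in> gL n \<Longrightarrow> A \<in> carrier L"
  by (erule gL_E) (simp add: gMc)

lemma gL_zero: "\<zero>\<^bsub>L\<^esub> \<in> gL n"
  unfolding L_zero by (rule gL_I[OF T_one gS_one gM_zero])

lemma gL_add: "A \<in> gL n \<Longrightarrow> B \<in> gL n \<Longrightarrow> A \<oplus>\<^bsub>L\<^esub> B \<in> gL n"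
proof -
  assume "A \<in> gL n" "B \<in> gL n"
  then obtain x t a y w b where A: "A = frac x t" "t \<in> T" "t \<in> gS a" "x \<in> gM (n + a)"
    and B: "B = frac y w" "w \<in> T" "w \<in> gS b" "y \<in> gM (n + b)" by (auto elim!: gL_E)
  have e: "A \<oplus>\<^bsub>L\<^esub> B = frac ((w \<odot>\<^bsub>M\<^esub> x) \<oplus>\<^bsub>M\<^esub> (t \<odot>\<^bsub>M\<^esub> y)) (t \<otimes> w)"
    using A B gMc by (simp add: L_add)
  have "w \<odot>\<^bsub>M\<^esub> x \<in> gM (n + (a + b))" using gM_smult[OF B(3) A(4)] by (simp only: add.assoc)
  moreover have "t \<odot>\<^bsub>M\<^esub> y \<in> gM (n + (a + b))"
    using gM_smult[OF A(3) B(4)] by (simp only: add.assoc add.commute[of a b])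
  ultimately show ?thesis unfolding e by (intro gL_I[OF T_mult[OF A(2) B(2)] gS_mult[OF A(3) B(3)]] gM_add)
qed

lemma L_neg_frac: "x \<in> carrier M \<Longrightarrow> t \<in> T \<Longrightarrow> \<ominus>\<^bsub>L\<^esub> frac x t = frac (\<ominus>\<^bsub>M\<^esub> x) t"
  using additive_map_neg[OF M.abelian_group_axioms L_group frac_map] by simp

lemma gL_neg: "A \<in> gL n \<Longrightarrow> \<ominus>\<^bsub>L\<^esub> A \<in> gL n"
  by (erule gL_E) (simp add: L_neg_frac gMc gL_I gM_neg)

lemma gL_sub: "additive_subgroup (gL n) L"
proof (rule additive_subgroupI)
  interpret L: abelian_group L by (rule L_group)
  show "subgroup (gL n) (add_monoid L)"
  proof (rule L.add.subgroupI)
    show "gL n \<noteq> {}" using gL_zero[of n] by auto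
  qed (use gL_carr gL_add gL_neg in auto)
qed

lemma gL_smult: "s \<in> gS b \<Longrightarrow> A \<in> gL n \<Longrightarrow> s \<odot>\<^bsub>L\<^esub> A \<in> gL (n + b)"
proof -
  assume s: "s \<in> gS b" and "A \<in> gL n"
  then obtain x t a where A: "A = frac x t" "t \<in> T" "t \<in> gS a" "x \<in> gM (n + a)" by (auto elim!: gL_E)
  have "s \<odot>\<^bsub>M\<^esub> x \<in> gM (n + b + a)"
    using gM_smult[OF s A(4)] by (simp only: add.assoc add.commute[of a b])
  then show ?thesis using A s gMc gSc by (simp add: L_smult gL_I)
qed

text \<open>Together with \<open>unit_surj\<close>, this says that elements of \<open>T\<close> act
  as graded units on the localisation, the form in which \<open>exactI\<close> wants its hypotheses
  \<open>inj\<close> and \<open>surj\<close>.\<close>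

lemma unit_inj:
  assumes u: "u \<in> T" and A: "A \<in> carrier L" and z: "u \<odot>\<^bsub>L\<^esub> A = \<zero>\<^bsub>L\<^esub>"
  shows "A = \<zero>\<^bsub>L\<^esub>"
proof -
  obtain x t where x: "A = frac x t" "x \<in> carrier M" "t \<in> T" using A by (rule L_cases)
  have "frac (u \<odot>\<^bsub>M\<^esub> x) t = \<zero>\<^bsub>L\<^esub>" using z u x Tc by (simp add: L_smult)
  then obtain w where w: "w \<in> T" "w \<odot>\<^bsub>M\<^esub> (u \<odot>\<^bsub>M\<^esub> x) = \<zero>\<^bsub>M\<^esub>"
    using frac_eq_zeroD x u Tc by (metis smult_closed)
  then have "(w \<otimes> u) \<odot>\<^bsub>M\<^esub> x = \<zero>\<^bsub>M\<^esub>" using u x Tc by (simp add: smult_assoc1)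
  then show ?thesis unfolding x(1) using x w u T_mult by (intro frac_eq_zeroI[of x t "w \<otimes> u"]) auto
qed

lemma unit_surj:
  assumes u: "u \<in> T" "u \<in> gS b" and A: "A \<in> gL (n + b)"
  shows "\<exists>B\<in>gL n. u \<odot>\<^bsub>L\<^esub> B = A"
proof -
  obtain x t a where x: "A = frac x t" "t \<in> T" "t \<in> gS a" "x \<in> gM (n + b + a)" using A by (rule gL_E)
  have "frac x (u \<otimes> t) \<in> gL n"
    by (rule gL_I[OF T_mult[OF u(1) x(2)] gS_mult[OF u(2) x(3)]]) (use x(4) in \<open>simp only: add.assoc\<close>)
  moreover have "u \<odot>\<^bsub>L\<^esub> frac x (u \<otimes> t) = A"
    using u x gMc Tc T_mult by (simp add: L_smult frac_scale)
  ultimately show ?thesis by blast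
qed

text \<open>Scalars act on numerators, so an identity between operators on \<open>M\<close> holds on
  every fraction.\<close>

lemma L_rel:
  assumes rel: "\<And>x. x \<in> carrier M \<Longrightarrow> u \<odot>\<^bsub>M\<^esub> x = (\<Oplus>\<^bsub>M\<^esub>i\<in>Y. c i \<odot>\<^bsub>M\<^esub> x)"
    and c: "u \<in> carrier S" "\<And>i. i \<in> Y \<Longrightarrow> c i \<in> carrier S" and A: "A \<in> carrier L"
  shows "u \<odot>\<^bsub>L\<^esub> A = (\<Oplus>\<^bsub>L\<^esub>i\<in>Y. c i \<odot>\<^bsub>L\<^esub> A)"
proof -
  interpret L: abelian_group L by (rule L_group)
  obtain x t where x: "A = frac x t" "x \<in> carrier M" "t \<in> T" using A by (rule L_cases)
  have "u \<odot>\<^bsub>L\<^esub> A = frac (\<Oplus>\<^bsub>M\<^esub>i\<in>Y. c i \<odot>\<^bsub>M\<^esub> x) t" using x c rel by (simp add: L_smult)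
  also have "\<dots> = (\<Oplus>\<^bsub>L\<^esub>i\<in>Y. frac (c i \<odot>\<^bsub>M\<^esub> x) t)"
    by (rule additive_map_finsum[OF M.abelian_group_axioms L_group frac_map[OF x(3)]]) (use x c in auto)
  also have "\<dots> = (\<Oplus>\<^bsub>L\<^esub>i\<in>Y. c i \<odot>\<^bsub>L\<^esub> A)"
    by (rule L.finsum_cong') (use x c in \<open>auto simp: L_smult\<close>)
  finally show ?thesis .
qed

end

section \<open>Cech cohomology as a face of a cube\<close>

text \<open>Identifies the part of a cube over a fixed face \<open>\<tau>\<close> with the Cech
  complex on \<open>fs\<close>. The indices in \<open>\<tau>\<close> come after those of
  \<open>fs\<close>, so they do not alter the parities in \<open>even_below\<close>. The degrees
  \<open>n\<close> and \<open>n'\<close> are kept apart because a Koszul face shifts the grading of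
  \<open>M\<close>.\<close>

locale cech_face = cube S gS X N D r y \<delta>
  for S :: "('g, 'w) ring_scheme" (structure) and gS :: "('s \<Rightarrow> int) \<Rightarrow> 'g set" and X :: "nat set"
    and N :: "nat set \<Rightarrow> ('g, ('m \<times> 'g) set) module"
    and D :: "('s \<Rightarrow> int) \<Rightarrow> nat set \<Rightarrow> ('m \<times> 'g) set set"
    and r :: "nat \<Rightarrow> nat set \<Rightarrow> ('m \<times> 'g) set \<Rightarrow> ('m \<times> 'g) set"
    and y :: "nat \<Rightarrow> 'g" and \<delta> :: "nat \<Rightarrow> 's \<Rightarrow> int" +
  fixes M :: "('g, 'm, 'v) module_scheme" and gM :: "('s \<Rightarrow> int) \<Rightarrow> 'm set"
    and fs :: "'g list" and \<tau> :: "nat set" and n n' :: "'s \<Rightarrow> int" and B :: "nat set"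
  defines "B \<equiv> {..<length fs}"
  assumes BX: "B \<subseteq> X" and \<tau>X: "\<tau> \<subseteq> X" and \<tau>_ge: "k \<in> \<tau> \<Longrightarrow> length fs \<le> k"
    and N_face: "\<sigma> \<subseteq> B \<Longrightarrow> N (\<sigma> \<union> \<tau>) = localization S M (mult_set S fs \<sigma>)"
    and D_face: "\<sigma> \<subseteq> B \<Longrightarrow> D n (\<sigma> \<union> \<tau>) = localization_component S gS M gM (mult_set S fs \<sigma>) n'"
    and r_face: "\<sigma> \<subseteq> B \<Longrightarrow> j \<in> B \<Longrightarrow> j \<notin> \<sigma> \<Longrightarrow>
        r j (\<sigma> \<union> \<tau>) = localization_map S M (mult_set S fs (insert j \<sigma>))"
begin

lemma tB: "\<tau> \<inter> B = {}" using \<tau>_ge unfolding B_def by force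

lemma face_simps:
  assumes "\<sigma> \<subseteq> B"
  shows "\<sigma> \<union> \<tau> \<subseteq> X" "(\<sigma> \<union> \<tau>) - B = \<tau>" "(\<sigma> \<union> \<tau>) \<inter> B = \<sigma>"
  using assms BX \<tau>X tB by auto

lemma face_split: "\<rho> - B = \<tau> \<Longrightarrow> (\<rho> \<inter> B) \<union> \<tau> = \<rho>" by auto

abbreviation face where "face \<equiv> cech_faces fs"

lemma face_iff: "\<sigma> \<in> face i \<longleftrightarrow> \<sigma> \<subseteq> B \<and> card \<sigma> = i" by (simp add: cech_faces_def B_def)

abbreviation cochain where "cochain i \<equiv> cech_cochains S gS M gM fs i n'"

lemma cochain_carr: "carrier (cochain i) = (\<Pi>\<^sub>E \<sigma>\<in>face i. D n (\<sigma> \<union> \<tau>))"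
  unfolding cech_cochains_def by (auto intro!: PiE_cong simp: face_iff D_face)

lemma cochain_one: "\<one>\<^bsub>cochain i\<^esub> = (\<lambda>\<sigma>\<in>face i. \<zero>\<^bsub>N (\<sigma> \<union> \<tau>)\<^esub>)"
  unfolding cech_cochains_def by (auto intro!: restrict_ext simp: face_iff N_face)

lemma cochain_mult: "c \<otimes>\<^bsub>cochain i\<^esub> c' = (\<lambda>\<sigma>\<in>face i. c \<sigma> \<oplus>\<^bsub>N (\<sigma> \<union> \<tau>)\<^esub> c' \<sigma>)"
  unfolding cech_cochains_def by (auto intro!: restrict_ext simp: face_iff N_face)

text \<open>\<open>rst\<close> and \<open>ext\<close> translate between cochains indexed by faces of
  the cube and those of \<open>cech_cochains\<close>, which are indexed by subsets of
  \<open>{..<length fs}\<close> of one size.\<close>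

definition rst :: "nat \<Rightarrow> (nat set \<Rightarrow> ('m \<times> 'g) set) \<Rightarrow> nat set \<Rightarrow> ('m \<times> 'g) set" where
  "rst i c = (\<lambda>\<sigma>\<in>face i. c (\<sigma> \<union> \<tau>))"

definition ext :: "nat \<Rightarrow> (nat set \<Rightarrow> ('m \<times> 'g) set) \<Rightarrow> nat set \<Rightarrow> ('m \<times> 'g) set" where
  "ext i c = (\<lambda>\<rho>\<in>Pow X. if \<rho> - B = \<tau> \<and> int (card (\<rho> \<inter> B)) = int i then c (\<rho> \<inter> B) else \<zero>\<^bsub>N \<rho>\<^esub>)"

lemma ext_CC: "c \<in> carrier (cochain i) \<Longrightarrow> ext i c \<in> CC B \<tau> (int i) n"
proof -
  assume c: "c \<in> carrier (cochain i)"
  have Dz: "ext i c \<rho> \<in> Dz B \<tau> (int i) n \<rho>" if r: "\<rho> \<subseteq> X" for \<rho>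
  proof (cases "\<rho> - B = \<tau> \<and> int (card (\<rho> \<inter> B)) = int i")
    case True
    then have "\<rho> \<inter> B \<in> face i" by (simp add: face_iff)
    then have "c (\<rho> \<inter> B) \<in> D n ((\<rho> \<inter> B) \<union> \<tau>)" using c unfolding cochain_carr by (rule PiE_mem[rotated])
    then have "c (\<rho> \<inter> B) \<in> D n \<rho>" using face_split True by simp
    then show ?thesis using True r by (simp add: ext_def Dz_def)
  next
    case False
    then have "ext i c \<rho> = \<zero>\<^bsub>N \<rho>\<^esub>" using r unfolding ext_def by auto
    then show ?thesis using Dz_zero[OF r] by simp
  qed
  have "ext i c \<in> carrier TC"
    unfolding TC_simps
  proof (rule PiE_I)
    fix \<rho> assume "\<rho> \<in> Pow X"
    then show "ext i c \<rho> \<in> carrier (N \<rho>)" using D_carr[OF _ Dz_D[OF _ Dz]] by simp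
  qed (simp add: ext_def)
  then show ?thesis using Dz by (simp add: CC_def)
qed

lemma rst_ext: "c \<in> carrier (cochain i) \<Longrightarrow> rst i (ext i c) = c"
proof (rule ext[rule_format])
  assume c: "c \<in> carrier (cochain i)"
  fix \<sigma>
  show "rst i (ext i c) \<sigma> = c \<sigma>"
  proof (cases "\<sigma> \<in> face i")
    case True
    then have s: "\<sigma> \<subseteq> B" "card \<sigma> = i" by (simp_all add: face_iff)
    then show ?thesis using True face_simps[OF s(1)] by (simp add: rst_def ext_def)
  next
    case False
    then have "c \<sigma> = undefined" using c unfolding cochain_carr by (rule PiE_arb[rotated])
    then show ?thesis using False by (simp add: rst_def)
  qed
qed

lemma rst_carr: "c \<in> CC B \<tau> (int i) n \<Longrightarrow> rst i c \<in> carrier (cochain i)"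
  unfolding cochain_carr
proof (rule PiE_I)
  fix \<sigma> assume c: "c \<in> CC B \<tau> (int i) n" and s: "\<sigma> \<in> face i"
  then show "rst i c \<sigma> \<in> D n (\<sigma> \<union> \<tau>)"
    using CC_D[OF c face_simps(1)] by (simp add: rst_def face_iff)
qed (simp add: rst_def)

lemma rst_inj:
  assumes c: "c \<in> CC B \<tau> (int i) n" and c': "c' \<in> CC B \<tau> (int i) n" and e: "rst i c = rst i c'"
  shows "c = c'"
proof (rule TC_eqI[OF CC_carr[OF c] CC_carr[OF c']])
  fix \<rho> assume r: "\<rho> \<subseteq> X"
  show "c \<rho> = c' \<rho>"
  proof (cases "\<rho> - B = \<tau> \<and> int (card (\<rho> \<inter> B)) = int i")
    case True
    then have f: "\<rho> \<inter> B \<in> face i" by (simp add: face_iff)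
    have "rst i c (\<rho> \<inter> B) = rst i c' (\<rho> \<inter> B)" by (simp add: e)
    then show ?thesis using f face_split True by (simp add: rst_def)
  next
    case False
    show ?thesis using Dz_off[OF CC_Dz[OF c r] False] Dz_off[OF CC_Dz[OF c' r] False] by simp
  qed
qed

lemma rst_zero: "rst i \<zero>\<^bsub>TC\<^esub> = \<one>\<^bsub>cochain i\<^esub>"
  unfolding cochain_one rst_def
  by (rule restrict_ext) (simp add: face_iff TC_ev_simps(1)[OF face_simps(1)])

lemma rst_add: "rst i (c \<oplus>\<^bsub>TC\<^esub> c') = rst i c \<otimes>\<^bsub>cochain i\<^esub> rst i c'"
  unfolding cochain_mult
proof (rule ext[rule_format])
  fix \<sigma>
  show "rst i (c \<oplus>\<^bsub>TC\<^esub> c') \<sigma> = (\<lambda>\<sigma>\<in>face i. rst i c \<sigma> \<oplus>\<^bsub>N (\<sigma> \<union> \<tau>)\<^esub> rst i c' \<sigma>) \<sigma>"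
  proof (cases "\<sigma> \<in> face i")
    case True
    then have "\<sigma> \<union> \<tau> \<subseteq> X" using face_simps(1)[of \<sigma>] unfolding face_iff by blast
    then show ?thesis using True by (simp add: rst_def TC_ev_simps(2))
  qed (simp add: rst_def)
qed

text \<open>Both differentials are sums over the elements of the face. For
  \<open>l \<in> \<sigma>\<close>, the face \<open>\<sigma> \<union> \<tau> - {l}\<close> is the
  image of \<open>\<sigma> - {l}\<close>, and the elements of \<open>\<tau>\<close> are never below
  \<open>l\<close>.\<close>

lemma rst_d:
  assumes c: "c \<in> CC B \<tau> (int i) n"
  shows "rst (Suc i) (d B c) = cech_diff S M fs i (rst i c)"
  unfolding cech_diff_def rst_def[of "Suc i"]
proof (rule restrict_ext)
  fix \<sigma> assume "\<sigma> \<in> face (Suc i)"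
  then have s: "\<sigma> \<subseteq> B" "card \<sigma> = Suc i" by (simp_all add: face_iff)
  have finB: "finite B" by (simp add: B_def)
  have finS: "finite \<sigma>" using s finB finite_subset by blast
  note fs = face_simps[OF s(1)]
  interpret Nm: abelian_group "N (\<sigma> \<union> \<tau>)" using fs(1) by (rule N_ag)
  have "d B c (\<sigma> \<union> \<tau>) = (\<Oplus>\<^bsub>N (\<sigma> \<union> \<tau>)\<^esub> l\<in>\<sigma>. sgn_mult (N (\<sigma> \<union> \<tau>)) (even_below (\<sigma> \<union> \<tau>) l)
      (r l (\<sigma> \<union> \<tau> - {l}) (c (\<sigma> \<union> \<tau> - {l}))))"
    using d_eval'[OF CC_carr[OF c] fs(1) finB] unfolding fs(3) .
  also have "\<dots> = (\<Oplus>\<^bsub>N (\<sigma> \<union> \<tau>)\<^esub> l\<in>\<sigma>.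
      (let z = localization_map S M (mult_set S fs \<sigma>) (rst i c (\<sigma> - {l}))
       in if even (card {k \<in> \<sigma>. k < l}) then z else \<ominus>\<^bsub>N (\<sigma> \<union> \<tau>)\<^esub> z))"
  proof -
    have eq: "sgn_mult (N (\<sigma> \<union> \<tau>)) (even_below (\<sigma> \<union> \<tau>) l) (r l (\<sigma> \<union> \<tau> - {l}) (c (\<sigma> \<union> \<tau> - {l}))) =
      (let z = localization_map S M (mult_set S fs \<sigma>) (rst i c (\<sigma> - {l}))
       in if even (card {k \<in> \<sigma>. k < l}) then z else \<ominus>\<^bsub>N (\<sigma> \<union> \<tau>)\<^esub> z)" if l: "l \<in> \<sigma>" for l
    proof -
      have lt: "l \<notin> \<tau>" using l s(1) tB by auto
      have e1: "\<sigma> \<union> \<tau> - {l} = (\<sigma> - {l}) \<union> \<tau>" using lt by auto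
      have e2: "\<sigma> - {l} \<subseteq> B" "l \<in> B" "l \<notin> \<sigma> - {l}" "insert l (\<sigma> - {l}) = \<sigma>" using s l by auto
      have "card (\<sigma> - {l}) = i" using finS l s(2) by simp
      then have f: "\<sigma> - {l} \<in> face i" using e2 by (simp add: face_iff)
      have "{k \<in> \<sigma> \<union> \<tau>. k < l} = {k \<in> \<sigma>. k < l}"
        using \<tau>_ge e2(2) unfolding B_def by force
      then have e3: "even_below (\<sigma> \<union> \<tau>) l = even (card {k \<in> \<sigma>. k < l})" by (simp add: even_below_def)
      have e4: "r l ((\<sigma> - {l}) \<union> \<tau>) = localization_map S M (mult_set S fs \<sigma>)"
        using r_face[OF e2(1-3)] unfolding e2(4) .
      show ?thesis
        unfolding e3 e1 e4 using f by (simp add: rst_def sgn_mult_def Let_def)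
    qed
    have cl: "sgn_mult (N (\<sigma> \<union> \<tau>)) (even_below (\<sigma> \<union> \<tau>) l) (r l (\<sigma> \<union> \<tau> - {l}) (c (\<sigma> \<union> \<tau> - {l})))
        \<in> carrier (N (\<sigma> \<union> \<tau>))" if "l \<in> \<sigma>" for l
      using del_ev_closed[OF CC_carr[OF c] fs(1), of l] del_eval[OF fs(1), of l c] that by simp
    show ?thesis by (rule Nm.finsum_cong') (use eq cl in auto)
  qed
  finally show "d B c (\<sigma> \<union> \<tau>) = (let L = localization S M (mult_set S fs \<sigma>)
       in \<Oplus>\<^bsub>L\<^esub>j\<in>\<sigma>. let z = localization_map S M (mult_set S fs \<sigma>) (rst i c (\<sigma> - {j}))
            in if even (card {k \<in> \<sigma>. k < j}) then z else \<ominus>\<^bsub>L\<^esub> z)"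
    unfolding Let_def N_face[OF s(1), symmetric] .
qed

text \<open>There are no cochains in place \<open>- 1\<close>; this puts the special case
  \<open>0\<close> of \<open>cech_coboundaries\<close> on the same footing as the others.\<close>

lemma CC_neg_empty: "CC B \<tau> (- 1) m = {\<zero>\<^bsub>TC\<^esub>}"
proof -
  have "c = \<zero>\<^bsub>TC\<^esub>" if c: "c \<in> CC B \<tau> (- 1) m" for c
    by (rule TC_eqI[OF CC_carr[OF c]]) (use Dz_off[OF CC_Dz[OF c]] in \<open>simp_all add: TC_ev_simps(1)\<close>)
  then show ?thesis using CC_zero by blast
qed

lemma carrier_cochain_rst: "carrier (cochain i) = rst i ` CC B \<tau> (int i) n"
proof
  show "carrier (cochain i) \<subseteq> rst i ` CC B \<tau> (int i) n"
  proof
    fix c assume c: "c \<in> carrier (cochain i)"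
    show "c \<in> rst i ` CC B \<tau> (int i) n" by (rule image_eqI[of c "rst i" "ext i c", OF rst_ext[OF c, symmetric] ext_CC[OF c]])
  qed
  show "rst i ` CC B \<tau> (int i) n \<subseteq> carrier (cochain i)" by (rule image_subsetI) (rule rst_carr)
qed

definition cocyc :: "nat \<Rightarrow> (nat set \<Rightarrow> ('m \<times> 'g) set) set" where
  "cocyc i = {c \<in> CC B \<tau> (int i) n. d B c = \<zero>\<^bsub>TC\<^esub>}"

definition cobd :: "nat \<Rightarrow> (nat set \<Rightarrow> ('m \<times> 'g) set) set" where
  "cobd i = d B ` CC B \<tau> (int i - 1) n"

lemma d_CC: "c \<in> CC B \<tau> (int i) n \<Longrightarrow> d B c \<in> CC B \<tau> (int (Suc i)) n"
  using CC_d[of c B \<tau> "int i" n] by (simp add: add.commute)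

lemma cocycles_eq: "cech_cocycles S gS M gM fs i n' = rst i ` cocyc i"
proof
  show "cech_cocycles S gS M gM fs i n' \<subseteq> rst i ` cocyc i"
  proof
    fix c assume "c \<in> cech_cocycles S gS M gM fs i n'"
    then have c: "c \<in> carrier (cochain i)" "cech_diff S M fs i c = \<one>\<^bsub>cochain (Suc i)\<^esub>"
      by (simp_all add: cech_cocycles_def)
    have e: "ext i c \<in> CC B \<tau> (int i) n" by (rule ext_CC[OF c(1)])
    have "rst (Suc i) (d B (ext i c)) = rst (Suc i) \<zero>\<^bsub>TC\<^esub>"
      unfolding rst_d[OF e] rst_ext[OF c(1)] c(2) rst_zero ..
    then have "d B (ext i c) = \<zero>\<^bsub>TC\<^esub>" by (rule rst_inj[OF d_CC[OF e] CC_zero])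
    then have "ext i c \<in> cocyc i" using e by (simp add: cocyc_def)
    then show "c \<in> rst i ` cocyc i" by (rule image_eqI[of c "rst i" "ext i c", OF rst_ext[OF c(1), symmetric]])
  qed
  show "rst i ` cocyc i \<subseteq> cech_cocycles S gS M gM fs i n'"
  proof (rule image_subsetI)
    fix c assume "c \<in> cocyc i"
    then have c: "c \<in> CC B \<tau> (int i) n" "d B c = \<zero>\<^bsub>TC\<^esub>" by (simp_all add: cocyc_def)
    have "cech_diff S M fs i (rst i c) = \<one>\<^bsub>cochain (Suc i)\<^esub>"
      unfolding rst_d[OF c(1), symmetric] c(2) rst_zero ..
    then show "rst i c \<in> cech_cocycles S gS M gM fs i n'"
      using rst_carr[OF c(1)] by (simp add: cech_cocycles_def)
  qed
qed

lemma coboundaries_eq: "cech_coboundaries S gS M gM fs i n' = rst i ` cobd i"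
proof (cases i)
  case 0
  then show ?thesis by (simp add: cech_coboundaries_def cobd_def CC_neg_empty d_zero rst_zero)
next
  case (Suc k)
  have "cech_diff S M fs k ` carrier (cochain k) = (\<lambda>c. cech_diff S M fs k (rst k c)) ` CC B \<tau> (int k) n"
    unfolding carrier_cochain_rst image_image ..
  also have "\<dots> = (\<lambda>c. rst (Suc k) (d B c)) ` CC B \<tau> (int k) n"
    by (rule image_cong[OF refl]) (simp add: rst_d)
  finally show ?thesis using Suc by (simp add: cech_coboundaries_def cobd_def image_image)
qed

lemma cobd_CC: "c \<in> cobd i \<Longrightarrow> c \<in> CC B \<tau> (int i) n"
  unfolding cobd_def using CC_d[of _ B \<tau> "int i - 1" n] by auto

lemma cobd_zero: "\<zero>\<^bsub>TC\<^esub> \<in> cobd i"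
  unfolding cobd_def by (rule image_eqI[of _ "d B" "\<zero>\<^bsub>TC\<^esub>", OF d_zero[symmetric] CC_zero])

lemma cobd_minus: "c \<in> cobd i \<Longrightarrow> c' \<in> cobd i \<Longrightarrow> c \<ominus>\<^bsub>TC\<^esub> c' \<in> cobd i"
proof -
  assume "c \<in> cobd i" "c' \<in> cobd i"
  then obtain h h' where h: "h \<in> CC B \<tau> (int i - 1) n" "c = d B h" "h' \<in> CC B \<tau> (int i - 1) n" "c' = d B h'"
    unfolding cobd_def by auto
  show ?thesis unfolding cobd_def
    by (rule image_eqI[of _ _ "h \<ominus>\<^bsub>TC\<^esub> h'"])
      (use h in \<open>simp_all only: d_minus[OF CC_carr CC_carr] CC_minus\<close>)
qed

lemma cobd_add: "c \<in> cobd i \<Longrightarrow> c' \<in> cobd i \<Longrightarrow> c \<oplus>\<^bsub>TC\<^esub> c' \<in> cobd i"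
proof -
  assume c: "c \<in> cobd i" "c' \<in> cobd i"
  have t: "c \<in> carrier TC" "c' \<in> carrier TC" using CC_carr[OF cobd_CC] c by auto
  have "\<zero>\<^bsub>TC\<^esub> \<ominus>\<^bsub>TC\<^esub> c' \<in> cobd i" by (rule cobd_minus[OF cobd_zero c(2)])
  then have "c \<ominus>\<^bsub>TC\<^esub> (\<zero>\<^bsub>TC\<^esub> \<ominus>\<^bsub>TC\<^esub> c') \<in> cobd i" by (rule cobd_minus[OF c(1)])
  then show ?thesis using t by (simp add: a_minus_def)
qed

text \<open>The quotient is trivial when each coset of a cocycle is the group of coboundaries
  itself. Injectivity of \<open>rst\<close> on cochains of one place allows this to be decided in
  \<open>TC\<close>, where it says that cocycles are coboundaries.\<close>

theorem vanish_iff: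
  "(let H = cech_cohomology S gS M gM fs i n' in carrier H = {\<one>\<^bsub>H\<^esub>}) \<longleftrightarrow> exact B \<tau> (int i) n"
proof -
  define G where "G = (cochain i)\<lparr>carrier := rst i ` cocyc i\<rparr>"
  define K where "K = rst i ` cobd i"
  have H: "carrier (G Mod K) = (\<lambda>c. K #>\<^bsub>G\<^esub> rst i c) ` cocyc i" "\<one>\<^bsub>G Mod K\<^esub> = K"
    by (auto simp: FactGroup_def RCOSETS_def G_def)
  have cos: "K #>\<^bsub>G\<^esub> rst i c = (\<lambda>b. rst i (b \<oplus>\<^bsub>TC\<^esub> c)) ` cobd i" for c
    unfolding r_coset_def K_def G_def by (auto simp: rst_add)
  have "(\<lambda>c. K #>\<^bsub>G\<^esub> rst i c) ` cocyc i = {K} \<longleftrightarrow> cocyc i \<subseteq> cobd i"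
  proof
    assume e: "(\<lambda>c. K #>\<^bsub>G\<^esub> rst i c) ` cocyc i = {K}"
    show "cocyc i \<subseteq> cobd i"
    proof
      fix c assume c: "c \<in> cocyc i"
      then have cc: "c \<in> CC B \<tau> (int i) n" by (simp add: cocyc_def)
      have "K #>\<^bsub>G\<^esub> rst i c = K" using e c by auto
      then have "rst i (\<zero>\<^bsub>TC\<^esub> \<oplus>\<^bsub>TC\<^esub> c) \<in> K" unfolding cos using cobd_zero by auto
      then have "rst i c \<in> K" using CC_carr[OF cc] by simp
      then obtain b where b: "b \<in> cobd i" "rst i c = rst i b" unfolding K_def by auto
      then have "c = b" using rst_inj[OF cc cobd_CC] by simp
      then show "c \<in> cobd i" using b by simp
    qed
  next
    assume sub: "cocyc i \<subseteq> cobd i"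
    have "K #>\<^bsub>G\<^esub> rst i c = K" if c: "c \<in> cocyc i" for c
    proof -
      have c: "c \<in> cobd i" using sub c by blast
      have ct: "c \<in> carrier TC" by (rule CC_carr[OF cobd_CC[OF c]])
      \<comment> \<open>Translation by an element of a subgroup permutes the subgroup.\<close>
      have "(\<lambda>b. b \<oplus>\<^bsub>TC\<^esub> c) ` cobd i = cobd i"
      proof
        show "(\<lambda>b. b \<oplus>\<^bsub>TC\<^esub> c) ` cobd i \<subseteq> cobd i" by (rule image_subsetI) (rule cobd_add[OF _ c])
        show "cobd i \<subseteq> (\<lambda>b. b \<oplus>\<^bsub>TC\<^esub> c) ` cobd i"
        proof
          fix b assume b: "b \<in> cobd i"
          have bt: "b \<in> carrier TC" by (rule CC_carr[OF cobd_CC[OF b]])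
          have "b = (b \<ominus>\<^bsub>TC\<^esub> c) \<oplus>\<^bsub>TC\<^esub> c" using bt ct by (simp add: a_minus_def T.a_assoc T.l_neg)
          then show "b \<in> (\<lambda>b. b \<oplus>\<^bsub>TC\<^esub> c) ` cobd i" by (rule image_eqI[of b "\<lambda>b. b \<oplus>\<^bsub>TC\<^esub> c" "b \<ominus>\<^bsub>TC\<^esub> c", OF _ cobd_minus[OF b c]])
        qed
      qed
      then have "rst i ` ((\<lambda>b. b \<oplus>\<^bsub>TC\<^esub> c) ` cobd i) = K" unfolding K_def by simp
      then show ?thesis unfolding cos image_image .
    qed
    moreover have "\<zero>\<^bsub>TC\<^esub> \<in> cocyc i" using CC_zero d_zero by (simp add: cocyc_def)
    ultimately show "(\<lambda>c. K #>\<^bsub>G\<^esub> rst i c) ` cocyc i = {K}" by auto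
  qed
  moreover have "cocyc i \<subseteq> cobd i \<longleftrightarrow> exact B \<tau> (int i) n"
    unfolding cocyc_def cobd_def exact_def by auto
  ultimately show ?thesis
    unfolding cech_cohomology_def cocycles_eq coboundaries_eq Let_def G_def[symmetric] K_def[symmetric] H
    by simp
qed

end

section \<open>The Cech and Koszul directions\<close>

context graded_module
begin

lemma localization_map_additive:
  assumes "localizing S M T" "localizing S M T'" "T' \<subseteq> T"
  shows "additive_map (localization S M T') (localization S M T) (localization_map S M T)"
proof -
  interpret T: localizing S M T by fact
  interpret T': localizing S M T' by fact
  note mf = localization_map_frac[OF assms]
  show ?thesis
    unfolding additive_map_def
  proof (intro conjI ballI funcsetI)
    fix A assume "A \<in> carrier (localization S M T')"
    then obtain x t where "A = T'.frac x t" "x \<in> carrier M" "t \<in> T'" by (rule T'.L_cases)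
    then show "localization_map S M T A \<in> carrier (localization S M T)"
      using assms(3) by (auto simp: mf)
  next
    fix A B assume "A \<in> carrier (localization S M T')" "B \<in> carrier (localization S M T')"
    then obtain x y t where A: "A = T'.frac x t" "B = T'.frac y t" "x \<in> carrier M" "y \<in> carrier M" "t \<in> T'"
      by (rule T'.L_common2)
    have t: "t \<in> T" using A assms(3) by blast
    show "localization_map S M T (A \<oplus>\<^bsub>localization S M T'\<^esub> B) =
        localization_map S M T A \<oplus>\<^bsub>localization S M T\<^esub> localization_map S M T B"
      using A t by (simp add: mf T.L_add_same T'.L_add_same)
  qed
qed

lemma localization_map_smult:
  assumes "localizing S M T" "localizing S M T'" "T' \<subseteq> T"
    and a: "a \<in> carrier S" and A: "A \<in> carrier (localization S M T')"
  shows "localization_map S M T (a \<odot>\<^bsub>localization S M T'\<^esub> A) = a \<odot>\<^bsub>localization S M T\<^esub> localization_map S M T A"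
proof -
  interpret T: localizing S M T by fact
  interpret T': localizing S M T' by fact
  obtain x t where x: "A = T'.frac x t" "x \<in> carrier M" "t \<in> T'" using A by (rule T'.L_cases)
  have "t \<in> T" using x assms(3) by blast
  then show ?thesis using a x by (simp add: localization_map_frac[OF assms(1-3)] T.L_smult T'.L_smult)
qed

lemma localization_map_comp:
  assumes "localizing S M T" "localizing S M T'" "localizing S M T''" "T'' \<subseteq> T'" "T' \<subseteq> T"
    and A: "A \<in> carrier (localization S M T'')"
  shows "localization_map S M T (localization_map S M T' A) = localization_map S M T A"
proof -
  interpret T'': localizing S M T'' by fact
  obtain x t where x: "A = T''.frac x t" "x \<in> carrier M" "t \<in> T''" using A by (rule T''.L_cases)
  have t: "t \<in> T'" "T'' \<subseteq> T" using x assms(4,5) by auto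
  show ?thesis unfolding x(1)
    using localization_map_frac[OF assms(2,3,4) x(2,3)] localization_map_frac[OF assms(1,2,5) x(2) t(1)]
      localization_map_frac[OF assms(1,3) t(2) x(2,3)] by simp
qed

lemma localization_map_graded:
  assumes "graded_localizing S M gS gM T" "graded_localizing S M gS gM T'" "T' \<subseteq> T"
    and A: "A \<in> localization_component S gS M gM T' n"
  shows "localization_map S M T A \<in> localization_component S gS M gM T n"
proof -
  interpret T: graded_localizing S M gS gM T by fact
  interpret T': graded_localizing S M gS gM T' by fact
  obtain x t a where x: "A = T'.frac x t" "t \<in> T'" "t \<in> gS a" "x \<in> gM (n + a)" using A by (rule T'.gL_E)
  have "localization_map S M T A = T.frac x t"
    unfolding x(1) by (rule localization_map_frac[OF T.localizing_axioms T'.localizing_axioms assms(3) gMc[OF x(4)] x(2)])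
  then show ?thesis using T.gL_I[OF _ x(3,4)] x(2) assms(3) by auto
qed

end

locale cech_setup = graded_module S M gS gM
  for S :: "('g, 'w) ring_scheme" (structure) and M :: "('g, 'm, 'v) module_scheme" (structure)
    and gS :: "('s \<Rightarrow> int) \<Rightarrow> 'g set" and gM :: "('s \<Rightarrow> int) \<Rightarrow> 'm set" +
  fixes gs :: "'g list" and \<delta> :: "nat \<Rightarrow> 's \<Rightarrow> int" and X :: "nat set"
  defines "X \<equiv> {..<length gs}"
  assumes gs_hom: "i \<in> X \<Longrightarrow> gs ! i \<in> gS (\<delta> i)"
begin

lemma finX: "finite X" by (simp add: X_def)

lemma finXs: "\<rho> \<subseteq> X \<Longrightarrow> finite \<rho>" using finX finite_subset by blast

lemma gsc: "i \<in> X \<Longrightarrow> gs ! i \<in> carrier S" using gs_hom gSc by blast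

abbreviation ms where "ms \<rho> \<equiv> mult_set S gs \<rho>"

definition mono :: "nat set \<Rightarrow> (nat \<Rightarrow> nat) \<Rightarrow> 'g" where
  "mono \<rho> a = (\<Otimes>i\<in>\<rho>. gs ! i [^] a i)"

lemma ms_eq: "ms \<rho> = range (mono \<rho>)"
  unfolding mult_set_def mono_def by auto

lemma mono_ms: "mono \<rho> a \<in> ms \<rho>" unfolding ms_eq by (rule rangeI)

lemma ms_E: assumes "t \<in> ms \<rho>" obtains a where "t = mono \<rho> a" using assms unfolding ms_eq by (rule rangeE)

lemma pow_Pi: "\<rho> \<subseteq> X \<Longrightarrow> (\<lambda>i. gs ! i [^] (a i :: nat)) \<in> \<rho> \<rightarrow> carrier S"
  using gsc by auto

lemma mono_carr: "\<rho> \<subseteq> X \<Longrightarrow> mono \<rho> a \<in> carrier S"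
  unfolding mono_def by (rule R.finprod_closed[OF pow_Pi])

lemma mono_mult: "\<rho> \<subseteq> X \<Longrightarrow> mono \<rho> a \<otimes> mono \<rho> b = mono \<rho> (\<lambda>i. a i + b i)"
proof -
  assume r: "\<rho> \<subseteq> X"
  have "mono \<rho> a \<otimes> mono \<rho> b = (\<Otimes>i\<in>\<rho>. gs ! i [^] a i \<otimes> gs ! i [^] b i)"
    unfolding mono_def by (rule R.finprod_multf[OF pow_Pi[OF r] pow_Pi[OF r], symmetric])
  also have "\<dots> = mono \<rho> (\<lambda>i. a i + b i)"
    unfolding mono_def by (rule R.finprod_cong') (use r gsc in \<open>auto simp: R.nat_pow_mult\<close>)
  finally show ?thesis .
qed

lemma mono_zero: "\<rho> \<subseteq> X \<Longrightarrow> mono \<rho> (\<lambda>i. 0) = \<one>"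
  unfolding mono_def by simp

lemma mono_insert: "insert l \<rho> \<subseteq> X \<Longrightarrow> l \<notin> \<rho> \<Longrightarrow> mono (insert l \<rho>) a = (gs ! l [^] a l) \<otimes> mono \<rho> a"
  unfolding mono_def by (rule R.finprod_insert) (use finXs[of \<rho>] gsc pow_Pi[of \<rho> a] in auto)

lemma mono_extend: "\<rho> \<subseteq> \<rho>' \<Longrightarrow> \<rho>' \<subseteq> X \<Longrightarrow> mono \<rho>' (\<lambda>i. if i \<in> \<rho> then a i else 0) = mono \<rho> a"
  unfolding mono_def
  by (rule R.finprod_mono_neutral_cong_right) (use finXs gsc in auto)

lemma ms_mono: "\<rho> \<subseteq> \<rho>' \<Longrightarrow> \<rho>' \<subseteq> X \<Longrightarrow> ms \<rho> \<subseteq> ms \<rho>'"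
proof
  fix t assume r: "\<rho> \<subseteq> \<rho>'" "\<rho>' \<subseteq> X" and "t \<in> ms \<rho>"
  then obtain a where "t = mono \<rho> a" by (elim ms_E)
  then show "t \<in> ms \<rho>'" using mono_ms mono_extend[OF r, of a] by metis
qed

lemma ms_ins: "l \<in> X \<Longrightarrow> \<rho> \<subseteq> X \<Longrightarrow> ms \<rho> \<subseteq> ms (insert l \<rho>)"
  by (rule ms_mono) auto

lemma ms_ins2: "l \<in> X \<Longrightarrow> k \<in> X \<Longrightarrow> \<rho> \<subseteq> X \<Longrightarrow> ms (insert l \<rho>) \<subseteq> ms (insert l (insert k \<rho>))"
  by (rule ms_mono) auto

lemma ms_gs: "\<rho> \<subseteq> X \<Longrightarrow> l \<in> \<rho> \<Longrightarrow> gs ! l [^] (k::nat) \<in> ms \<rho>"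
proof -
  assume r: "\<rho> \<subseteq> X" "l \<in> \<rho>"
  have "mono (insert l {}) (\<lambda>i. k) = gs ! l [^] k"
    using r gsc by (subst mono_insert) (auto simp: mono_def)
  then have "gs ! l [^] k \<in> ms {l}" using mono_ms by metis
  then show ?thesis using ms_mono[of "{l}" \<rho>] r by auto
qed

lemma mono_hom: "\<rho> \<subseteq> X \<Longrightarrow> mono \<rho> a \<in> gS (\<Sum>i\<in>\<rho>. of_nat (a i) * \<delta> i)"
proof (induction "card \<rho>" arbitrary: \<rho>)
  case 0
  then have "\<rho> = {}" using finXs by simp
  then show ?case unfolding mono_def by (simp only: R.finprod_empty sum.empty gS_one)
next
  case (Suc n)
  have fin: "finite \<rho>" using Suc.prems finXs by blast
  obtain l where l: "l \<in> \<rho>" using Suc(2) by fastforce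
  let ?r = "\<rho> - {l}"
  have r: "insert l ?r = \<rho>" "l \<notin> ?r" "?r \<subseteq> X" "n = card ?r" "l \<in> X" using l Suc fin by auto
  have m: "mono \<rho> a = (gs ! l [^] a l) \<otimes> mono ?r a"
    using mono_insert[of l ?r a] r Suc.prems by simp
  have s: "(\<Sum>i\<in>\<rho>. of_nat (a i) * \<delta> i) = of_nat (a l) * \<delta> l + (\<Sum>i\<in>?r. of_nat (a i) * \<delta> i)"
    by (rule sum.remove[OF fin l])
  show ?case unfolding m s by (rule gS_mult[OF gS_pow[OF gs_hom[OF r(5)]] Suc(1)[OF r(4) r(3)]])
qed

lemma ms_loc: assumes r: "\<rho> \<subseteq> X" shows "graded_localizing S M gS gM (ms \<rho>)"
proof
  show "ms \<rho> \<subseteq> carrier S" unfolding ms_eq using mono_carr[OF r] by (rule image_subsetI)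
  show "\<one> \<in> ms \<rho>" using mono_ms[of \<rho> "\<lambda>i. 0"] mono_zero[OF r] by simp
  show "s \<otimes> t \<in> ms \<rho>" if st: "s \<in> ms \<rho>" "t \<in> ms \<rho>" for s t
  proof -
    obtain a b where "s = mono \<rho> a" "t = mono \<rho> b" using st by (elim ms_E)
    then show ?thesis using mono_mult[OF r] mono_ms by simp
  qed
  show "\<exists>a. t \<in> gS a" if "t \<in> ms \<rho>" for t
    using that by (elim ms_E) (use mono_hom[OF r] in blast)
qed

lemma ms_loc': "\<rho> \<subseteq> X \<Longrightarrow> localizing S M (ms \<rho>)"
  using ms_loc graded_localizing.axioms(2) by blast

text \<open>\<open>localization_component\<close> asks for a denominator of some degree
  \<open>c\<close>, while the monomial has a known degree. If the two differ, the denominator lies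
  in two components and is zero, so the fraction is zero and can be rewritten.\<close>

lemma gL_rep:
  assumes r: "\<rho> \<subseteq> X" and A: "A \<in> localization_component S gS M gM (ms \<rho>) n"
  obtains a x where "A = fraction S M (ms \<rho>) x (mono \<rho> a)" "x \<in> gM (n + (\<Sum>i\<in>\<rho>. of_nat (a i) * \<delta> i))"
proof -
  interpret graded_localizing S M gS gM "ms \<rho>" by (rule ms_loc[OF r])
  obtain x t c where x: "A = frac x t" "t \<in> ms \<rho>" "t \<in> gS c" "x \<in> gM (n + c)" using A by (rule gL_E)
  obtain a where a: "t = mono \<rho> a" using x(2) by (rule ms_E)
  let ?s = "\<Sum>i\<in>\<rho>. of_nat (a i) * \<delta> i"
  show thesis
  proof (cases "c = ?s")
    case True
    then show thesis using that[of x a] x a by simp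
  next
    case False
    then have t0: "t = \<zero>" using gS_disj[OF x(3)] mono_hom[OF r, of a] a by blast
    have "A = \<zero>\<^bsub>L\<^esub>"
      unfolding x(1) by (rule frac_eq_zeroI[where w = t]) (use x gMc t0 in auto)
    then have "A = frac \<zero>\<^bsub>M\<^esub> (mono \<rho> a)" using frac_zero[OF mono_ms] by simp
    then show thesis using that[of "\<zero>\<^bsub>M\<^esub>" a] gM_zero by simp
  qed
qed

text \<open>A denominator over \<open>insert l \<rho>\<close> is a power of \<open>gs ! l\<close>
  times a monomial over \<open>\<rho>\<close>; multiplying the fraction by that power clears
  it.\<close>

lemma cech_lift:
  assumes r: "insert l \<rho> \<subseteq> X" "l \<notin> \<rho>" and z: "z \<in> localization_component S gS M gM (ms (insert l \<rho>)) n"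
  shows "\<exists>k. \<exists>w\<in>localization_component S gS M gM (ms \<rho>) (n + of_nat k * \<delta> l).
     localization_map S M (ms (insert l \<rho>)) w = (gs ! l [^] k) \<odot>\<^bsub>localization S M (ms (insert l \<rho>))\<^esub> z"
proof -
  have r': "\<rho> \<subseteq> X" "l \<in> X" using r by auto
  interpret T: graded_localizing S M gS gM "ms (insert l \<rho>)" by (rule ms_loc[OF r(1)])
  interpret T': graded_localizing S M gS gM "ms \<rho>" by (rule ms_loc[OF r'(1)])
  have sub: "ms \<rho> \<subseteq> ms (insert l \<rho>)" by (rule ms_mono[OF _ r(1)]) auto
  obtain a x where x: "z = T.frac x (mono (insert l \<rho>) a)" "x \<in> gM (n + (\<Sum>i\<in>insert l \<rho>. of_nat (a i) * \<delta> i))"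
    using r(1) z by (rule gL_rep)
  have s: "(\<Sum>i\<in>insert l \<rho>. of_nat (a i) * \<delta> i) = of_nat (a l) * \<delta> l + (\<Sum>i\<in>\<rho>. of_nat (a i) * \<delta> i)"
    by (rule sum.insert[OF finXs[OF r'(1)] r(2)])
  have xc: "x \<in> carrier M" using x gMc by blast
  show ?thesis
  proof (intro exI bexI)
    show "T'.frac x (mono \<rho> a) \<in> T'.gL (n + of_nat (a l) * \<delta> l)"
      by (rule T'.gL_I[OF mono_ms mono_hom[OF r'(1)]]) (use x(2) in \<open>simp only: s add.assoc\<close>)
    have "localization_map S M (ms (insert l \<rho>)) (T'.frac x (mono \<rho> a)) = T.frac x (mono \<rho> a)"
      by (rule localization_map_frac[OF T.localizing_axioms T'.localizing_axioms sub xc mono_ms])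
    also have "\<dots> = T.frac ((gs ! l [^] a l) \<odot>\<^bsub>M\<^esub> x) ((gs ! l [^] a l) \<otimes> mono \<rho> a)"
      by (rule T.frac_scale[symmetric, OF xc]) (use mono_ms sub ms_gs[OF r(1)] in auto)
    also have "\<dots> = (gs ! l [^] a l) \<odot>\<^bsub>T.L\<^esub> z"
      unfolding x(1) mono_insert[OF r] using gsc[OF r'(2)] xc mono_ms[of "insert l \<rho>" a]
      by (intro T.L_smult[symmetric]) (simp_all add: mono_insert[OF r])
    finally show "localization_map S M (ms (insert l \<rho>)) (T'.frac x (mono \<rho> a)) = (gs ! l [^] a l) \<odot>\<^bsub>T.L\<^esub> z" .
  qed
qed

text \<open>A multiplier that kills the numerator factors in the same way; its part over
  \<open>\<rho>\<close> is already invertible, so the power of \<open>gs ! l\<close> alone kills the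
  fraction.\<close>

lemma cech_tors:
  assumes r: "insert l \<rho> \<subseteq> X" "l \<notin> \<rho>" and z: "z \<in> localization_component S gS M gM (ms \<rho>) n"
    and e: "localization_map S M (ms (insert l \<rho>)) z = \<zero>\<^bsub>localization S M (ms (insert l \<rho>))\<^esub>"
  shows "\<exists>k::nat. (gs ! l [^] k) \<odot>\<^bsub>localization S M (ms \<rho>)\<^esub> z = \<zero>\<^bsub>localization S M (ms \<rho>)\<^esub>"
proof -
  have r': "\<rho> \<subseteq> X" "l \<in> X" using r by auto
  interpret T: graded_localizing S M gS gM "ms (insert l \<rho>)" by (rule ms_loc[OF r(1)])
  interpret T': graded_localizing S M gS gM "ms \<rho>" by (rule ms_loc[OF r'(1)])
  have sub: "ms \<rho> \<subseteq> ms (insert l \<rho>)" by (rule ms_mono[OF _ r(1)]) auto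
  obtain x t where x: "z = T'.frac x t" "x \<in> carrier M" "t \<in> ms \<rho>" using T'.gL_carr[OF z] by (rule T'.L_cases)
  have "T.frac x t = \<zero>\<^bsub>T.L\<^esub>"
    using e localization_map_frac[OF T.localizing_axioms T'.localizing_axioms sub x(2,3)] x(1) by simp
  then obtain v where v: "v \<in> ms (insert l \<rho>)" "v \<odot>\<^bsub>M\<^esub> x = \<zero>\<^bsub>M\<^esub>"
    using T.frac_eq_zeroD[OF _ x(2)] x(3) sub by blast
  obtain a where a: "v = mono (insert l \<rho>) a" using v(1) by (rule ms_E)
  have "mono \<rho> a \<odot>\<^bsub>M\<^esub> ((gs ! l [^] a l) \<odot>\<^bsub>M\<^esub> x) = v \<odot>\<^bsub>M\<^esub> x"
    unfolding a mono_insert[OF r] using gsc[OF r'(2)] mono_carr[OF r'(1)] x(2)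
    by (simp add: R.m_comm flip: smult_assoc1)
  then have "T'.frac ((gs ! l [^] a l) \<odot>\<^bsub>M\<^esub> x) t = \<zero>\<^bsub>T'.L\<^esub>"
    using v(2) x gsc[OF r'(2)] by (intro T'.frac_eq_zeroI[OF _ _ mono_ms[of \<rho> a]]) auto
  then show ?thesis using T'.L_smult[of "gs ! l [^] a l" x t] x gsc[OF r'(2)] by auto
qed

sublocale cech: cube S gS X "\<lambda>\<rho>. localization S M (ms \<rho>)"
  "\<lambda>n \<rho>. localization_component S gS M gM (ms \<rho>) n" "\<lambda>l \<rho>. localization_map S M (ms (insert l \<rho>))"
  "\<lambda>l. gs ! l" \<delta>
proof (intro cube.intro cube_axioms.intro)
  show "cring S" by (rule R.is_cring)
  show "finite X" by (rule finX)
  show "s \<in> carrier S" if "s \<in> gS a" for s a using that by (rule gSc)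
  show "\<one> \<in> gS 0" by (rule gS_one)
  show "s \<otimes> t \<in> gS (a + b)" if "s \<in> gS a" "t \<in> gS b" for s t a b using that by (rule gS_mult)
  show "module S (localization S M (ms \<rho>))" if r: "\<rho> \<subseteq> X" for \<rho>
    by (rule localizing.L_module[OF ms_loc'[OF r]])
  show "additive_subgroup (localization_component S gS M gM (ms \<rho>) n) (localization S M (ms \<rho>))"
    if r: "\<rho> \<subseteq> X" for \<rho> n by (rule graded_localizing.gL_sub[OF ms_loc[OF r]])
  show "s \<odot>\<^bsub>localization S M (ms \<rho>)\<^esub> z \<in> localization_component S gS M gM (ms \<rho>) (n + a)"
    if "\<rho> \<subseteq> X" "s \<in> gS a" "z \<in> localization_component S gS M gM (ms \<rho>) n" for \<rho> s a z n
    by (rule graded_localizing.gL_smult[OF ms_loc[OF that(1)] that(2,3)])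
  show "additive_map (localization S M (ms \<rho>)) (localization S M (ms (insert l \<rho>))) (localization_map S M (ms (insert l \<rho>)))"
    if "l \<in> X" "\<rho> \<subseteq> X" "l \<notin> \<rho>" for l \<rho>
    by (rule localization_map_additive) (use that in \<open>simp_all add: ms_loc' ms_ins ms_ins2\<close>)
  show "localization_map S M (ms (insert l \<rho>)) (s \<odot>\<^bsub>localization S M (ms \<rho>)\<^esub> z) =
      s \<odot>\<^bsub>localization S M (ms (insert l \<rho>))\<^esub> localization_map S M (ms (insert l \<rho>)) z"
    if "l \<in> X" "\<rho> \<subseteq> X" "l \<notin> \<rho>" "s \<in> carrier S" "z \<in> carrier (localization S M (ms \<rho>))" for l \<rho> s z
    by (rule localization_map_smult[OF _ _ _ that(4,5)]) (use that(1-3) in \<open>simp_all add: ms_loc' ms_ins ms_ins2\<close>)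
  show "localization_map S M (ms (insert l \<rho>)) z \<in> localization_component S gS M gM (ms (insert l \<rho>)) n"
    if "l \<in> X" "\<rho> \<subseteq> X" "l \<notin> \<rho>" "z \<in> localization_component S gS M gM (ms \<rho>) n" for l \<rho> z n
    by (rule localization_map_graded[OF _ _ _ that(4)]) (use that(1-3) in \<open>simp_all add: ms_loc ms_ins\<close>)
  show "localization_map S M (ms (insert l (insert k \<rho>))) (localization_map S M (ms (insert k \<rho>)) z) =
      localization_map S M (ms (insert k (insert l \<rho>))) (localization_map S M (ms (insert l \<rho>)) z)"
    if h: "l \<in> X" "k \<in> X" "\<rho> \<subseteq> X" "l \<noteq> k" "l \<notin> \<rho>" "k \<notin> \<rho>" "z \<in> carrier (localization S M (ms \<rho>))" for l k \<rho> z
  proof -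
    have i: "insert k (insert l \<rho>) = insert l (insert k \<rho>)" by (rule insert_commute)
    have "localization_map S M (ms (insert l (insert k \<rho>))) (localization_map S M (ms (insert k \<rho>)) z)
      = localization_map S M (ms (insert l (insert k \<rho>))) z"
      by (rule localization_map_comp[OF _ _ _ _ _ h(7)]) (use h(1-6) in \<open>simp_all add: ms_loc' ms_ins ms_ins2\<close>)
    moreover have "localization_map S M (ms (insert l (insert k \<rho>))) (localization_map S M (ms (insert l \<rho>)) z)
      = localization_map S M (ms (insert l (insert k \<rho>))) z"
      by (rule localization_map_comp[OF _ _ _ _ _ h(7)]) (use h(1-6) in \<open>simp_all add: ms_loc' ms_ins ms_ins2\<close>)
    ultimately show ?thesis unfolding i by simp
  qed
  show "gs ! l \<in> gS (\<delta> l)" if "l \<in> X" for l using that by (rule gs_hom)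
  show "\<exists>k. \<exists>w\<in>localization_component S gS M gM (ms \<rho>) (n + of_nat k * \<delta> l).
     localization_map S M (ms (insert l \<rho>)) w = (gs ! l [^] k) \<odot>\<^bsub>localization S M (ms (insert l \<rho>))\<^esub> z"
    if "l \<in> X" "\<rho> \<subseteq> X" "l \<notin> \<rho>" "z \<in> localization_component S gS M gM (ms (insert l \<rho>)) n" for l \<rho> z n
    by (rule cech_lift) (use that in auto)
  show "\<exists>k::nat. (gs ! l [^] k) \<odot>\<^bsub>localization S M (ms \<rho>)\<^esub> z = \<zero>\<^bsub>localization S M (ms \<rho>)\<^esub>"
    if "l \<in> X" "\<rho> \<subseteq> X" "l \<notin> \<rho>" "z \<in> localization_component S gS M gM (ms \<rho>) n"
      "localization_map S M (ms (insert l \<rho>)) z = \<zero>\<^bsub>localization S M (ms (insert l \<rho>))\<^esub>" for l \<rho> z n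
    by (rule cech_tors[OF _ _ that(4,5)]) (use that in auto)
qed

end

section \<open>A cube mixing Cech and Koszul directions\<close>

locale reduction_setup = cech_setup S M gS gM "fs @ ys" \<delta> X
  for S :: "('g, 'w) ring_scheme" (structure) and M :: "('g, 'm, 'v) module_scheme" (structure)
    and gS :: "('s \<Rightarrow> int) \<Rightarrow> 'g set" and gM :: "('s \<Rightarrow> int) \<Rightarrow> 'm set"
    and fs ys :: "'g list" and \<delta> :: "nat \<Rightarrow> 's \<Rightarrow> int" and X :: "nat set" +
  fixes A B :: "nat set"
  defines "B \<equiv> {..<length fs}" and "A \<equiv> {length fs..<length fs + length ys}"
  assumes ys_deg: "i \<in> A \<Longrightarrow> \<delta> i = 1"
begin

abbreviation gs where "gs \<equiv> fs @ ys"
abbreviation Lc where "Lc \<rho> \<equiv> localization S M (ms \<rho>)"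
abbreviation Dc where "Dc n \<rho> \<equiv> localization_component S gS M gM (ms \<rho>) n"

lemma XAB: "X = A \<union> B" "A \<inter> B = {}" "A \<subseteq> X" "B \<subseteq> X"
  unfolding X_def A_def B_def by auto

lemma finA: "finite A" and finB: "finite B" unfolding A_def B_def by auto

lemma cardA: "card A = length ys" unfolding A_def by simp

lemma notB: "l \<in> X \<Longrightarrow> l \<notin> B \<longleftrightarrow> l \<in> A" using XAB by auto

text \<open>The degree shift makes multiplication by \<open>gs ! l\<close>, \<open>l \<in> A\<close>, a map of degree zero.\<close>

definition degK :: "nat set \<Rightarrow> 's \<Rightarrow> int" where
  "degK \<rho> = of_nat (length ys - card (\<rho> \<inter> A))"

abbreviation NK where "NK \<rho> \<equiv> Lc (\<rho> \<inter> B)"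
abbreviation DK where "DK n \<rho> \<equiv> Dc (n - degK \<rho>) (\<rho> \<inter> B)"
text \<open>A Koszul direction keeps the module and only multiplies, which is why \<open>NK\<close>
  looks at the Cech part of the face alone.\<close>

definition rK :: "nat \<Rightarrow> nat set \<Rightarrow> ('m \<times> 'g) set \<Rightarrow> ('m \<times> 'g) set" where
  "rK l \<rho> = (if l \<in> B then localization_map S M (ms (insert l (\<rho> \<inter> B))) else (\<lambda>z. gs ! l \<odot>\<^bsub>NK \<rho>\<^esub> z))"

lemma insB: "l \<in> B \<Longrightarrow> insert l \<rho> \<inter> B = insert l (\<rho> \<inter> B)" "l \<in> A \<Longrightarrow> insert l \<rho> \<inter> B = \<rho> \<inter> B"
  using XAB by auto

lemma degK_B: "l \<in> B \<Longrightarrow> degK (insert l \<rho>) = degK \<rho>"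
proof -
  assume "l \<in> B"
  then have "insert l \<rho> \<inter> A = \<rho> \<inter> A" using XAB by auto
  then show ?thesis by (simp add: degK_def)
qed

lemma degK_A:
  assumes "l \<in> A" "l \<notin> \<rho>"
  shows "n - degK (insert l \<rho>) = n - degK \<rho> + 1"
proof -
  have e: "insert l \<rho> \<inter> A = insert l (\<rho> \<inter> A)" using assms by auto
  have "insert l (\<rho> \<inter> A) \<subseteq> A" using assms by auto
  \<comment> \<open>The subtraction of naturals in \<open>degK\<close> is truncated; this bound
    ensures that it really drops by one.\<close>
  then have "card (insert l (\<rho> \<inter> A)) \<le> card A" using finA card_mono by blast
  moreover have c: "card (insert l (\<rho> \<inter> A)) = Suc (card (\<rho> \<inter> A))" using assms finA by simp
  ultimately have "length ys - card (\<rho> \<inter> A) = Suc (length ys - card (insert l \<rho> \<inter> A))"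
    unfolding e cardA by linarith
  then have "degK \<rho> = degK (insert l \<rho>) + 1"
    unfolding degK_def by (simp only: of_nat_Suc add.commute)
  then show ?thesis by simp
qed

lemma sB: "\<rho> \<subseteq> X \<Longrightarrow> \<rho> \<inter> B \<subseteq> X" by auto

lemma gl: "\<rho> \<subseteq> X \<Longrightarrow> graded_localizing S M gS gM (ms (\<rho> \<inter> B))" by (rule ms_loc[OF sB])

lemma ll: "\<rho> \<subseteq> X \<Longrightarrow> localizing S M (ms (\<rho> \<inter> B))" by (rule ms_loc'[OF sB])

sublocale kos: cube S gS X "\<lambda>\<rho>. NK \<rho>" "\<lambda>n \<rho>. DK n \<rho>" rK "\<lambda>l. gs ! l" \<delta>
proof (intro cube.intro cube_axioms.intro)
  show "cring S" by (rule R.is_cring)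
  show "finite X" by (rule finX)
  show "s \<in> carrier S" if "s \<in> gS a" for s a using that by (rule gSc)
  show "\<one> \<in> gS 0" by (rule gS_one)
  show "s \<otimes> t \<in> gS (a + b)" if "s \<in> gS a" "t \<in> gS b" for s t a b using that by (rule gS_mult)
  show "module S (NK \<rho>)" if r: "\<rho> \<subseteq> X" for \<rho> by (rule localizing.L_module[OF ll[OF r]])
  show "additive_subgroup (DK n \<rho>) (NK \<rho>)" if r: "\<rho> \<subseteq> X" for \<rho> n by (rule graded_localizing.gL_sub[OF gl[OF r]])
  show "s \<odot>\<^bsub>NK \<rho>\<^esub> z \<in> DK (n + a) \<rho>" if h: "\<rho> \<subseteq> X" "s \<in> gS a" "z \<in> DK n \<rho>" for \<rho> s a z n
  proof -
    have e: "n + a - degK \<rho> = n - degK \<rho> + a" by simp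
    show ?thesis unfolding e by (rule graded_localizing.gL_smult[OF gl[OF h(1)] h(2,3)])
  qed
  show "additive_map (NK \<rho>) (NK (insert l \<rho>)) (rK l \<rho>)" if h: "l \<in> X" "\<rho> \<subseteq> X" "l \<notin> \<rho>" for l \<rho>
  proof (cases "l \<in> B")
    case True
    have "additive_map (NK \<rho>) (Lc (insert l (\<rho> \<inter> B))) (localization_map S M (ms (insert l (\<rho> \<inter> B))))"
      by (rule localization_map_additive) (use h sB in \<open>simp_all add: ms_loc' ms_ins\<close>)
    then show ?thesis using True by (simp add: rK_def insB)
  next
    case False
    then have lA: "l \<in> A" using notB h by blast
    interpret N: module S "NK \<rho>" by (rule localizing.L_module[OF ll[OF h(2)]])
    have "additive_map (NK \<rho>) (NK \<rho>) (\<lambda>z. gs ! l \<odot>\<^bsub>NK \<rho>\<^esub> z)"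
      using gsc[OF h(1)] by (simp add: additive_map_def N.smult_r_distr)
    then show ?thesis using False by (simp add: rK_def insB(2)[OF lA])
  qed
  show "rK l \<rho> (s \<odot>\<^bsub>NK \<rho>\<^esub> z) = s \<odot>\<^bsub>NK (insert l \<rho>)\<^esub> rK l \<rho> z"
    if h: "l \<in> X" "\<rho> \<subseteq> X" "l \<notin> \<rho>" "s \<in> carrier S" "z \<in> carrier (NK \<rho>)" for l \<rho> s z
  proof (cases "l \<in> B")
    case True
    have "localization_map S M (ms (insert l (\<rho> \<inter> B))) (s \<odot>\<^bsub>NK \<rho>\<^esub> z) =
      s \<odot>\<^bsub>Lc (insert l (\<rho> \<inter> B))\<^esub> localization_map S M (ms (insert l (\<rho> \<inter> B))) z"
      by (rule localization_map_smult[OF _ _ _ h(4,5)]) (use h sB in \<open>simp_all add: ms_loc' ms_ins\<close>)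
    then show ?thesis using True by (simp add: rK_def insB)
  next
    case False
    then have lA: "l \<in> A" using notB h by blast
    interpret N: module S "NK \<rho>" by (rule localizing.L_module[OF ll[OF h(2)]])
    show ?thesis using False gsc[OF h(1)] h(4,5)
      by (simp add: rK_def insB(2)[OF lA] R.m_comm flip: N.smult_assoc1)
  qed
  show "rK l \<rho> z \<in> DK n (insert l \<rho>)" if h: "l \<in> X" "\<rho> \<subseteq> X" "l \<notin> \<rho>" "z \<in> DK n \<rho>" for l \<rho> z n
  proof (cases "l \<in> B")
    case True
    have "localization_map S M (ms (insert l (\<rho> \<inter> B))) z \<in> Dc (n - degK \<rho>) (insert l (\<rho> \<inter> B))"
      by (rule localization_map_graded[OF _ _ _ h(4)]) (use h sB in \<open>simp_all add: ms_loc ms_ins\<close>)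
    then show ?thesis using True by (simp add: rK_def insB degK_B)
  next
    case False
    then have lA: "l \<in> A" using notB h by blast
    have "gs ! l \<in> gS 1" using gs_hom[OF h(1)] ys_deg[OF lA] by simp
    then have "gs ! l \<odot>\<^bsub>NK \<rho>\<^esub> z \<in> Dc (n - degK \<rho> + 1) (\<rho> \<inter> B)"
      by (rule graded_localizing.gL_smult[OF gl[OF h(2)] _ h(4)])
    then show ?thesis using False unfolding degK_A[OF lA h(3)] insB(2)[OF lA] by (simp only: rK_def if_False)
  qed
  show "rK l (insert k \<rho>) (rK k \<rho> z) = rK k (insert l \<rho>) (rK l \<rho> z)"
    if h: "l \<in> X" "k \<in> X" "\<rho> \<subseteq> X" "l \<noteq> k" "l \<notin> \<rho>" "k \<notin> \<rho>" "z \<in> carrier (NK \<rho>)" for l k \<rho> z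
  proof -
    let ?\<sigma> = "\<rho> \<inter> B"
    have s: "?\<sigma> \<subseteq> X" using sB h by blast
    interpret N: module S "NK \<rho>" by (rule localizing.L_module[OF ll[OF h(3)]])
    have BA: "localization_map S M (ms (insert l ?\<sigma>)) (gs ! k \<odot>\<^bsub>NK \<rho>\<^esub> z) =
        gs ! k \<odot>\<^bsub>Lc (insert l ?\<sigma>)\<^esub> localization_map S M (ms (insert l ?\<sigma>)) z" if "l \<in> X" "k \<in> X" for l k
      by (rule localization_map_smult[OF _ _ _ _ h(7)]) (use s that gsc in \<open>simp_all add: ms_loc' ms_ins\<close>)
    consider "l \<in> B" "k \<in> B" | "l \<in> B" "k \<notin> B" "k \<in> A" | "l \<notin> B" "l \<in> A" "k \<in> B" | "l \<notin> B" "k \<notin> B" "l \<in> A" "k \<in> A"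
      using notB h by blast
    then show ?thesis
    proof cases
      case 1
      have i: "insert k (insert l ?\<sigma>) = insert l (insert k ?\<sigma>)" by (rule insert_commute)
      have "localization_map S M (ms (insert l (insert k ?\<sigma>))) (localization_map S M (ms (insert k ?\<sigma>)) z)
        = localization_map S M (ms (insert l (insert k ?\<sigma>))) z"
        by (rule localization_map_comp[OF _ _ _ _ _ h(7)]) (use h(1-6) s in \<open>simp_all add: ms_loc' ms_ins ms_ins2\<close>)
      moreover have "localization_map S M (ms (insert l (insert k ?\<sigma>))) (localization_map S M (ms (insert l ?\<sigma>)) z)
        = localization_map S M (ms (insert l (insert k ?\<sigma>))) z"
        by (rule localization_map_comp[OF _ _ _ _ _ h(7)]) (use h(1-6) s in \<open>simp_all add: ms_loc' ms_ins ms_ins2\<close>)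
      ultimately show ?thesis using 1 i by (simp add: rK_def insB)
    next
      case 2
      then show ?thesis using BA[OF h(1,2)] by (simp add: rK_def insB)
    next
      case 3
      then show ?thesis using BA[OF h(2,1)] by (simp add: rK_def insB)
    next
      case 4
      then show ?thesis using gsc h(1,2,7) by (simp add: rK_def insB R.m_comm flip: N.smult_assoc1)
    qed
  qed
  show "gs ! l \<in> gS (\<delta> l)" if "l \<in> X" for l using that by (rule gs_hom)
  show "\<exists>k. \<exists>w\<in>DK (n + of_nat k * \<delta> l) \<rho>. rK l \<rho> w = (gs ! l [^] k) \<odot>\<^bsub>NK (insert l \<rho>)\<^esub> z"
    if h: "l \<in> X" "\<rho> \<subseteq> X" "l \<notin> \<rho>" "z \<in> DK n (insert l \<rho>)" for l \<rho> z n
  proof (cases "l \<in> B")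
    case True
    have "\<exists>k. \<exists>w\<in>Dc (n - degK \<rho> + of_nat k * \<delta> l) (\<rho> \<inter> B).
        localization_map S M (ms (insert l (\<rho> \<inter> B))) w = (gs ! l [^] k) \<odot>\<^bsub>Lc (insert l (\<rho> \<inter> B))\<^esub> z"
      by (rule cech_lift) (use h True sB[OF h(2)] degK_B[OF True, of \<rho>] insB(1)[OF True, of \<rho>] in auto)
    then obtain k w where kw: "w \<in> Dc (n - degK \<rho> + of_nat k * \<delta> l) (\<rho> \<inter> B)"
        "localization_map S M (ms (insert l (\<rho> \<inter> B))) w = (gs ! l [^] k) \<odot>\<^bsub>Lc (insert l (\<rho> \<inter> B))\<^esub> z" by blast
    have e: "n - degK \<rho> + of_nat k * \<delta> l = n + of_nat k * \<delta> l - degK \<rho>" by (simp only: add_diff_eq diff_add_eq)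
    have "w \<in> DK (n + of_nat k * \<delta> l) \<rho>" using kw(1) unfolding e .
    moreover have "rK l \<rho> w = (gs ! l [^] k) \<odot>\<^bsub>NK (insert l \<rho>)\<^esub> z"
      using kw(2) True by (simp add: rK_def insB)
    ultimately show ?thesis by blast
  next
    case False
    then have lA: "l \<in> A" using notB h by blast
    \<comment> \<open>Source and target module coincide, so \<open>z\<close> itself lifts
      \<open>gs ! l\<close> times \<open>z\<close>: the exponent is 1, and the degree matches
      because \<open>\<delta> l = 1\<close>.\<close>
    have "z \<in> Dc (n - degK \<rho> + 1) (\<rho> \<inter> B)" using h(4) unfolding degK_A[OF lA h(3)] insB(2)[OF lA] .
    moreover have e: "n - degK \<rho> + 1 = n + of_nat 1 * \<delta> l - degK \<rho>"
      unfolding ys_deg[OF lA] of_nat_1 mult_1_left by (simp only: add_diff_eq diff_add_eq)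
    ultimately have "z \<in> DK (n + of_nat 1 * \<delta> l) \<rho>" unfolding e by (simp only:)
    moreover have "rK l \<rho> z = (gs ! l [^] (1::nat)) \<odot>\<^bsub>NK (insert l \<rho>)\<^esub> z"
      using False gsc[OF h(1)] by (simp add: rK_def insB(2)[OF lA])
    ultimately show ?thesis by blast
  qed
  show "\<exists>k::nat. (gs ! l [^] k) \<odot>\<^bsub>NK \<rho>\<^esub> z = \<zero>\<^bsub>NK \<rho>\<^esub>"
    if h: "l \<in> X" "\<rho> \<subseteq> X" "l \<notin> \<rho>" "z \<in> DK n \<rho>" "rK l \<rho> z = \<zero>\<^bsub>NK (insert l \<rho>)\<^esub>" for l \<rho> z n
  proof (cases "l \<in> B")
    case True
    show ?thesis
      by (rule cech_tors[OF _ _ h(4)]) (use h True sB[OF h(2)] in \<open>simp_all add: rK_def insB\<close>)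
  next
    case False
    then have lA: "l \<in> A" using notB h by blast
    \<comment> \<open>The kernel of multiplication by \<open>gs ! l\<close> is killed by its first
      power.\<close>
    have "(gs ! l [^] (1::nat)) \<odot>\<^bsub>NK \<rho>\<^esub> z = \<zero>\<^bsub>NK \<rho>\<^esub>"
      using False gsc[OF h(1)] h(5) by (simp add: rK_def insB(2)[OF lA])
    then show ?thesis by blast
  qed
qed

text \<open>
  The unit \<open>u\<close> acts as a combination of the \<open>gs ! l\<close>, so a power of it multiplies every cocycle into
  the coboundaries.
\<close>

lemma cech_exact:
  assumes Y: "Y \<subseteq> X" and t: "\<tau> \<subseteq> X" "Y \<inter> \<tau> = {}" and u: "u \<in> ms \<tau>" "u \<in> gS b"
    and \<beta>: "\<And>l. l \<in> Y \<Longrightarrow> \<beta> l \<in> gS (b - \<delta> l)"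
    and rel: "\<And>x. x \<in> carrier M \<Longrightarrow> u \<odot>\<^bsub>M\<^esub> x = (\<Oplus>\<^bsub>M\<^esub>l\<in>Y. (\<beta> l \<otimes> gs ! l) \<odot>\<^bsub>M\<^esub> x)"
  shows "cech.exact Y \<tau> p n"
proof (rule cech.exactI[OF Y u(2) \<beta>])
  fix \<rho> assume r: "\<rho> \<subseteq> X" "\<rho> - Y = \<tau>"
  interpret graded_localizing S M gS gM "ms \<rho>" by (rule ms_loc[OF r(1)])
  have um: "u \<in> ms \<rho>" using u(1) ms_mono[of \<tau> \<rho>] r by auto
  show "u \<odot>\<^bsub>L\<^esub> z = (\<Oplus>\<^bsub>L\<^esub>l\<in>Y. (\<beta> l \<otimes> gs ! l) \<odot>\<^bsub>L\<^esub> z)" if "z \<in> carrier L" for z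
    by (rule L_rel[OF rel _ _ that]) (use gSc[OF u(2)] gSc[OF \<beta>] gsc subsetD[OF Y] in simp_all)
  show "z = \<zero>\<^bsub>L\<^esub>" if "z \<in> carrier L" "u \<odot>\<^bsub>L\<^esub> z = \<zero>\<^bsub>L\<^esub>" for z by (rule unit_inj[OF um that])
  show "\<exists>z'\<in>Dc n \<rho>. u \<odot>\<^bsub>L\<^esub> z' = z" if "z \<in> Dc (n + b) \<rho>" for n z by (rule unit_surj[OF um u(2) that])
qed

text \<open>Koszul directions invert nothing, but every face over \<open>\<tau>\<close> has a Cech
  part containing \<open>\<tau>\<close>, where \<open>u\<close> is already a unit.\<close>

lemma koszul_exact:
  assumes t: "\<tau> \<subseteq> B" and u: "u \<in> ms \<tau>" "u \<in> gS b"
    and \<beta>: "\<And>l. l \<in> A \<Longrightarrow> \<beta> l \<in> gS (b - \<delta> l)"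
    and rel: "\<And>x. x \<in> carrier M \<Longrightarrow> u \<odot>\<^bsub>M\<^esub> x = (\<Oplus>\<^bsub>M\<^esub>l\<in>A. (\<beta> l \<otimes> gs ! l) \<odot>\<^bsub>M\<^esub> x)"
  shows "kos.exact A \<tau> p n"
proof (rule kos.exactI[OF XAB(3) u(2) \<beta>])
  fix \<rho> assume r: "\<rho> \<subseteq> X" "\<rho> - A = \<tau>"
  interpret graded_localizing S M gS gM "ms (\<rho> \<inter> B)" by (rule gl[OF r(1)])
  have "\<tau> \<subseteq> \<rho> \<inter> B" using r t by auto
  then have um: "u \<in> ms (\<rho> \<inter> B)" using u(1) ms_mono[OF _ sB[OF r(1)], of \<tau>] by auto
  show "u \<odot>\<^bsub>L\<^esub> z = (\<Oplus>\<^bsub>L\<^esub>l\<in>A. (\<beta> l \<otimes> gs ! l) \<odot>\<^bsub>L\<^esub> z)" if "z \<in> carrier L" for z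
    by (rule L_rel[OF rel _ _ that]) (use gSc[OF u(2)] gSc[OF \<beta>] gsc subsetD[OF XAB(3)] in simp_all)
  show "z = \<zero>\<^bsub>L\<^esub>" if "z \<in> carrier L" "u \<odot>\<^bsub>L\<^esub> z = \<zero>\<^bsub>L\<^esub>" for z by (rule unit_inj[OF um that])
  show "\<exists>z'\<in>DK n \<rho>. u \<odot>\<^bsub>L\<^esub> z' = z" if "z \<in> DK (n + b) \<rho>" for n z
  proof -
    have e: "n + b - degK \<rho> = n - degK \<rho> + b" by simp
    show ?thesis by (rule unit_surj[OF um u(2)]) (use that in \<open>simp only: e\<close>)
  qed
qed

lemma mult_set_append: "\<rho> \<subseteq> B \<Longrightarrow> ms \<rho> = mult_set S fs \<rho>"
proof -
  assume r: "\<rho> \<subseteq> B"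
  have "(\<Otimes>i\<in>\<rho>. gs ! i [^] (a i :: nat)) = (\<Otimes>i\<in>\<rho>. fs ! i [^] a i)" for a
  proof (rule R.finprod_cong')
    show "(\<lambda>i. fs ! i [^] a i) \<in> \<rho> \<rightarrow> carrier S"
    proof (rule Pi_I)
      fix i assume "i \<in> \<rho>"
      then have "i \<in> X" "gs ! i = fs ! i" using r XAB(4) by (auto simp: B_def nth_append)
      then show "fs ! i [^] a i \<in> carrier S" using gsc[of i] by simp
    qed
    show "gs ! i [^] a i = fs ! i [^] a i" if "i \<in> \<rho>" for i
      using that r by (auto simp: B_def nth_append)
  qed simp
  then show ?thesis unfolding mult_set_def by simp
qed

end

section \<open>Graded Nakayama lemma\<close>

text \<open>\<open>ys_comb\<close> is the inclusion of the ideal of \<open>y\<close> in that of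
  \<open>f\<close>, in homogeneous form; \<open>ev_red\<close> is the reduction from
  \<open>m0\<close> on. Finite generation of \<open>M\<close> is the closure principle
  \<open>gen_span\<close>, which asks for no explicit sums when it is established and can be applied
  to any set \<open>H\<close> closed under addition.\<close>

locale reduction_data = reduction_setup S M gS gM fs ys \<delta> X A B
  for S :: "('g, 'w) ring_scheme" (structure) and M :: "('g, 'm, 'v) module_scheme" (structure)
    and gS :: "('s::finite \<Rightarrow> int) \<Rightarrow> 'g set" and gM :: "('s \<Rightarrow> int) \<Rightarrow> 'm set"
    and fs ys :: "'g list" and \<delta> :: "nat \<Rightarrow> 's \<Rightarrow> int" and X A B :: "nat set" +
  fixes gen :: "nat \<Rightarrow> 'm" and \<gamma> :: "nat \<Rightarrow> 's \<Rightarrow> int" and rk :: nat and m0 :: "'s \<Rightarrow> int"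
  assumes fs_deg: "i \<in> B \<Longrightarrow> 1 \<le> \<delta> i"
    and ys_comb: "j \<in> A \<Longrightarrow> \<exists>c. (\<forall>i\<in>B. c i \<in> gS (1 - \<delta> i)) \<and> gs ! j = (\<Oplus>i\<in>B. c i \<otimes> gs ! i)"
    and gM_neg: "\<not> 0 \<le> n \<Longrightarrow> gM n \<subseteq> {\<zero>\<^bsub>M\<^esub>}"
    and M_hom: "x \<in> carrier M \<Longrightarrow> \<exists>Q u. finite Q \<and> (\<forall>n\<in>Q. u n \<in> gM n) \<and> x = (\<Oplus>\<^bsub>M\<^esub>n\<in>Q. u n)"
    and gen_hom: "i < rk \<Longrightarrow> gen i \<in> gM (\<gamma> i)"
    and gen_span: "x \<in> gM \<nu> \<Longrightarrow> \<zero>\<^bsub>M\<^esub> \<in> H \<Longrightarrow> (\<And>y z. y \<in> H \<Longrightarrow> z \<in> H \<Longrightarrow> y \<oplus>\<^bsub>M\<^esub> z \<in> H) \<Longrightarrow>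
        (\<And>i s. i < rk \<Longrightarrow> s \<in> gS (\<nu> - \<gamma> i) \<Longrightarrow> s \<odot>\<^bsub>M\<^esub> gen i \<in> H) \<Longrightarrow> x \<in> H"
    and ev_red: "m0 \<le> n \<Longrightarrow> x \<in> gM (n + 1) \<Longrightarrow>
        \<exists>w. (\<forall>i\<in>A. w i \<in> gM n) \<and> x = (\<Oplus>\<^bsub>M\<^esub>i\<in>A. gs ! i \<odot>\<^bsub>M\<^esub> w i)"
begin

definition red_at :: "('s \<Rightarrow> int) \<Rightarrow> bool" where
  "red_at n \<longleftrightarrow> (\<forall>x\<in>gM (n + 1). \<exists>w. (\<forall>i\<in>A. w i \<in> gM n) \<and> x = (\<Oplus>\<^bsub>M\<^esub>i\<in>A. gs ! i \<odot>\<^bsub>M\<^esub> w i))"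

text \<open>Degree \<open>\<nu>\<close> part of the submodule spanned by the first \<open>q\<close>
  generators. Recursion on \<open>q\<close> exposes the coefficient of the last generator, which
  \<open>nakayama_step\<close> eliminates.\<close>

primrec Sp :: "nat \<Rightarrow> ('s \<Rightarrow> int) \<Rightarrow> 'm set" where
  "Sp 0 \<nu> = {\<zero>\<^bsub>M\<^esub>}"
| "Sp (Suc q) \<nu> = {z \<oplus>\<^bsub>M\<^esub> s \<odot>\<^bsub>M\<^esub> gen q | z s. z \<in> Sp q \<nu> \<and> s \<in> gS (\<nu> - \<gamma> q)}"

lemma genc: "i < rk \<Longrightarrow> gen i \<in> carrier M" using gen_hom gMc by blast

lemma Sp_carr: "q \<le> rk \<Longrightarrow> z \<in> Sp q \<nu> \<Longrightarrow> z \<in> carrier M"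
proof (induction q arbitrary: z)
  case (Suc q)
  then obtain z' s where z: "z = z' \<oplus>\<^bsub>M\<^esub> s \<odot>\<^bsub>M\<^esub> gen q" "z' \<in> Sp q \<nu>" "s \<in> gS (\<nu> - \<gamma> q)" by auto
  then show ?case using Suc gSc[OF z(3)] genc[of q] by simp
qed simp

lemma Sp_zero: "q \<le> rk \<Longrightarrow> \<zero>\<^bsub>M\<^esub> \<in> Sp q \<nu>"
proof (induction q)
  case (Suc q)
  have "\<zero>\<^bsub>M\<^esub> = \<zero>\<^bsub>M\<^esub> \<oplus>\<^bsub>M\<^esub> \<zero> \<odot>\<^bsub>M\<^esub> gen q" using genc[of q] Suc.prems by simp
  then show ?case using Suc gS_zero by auto
qed simp

lemma Sp_add: "q \<le> rk \<Longrightarrow> z \<in> Sp q \<nu> \<Longrightarrow> w \<in> Sp q \<nu> \<Longrightarrow> z \<oplus>\<^bsub>M\<^esub> w \<in> Sp q \<nu>"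
proof (induction q arbitrary: z w)
  case (Suc q)
  obtain z' s where z: "z = z' \<oplus>\<^bsub>M\<^esub> s \<odot>\<^bsub>M\<^esub> gen q" "z' \<in> Sp q \<nu>" "s \<in> gS (\<nu> - \<gamma> q)" using Suc.prems by auto
  obtain w' t where w: "w = w' \<oplus>\<^bsub>M\<^esub> t \<odot>\<^bsub>M\<^esub> gen q" "w' \<in> Sp q \<nu>" "t \<in> gS (\<nu> - \<gamma> q)" using Suc.prems by auto
  have c: "z' \<in> carrier M" "w' \<in> carrier M" "s \<in> carrier S" "t \<in> carrier S" "gen q \<in> carrier M"
    using Sp_carr[OF _ z(2)] Sp_carr[OF _ w(2)] gSc[OF z(3)] gSc[OF w(3)] genc[of q] Suc.prems(1) by auto
  have "z \<oplus>\<^bsub>M\<^esub> w = (z' \<oplus>\<^bsub>M\<^esub> w') \<oplus>\<^bsub>M\<^esub> (s \<oplus> t) \<odot>\<^bsub>M\<^esub> gen q"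
    unfolding z w using c by (simp add: smult_l_distr M.a_ac)
  then show ?case using Suc z w gS_add[OF z(3) w(3)] by auto
qed simp

lemma Sp_smult: "q \<le> rk \<Longrightarrow> z \<in> Sp q \<nu> \<Longrightarrow> t \<in> gS b \<Longrightarrow> t \<odot>\<^bsub>M\<^esub> z \<in> Sp q (\<nu> + b)"
proof (induction q arbitrary: z)
  case (Suc q)
  obtain z' s where z: "z = z' \<oplus>\<^bsub>M\<^esub> s \<odot>\<^bsub>M\<^esub> gen q" "z' \<in> Sp q \<nu>" "s \<in> gS (\<nu> - \<gamma> q)" using Suc.prems by auto
  have c: "z' \<in> carrier M" "s \<in> carrier S" "t \<in> carrier S" "gen q \<in> carrier M"
    using Sp_carr[OF _ z(2)] gSc[OF z(3)] gSc[OF Suc.prems(3)] genc[of q] Suc.prems(1) by auto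
  have "t \<odot>\<^bsub>M\<^esub> z = t \<odot>\<^bsub>M\<^esub> z' \<oplus>\<^bsub>M\<^esub> (t \<otimes> s) \<odot>\<^bsub>M\<^esub> gen q"
    unfolding z using c by (simp add: smult_r_distr smult_assoc1)
  moreover have "b + (\<nu> - \<gamma> q) = \<nu> + b - \<gamma> q" by simp
  then have "t \<otimes> s \<in> gS (\<nu> + b - \<gamma> q)" using gS_mult[OF Suc.prems(3) z(3)] by metis
  moreover have "t \<odot>\<^bsub>M\<^esub> z' \<in> Sp q (\<nu> + b)" by (rule Suc.IH[OF _ z(2) Suc.prems(3)]) (use Suc.prems in simp)
  ultimately show ?case unfolding Sp.simps by blast
qed (simp add: gSc)

lemma Sp_finsum: "q \<le> rk \<Longrightarrow> (\<And>i. i \<in> Q \<Longrightarrow> f i \<in> Sp q \<nu>) \<Longrightarrow> (\<Oplus>\<^bsub>M\<^esub>i\<in>Q. f i) \<in> Sp q \<nu>"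
  by (rule M.subgroup_finsum_closed) (use Sp_zero Sp_add Sp_carr in auto)

lemma Sp_mono: "q \<le> q' \<Longrightarrow> q' \<le> rk \<Longrightarrow> z \<in> Sp q \<nu> \<Longrightarrow> z \<in> Sp q' \<nu>"
proof (induction q' rule: dec_induct)
  case (step k)
  then have z: "z \<in> Sp k \<nu>" by simp
  have "z = z \<oplus>\<^bsub>M\<^esub> \<zero> \<odot>\<^bsub>M\<^esub> gen k" using Sp_carr[OF _ z] genc[of k] step.prems by simp
  then show ?case unfolding Sp.simps using z gS_zero by blast
qed simp

lemma Sp_full: assumes x: "x \<in> gM \<nu>" shows "x \<in> Sp rk \<nu>"
proof (rule gen_span[OF x])
  show "\<zero>\<^bsub>M\<^esub> \<in> Sp rk \<nu>" by (rule Sp_zero) simp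
  show "y \<oplus>\<^bsub>M\<^esub> z \<in> Sp rk \<nu>" if "y \<in> Sp rk \<nu>" "z \<in> Sp rk \<nu>" for y z using that by (rule Sp_add[OF order_refl])
  fix i s assume i: "i < rk" and s: "s \<in> gS (\<nu> - \<gamma> i)"
  have "s \<odot>\<^bsub>M\<^esub> gen i = \<zero>\<^bsub>M\<^esub> \<oplus>\<^bsub>M\<^esub> s \<odot>\<^bsub>M\<^esub> gen i" using gSc[OF s] genc[OF i] by simp
  moreover have "\<zero>\<^bsub>M\<^esub> \<in> Sp i \<nu>" using i by (intro Sp_zero) simp
  ultimately have "s \<odot>\<^bsub>M\<^esub> gen i \<in> Sp (Suc i) \<nu>" unfolding Sp.simps using s by blast
  then show "s \<odot>\<^bsub>M\<^esub> gen i \<in> Sp rk \<nu>" using i by (intro Sp_mono[of "Suc i" rk]) simp_all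
qed

text \<open>Degree \<open>\<nu>\<close> part of the ideal of \<open>S\<close> generated by the
  \<open>y\<close>; the coefficients have degree \<open>\<nu> - 1\<close> as each \<open>y\<close>
  has degree 1.\<close>

definition Yb :: "('s \<Rightarrow> int) \<Rightarrow> 'g set" where
  "Yb \<nu> = {(\<Oplus>i\<in>A. b i \<otimes> gs ! i) | b. \<forall>i\<in>A. b i \<in> gS (\<nu> - 1)}"

lemma gsA: "i \<in> A \<Longrightarrow> gs ! i \<in> gS 1" using gs_hom[of i] ys_deg[of i] XAB by auto

lemma gsAc: "i \<in> A \<Longrightarrow> gs ! i \<in> carrier S" using gsA gSc by blast

lemma Yb_gS: "a \<in> Yb \<nu> \<Longrightarrow> a \<in> gS \<nu>"
proof -
  assume "a \<in> Yb \<nu>"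
  then obtain b where b: "a = (\<Oplus>i\<in>A. b i \<otimes> gs ! i)" "\<And>i. i \<in> A \<Longrightarrow> b i \<in> gS (\<nu> - 1)" unfolding Yb_def by blast
  have "b i \<otimes> gs ! i \<in> gS \<nu>" if "i \<in> A" for i
    using gS_mult[OF b(2)[OF that] gsA[OF that]] by simp
  then show ?thesis unfolding b(1) by (rule gS_finsum)
qed

lemma Yb_I: "(\<And>i. i \<in> A \<Longrightarrow> b i \<in> gS (\<nu> - 1)) \<Longrightarrow> (\<Oplus>i\<in>A. b i \<otimes> gs ! i) \<in> Yb \<nu>"
  unfolding Yb_def by blast

lemma Yb_zero: "\<zero> \<in> Yb \<nu>"
proof -
  have "(\<Oplus>i\<in>A. \<zero> \<otimes> gs ! i) = \<zero>" using gsAc by (intro R.add.finprod_one_eqI) simp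
  then show ?thesis using Yb_I[of "\<lambda>i. \<zero>" \<nu>] gS_zero by simp
qed

lemma Yb_add: "a \<in> Yb \<nu> \<Longrightarrow> a' \<in> Yb \<nu> \<Longrightarrow> a \<oplus> a' \<in> Yb \<nu>"
proof -
  assume "a \<in> Yb \<nu>" "a' \<in> Yb \<nu>"
  then obtain b b' where b: "a = (\<Oplus>i\<in>A. b i \<otimes> gs ! i)" "\<And>i. i \<in> A \<Longrightarrow> b i \<in> gS (\<nu> - 1)"
    and b': "a' = (\<Oplus>i\<in>A. b' i \<otimes> gs ! i)" "\<And>i. i \<in> A \<Longrightarrow> b' i \<in> gS (\<nu> - 1)" unfolding Yb_def by blast
  have "a \<oplus> a' = (\<Oplus>i\<in>A. b i \<otimes> gs ! i \<oplus> b' i \<otimes> gs ! i)"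
    unfolding b b' by (rule R.finsum_addf[symmetric]) (use gSc[OF b(2)] gSc[OF b'(2)] gsAc in auto)
  also have "\<dots> = (\<Oplus>i\<in>A. (b i \<oplus> b' i) \<otimes> gs ! i)"
    by (rule R.finsum_cong') (use gSc[OF b(2)] gSc[OF b'(2)] gsAc in \<open>auto simp: R.l_distr\<close>)
  also have "\<dots> \<in> Yb \<nu>" by (rule Yb_I) (use gS_add b b' in auto)
  finally show ?thesis .
qed

lemma Yb_smult: "a \<in> Yb \<nu> \<Longrightarrow> t \<in> gS c \<Longrightarrow> t \<otimes> a \<in> Yb (\<nu> + c)"
proof -
  assume "a \<in> Yb \<nu>" and t: "t \<in> gS c"
  then obtain b where b: "a = (\<Oplus>i\<in>A. b i \<otimes> gs ! i)" "\<And>i. i \<in> A \<Longrightarrow> b i \<in> gS (\<nu> - 1)" unfolding Yb_def by blast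
  have "t \<otimes> a = (\<Oplus>i\<in>A. t \<otimes> (b i \<otimes> gs ! i))"
    unfolding b by (rule R.finsum_rdistr[OF finA]) (use gSc[OF t] gSc[OF b(2)] gsAc in auto)
  also have "\<dots> = (\<Oplus>i\<in>A. (t \<otimes> b i) \<otimes> gs ! i)"
    by (rule R.finsum_cong') (use gSc[OF b(2)] gSc[OF t] gsAc in \<open>auto simp: R.m_assoc\<close>)
  also have "\<dots> \<in> Yb (\<nu> + c)"
  proof (rule Yb_I)
    fix i assume i: "i \<in> A"
    have "c + (\<nu> - 1) = \<nu> + c - 1" by simp
    then show "t \<otimes> b i \<in> gS (\<nu> + c - 1)" using gS_mult[OF t b(2)[OF i]] by metis
  qed
  finally show ?thesis .
qed

text \<open>Every entry of \<open>\<delta> l\<close> is at least 1, so a high power of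
  \<open>gs ! l\<close> moves any degree \<open>\<nu> \<ge> 0\<close> beyond \<open>m0\<close>,
  where the reduction is known. Other degrees are zero in \<open>M\<close>; hence one exponent
  serves for all \<open>\<nu>\<close>.\<close>

lemma gM_power_red:
  assumes l: "l \<in> B"
  shows "\<exists>K. \<forall>\<nu>. \<forall>x\<in>gM \<nu>. \<exists>w. (\<forall>i\<in>A. w i \<in> gM (\<nu> + of_nat K * \<delta> l - 1)) \<and>
    (gs ! l [^] K) \<odot>\<^bsub>M\<^esub> x = (\<Oplus>\<^bsub>M\<^esub>i\<in>A. gs ! i \<odot>\<^bsub>M\<^esub> w i)"
proof -
  \<comment> \<open>The sum dominates every entry of \<open>m0\<close>; the successor pays for the
    one degree consumed by \<open>y\<close>.\<close>
  define K where "K = Suc (\<Sum>s\<in>UNIV. nat (m0 s))"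
  have K: "m0 s \<le> int K - 1" for s
  proof -
    have "nat (m0 s) \<le> (\<Sum>s\<in>UNIV. nat (m0 s))" by (rule member_le_sum) auto
    then show ?thesis unfolding K_def by linarith
  qed
  have lX: "l \<in> X" using l XAB by auto
  have "\<exists>w. (\<forall>i\<in>A. w i \<in> gM (\<nu> + of_nat K * \<delta> l - 1)) \<and>
    (gs ! l [^] K) \<odot>\<^bsub>M\<^esub> x = (\<Oplus>\<^bsub>M\<^esub>i\<in>A. gs ! i \<odot>\<^bsub>M\<^esub> w i)" if x: "x \<in> gM \<nu>" for x \<nu>
  proof (cases "0 \<le> \<nu>")
    case True
    have "m0 \<le> \<nu> + of_nat K * \<delta> l - 1"
    proof (rule le_funI)
      fix s
      have "0 \<le> \<nu> s" "1 \<le> \<delta> l s" using True fs_deg[OF l] by (auto simp: le_fun_def)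
      then have "int K * 1 \<le> int K * \<delta> l s" by (intro mult_left_mono) auto
      then show "m0 s \<le> (\<nu> + of_nat K * \<delta> l - 1) s" using K[of s] \<open>0 \<le> \<nu> s\<close> by simp
    qed
    moreover have "(gs ! l [^] K) \<odot>\<^bsub>M\<^esub> x \<in> gM (\<nu> + of_nat K * \<delta> l - 1 + 1)"
      using gM_smult[OF gS_pow[OF gs_hom[OF lX]] x] by (simp only: diff_add_cancel)
    ultimately show ?thesis by (rule ev_red)
  next
    case False
    then have "x = \<zero>\<^bsub>M\<^esub>" using gM_neg x by blast
    moreover have "(\<Oplus>\<^bsub>M\<^esub>i\<in>A. gs ! i \<odot>\<^bsub>M\<^esub> \<zero>\<^bsub>M\<^esub>) = \<zero>\<^bsub>M\<^esub>"
      using gsAc by (intro M.add.finprod_one_eqI) simp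
    ultimately show ?thesis using gM_zero gsc[OF lX] by (intro exI[of _ "\<lambda>i. \<zero>\<^bsub>M\<^esub>"]) simp
  qed
  then show ?thesis by blast
qed

text \<open>
  Nakayama's lemma in graded form, by eliminating the generators one at a time: the invariant is
  that \<open>(f\<^sup>K - a) M\<close> lies in the span of the first \<open>q\<close> generators for some \<open>a \<in> (y)\<close>.
\<close>

lemma nakayama_step:
  assumes l: "l \<in> B" and q: "Suc q \<le> rk"
    and IH: "a \<in> Yb (of_nat K * \<delta> l)"
      "\<And>\<nu> x. x \<in> gM \<nu> \<Longrightarrow> ((gs ! l [^] K) \<ominus> a) \<odot>\<^bsub>M\<^esub> x \<in> Sp (Suc q) (\<nu> + of_nat K * \<delta> l)"
  shows "\<exists>K a. a \<in> Yb (of_nat K * \<delta> l) \<and>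
     (\<forall>\<nu>. \<forall>x\<in>gM \<nu>. ((gs ! l [^] K) \<ominus> a) \<odot>\<^bsub>M\<^esub> x \<in> Sp q (\<nu> + of_nat K * \<delta> l))"
proof -
  define D where "D = (\<lambda>k::nat. of_nat k * \<delta> l)"
  have D_add: "D (a + b) = D a + D b" for a b unfolding D_def by (simp only: of_nat_add distrib_right)
  have lX: "l \<in> X" using l XAB by auto
  let ?f = "gs ! l"
  have fc: "?f \<in> carrier S" by (rule gsc[OF lX])
  have fg: "?f [^] k \<in> gS (D k)" for k :: nat unfolding D_def by (rule gS_pow[OF gs_hom[OF lX]])
  define \<phi> where "\<phi> = (?f [^] K) \<ominus> a"
  have aY: "a \<in> Yb (D K)" using IH(1) unfolding D_def .
  have \<phi>S: "\<phi> \<in> gS (D K)" unfolding \<phi>_def a_minus_def by (intro gS_add gS_neg fg Yb_gS[OF aY])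
  have \<phi>: "\<phi> \<odot>\<^bsub>M\<^esub> x \<in> Sp (Suc q) (\<nu> + D K)" if "x \<in> gM \<nu>" for \<nu> x
    using IH(2)[OF that] unfolding \<phi>_def D_def .
  obtain K0 where K0: "\<And>\<nu> x. x \<in> gM \<nu> \<Longrightarrow> \<exists>w. (\<forall>i\<in>A. w i \<in> gM (\<nu> + D K0 - 1)) \<and>
    (?f [^] K0) \<odot>\<^bsub>M\<^esub> x = (\<Oplus>\<^bsub>M\<^esub>i\<in>A. gs ! i \<odot>\<^bsub>M\<^esub> w i)"
    using gM_power_red[OF l] unfolding D_def by blast
  let ?g = "gen q"
  have gq: "?g \<in> gM (\<gamma> q)" using gen_hom q by simp
  have gc: "?g \<in> carrier M" by (rule gMc[OF gq])
  \<comment> \<open>The last generator is attacked first: a power of \<open>f\<close> writes it as a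
    combination of the \<open>y\<close> with coefficients \<open>w i\<close> in \<open>M\<close>.
    The invariant then expresses \<open>\<phi>\<close> times \<open>w i\<close> through the first
    \<open>Suc q\<close> generators.\<close>
  obtain w where w: "\<And>i. i \<in> A \<Longrightarrow> w i \<in> gM (\<gamma> q + D K0 - 1)"
    "(?f [^] K0) \<odot>\<^bsub>M\<^esub> ?g = (\<Oplus>\<^bsub>M\<^esub>i\<in>A. gs ! i \<odot>\<^bsub>M\<^esub> w i)" using K0[OF gq] by blast
  have "\<exists>z s. \<phi> \<odot>\<^bsub>M\<^esub> w i = z \<oplus>\<^bsub>M\<^esub> s \<odot>\<^bsub>M\<^esub> ?g \<and> z \<in> Sp q (\<gamma> q + D K0 - 1 + D K) \<and>
      s \<in> gS (\<gamma> q + D K0 - 1 + D K - \<gamma> q)" if "i \<in> A" for i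
    using \<phi>[OF w(1)[OF that]] by auto
  then obtain z s where zs: "\<And>i. i \<in> A \<Longrightarrow> \<phi> \<odot>\<^bsub>M\<^esub> w i = z i \<oplus>\<^bsub>M\<^esub> s i \<odot>\<^bsub>M\<^esub> ?g"
    "\<And>i. i \<in> A \<Longrightarrow> z i \<in> Sp q (\<gamma> q + D K0 - 1 + D K)"
    "\<And>i. i \<in> A \<Longrightarrow> s i \<in> gS (\<gamma> q + D K0 - 1 + D K - \<gamma> q)" by metis
  have q': "q \<le> rk" using q by simp
  have sS: "s i \<in> gS (D (K0 + K) - 1)" if "i \<in> A" for i
  proof -
    have e: "\<gamma> q + D K0 - 1 + D K - \<gamma> q = D (K0 + K) - 1" unfolding D_add by simp
    show ?thesis using zs(3)[OF that] unfolding e .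
  qed
  \<comment> \<open>Collects the coefficients that the last generator receives from itself; they lie
    in the ideal of \<open>y\<close>.\<close>
  define c where "c = (\<Oplus>i\<in>A. s i \<otimes> gs ! i)"
  have cY: "c \<in> Yb (D (K0 + K))" unfolding c_def by (rule Yb_I[OF sS])
  have cS: "c \<in> gS (D (K0 + K))" by (rule Yb_gS[OF cY])
  have car: "\<phi> \<in> carrier S" "c \<in> carrier S" "a \<in> carrier S" using gSc \<phi>S cS Yb_gS[OF aY] by auto
  have zc: "z i \<in> carrier M" "s i \<in> carrier S" "w i \<in> carrier M" if "i \<in> A" for i
    using Sp_carr[OF q' zs(2)] gSc[OF zs(3)] gMc[OF w(1)] that by auto
  \<comment> \<open>The one-row form of the determinant trick: subtracting \<open>c\<close> removes
    the last generator, so \<open>\<psi>\<close> sends it into the span of the first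
    \<open>q\<close>.\<close>
  define \<psi> where "\<psi> = ((?f [^] K0) \<otimes> \<phi>) \<ominus> c"
  have \<psi>S: "\<psi> \<in> gS (D (K0 + K))"
    unfolding \<psi>_def a_minus_def D_add[of K0 K]
    by (intro gS_add gS_neg gS_mult fg \<phi>S) (use cS D_add in simp)
  have \<psi>g: "\<psi> \<odot>\<^bsub>M\<^esub> ?g \<in> Sp q (\<gamma> q + D (K0 + K))"
  proof -
    have "((?f [^] K0) \<otimes> \<phi>) \<odot>\<^bsub>M\<^esub> ?g = \<phi> \<odot>\<^bsub>M\<^esub> (\<Oplus>\<^bsub>M\<^esub>i\<in>A. gs ! i \<odot>\<^bsub>M\<^esub> w i)"
      unfolding w(2)[symmetric] using car fc gc by (simp add: R.m_comm flip: smult_assoc1)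
    also have "\<dots> = (\<Oplus>\<^bsub>M\<^esub>i\<in>A. \<phi> \<odot>\<^bsub>M\<^esub> (gs ! i \<odot>\<^bsub>M\<^esub> w i))"
      by (rule finsum_smult_ldistr[OF finA]) (use car gsAc zc in auto)
    also have "\<dots> = (\<Oplus>\<^bsub>M\<^esub>i\<in>A. gs ! i \<odot>\<^bsub>M\<^esub> z i \<oplus>\<^bsub>M\<^esub> (s i \<otimes> gs ! i) \<odot>\<^bsub>M\<^esub> ?g)"
    proof (rule M.finsum_cong')
      fix i assume i: "i \<in> A"
      have "\<phi> \<odot>\<^bsub>M\<^esub> (gs ! i \<odot>\<^bsub>M\<^esub> w i) = gs ! i \<odot>\<^bsub>M\<^esub> (\<phi> \<odot>\<^bsub>M\<^esub> w i)"
        using car gsAc[OF i] zc[OF i] by (simp add: R.m_comm flip: smult_assoc1)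
      also have "\<dots> = gs ! i \<odot>\<^bsub>M\<^esub> z i \<oplus>\<^bsub>M\<^esub> (s i \<otimes> gs ! i) \<odot>\<^bsub>M\<^esub> ?g"
        unfolding zs(1)[OF i] using gsAc[OF i] zc[OF i] gc
        by (simp add: smult_r_distr R.m_comm flip: smult_assoc1)
      finally show "\<phi> \<odot>\<^bsub>M\<^esub> (gs ! i \<odot>\<^bsub>M\<^esub> w i) = gs ! i \<odot>\<^bsub>M\<^esub> z i \<oplus>\<^bsub>M\<^esub> (s i \<otimes> gs ! i) \<odot>\<^bsub>M\<^esub> ?g" .
    qed (use gsAc zc gc in auto)
    also have "\<dots> = (\<Oplus>\<^bsub>M\<^esub>i\<in>A. gs ! i \<odot>\<^bsub>M\<^esub> z i) \<oplus>\<^bsub>M\<^esub> (\<Oplus>\<^bsub>M\<^esub>i\<in>A. (s i \<otimes> gs ! i) \<odot>\<^bsub>M\<^esub> ?g)"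
      by (rule M.finsum_addf) (use gsAc zc gc in auto)
    also have "(\<Oplus>\<^bsub>M\<^esub>i\<in>A. (s i \<otimes> gs ! i) \<odot>\<^bsub>M\<^esub> ?g) = c \<odot>\<^bsub>M\<^esub> ?g"
      unfolding c_def
    proof (rule additive_map_finsum[symmetric])
      show "additive_map S M (\<lambda>r. r \<odot>\<^bsub>M\<^esub> ?g)" using gc by (simp add: additive_map_def smult_l_distr)
    qed (use R.abelian_group_axioms M.abelian_group_axioms gsAc zc in auto)
    finally have e: "((?f [^] K0) \<otimes> \<phi>) \<odot>\<^bsub>M\<^esub> ?g = (\<Oplus>\<^bsub>M\<^esub>i\<in>A. gs ! i \<odot>\<^bsub>M\<^esub> z i) \<oplus>\<^bsub>M\<^esub> c \<odot>\<^bsub>M\<^esub> ?g" .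
    have "(\<Oplus>\<^bsub>M\<^esub>i\<in>A. gs ! i \<odot>\<^bsub>M\<^esub> z i) \<in> Sp q (\<gamma> q + D (K0 + K))"
    proof (rule Sp_finsum[OF q'])
      fix i assume i: "i \<in> A"
      have "\<gamma> q + D K0 - 1 + D K + 1 = \<gamma> q + D (K0 + K)" unfolding D_add by simp
      then show "gs ! i \<odot>\<^bsub>M\<^esub> z i \<in> Sp q (\<gamma> q + D (K0 + K))"
        using Sp_smult[OF q' zs(2)[OF i] gsA[OF i]] by metis
    qed
    moreover have "\<psi> \<odot>\<^bsub>M\<^esub> ?g = (\<Oplus>\<^bsub>M\<^esub>i\<in>A. gs ! i \<odot>\<^bsub>M\<^esub> z i)"
    proof -
      have sc: "(\<Oplus>\<^bsub>M\<^esub>i\<in>A. gs ! i \<odot>\<^bsub>M\<^esub> z i) \<in> carrier M" using gsAc zc by (intro M.finsum_closed) auto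
      have "\<psi> \<odot>\<^bsub>M\<^esub> ?g = ((?f [^] K0) \<otimes> \<phi>) \<odot>\<^bsub>M\<^esub> ?g \<oplus>\<^bsub>M\<^esub> \<ominus>\<^bsub>M\<^esub> (c \<odot>\<^bsub>M\<^esub> ?g)"
        unfolding \<psi>_def a_minus_def using car fc gc by (simp add: smult_l_distr smult_l_minus)
      then show ?thesis unfolding e using sc car gc by (simp add: M.a_assoc M.r_neg)
    qed
    ultimately show ?thesis by simp
  qed
  \<comment> \<open>\<open>\<psi>\<close> has the degree of \<open>f\<close> to the power
    \<open>K0 + K\<close>, and \<open>\<phi>\<close> adds another \<open>K\<close>.\<close>
  define K' where "K' = K0 + K + K"
  define a' where "a' = ((?f [^] (K0 + K)) \<otimes> a) \<oplus> (\<phi> \<otimes> c)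
     \<oplus> (?f [^] K) \<otimes> ((?f [^] K0) \<otimes> a) \<ominus> a \<otimes> ((?f [^] K0) \<otimes> a)"
  \<comment> \<open>The remainder of \<open>f\<close> to the power \<open>K'\<close> modulo
    \<open>\<psi> \<otimes> \<phi>\<close>: write \<open>?f [^] K\<close> as
    \<open>\<phi> \<oplus> a\<close> twice and \<open>?f [^] K0 \<otimes> \<phi>\<close> as
    \<open>\<psi> \<oplus> c\<close>. Every term contains \<open>a\<close> or
    \<open>c\<close>.\<close>
  define a2 where "a2 = (?f [^] K0 \<otimes> (?f [^] K)) \<otimes> a \<oplus> (?f [^] K0 \<otimes> \<phi>) \<otimes> a \<oplus> \<phi> \<otimes> c"
  have a2e: "(?f [^] K') \<ominus> a2 = \<psi> \<otimes> \<phi>"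
  proof -
    let ?u = "?f [^] K0" and ?v = "?f [^] K"
    have fK: "?f [^] K' = ?u \<otimes> ?v \<otimes> ?v" unfolding K'_def using fc by (simp add: R.nat_pow_mult)
    have uv: "?u \<in> carrier S" "?v \<in> carrier S" using fc by auto
    have v: "?v = \<phi> \<oplus> a" unfolding \<phi>_def using uv car by (simp add: a_minus_def R.a_assoc R.l_neg)
    have "?u \<otimes> ?v \<otimes> ?v = ?u \<otimes> ?v \<otimes> a \<oplus> ?u \<otimes> ?v \<otimes> \<phi>"
      by (subst (2) v) (use uv car in \<open>simp add: R.r_distr R.a_comm\<close>)
    also have "?u \<otimes> ?v \<otimes> \<phi> = ?u \<otimes> \<phi> \<otimes> a \<oplus> ?u \<otimes> \<phi> \<otimes> \<phi>"
      by (subst v) (use uv car in \<open>simp add: R.r_distr R.l_distr R.m_ac R.a_comm\<close>)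
    also have "?u \<otimes> \<phi> \<otimes> \<phi> = \<psi> \<otimes> \<phi> \<oplus> \<phi> \<otimes> c"
      unfolding \<psi>_def using uv car
      by (simp add: a_minus_def R.l_distr R.l_minus R.m_comm[of c \<phi>] R.a_assoc R.l_neg)
    finally have e: "?f [^] K' = ?u \<otimes> ?v \<otimes> a \<oplus> (?u \<otimes> \<phi> \<otimes> a \<oplus> (\<psi> \<otimes> \<phi> \<oplus> \<phi> \<otimes> c))" unfolding fK .
    have pc: "\<psi> \<in> carrier S" by (rule gSc[OF \<psi>S])
    have "?f [^] K' = \<psi> \<otimes> \<phi> \<oplus> a2" unfolding e a2_def using uv car pc by (simp add: R.a_ac)
    moreover have "a2 \<in> carrier S" unfolding a2_def using uv car by simp
    ultimately show ?thesis using pc car by (simp add: a_minus_def R.a_assoc R.r_neg)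
  qed
  have a2Y: "a2 \<in> Yb (D K')"
  proof -
    have e1: "D K' = D K + (D K0 + D K)" and e3: "D K' = D (K0 + K) + D K"
      unfolding K'_def D_add by (simp_all only: add.assoc add.left_commute)
    have "(?f [^] K0 \<otimes> (?f [^] K)) \<otimes> a \<in> Yb (D K')" unfolding e1 by (rule Yb_smult[OF aY gS_mult[OF fg fg]])
    moreover have "(?f [^] K0 \<otimes> \<phi>) \<otimes> a \<in> Yb (D K')" unfolding e1 by (rule Yb_smult[OF aY gS_mult[OF fg \<phi>S]])
    moreover have "\<phi> \<otimes> c \<in> Yb (D K')" unfolding e3 by (rule Yb_smult[OF cY \<phi>S])
    ultimately show ?thesis unfolding a2_def by (intro Yb_add)
  qed
  \<comment> \<open>First \<open>\<phi>\<close> moves \<open>x\<close> into the span of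
    \<open>Suc q\<close> generators, then \<open>\<psi>\<close> moves the last of these into the
    span of the others.\<close>
  have "(\<psi> \<otimes> \<phi>) \<odot>\<^bsub>M\<^esub> x \<in> Sp q (\<nu> + D K')" if x: "x \<in> gM \<nu>" for x \<nu>
  proof -
    obtain z' s' where z': "\<phi> \<odot>\<^bsub>M\<^esub> x = z' \<oplus>\<^bsub>M\<^esub> s' \<odot>\<^bsub>M\<^esub> ?g" "z' \<in> Sp q (\<nu> + D K)" "s' \<in> gS (\<nu> + D K - \<gamma> q)"
      using \<phi>[OF x] by auto
    have c': "z' \<in> carrier M" "s' \<in> carrier S" "x \<in> carrier M" "\<psi> \<in> carrier S"
      using Sp_carr[OF q' z'(2)] gSc[OF z'(3)] gMc[OF x] gSc[OF \<psi>S] by auto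
    have "(\<psi> \<otimes> \<phi>) \<odot>\<^bsub>M\<^esub> x = \<psi> \<odot>\<^bsub>M\<^esub> z' \<oplus>\<^bsub>M\<^esub> s' \<odot>\<^bsub>M\<^esub> (\<psi> \<odot>\<^bsub>M\<^esub> ?g)"
    proof -
      have "(\<psi> \<otimes> \<phi>) \<odot>\<^bsub>M\<^esub> x = \<psi> \<odot>\<^bsub>M\<^esub> (z' \<oplus>\<^bsub>M\<^esub> s' \<odot>\<^bsub>M\<^esub> ?g)"
        unfolding z'(1)[symmetric] using c' car by (intro smult_assoc1)
      also have "\<dots> = \<psi> \<odot>\<^bsub>M\<^esub> z' \<oplus>\<^bsub>M\<^esub> \<psi> \<odot>\<^bsub>M\<^esub> (s' \<odot>\<^bsub>M\<^esub> ?g)"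
        using c' gc by (intro smult_r_distr) auto
      also have "\<psi> \<odot>\<^bsub>M\<^esub> (s' \<odot>\<^bsub>M\<^esub> ?g) = s' \<odot>\<^bsub>M\<^esub> (\<psi> \<odot>\<^bsub>M\<^esub> ?g)"
        using c' gc by (simp add: R.m_comm flip: smult_assoc1)
      finally show ?thesis .
    qed
    moreover have "\<psi> \<odot>\<^bsub>M\<^esub> z' \<in> Sp q (\<nu> + D K')"
    proof -
      have "\<nu> + D K + D (K0 + K) = \<nu> + D K'" unfolding K'_def D_add by simp
      then show ?thesis using Sp_smult[OF q' z'(2) \<psi>S] by metis
    qed
    moreover have "s' \<odot>\<^bsub>M\<^esub> (\<psi> \<odot>\<^bsub>M\<^esub> ?g) \<in> Sp q (\<nu> + D K')"
    proof -
      have "\<gamma> q + D (K0 + K) + (\<nu> + D K - \<gamma> q) = \<nu> + D K'" unfolding K'_def D_add by simp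
      then show ?thesis using Sp_smult[OF q' \<psi>g z'(3)] by metis
    qed
    ultimately show ?thesis using Sp_add[OF q'] by simp
  qed
  then show ?thesis using a2Y unfolding a2e[symmetric] D_def by blast
qed

text \<open>Starting from \<open>f^0 - 0 = 1\<close>, which maps into the span of all generators,
  \<open>nakayama_step\<close> is repeated until no generator is left. Then \<open>f^K - a\<close>
  annihilates every homogeneous element, hence \<open>M\<close>, for some \<open>a\<close> in the
  ideal of \<open>y\<close>.\<close>

lemma power_comb:
  assumes l: "l \<in> B"
  shows "\<exists>K \<beta>. (\<forall>i\<in>A. \<beta> i \<in> gS (of_nat K * \<delta> l - 1)) \<and>
    (\<forall>x\<in>carrier M. (gs ! l [^] K) \<odot>\<^bsub>M\<^esub> x = (\<Oplus>\<^bsub>M\<^esub>i\<in>A. (\<beta> i \<otimes> gs ! i) \<odot>\<^bsub>M\<^esub> x))"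
proof -
  have lX: "l \<in> X" using l XAB by auto
  have fc: "gs ! l \<in> carrier S" by (rule gsc[OF lX])
  have "\<exists>K a. a \<in> Yb (of_nat K * \<delta> l) \<and>
     (\<forall>\<nu>. \<forall>x\<in>gM \<nu>. ((gs ! l [^] K) \<ominus> a) \<odot>\<^bsub>M\<^esub> x \<in> Sp (rk - j) (\<nu> + of_nat K * \<delta> l))" if "j \<le> rk" for j
    using that
  proof (induction j)
    case 0
    have "((gs ! l [^] (0::nat)) \<ominus> \<zero>) \<odot>\<^bsub>M\<^esub> x \<in> Sp rk (\<nu> + of_nat 0 * \<delta> l)" if "x \<in> gM \<nu>" for x \<nu>
      using Sp_full[OF that] gMc[OF that] by (simp add: a_minus_def)
    moreover have "\<zero> \<in> Yb (of_nat 0 * \<delta> l)" by (rule Yb_zero)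
    ultimately show ?case unfolding diff_zero by blast
  next
    case (Suc j)
    have j: "j \<le> rk" using Suc.prems by simp
    obtain K a where Ka: "a \<in> Yb (of_nat K * \<delta> l)"
     "\<And>\<nu> x. x \<in> gM \<nu> \<Longrightarrow> ((gs ! l [^] K) \<ominus> a) \<odot>\<^bsub>M\<^esub> x \<in> Sp (rk - j) (\<nu> + of_nat K * \<delta> l)"
      using Suc.IH[OF j] by blast
    have e: "rk - j = Suc (rk - Suc j)" using Suc.prems by simp
    show ?case by (rule nakayama_step[OF l _ Ka(1) Ka(2)[unfolded e]]) (use Suc.prems in auto)
  qed
  from this[OF order_refl] obtain K a where Ka: "a \<in> Yb (of_nat K * \<delta> l)"
     "\<And>\<nu> x. x \<in> gM \<nu> \<Longrightarrow> ((gs ! l [^] K) \<ominus> a) \<odot>\<^bsub>M\<^esub> x = \<zero>\<^bsub>M\<^esub>"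
    unfolding diff_self_eq_0 Sp.simps(1) singleton_iff by blast
  obtain \<beta> where \<beta>: "a = (\<Oplus>i\<in>A. \<beta> i \<otimes> gs ! i)" "\<And>i. i \<in> A \<Longrightarrow> \<beta> i \<in> gS (of_nat K * \<delta> l - 1)"
    using Ka(1) unfolding Yb_def by blast
  have ac: "a \<in> carrier S" by (rule gSc[OF Yb_gS[OF Ka(1)]])
  have "(gs ! l [^] K) \<odot>\<^bsub>M\<^esub> x = (\<Oplus>\<^bsub>M\<^esub>i\<in>A. (\<beta> i \<otimes> gs ! i) \<odot>\<^bsub>M\<^esub> x)" if x: "x \<in> carrier M" for x
  proof -
    obtain Q u where Q: "finite Q" "\<And>n. n \<in> Q \<Longrightarrow> u n \<in> gM n" "x = (\<Oplus>\<^bsub>M\<^esub>n\<in>Q. u n)" using M_hom[OF x] by blast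
    have h: "((gs ! l [^] K) \<ominus> a) \<in> carrier S" using fc ac by simp
    have "((gs ! l [^] K) \<ominus> a) \<odot>\<^bsub>M\<^esub> x = (\<Oplus>\<^bsub>M\<^esub>n\<in>Q. ((gs ! l [^] K) \<ominus> a) \<odot>\<^bsub>M\<^esub> u n)"
      unfolding Q(3) by (rule finsum_smult_ldistr[OF Q(1) h]) (use gMc[OF Q(2)] in auto)
    also have "\<dots> = \<zero>\<^bsub>M\<^esub>" by (rule M.add.finprod_one_eqI) (rule Ka(2)[OF Q(2)])
    finally have "(gs ! l [^] K) \<odot>\<^bsub>M\<^esub> x \<ominus>\<^bsub>M\<^esub> a \<odot>\<^bsub>M\<^esub> x = \<zero>\<^bsub>M\<^esub>"
      using fc ac x by (simp add: a_minus_def smult_l_distr smult_l_minus)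
    then have "(gs ! l [^] K) \<odot>\<^bsub>M\<^esub> x = a \<odot>\<^bsub>M\<^esub> x"
      by (rule M.minus_eq_zeroD) (use fc ac x in auto)
    also have "\<dots> = (\<Oplus>\<^bsub>M\<^esub>i\<in>A. (\<beta> i \<otimes> gs ! i) \<odot>\<^bsub>M\<^esub> x)"
      unfolding \<beta>(1)
    proof (rule additive_map_finsum)
      show "additive_map S M (\<lambda>r. r \<odot>\<^bsub>M\<^esub> x)" using x by (simp add: additive_map_def smult_l_distr)
    qed (use R.abelian_group_axioms M.abelian_group_axioms gsAc gSc[OF \<beta>(2)] in auto)
    finally show ?thesis .
  qed
  then show ?thesis using \<beta>(2) by blast
qed

end

section \<open>Reduction and vanishing of local cohomology\<close>

lemma of_nat_fun_nonneg: "0 \<le> (of_nat n :: 's \<Rightarrow> int)"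
  by (simp add: le_fun_def)

context cube
begin

lemma CC_big:
  assumes "finite Y" "int (card Y) < p" and c: "c \<in> CC Y \<tau> p n"
  shows "c = \<zero>\<^bsub>TC\<^esub>"
proof (rule TC_eqI[OF CC_carr[OF c]])
  fix \<rho> assume r: "\<rho> \<subseteq> X"
  have "card (\<rho> \<inter> Y) \<le> card Y" using assms(1) by (intro card_mono) auto
  then have "c \<rho> = \<zero>\<^bsub>N \<rho>\<^esub>" using Dz_off[OF CC_Dz[OF c r]] assms(2) by auto
  then show "c \<rho> = \<zero>\<^bsub>TC\<^esub> \<rho>" using r by (simp add: TC_ev_simps(1))
qed simp

lemma exact_big: "finite Y \<Longrightarrow> int (card Y) < p \<Longrightarrow> exact Y \<tau> p n"
  unfolding exact_def using CC_big CC_zero d_zero by metis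

end

context reduction_data
begin

abbreviation vanishes :: "nat \<Rightarrow> ('s \<Rightarrow> int) \<Rightarrow> bool" where
  "vanishes i n \<equiv> (let H = cech_cohomology S gS M gM fs i n in carrier H = {\<one>\<^bsub>H\<^esub>})"

text \<open>Over a nonempty face of \<open>y\<close> directions some \<open>y\<close> is inverted;
  it is a combination of the \<open>f\<close>, so the \<open>f\<close> generate the unit ideal
  there.\<close>

lemma exact_f: assumes t: "\<tau> \<subseteq> A" "\<tau> \<noteq> {}" shows "cech.exact B \<tau> p n"
proof -
  obtain j where j: "j \<in> \<tau>" using t by blast
  have jA: "j \<in> A" "j \<in> X" using j t XAB by auto
  obtain c where c: "\<And>i. i \<in> B \<Longrightarrow> c i \<in> gS (1 - \<delta> i)" "gs ! j = (\<Oplus>i\<in>B. c i \<otimes> gs ! i)"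
    using ys_comb[OF jA(1)] by blast
  have tX: "\<tau> \<subseteq> X" using t XAB by auto
  show ?thesis
  proof (rule cech_exact[where u = "gs ! j" and b = 1 and \<beta> = c])
    show "gs ! j \<in> ms \<tau>" using ms_gs[OF tX j, of 1] gsc[OF jA(2)] by simp
    show "gs ! j \<in> gS 1" by (rule gsA[OF jA(1)])
    fix x assume x: "x \<in> carrier M"
    have m: "additive_map S M (\<lambda>r. r \<odot>\<^bsub>M\<^esub> x)" using x by (simp add: additive_map_def smult_l_distr)
    have g: "(\<lambda>i. c i \<otimes> gs ! i) \<in> B \<rightarrow> carrier S" using gSc[OF c(1)] gsc subsetD[OF XAB(4)] by simp
    show "gs ! j \<odot>\<^bsub>M\<^esub> x = (\<Oplus>\<^bsub>M\<^esub>l\<in>B. (c l \<otimes> gs ! l) \<odot>\<^bsub>M\<^esub> x)"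
      unfolding c(2) by (rule additive_map_finsum[OF R.abelian_group_axioms M.abelian_group_axioms m g])
  qed (use t tX XAB c(1) in auto)
qed

lemma power_comb_ms:
  assumes "\<sigma> \<subseteq> B" "\<sigma> \<noteq> {}"
  obtains u b \<beta> where "u \<in> ms \<sigma>" "u \<in> gS b" "\<And>i. i \<in> A \<Longrightarrow> \<beta> i \<in> gS (b - \<delta> i)"
    "\<And>x. x \<in> carrier M \<Longrightarrow> u \<odot>\<^bsub>M\<^esub> x = (\<Oplus>\<^bsub>M\<^esub>i\<in>A. (\<beta> i \<otimes> gs ! i) \<odot>\<^bsub>M\<^esub> x)"
proof -
  obtain l where l: "l \<in> \<sigma>" using assms by blast
  have lB: "l \<in> B" "l \<in> X" "\<sigma> \<subseteq> X" using l assms XAB by auto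
  obtain K \<beta> where K: "\<And>i. i \<in> A \<Longrightarrow> \<beta> i \<in> gS (of_nat K * \<delta> l - 1)"
    "\<And>x. x \<in> carrier M \<Longrightarrow> (gs ! l [^] K) \<odot>\<^bsub>M\<^esub> x = (\<Oplus>\<^bsub>M\<^esub>i\<in>A. (\<beta> i \<otimes> gs ! i) \<odot>\<^bsub>M\<^esub> x)"
    using power_comb[OF lB(1)] by blast
  have "\<beta> i \<in> gS (of_nat K * \<delta> l - \<delta> i)" if "i \<in> A" for i using K(1)[OF that] ys_deg[OF that] by simp
  then show thesis using that[OF ms_gs[OF lB(3) l] gS_pow[OF gs_hom[OF lB(2)]] _ K(2)] by blast
qed

text \<open>The converse direction: once some \<open>f\<close> is inverted, a power of it acts on
  \<open>M\<close> as an element of the ideal of \<open>y\<close>. The relation is available on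
  \<open>M\<close> only, not in \<open>S\<close>, and this suffices as all terms are localisations
  of \<open>M\<close>.\<close>

lemma exact_y: assumes t: "\<sigma> \<subseteq> B" "\<sigma> \<noteq> {}" shows "cech.exact A \<sigma> p n"
proof (rule power_comb_ms[OF t])
  fix u b \<beta>
  assume u: "u \<in> ms \<sigma>" "u \<in> gS b" "\<And>i. i \<in> A \<Longrightarrow> \<beta> i \<in> gS (b - \<delta> i)"
    "\<And>x. x \<in> carrier M \<Longrightarrow> u \<odot>\<^bsub>M\<^esub> x = (\<Oplus>\<^bsub>M\<^esub>i\<in>A. (\<beta> i \<otimes> gs ! i) \<odot>\<^bsub>M\<^esub> x)"
  show ?thesis by (rule cech_exact[OF XAB(3) _ _ u]) (use t XAB in auto)
qed

lemma exact_k: assumes t: "\<tau> \<subseteq> B" "\<tau> \<noteq> {}" shows "kos.exact A \<tau> p n"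
proof (rule power_comb_ms[OF t])
  fix u b \<beta>
  assume u: "u \<in> ms \<tau>" "u \<in> gS b" "\<And>i. i \<in> A \<Longrightarrow> \<beta> i \<in> gS (b - \<delta> i)"
    "\<And>x. x \<in> carrier M \<Longrightarrow> u \<odot>\<^bsub>M\<^esub> x = (\<Oplus>\<^bsub>M\<^esub>i\<in>A. (\<beta> i \<otimes> gs ! i) \<odot>\<^bsub>M\<^esub> x)"
  show ?thesis by (rule koszul_exact[OF t(1) u])
qed

lemma vanishes_cech: "vanishes i n \<longleftrightarrow> cech.exact B {} (int i) n"
proof -
  have "cech_face S gS X (\<lambda>\<rho>. Lc \<rho>) (\<lambda>n \<rho>. Dc n \<rho>) (\<lambda>l \<rho>. localization_map S M (ms (insert l \<rho>)))
     (\<lambda>l. gs ! l) \<delta> M gM fs {} n n"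
  proof (intro cech_face.intro cech_face_axioms.intro cech.cube_axioms)
    show "{..<length fs} \<subseteq> X" using XAB(4) unfolding B_def .
  next
    fix \<sigma> assume "\<sigma> \<subseteq> {..<length fs}"
    then have s: "\<sigma> \<subseteq> B" unfolding B_def .
    show "Lc (\<sigma> \<union> {}) = localization S M (mult_set S fs \<sigma>)" using mult_set_append[OF s] by simp
    show "Dc n (\<sigma> \<union> {}) = localization_component S gS M gM (mult_set S fs \<sigma>) n" using mult_set_append[OF s] by simp
    fix j assume "j \<in> {..<length fs}"
    then have "insert j \<sigma> \<subseteq> B" using s unfolding B_def by simp
    then show "localization_map S M (ms (insert j (\<sigma> \<union> {}))) = localization_map S M (mult_set S fs (insert j \<sigma>))"
      using mult_set_append by simp
  qed auto
  then show ?thesis unfolding B_def by (rule cech_face.vanish_iff)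
qed

text \<open>Over a fixed Koszul face \<open>\<sigma>\<close> the cube is the Cech complex of
  \<open>M\<close> itself, moved by the degree shift that \<open>degK\<close> assigns to
  \<open>\<sigma>\<close>.\<close>

lemma vanishes_koszul:
  assumes s: "\<sigma> \<subseteq> A"
  shows "vanishes i (n - of_nat (length ys - card \<sigma>)) \<longleftrightarrow> kos.exact B \<sigma> (int i) n"
proof -
  have "cech_face S gS X (\<lambda>\<rho>. NK \<rho>) (\<lambda>n \<rho>. DK n \<rho>) rK (\<lambda>l. gs ! l) \<delta> M gM fs \<sigma> n (n - of_nat (length ys - card \<sigma>))"
  proof (intro cech_face.intro cech_face_axioms.intro kos.cube_axioms)
    show "{..<length fs} \<subseteq> X" using XAB(4) unfolding B_def .
    show "\<sigma> \<subseteq> X" using s XAB by auto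
    show "length fs \<le> k" if "k \<in> \<sigma>" for k using that s unfolding A_def by auto
  next
    fix \<rho> assume "\<rho> \<subseteq> {..<length fs}"
    then have r: "\<rho> \<subseteq> B" unfolding B_def .
    have e: "(\<rho> \<union> \<sigma>) \<inter> B = \<rho>" "(\<rho> \<union> \<sigma>) \<inter> A = \<sigma>" using r s XAB by auto
    show "NK (\<rho> \<union> \<sigma>) = localization S M (mult_set S fs \<rho>)" using mult_set_append[OF r] e by simp
    show "DK n (\<rho> \<union> \<sigma>) = localization_component S gS M gM (mult_set S fs \<rho>) (n - of_nat (length ys - card \<sigma>))"
      unfolding e(1) degK_def e(2) mult_set_append[OF r] ..
    fix j assume "j \<in> {..<length fs}"
    then have j: "insert j \<rho> \<subseteq> B" "j \<in> B" using r unfolding B_def by auto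
    then show "rK j (\<rho> \<union> \<sigma>) = localization_map S M (mult_set S fs (insert j \<rho>))"
      using mult_set_append[OF j(1)] e by (simp add: rK_def)
  qed
  then show ?thesis unfolding B_def by (rule cech_face.vanish_iff)
qed

lemma mono_empty: "mono {} a = \<one>" by (simp add: mono_def)

text \<open>An element \<open>x\<close> of degree \<open>\<nu>\<close>, placed at the last Koszul
  face \<open>A\<close>, is a cocycle because nothing follows it. Exactness there makes it a
  differential, whose terms are the \<open>gs ! l\<close> times elements of degree
  \<open>\<nu> - 1\<close>.\<close>

theorem red_of_vanishing:
  assumes van: "\<And>i. i \<le> length ys \<Longrightarrow> vanishes i (\<nu> - of_nat i)" and x: "x \<in> gM \<nu>"
  shows "\<exists>w. (\<forall>i\<in>A. w i \<in> gM (\<nu> - 1)) \<and> x = (\<Oplus>\<^bsub>M\<^esub>i\<in>A. gs ! i \<odot>\<^bsub>M\<^esub> w i)"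
proof -
  let ?d = "length ys"
  have ex: "kos.exact A {} (int ?d) \<nu>"
  proof (rule kos.exact_transfer[OF XAB(1,2)])
    show "kos.exact A \<tau> (int ?d + 1 - int (card \<tau>)) \<nu>" if "\<tau> \<subseteq> B" "\<tau> \<noteq> {}" for \<tau> using that by (rule exact_k)
    fix \<sigma> assume s: "\<sigma> \<subseteq> A"
    have c: "card \<sigma> \<le> ?d" using card_mono[OF finA s] cardA by simp
    \<comment> \<open>The staircase meets the Koszul face \<open>\<sigma>\<close> at Cech place
      \<open>?d - card \<sigma>\<close>, and the degree shift there is the same number: cohomology
      of index \<open>i\<close> is asked for exactly in degree \<open>\<nu> - i\<close>.\<close>
    have "vanishes (?d - card \<sigma>) (\<nu> - of_nat (?d - card \<sigma>))" by (rule van) simp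
    then have "kos.exact B \<sigma> (int (?d - card \<sigma>)) \<nu>" using vanishes_koszul[OF s] by blast
    then show "kos.exact B \<sigma> (int ?d - int (card \<sigma>)) \<nu>" using c by (simp add: of_nat_diff)
  qed simp
  interpret L: graded_localizing S M gS gM "ms {}" by (rule ms_loc) simp
  \<comment> \<open>At the empty Cech face nothing is inverted, so fractions over
    \<open>\<one>\<close> are the same as elements of \<open>M\<close>.\<close>
  have ms1: "t = \<one>" if "t \<in> ms {}" for t using that by (elim ms_E) (simp add: mono_empty)
  have AB0: "A \<inter> B = {}" by (rule XAB(2))
  \<comment> \<open>The shift is normalised to vanish at the last Koszul place, where
    \<open>x\<close> has its own degree.\<close>
  have dA: "degK A = 0" unfolding degK_def using cardA by simp
  have xc: "x \<in> carrier M" by (rule gMc[OF x])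
  define c where "c = (\<lambda>\<rho>\<in>Pow X. if \<rho> = A then L.frac x \<one> else \<zero>\<^bsub>NK \<rho>\<^esub>)"
  have cA: "c A = L.frac x \<one>" using XAB(3) by (simp add: c_def)
  have xD: "L.frac x \<one> \<in> DK \<nu> A"
    unfolding AB0 dA diff_zero by (rule L.gL_I[OF L.T_one gS_one]) (use x in simp)
  have cDz: "c \<rho> \<in> kos.Dz A {} (int ?d) \<nu> \<rho>" if r: "\<rho> \<subseteq> X" for \<rho>
  proof (cases "\<rho> = A")
    case True
    then have "\<rho> - A = {} \<and> int (card (\<rho> \<inter> A)) = int ?d" using cardA by simp
    then have "kos.Dz A {} (int ?d) \<nu> \<rho> = DK \<nu> A" unfolding kos.Dz_def using True by (simp only: if_True simp_thms)
    then show ?thesis using xD cA True by simp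
  next
    case False
    then have "c \<rho> = \<zero>\<^bsub>NK \<rho>\<^esub>" using r unfolding c_def by auto
    then show ?thesis using kos.Dz_zero[OF r] by simp
  qed
  have cT: "c \<in> carrier kos.TC"
    unfolding kos.TC_simps
  proof (rule PiE_I)
    fix \<rho> assume "\<rho> \<in> Pow X"
    then show "c \<rho> \<in> carrier (NK \<rho>)" using kos.D_carr[OF _ kos.Dz_D[OF _ cDz]] by simp
  qed (simp add: c_def)
  have c: "c \<in> kos.CC A {} (int ?d) \<nu>" using cT cDz by (simp add: kos.CC_def)
  have "kos.d A c = \<zero>\<^bsub>kos.TC\<^esub>" by (rule kos.CC_big[OF finA _ kos.CC_d[OF c]]) (simp add: cardA)
  then obtain h where h: "h \<in> kos.CC A {} (int ?d - 1) \<nu>" "c = kos.d A h"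
    using ex c unfolding kos.exact_def by blast
  have "\<exists>v. v \<in> gM (\<nu> - 1) \<and> h (A - {l}) = L.frac v \<one>" if l: "l \<in> A" for l
  proof -
    have sX: "A - {l} \<subseteq> X" using XAB(3) by auto
    have d1: "degK (A - {l}) = 1"
    proof -
      have e: "(A - {l}) \<inter> A = A - {l}" by auto
      have "card (A - {l}) = ?d - 1" using l finA cardA by simp
      moreover have "A \<noteq> {}" using l by auto
      then have "?d > 0" unfolding cardA[symmetric] by (simp only: card_gt_0_iff finA simp_thms)
      ultimately have "?d - card ((A - {l}) \<inter> A) = 1" unfolding e by linarith
      then show ?thesis unfolding degK_def by (simp only: of_nat_1)
    qed
    have eB: "(A - {l}) \<inter> B = {}" using AB0 by auto
    have "h (A - {l}) \<in> Dc (\<nu> - 1) {}" using kos.CC_D[OF h(1) sX] unfolding d1 eB .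
    then obtain a v where v: "h (A - {l}) = L.frac v (mono {} a)" "v \<in> gM (\<nu> - 1 + (\<Sum>i\<in>{}. of_nat (a i) * \<delta> i))"
      by (rule gL_rep[OF empty_subsetI])
    then show ?thesis unfolding mono_empty sum.empty add_0_right by blast
  qed
  then obtain v where v: "\<And>l. l \<in> A \<Longrightarrow> v l \<in> gM (\<nu> - 1)" "\<And>l. l \<in> A \<Longrightarrow> h (A - {l}) = L.frac (v l) \<one>" by metis
  \<comment> \<open>The signs of the Koszul differential are absorbed into the coefficients.\<close>
  define w where "w = (\<lambda>l. sgn_mult M (even_below A l) (v l))"
  have w: "w l \<in> gM (\<nu> - 1)" if "l \<in> A" for l unfolding w_def sgn_mult_def using v(1)[OF that] gM_neg by (simp add: additive_subgroup.a_inv_closed[OF gM_sub])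
  interpret LG: abelian_group "L.L" by (rule L.L_group)
  have fm: "additive_map M L.L (\<lambda>x. L.frac x \<one>)" by (rule L.frac_map[OF L.T_one])
  have wc: "gs ! l \<odot>\<^bsub>M\<^esub> w l \<in> carrier M" if "l \<in> A" for l using gsAc[OF that] gMc[OF w[OF that]] by simp
  have "L.frac x \<one> = kos.d A h A" using cA h(2) by simp
  also have "\<dots> = (\<Oplus>\<^bsub>NK A\<^esub>l\<in>A \<inter> A. sgn_mult (NK A) (even_below A l) (rK l (A - {l}) (h (A - {l}))))"
    by (rule kos.d_eval'[OF kos.CC_carr[OF h(1)] XAB(3) finA])
  also have "\<dots> = (\<Oplus>\<^bsub>L.L\<^esub>l\<in>A. L.frac (gs ! l \<odot>\<^bsub>M\<^esub> w l) \<one>)"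
    unfolding AB0 Int_absorb
  proof (rule LG.finsum_cong')
    fix l assume l: "l \<in> A"
    have lB: "l \<notin> B" and eB: "(A - {l}) \<inter> B = {}" using l AB0 by auto
    have vc: "v l \<in> carrier M" by (rule gMc[OF v(1)[OF l]])
    have "rK l (A - {l}) (h (A - {l})) = gs ! l \<odot>\<^bsub>L.L\<^esub> L.frac (v l) \<one>"
      unfolding v(2)[OF l] rK_def eB using lB by simp
    also have "\<dots> = L.frac (gs ! l \<odot>\<^bsub>M\<^esub> v l) \<one>" by (rule L.L_smult[OF gsAc[OF l] vc L.T_one])
    finally have e: "rK l (A - {l}) (h (A - {l})) = L.frac (gs ! l \<odot>\<^bsub>M\<^esub> v l) \<one>" .
    have "sgn_mult L.L (even_below A l) (L.frac (gs ! l \<odot>\<^bsub>M\<^esub> v l) \<one>) = L.frac (sgn_mult M (even_below A l) (gs ! l \<odot>\<^bsub>M\<^esub> v l)) \<one>"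
      by (rule additive_map_sgn_mult[OF M.abelian_group_axioms L.L_group fm, symmetric]) (use gsAc[OF l] vc in simp)
    also have "sgn_mult M (even_below A l) (gs ! l \<odot>\<^bsub>M\<^esub> v l) = gs ! l \<odot>\<^bsub>M\<^esub> w l"
      unfolding w_def sgn_mult_def using gsAc[OF l] vc by (simp add: smult_r_minus)
    finally show "sgn_mult L.L (even_below A l) (rK l (A - {l}) (h (A - {l}))) = L.frac (gs ! l \<odot>\<^bsub>M\<^esub> w l) \<one>"
      unfolding e .
  qed (use wc L.T_one in auto)
  also have "\<dots> = L.frac (\<Oplus>\<^bsub>M\<^esub>l\<in>A. gs ! l \<odot>\<^bsub>M\<^esub> w l) \<one>"
    by (rule additive_map_finsum[OF M.abelian_group_axioms L.L_group fm, symmetric]) (use wc in simp)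
  finally have e: "L.frac x \<one> = L.frac (\<Oplus>\<^bsub>M\<^esub>l\<in>A. gs ! l \<odot>\<^bsub>M\<^esub> w l) \<one>" .
  have sc: "(\<Oplus>\<^bsub>M\<^esub>l\<in>A. gs ! l \<odot>\<^bsub>M\<^esub> w l) \<in> carrier M" using wc by (intro M.finsum_closed) simp
  obtain t where t: "t \<in> ms {}" "(t \<otimes> \<one>) \<odot>\<^bsub>M\<^esub> x = (t \<otimes> \<one>) \<odot>\<^bsub>M\<^esub> (\<Oplus>\<^bsub>M\<^esub>l\<in>A. gs ! l \<odot>\<^bsub>M\<^esub> w l)"
    using L.frac_eqD[OF e sc L.T_one] by blast
  have "x = (\<Oplus>\<^bsub>M\<^esub>l\<in>A. gs ! l \<odot>\<^bsub>M\<^esub> w l)" using t(2) ms1[OF t(1)] xc sc by simp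
  then show ?thesis using w by blast
qed

text \<open>Degree \<open>\<nu>\<close> part of the submodule generated by the powers
  \<open>gs ! i [^] k i\<close> applied to \<open>M\<close>. The exponents may differ, because
  \<open>power_red\<close> lowers them one at a time.\<close>

definition PS :: "(nat \<Rightarrow> nat) \<Rightarrow> ('s \<Rightarrow> int) \<Rightarrow> 'm set" where
  "PS k \<nu> = {(\<Oplus>\<^bsub>M\<^esub>i\<in>A. (gs ! i [^] k i) \<odot>\<^bsub>M\<^esub> w i) | w. \<forall>i\<in>A. w i \<in> gM (\<nu> - of_nat (k i))}"

lemma PS_I: "(\<And>i. i \<in> A \<Longrightarrow> w i \<in> gM (\<nu> - of_nat (k i))) \<Longrightarrow>
    (\<Oplus>\<^bsub>M\<^esub>i\<in>A. (gs ! i [^] k i) \<odot>\<^bsub>M\<^esub> w i) \<in> PS k \<nu>"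
  unfolding PS_def by (intro CollectI exI[of _ w]) simp

lemma PS_term: "i \<in> A \<Longrightarrow> v \<in> gM (\<nu> - of_nat (k i)) \<Longrightarrow> (gs ! i [^] k i) \<odot>\<^bsub>M\<^esub> v \<in> PS k \<nu>"
proof -
  assume i: "i \<in> A" and v: "v \<in> gM (\<nu> - of_nat (k i))"
  let ?w = "\<lambda>j. if j = i then v else \<zero>\<^bsub>M\<^esub>"
  have "(\<Oplus>\<^bsub>M\<^esub>j\<in>A. (gs ! j [^] k j) \<odot>\<^bsub>M\<^esub> ?w j) \<in> PS k \<nu>"
    by (rule PS_I) (use v gM_zero in simp)
  moreover have "(\<Oplus>\<^bsub>M\<^esub>j\<in>A. (gs ! j [^] k j) \<odot>\<^bsub>M\<^esub> ?w j) = (gs ! i [^] k i) \<odot>\<^bsub>M\<^esub> ?w i"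
    by (rule M.finsum_single[OF finA i]) (use gsAc gMc[OF v] i in auto)
  ultimately show ?thesis by simp
qed

lemma PS_carr: "z \<in> PS k \<nu> \<Longrightarrow> z \<in> carrier M"
proof -
  assume "z \<in> PS k \<nu>"
  then obtain w where w: "z = (\<Oplus>\<^bsub>M\<^esub>i\<in>A. (gs ! i [^] k i) \<odot>\<^bsub>M\<^esub> w i)" "\<And>i. i \<in> A \<Longrightarrow> w i \<in> gM (\<nu> - of_nat (k i))"
    unfolding PS_def by blast
  show ?thesis unfolding w(1) by (rule M.finsum_closed) (use gsAc gMc[OF w(2)] in simp)
qed

lemma PS_zero: "\<zero>\<^bsub>M\<^esub> \<in> PS k \<nu>"
proof -
  have "(\<Oplus>\<^bsub>M\<^esub>i\<in>A. (gs ! i [^] k i) \<odot>\<^bsub>M\<^esub> \<zero>\<^bsub>M\<^esub>) = \<zero>\<^bsub>M\<^esub>"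
    using gsAc by (intro M.add.finprod_one_eqI) simp
  then show ?thesis using PS_I[of "\<lambda>i. \<zero>\<^bsub>M\<^esub>" \<nu> k] gM_zero by simp
qed

lemma PS_add: "z \<in> PS k \<nu> \<Longrightarrow> z' \<in> PS k \<nu> \<Longrightarrow> z \<oplus>\<^bsub>M\<^esub> z' \<in> PS k \<nu>"
proof -
  assume "z \<in> PS k \<nu>" "z' \<in> PS k \<nu>"
  then obtain w w' where w: "z = (\<Oplus>\<^bsub>M\<^esub>i\<in>A. (gs ! i [^] k i) \<odot>\<^bsub>M\<^esub> w i)" "\<And>i. i \<in> A \<Longrightarrow> w i \<in> gM (\<nu> - of_nat (k i))"
    and w': "z' = (\<Oplus>\<^bsub>M\<^esub>i\<in>A. (gs ! i [^] k i) \<odot>\<^bsub>M\<^esub> w' i)" "\<And>i. i \<in> A \<Longrightarrow> w' i \<in> gM (\<nu> - of_nat (k i))"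
    unfolding PS_def by blast
  have "z \<oplus>\<^bsub>M\<^esub> z' = (\<Oplus>\<^bsub>M\<^esub>i\<in>A. (gs ! i [^] k i) \<odot>\<^bsub>M\<^esub> w i \<oplus>\<^bsub>M\<^esub> (gs ! i [^] k i) \<odot>\<^bsub>M\<^esub> w' i)"
    unfolding w(1) w'(1) by (rule M.finsum_addf[symmetric]) (use gsAc gMc[OF w(2)] gMc[OF w'(2)] in simp_all)
  also have "\<dots> = (\<Oplus>\<^bsub>M\<^esub>i\<in>A. (gs ! i [^] k i) \<odot>\<^bsub>M\<^esub> (w i \<oplus>\<^bsub>M\<^esub> w' i))"
    by (rule M.finsum_cong') (use gsAc gMc[OF w(2)] gMc[OF w'(2)] in \<open>simp_all add: smult_r_distr\<close>)
  also have "\<dots> \<in> PS k \<nu>" by (rule PS_I) (rule gM_add[OF w(2) w'(2)])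
  finally show ?thesis .
qed

lemma PS_finsum: "(\<And>i. i \<in> Q \<Longrightarrow> f i \<in> PS k \<nu>) \<Longrightarrow> (\<Oplus>\<^bsub>M\<^esub>i\<in>Q. f i) \<in> PS k \<nu>"
  by (rule M.subgroup_finsum_closed) (use PS_zero PS_add PS_carr in auto)

text \<open>The pigeonhole inclusion \<open>(y)\<^sup>N \<subseteq> (y\<^sub>1\<^sup>k, \<dots>)\<close> for large \<open>N\<close>, read in degrees where multiplication by \<open>(y)\<close> is onto.\<close>

lemma power_red:
  assumes red: "\<And>n. r0 \<le> n \<Longrightarrow> red_at n"
    and "\<And>i. i \<in> A \<Longrightarrow> 1 \<le> k i" "x \<in> gM \<nu>" "r0 + of_nat (\<Sum>i\<in>A. k i - 1) + 1 \<le> \<nu>"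
  shows "x \<in> PS k \<nu>"
  using assms(2-)
proof (induction "\<Sum>i\<in>A. k i - 1" arbitrary: k x \<nu> rule: less_induct)
  case less
  have "0 \<le> (of_nat (\<Sum>i\<in>A. k i - 1) :: 's \<Rightarrow> int)" by (rule of_nat_fun_nonneg)
  then have "r0 \<le> r0 + of_nat (\<Sum>i\<in>A. k i - 1)" by simp
  \<comment> \<open>The bound on \<open>\<nu>\<close> leaves room for one reduction now and for one
    more each time an exponent is lowered.\<close>
  also have "\<dots> \<le> \<nu> - 1" using less.prems(3) by (simp only: le_diff_eq)
  finally have "red_at (\<nu> - 1)" by (rule red)
  moreover have "x \<in> gM (\<nu> - 1 + 1)" using less.prems(2) by simp
  ultimately obtain w where w: "\<And>i. i \<in> A \<Longrightarrow> w i \<in> gM (\<nu> - 1)" "x = (\<Oplus>\<^bsub>M\<^esub>i\<in>A. gs ! i \<odot>\<^bsub>M\<^esub> w i)"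
    unfolding red_at_def by blast
  have "gs ! i \<odot>\<^bsub>M\<^esub> w i \<in> PS k \<nu>" if i: "i \<in> A" for i
  proof (cases "k i = 1")
    case True
    then have "(gs ! i [^] k i) \<odot>\<^bsub>M\<^esub> w i \<in> PS k \<nu>" by (intro PS_term[OF i]) (use w(1)[OF i] in simp)
    then show ?thesis using True gsAc[OF i] by simp
  next
    case False
    \<comment> \<open>The factor \<open>gs ! i\<close> in front is to become part of the power in
      direction \<open>i\<close>, so \<open>w i\<close> is needed only modulo one power
      less.\<close>
    define k' where "k' = k(i := k i - 1)"
    have ki: "k i \<ge> 2" using False less.prems(1)[OF i] by simp
    have le: "(\<Sum>j\<in>A. k j - 1) = Suc (\<Sum>j\<in>A. k' j - 1)"
    proof -
      have "(\<Sum>j\<in>A. k j - 1) = (k i - 1) + (\<Sum>j\<in>A - {i}. k j - 1)" by (rule sum.remove[OF finA i])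
      moreover have "(\<Sum>j\<in>A. k' j - 1) = (k' i - 1) + (\<Sum>j\<in>A - {i}. k' j - 1)" by (rule sum.remove[OF finA i])
      moreover have "(\<Sum>j\<in>A - {i}. k' j - 1) = (\<Sum>j\<in>A - {i}. k j - 1)" by (rule sum.cong) (auto simp: k'_def)
      ultimately show ?thesis using ki by (simp add: k'_def)
    qed
    have "w i \<in> PS k' (\<nu> - 1)"
    proof (rule less.hyps)
      show "(\<Sum>j\<in>A. k' j - 1) < (\<Sum>j\<in>A. k j - 1)" unfolding le by simp
      show "1 \<le> k' j" if "j \<in> A" for j using less.prems(1)[OF that] ki by (auto simp: k'_def)
      show "w i \<in> gM (\<nu> - 1)" by (rule w(1)[OF i])
      have "r0 + of_nat (\<Sum>j\<in>A. k' j - 1) + 1 + 1 \<le> \<nu>"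
        using less.prems(3) unfolding le by (simp only: of_nat_Suc ac_simps)
      then show "r0 + of_nat (\<Sum>j\<in>A. k' j - 1) + 1 \<le> \<nu> - 1" by (simp only: le_diff_eq)
    qed
    then obtain v where v: "w i = (\<Oplus>\<^bsub>M\<^esub>j\<in>A. (gs ! j [^] k' j) \<odot>\<^bsub>M\<^esub> v j)" "\<And>j. j \<in> A \<Longrightarrow> v j \<in> gM (\<nu> - 1 - of_nat (k' j))"
      unfolding PS_def by blast
    have vc: "v j \<in> carrier M" if "j \<in> A" for j by (rule gMc[OF v(2)[OF that]])
    have "gs ! i \<odot>\<^bsub>M\<^esub> w i = (\<Oplus>\<^bsub>M\<^esub>j\<in>A. gs ! i \<odot>\<^bsub>M\<^esub> ((gs ! j [^] k' j) \<odot>\<^bsub>M\<^esub> v j))"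
      unfolding v(1) by (rule finsum_smult_ldistr[OF finA gsAc[OF i]]) (use gsAc vc in simp)
    also have "\<dots> \<in> PS k \<nu>"
    proof (rule PS_finsum)
      fix j assume j: "j \<in> A"
      show "gs ! i \<odot>\<^bsub>M\<^esub> ((gs ! j [^] k' j) \<odot>\<^bsub>M\<^esub> v j) \<in> PS k \<nu>"
      proof (cases "j = i")
        case True
        have kk: "k i = Suc (k i - 1)" using ki by simp
        have "gs ! i \<odot>\<^bsub>M\<^esub> ((gs ! i [^] (k i - 1)) \<odot>\<^bsub>M\<^esub> v i) = (gs ! i [^] k i) \<odot>\<^bsub>M\<^esub> v i"
          by (subst (2) kk) (use gsAc[OF i] vc[OF i] in \<open>simp add: R.m_comm flip: smult_assoc1\<close>)
        moreover have "(gs ! i [^] k i) \<odot>\<^bsub>M\<^esub> v i \<in> PS k \<nu>"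
        proof (rule PS_term[OF i])
          have e: "(of_nat (k i) :: 's \<Rightarrow> int) = 1 + of_nat (k i - 1)" by (subst kk) (simp only: of_nat_Suc)
          show "v i \<in> gM (\<nu> - of_nat (k i))" using v(2)[OF i] unfolding e k'_def fun_upd_same diff_diff_eq .
        qed
        ultimately show ?thesis using True by (simp add: k'_def)
      next
        case False
        then have kj: "k' j = k j" by (simp add: k'_def)
        have "gs ! i \<odot>\<^bsub>M\<^esub> ((gs ! j [^] k j) \<odot>\<^bsub>M\<^esub> v j) = (gs ! j [^] k j) \<odot>\<^bsub>M\<^esub> (gs ! i \<odot>\<^bsub>M\<^esub> v j)"
          using gsAc[OF i] gsAc[OF j] vc[OF j] by (simp add: R.m_comm flip: smult_assoc1)
        moreover have "(gs ! j [^] k j) \<odot>\<^bsub>M\<^esub> (gs ! i \<odot>\<^bsub>M\<^esub> v j) \<in> PS k \<nu>"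
        proof (rule PS_term[OF j])
          have e: "\<nu> - of_nat (k j) = \<nu> - 1 - of_nat (k j) + 1" by simp
          show "gs ! i \<odot>\<^bsub>M\<^esub> v j \<in> gM (\<nu> - of_nat (k j))"
            unfolding e by (rule gM_smult[OF gsA[OF i]]) (use v(2)[OF j] kj in simp)
        qed
        ultimately show ?thesis using kj by simp
      qed
    qed
    finally show ?thesis .
  qed
  then show ?case unfolding w(2) by (rule PS_finsum)
qed

text \<open>A last cochain is a fraction with a monomial in the \<open>y\<close> as denominator.
  Made uniform, the denominator is the product of the \<open>k\<close>-th powers; by
  \<open>power_red\<close> the numerator lies in the submodule these powers generate, and cancelling
  a power in each summand leaves fractions over the faces that miss one direction.\<close>

lemma exact_top:
  assumes red: "\<And>n. r0 \<le> n \<Longrightarrow> red_at n" and d1: "1 \<le> length ys"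
    and n: "r0 \<le> n + of_nat (length ys - 1)"
  shows "cech.exact A {} (int (length ys)) n"
  unfolding cech.exact_def
proof (intro ballI impI)
  let ?d = "length ys"
  fix c assume c: "c \<in> cech.CC A {} (int ?d) n"
  have AX: "A \<subseteq> X" by (rule XAB(3))
  interpret L: graded_localizing S M gS gM "ms A" by (rule ms_loc[OF AX])
  obtain a x where ax: "c A = L.frac x (mono A a)" "x \<in> gM (n + (\<Sum>i\<in>A. of_nat (a i) * \<delta> i))"
    using cech.CC_D[OF c AX] by (rule gL_rep[OF AX])
  \<comment> \<open>Bounds all exponents of the given denominator and is positive, as
    \<open>power_red\<close> requires.\<close>
  define k where "k = Suc (\<Sum>i\<in>A. a i)"
  have ak: "a i \<le> k" if "i \<in> A" for i
    using member_le_sum[of i A a] that finA unfolding k_def by simp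
  have sd: "(\<Sum>i\<in>Q. of_nat (b i) * \<delta> i) = of_nat (\<Sum>i\<in>Q. b i)" if "Q \<subseteq> A" for Q b
  proof -
    have "(\<Sum>i\<in>Q. of_nat (b i) * \<delta> i) = (\<Sum>i\<in>Q. of_nat (b i))"
      by (rule sum.cong[OF refl]) (use ys_deg that in auto)
    then show ?thesis by (simp only: of_nat_sum)
  qed
  \<comment> \<open>Numerator after raising every exponent of the denominator to
    \<open>k\<close>.\<close>
  define x' where "x' = mono A (\<lambda>i. k - a i) \<odot>\<^bsub>M\<^esub> x"
  have xc: "x \<in> carrier M" by (rule gMc[OF ax(2)])
  have mk: "mono A (\<lambda>i. k - a i) \<otimes> mono A a = mono A (\<lambda>i. k)"
    unfolding mono_mult[OF AX] unfolding mono_def by (rule R.finprod_cong') (use ak gsAc in auto)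
  have cA: "c A = L.frac x' (mono A (\<lambda>i. k))"
    unfolding ax(1) x'_def mk[symmetric] by (rule L.frac_scale[OF xc mono_ms mono_ms, symmetric])
  have x': "x' \<in> gM (n + of_nat (?d * k))"
  proof -
    have "(\<Sum>i\<in>A. a i) + (\<Sum>i\<in>A. k - a i) = (\<Sum>i\<in>A. k)"
      unfolding sum.distrib[symmetric] by (rule sum.cong[OF refl]) (use ak in simp)
    also have "\<dots> = ?d * k" using cardA by simp
    finally have "of_nat (\<Sum>i\<in>A. a i) + of_nat (\<Sum>i\<in>A. k - a i) = (of_nat (?d * k) :: 's \<Rightarrow> int)"
      unfolding of_nat_add[symmetric] by (rule arg_cong)
    then have e: "n + of_nat (?d * k) = n + of_nat (\<Sum>i\<in>A. a i) + of_nat (\<Sum>i\<in>A. k - a i)"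
      by (simp only: add.assoc)
    show ?thesis unfolding e x'_def
      by (rule gM_smult[OF mono_hom[OF AX, of "\<lambda>i. k - a i", unfolded sd[OF order_refl]] ax(2)[unfolded sd[OF order_refl]]])
  qed
  have "x' \<in> PS (\<lambda>i. k) (n + of_nat (?d * k))"
  proof (rule power_red[OF red _ x'])
    show "r0 + of_nat (\<Sum>i\<in>A. k - 1) + 1 \<le> n + of_nat (?d * k)"
    proof (rule le_funI)
      fix s
      have "r0 s \<le> n s + int (?d - 1)" using n by (simp add: le_fun_def)
      \<comment> \<open>With \<open>?d\<close> directions, \<open>power_red\<close> asks for
        \<open>r0 + ?d * (k - 1) + 1 \<le> n + ?d * k\<close>. Independently of \<open>k\<close>,
        this is \<open>r0 \<le> n + (?d - 1)\<close>, which explains the bound in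
        \<open>n\<close>.\<close>
      moreover have "int (?d * (k - 1)) + int ?d = int (?d * k)"
        unfolding k_def by (simp add: algebra_simps)
      ultimately have "r0 s + int (?d * (k - 1)) + 1 \<le> n s + int (?d * k)" using d1 by simp
      then show "(r0 + of_nat (\<Sum>i\<in>A. k - 1) + 1) s \<le> (n + of_nat (?d * k)) s" using cardA by simp
    qed
  qed (simp_all add: k_def)
  then obtain w where w: "x' = (\<Oplus>\<^bsub>M\<^esub>i\<in>A. (gs ! i [^] k) \<odot>\<^bsub>M\<^esub> w i)"
    "\<And>i. i \<in> A \<Longrightarrow> w i \<in> gM (n + of_nat (?d * k) - of_nat k)"
    unfolding PS_def by blast
  define t where "t = (\<lambda>\<rho>. mono \<rho> (\<lambda>i. k))"
  \<comment> \<open>Recovers the direction missing from a face of the form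
    \<open>A - {j}\<close>.\<close>
  define pick where "pick = (\<lambda>\<rho>. SOME j. j \<in> A - \<rho>)"
  define on where "on = (\<lambda>\<rho>. \<exists>j\<in>A. \<rho> = A - {j})"
  \<comment> \<open>The summand \<open>i\<close> of \<open>x'\<close>, with its power cancelled, is
    placed on the face without \<open>i\<close>. The sign is the one of \<open>i\<close> in
    \<open>A\<close>, so it disappears again in the differential.\<close>
  define h where "h = (\<lambda>\<rho>\<in>Pow X. if on \<rho> then
      sgn_mult (Lc \<rho>) (even_below A (pick \<rho>)) (fraction S M (ms \<rho>) (w (pick \<rho>)) (t \<rho>)) else \<zero>\<^bsub>Lc \<rho>\<^esub>)"
  have pick: "pick (A - {j}) = j" if "j \<in> A" for j
  proof -
    have "A - (A - {j}) = {j}" using that by auto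
    then show ?thesis unfolding pick_def by simp
  qed
  have fD: "fraction S M (ms (A - {j})) (w j) (t (A - {j})) \<in> Dc n (A - {j})" if j: "j \<in> A" for j
  proof -
    have s: "A - {j} \<subseteq> X" using AX by auto
    interpret L': graded_localizing S M gS gM "ms (A - {j})" by (rule ms_loc[OF s])
    have "(\<Sum>i\<in>A - {j}. k) = (?d - 1) * k" using j finA cardA by simp
    then have th: "t (A - {j}) \<in> gS (of_nat ((?d - 1) * k))"
      unfolding t_def using mono_hom[OF s, of "\<lambda>i. k"] sd[of "A - {j}" "\<lambda>i. k"] by auto
    have "?d * k = (?d - 1) * k + k" using d1 by (simp add: algebra_simps flip: mult_Suc)
    then have e: "n + of_nat (?d * k) - of_nat k = n + of_nat ((?d - 1) * k)"
      by (simp only: of_nat_add add.assoc[symmetric] add_diff_cancel_right')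
    show ?thesis by (rule L'.gL_I[OF _ th]) (use w(2)[OF j] mono_ms in \<open>simp_all only: e t_def\<close>)
  qed
  have hA: "h (A - {j}) = sgn_mult (Lc (A - {j})) (even_below A j) (fraction S M (ms (A - {j})) (w j) (t (A - {j})))"
    if "j \<in> A" for j
    using that AX pick[OF that] unfolding h_def on_def by auto
  have hDz: "h \<rho> \<in> cech.Dz A {} (int ?d - 1) n \<rho>" if r: "\<rho> \<subseteq> X" for \<rho>
  proof (cases "on \<rho>")
    case True
    then obtain j where j: "j \<in> A" "\<rho> = A - {j}" unfolding on_def by blast
    have "\<rho> - A = {}" "int (card (\<rho> \<inter> A)) = int ?d - 1"
    proof -
      have "\<rho> \<inter> A = A - {j}" using j by auto
      then show "int (card (\<rho> \<inter> A)) = int ?d - 1" using j finA cardA d1 by simp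
    qed (use j in auto)
    then have "cech.Dz A {} (int ?d - 1) n \<rho> = Dc n \<rho>" unfolding cech.Dz_def by simp
    moreover have "h \<rho> \<in> Dc n \<rho>"
      unfolding j(2) hA[OF j(1)] by (rule cech.D_sgn[OF _ fD[OF j(1)]]) (use AX in auto)
    ultimately show ?thesis by simp
  next
    case False
    then have "h \<rho> = \<zero>\<^bsub>Lc \<rho>\<^esub>" using r unfolding h_def by auto
    then show ?thesis using cech.Dz_zero[OF r] by simp
  qed
  have hT: "h \<in> carrier cech.TC"
    unfolding cech.TC_simps
  proof (rule PiE_I)
    fix \<rho> assume "\<rho> \<in> Pow X"
    then show "h \<rho> \<in> carrier (Lc \<rho>)" using cech.D_carr[OF _ cech.Dz_D[OF _ hDz]] by simp
  qed (simp add: h_def)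
  have h: "h \<in> cech.CC A {} (int ?d - 1) n" using hT hDz by (simp add: cech.CC_def)
  have dh: "cech.d A h \<in> cech.CC A {} (int ?d) n" using cech.CC_d[OF h] by simp
  interpret LG: abelian_group "L.L" by (rule L.L_group)
  have wc: "w i \<in> carrier M" if "i \<in> A" for i by (rule gMc[OF w(2)[OF that]])
  have dhA: "cech.d A h A = c A"
  proof -
    have "cech.d A h A = (\<Oplus>\<^bsub>Lc A\<^esub>l\<in>A \<inter> A. sgn_mult (Lc A) (even_below A l)
        (localization_map S M (ms (insert l (A - {l}))) (h (A - {l}))))"
      by (rule cech.d_eval'[OF hT AX finA])
    also have "\<dots> = (\<Oplus>\<^bsub>Lc A\<^esub>l\<in>A. L.frac ((gs ! l [^] k) \<odot>\<^bsub>M\<^esub> w l) (t A))"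
      unfolding Int_absorb
    proof (rule LG.finsum_cong')
      fix l assume l: "l \<in> A"
      let ?\<sigma> = "A - {l}"
      have s: "?\<sigma> \<subseteq> X" "insert l ?\<sigma> = A" "l \<notin> ?\<sigma>" "insert l ?\<sigma> \<subseteq> X" using AX l by auto
      interpret L': graded_localizing S M gS gM "ms ?\<sigma>" by (rule ms_loc[OF s(1)])
      have sub: "ms ?\<sigma> \<subseteq> ms A" by (rule ms_mono[OF _ AX]) auto
      have tm: "t ?\<sigma> \<in> ms ?\<sigma>" unfolding t_def by (rule mono_ms)
      have m: "additive_map L'.L L.L (localization_map S M (ms A))"
        by (rule localization_map_additive[OF L.localizing_axioms L'.localizing_axioms sub])
      have fc: "L'.frac (w l) (t ?\<sigma>) \<in> carrier L'.L" using wc[OF l] tm by simp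
      have tA: "t A = (gs ! l [^] k) \<otimes> t ?\<sigma>" unfolding t_def using mono_insert[OF s(4,3), of "\<lambda>i. k"] unfolding s(2) .
      have e1: "localization_map S M (ms A) (L'.frac (w l) (t ?\<sigma>)) = L.frac (w l) (t ?\<sigma>)"
        by (rule localization_map_frac[OF L.localizing_axioms L'.localizing_axioms sub wc[OF l] tm])
      have e2: "L.frac (w l) (t ?\<sigma>) = L.frac ((gs ! l [^] k) \<odot>\<^bsub>M\<^esub> w l) (t A)"
        unfolding tA by (rule L.frac_scale[symmetric, OF wc[OF l]]) (use tm sub ms_gs[OF AX l] in auto)
      have "localization_map S M (ms A) (h ?\<sigma>) = sgn_mult L.L (even_below A l) (L.frac ((gs ! l [^] k) \<odot>\<^bsub>M\<^esub> w l) (t A))"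
        unfolding hA[OF l] additive_map_sgn_mult[OF L'.L_group L.L_group m fc] e1 e2 ..
      moreover have "L.frac ((gs ! l [^] k) \<odot>\<^bsub>M\<^esub> w l) (t A) \<in> carrier L.L"
        using wc[OF l] gsAc[OF l] mono_ms[of A] unfolding t_def by simp
      ultimately show "sgn_mult (Lc A) (even_below A l) (localization_map S M (ms (insert l ?\<sigma>)) (h ?\<sigma>)) =
          L.frac ((gs ! l [^] k) \<odot>\<^bsub>M\<^esub> w l) (t A)"
        unfolding s(2) by (simp add: LG.sgn_mult_sgn_mult) (simp add: sgn_mult_def)
    qed (use wc gsAc mono_ms[of A] in \<open>simp_all add: t_def\<close>)
    also have "\<dots> = L.frac x' (t A)"
      unfolding w(1) using additive_map_finsum[OF M.abelian_group_axioms L.L_group L.frac_map[OF mono_ms[of A "\<lambda>i. k"]], 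
          of "\<lambda>l. (gs ! l [^] k) \<odot>\<^bsub>M\<^esub> w l" A] wc gsAc unfolding t_def by simp
    finally show ?thesis unfolding cA t_def .
  qed
  have "c = cech.d A h"
  proof (rule cech.TC_eqI[OF cech.CC_carr[OF c] cech.CC_carr[OF dh]])
    fix \<rho> assume r: "\<rho> \<subseteq> X"
    show "c \<rho> = cech.d A h \<rho>"
    proof (cases "\<rho> - A = {} \<and> int (card (\<rho> \<inter> A)) = int ?d")
      case True
      then have "\<rho> \<subseteq> A" "card \<rho> = card A" using cardA by (auto simp: Int_absorb2)
      then have "\<rho> = A" using finA by (intro card_subset_eq) auto
      then show ?thesis using dhA by simp
    next
      case False
      show ?thesis using cech.Dz_off[OF cech.CC_Dz[OF c r] False] cech.Dz_off[OF cech.CC_Dz[OF dh r] False] by simp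
    qed
  qed
  then show "\<exists>h\<in>cech.CC A {} (int ?d - 1) n. c = cech.d A h" using h by blast
qed

text \<open>Here \<open>f\<close> and \<open>y\<close> are the two Cech sides of one cube. Faces
  with some element inverted are settled by \<open>exact_f\<close> and \<open>exact_y\<close>; only
  the pure complex on \<open>y\<close> remains. Beyond place \<open>d\<close> it is empty, and at
  place \<open>d\<close> it is \<open>exact_top\<close>.\<close>

theorem vanishing_of_red:
  assumes red: "\<And>n. r0 \<le> n \<Longrightarrow> red_at n" and d1: "1 \<le> length ys"
    and i: "length ys < i \<or> length ys = i \<and> r0 \<le> n + of_nat (length ys - 1)"
  shows "vanishes i n"
  unfolding vanishes_cech
proof (rule cech.exact_transfer)
  show "X = B \<union> A" "B \<inter> A = {}" using XAB by auto
  show "cech.exact B \<tau> (int i + 1 - int (card \<tau>)) n" if "\<tau> \<subseteq> A" "\<tau> \<noteq> {}" for \<tau>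
    using that by (rule exact_f)
  show "cech.exact A \<sigma> (int i - int (card \<sigma>)) n" if s: "\<sigma> \<subseteq> B" for \<sigma>
  proof (cases "\<sigma> = {}")
    case True
    show ?thesis
    proof (cases "length ys < i")
      case True
      then show ?thesis using \<open>\<sigma> = {}\<close> cech.exact_big[OF finA] cardA by simp
    next
      case False
      then have "length ys = i" "r0 \<le> n + of_nat (length ys - 1)" using i by auto
      then have "cech.exact A {} (int i) n" using exact_top[OF red d1] by simp
      then show ?thesis using True by simp
    qed
  qed (use exact_y[OF s] in blast)
qed simp

end

section \<open>Associated graded rings of filtrations\<close>

text \<open>Needed because a \<open>finsum\<close> over an infinite interval would be zero by
  convention.\<close>

lemma finite_index_interval: "finite {a..b :: 's::finite \<Rightarrow> int}"
proof (rule finite_subset)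
  show "{a..b} \<subseteq> (\<Pi>\<^sub>E i\<in>UNIV. {a i..b i})" by (auto simp: le_fun_def)
  show "finite (\<Pi>\<^sub>E i\<in>(UNIV :: 's set). {a i..b i})" by (intro finite_PiE) auto
qed

context abelian_monoid
begin

lemma finsum_Sigma:
  assumes "finite A" "\<And>a. a \<in> A \<Longrightarrow> finite (B a)" "\<And>a b. a \<in> A \<Longrightarrow> b \<in> B a \<Longrightarrow> g a b \<in> carrier G"
  shows "(\<Oplus>a\<in>A. \<Oplus>b\<in>B a. g a b) = (\<Oplus>p\<in>Sigma A B. g (fst p) (snd p))"
  using assms
proof (induction A rule: finite_induct)
  case (insert a A)
  have e: "Sigma (insert a A) B = (Pair a ` B a) \<union> Sigma A B" by auto
  have c: "(\<lambda>p. g (fst p) (snd p)) \<in> Pair a ` B a \<rightarrow> carrier G" "(\<lambda>p. g (fst p) (snd p)) \<in> Sigma A B \<rightarrow> carrier G"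
    using insert by auto
  have "(\<Oplus>p\<in>Sigma (insert a A) B. g (fst p) (snd p))
      = (\<Oplus>p\<in>Pair a ` B a. g (fst p) (snd p)) \<oplus> (\<Oplus>p\<in>Sigma A B. g (fst p) (snd p))"
    unfolding e using insert c by (intro finsum_Un_disjoint) auto
  also have "(\<Oplus>p\<in>Pair a ` B a. g (fst p) (snd p)) = (\<Oplus>b\<in>B a. g a b)"
    using c(1) by (subst finsum_reindex) (auto simp: inj_on_def)
  also have "(\<Oplus>p\<in>Sigma A B. g (fst p) (snd p)) = (\<Oplus>a\<in>A. \<Oplus>b\<in>B a. g a b)"
    using insert by (intro insert.IH[symmetric]) auto
  finally show ?case using insert by (subst finsum_insert) (auto intro!: finsum_closed)
qed simp

end

section \<open>Convolution of families and members of generated ideals\<close>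

context cring
begin

text \<open>The product of \<open>gr_mult\<close> before passing to cosets. The laws of the graded
  ring are proved here, for families in \<open>R\<close>, and then descend.\<close>

definition conv :: "(('s::finite \<Rightarrow> int) \<Rightarrow> 'a) \<Rightarrow> (('s \<Rightarrow> int) \<Rightarrow> 'a) \<Rightarrow> ('s \<Rightarrow> int) \<Rightarrow> 'a" where
  "conv u v n = (\<Oplus>a\<in>{0..n}. u a \<otimes> v (n - a))"

lemma conv_comm:
  assumes u: "\<And>n. 0 \<le> n \<Longrightarrow> u n \<in> carrier R" and v: "\<And>n. 0 \<le> n \<Longrightarrow> v n \<in> carrier R"
  shows "conv u v n = conv v u n"
proof -
  have e: "(\<lambda>a. n - a) ` {0..n} = {0..n}"
  proof
    show "{0..n} \<subseteq> (\<lambda>a. n - a) ` {0..n}"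
    proof
      fix a assume "a \<in> {0..n}"
      then show "a \<in> (\<lambda>a. n - a) ` {0..n}" by (intro image_eqI[of _ _ "n - a"]) auto
    qed
  qed auto
  have "conv u v n = (\<Oplus>a\<in>(\<lambda>a. n - a) ` {0..n}. u a \<otimes> v (n - a))" unfolding conv_def e ..
  also have "\<dots> = (\<Oplus>a\<in>{0..n}. u (n - a) \<otimes> v (n - (n - a)))"
    using u v by (subst finsum_reindex) (auto simp: inj_on_def)
  also have "\<dots> = conv v u n"
    unfolding conv_def by (rule finsum_cong') (use u v in \<open>auto simp: m_comm\<close>)
  finally show ?thesis .
qed

lemma conv_add:
  assumes u: "\<And>n. 0 \<le> n \<Longrightarrow> u n \<in> carrier R" "\<And>n. 0 \<le> n \<Longrightarrow> u' n \<in> carrier R"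
    and v: "\<And>n. 0 \<le> n \<Longrightarrow> v n \<in> carrier R"
  shows "conv (\<lambda>a. u a \<oplus> u' a) v n = conv u v n \<oplus> conv u' v n"
proof -
  have "conv (\<lambda>a. u a \<oplus> u' a) v n = (\<Oplus>a\<in>{0..n}. u a \<otimes> v (n - a) \<oplus> u' a \<otimes> v (n - a))"
    unfolding conv_def by (rule finsum_cong') (use u v in \<open>auto simp: l_distr\<close>)
  also have "\<dots> = conv u v n \<oplus> conv u' v n"
    unfolding conv_def by (rule finsum_addf) (use u v in auto)
  finally show ?thesis .
qed

text \<open>Both sides sum over the ways of splitting \<open>n\<close> into three parts; the pair
  \<open>(a, b)\<close> with \<open>b \<le> a \<le> n\<close> corresponds to \<open>(b, c)\<close>
  with \<open>a = b + c\<close>.\<close>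

lemma conv_assoc:
  assumes u: "\<And>n. 0 \<le> n \<Longrightarrow> u n \<in> carrier R" and v: "\<And>n. 0 \<le> n \<Longrightarrow> v n \<in> carrier R"
    and w: "\<And>n. 0 \<le> n \<Longrightarrow> w n \<in> carrier R"
  shows "conv (conv u v) w n = conv u (conv v w) n"
proof -
  note fin = finite_index_interval
  let ?g = "\<lambda>a b. u b \<otimes> v (a - b) \<otimes> w (n - a)"
  let ?h = "\<lambda>b c. u b \<otimes> (v c \<otimes> w (n - b - c))"
  have "conv (conv u v) w n = (\<Oplus>a\<in>{0..n}. \<Oplus>b\<in>{0..a}. ?g a b)"
    unfolding conv_def
  proof (rule finsum_cong')
    fix a assume a: "a \<in> {0..n}"
    show "(\<Oplus>b\<in>{0..a}. u b \<otimes> v (a - b)) \<otimes> w (n - a) = (\<Oplus>b\<in>{0..a}. ?g a b)"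
      by (rule finsum_ldistr[OF fin]) (use a u v w in auto)
  qed (use u v w in \<open>auto intro!: finsum_closed\<close>)
  also have "\<dots> = (\<Oplus>p\<in>(SIGMA a:{0..n}. {0..a}). ?g (fst p) (snd p))"
    by (rule finsum_Sigma) (use u v w fin in auto)
  also have "(SIGMA a:{0..n}. {0..a}) = (\<lambda>(b, c). (b + c, b)) ` (SIGMA b:{0..n}. {0..n - b})"
  proof
    show "(SIGMA a:{0..n}. {0..a}) \<subseteq> (\<lambda>(b, c). (b + c, b)) ` (SIGMA b:{0..n}. {0..n - b})"
    proof
      fix p assume "p \<in> (SIGMA a:{0..n}. {0..a})"
      then obtain a b where p: "p = (a, b)" "0 \<le> a" "a \<le> n" "0 \<le> b" "b \<le> a" by auto
      have "b \<le> n" using p order_trans by blast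
      moreover have "a - b \<le> n - b" using p(3) by (rule diff_right_mono)
      ultimately show "p \<in> (\<lambda>(b, c). (b + c, b)) ` (SIGMA b:{0..n}. {0..n - b})"
        using p by (intro image_eqI[of _ _ "(b, a - b)"]) auto
    qed
    show "(\<lambda>(b, c). (b + c, b)) ` (SIGMA b:{0..n}. {0..n - b}) \<subseteq> (SIGMA a:{0..n}. {0..a})"
    proof (rule image_subsetI)
      fix p assume "p \<in> (SIGMA b:{0..n}. {0..n - b})"
      then obtain b c where p: "p = (b, c)" "0 \<le> b" "b \<le> n" "0 \<le> c" "c \<le> n - b" by auto
      have "b + c \<le> n" using p(5) by (simp add: le_diff_eq add.commute)
      then show "(case p of (b, c) \<Rightarrow> (b + c, b)) \<in> (SIGMA a:{0..n}. {0..a})"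
        using p by auto
    qed
  qed
  also have "(\<Oplus>p\<in>(\<lambda>(b, c). (b + c, b)) ` (SIGMA b:{0..n}. {0..n - b}). ?g (fst p) (snd p))
     = (\<Oplus>p\<in>(SIGMA b:{0..n}. {0..n - b}). ?h (fst p) (snd p))"
  proof (subst finsum_reindex)
    have c: "u b \<in> carrier R" "v c \<in> carrier R" "w (n - b - c) \<in> carrier R"
      if "0 \<le> b" "0 \<le> c" "c \<le> n - b" for b c using u v w that by simp_all
    have e: "n - (b + c) = n - b - c" for b c :: "'c \<Rightarrow> int" by simp
    show "(\<lambda>p. ?g (fst p) (snd p)) \<in> (\<lambda>(b, c). (b + c, b)) ` (SIGMA b:{0..n}. {0..n - b}) \<rightarrow> carrier R"
      using c by (auto simp: e)
    show "inj_on (\<lambda>(b, c). (b + c, b)) (SIGMA b:{0..n}. {0..n - b})" by (auto simp: inj_on_def)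
    show "(\<Oplus>p\<in>(SIGMA b:{0..n}. {0..n - b}). ?g (fst (case p of (b, c) \<Rightarrow> (b + c, b))) (snd (case p of (b, c) \<Rightarrow> (b + c, b))))
      = (\<Oplus>p\<in>(SIGMA b:{0..n}. {0..n - b}). ?h (fst p) (snd p))"
      by (rule finsum_cong') (use c in \<open>auto simp: m_assoc e\<close>)
  qed
  also have "\<dots> = (\<Oplus>b\<in>{0..n}. \<Oplus>c\<in>{0..n - b}. ?h b c)"
    by (rule finsum_Sigma[symmetric]) (use u v w fin in auto)
  also have "\<dots> = conv u (conv v w) n"
    unfolding conv_def
  proof (rule finsum_cong')
    fix b assume b: "b \<in> {0..n}"
    show "(\<Oplus>c\<in>{0..n - b}. ?h b c) = u b \<otimes> (\<Oplus>c\<in>{0..n - b}. v c \<otimes> w (n - b - c))"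
      by (rule finsum_rdistr[OF fin, symmetric]) (use b u v w in auto)
  qed (use u v w in \<open>auto intro!: finsum_closed\<close>)
  finally show ?thesis .
qed

lemma conv_delta:
  assumes v: "\<And>n. 0 \<le> n \<Longrightarrow> v n \<in> carrier R" and x: "x \<in> carrier R" and b: "0 \<le> b"
  shows "conv (\<lambda>k. if k = b then x else \<zero>) v n = (if b \<le> n then x \<otimes> v (n - b) else \<zero>)"
proof (cases "b \<le> n")
  case True
  have "conv (\<lambda>k. if k = b then x else \<zero>) v n = (\<Oplus>a\<in>{0..n}. if b = a then x \<otimes> v (n - a) else \<zero>)"
    unfolding conv_def by (rule finsum_cong') (use v x in auto)
  also have "\<dots> = x \<otimes> v (n - b)"
    by (rule finsum_singleton) (use True b v x finite_index_interval in auto)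
  finally show ?thesis using True by simp
next
  case False
  have "conv (\<lambda>k. if k = b then x else \<zero>) v n = \<zero>"
    unfolding conv_def by (rule add.finprod_one_eqI) (use False v in auto)
  then show ?thesis using False by simp
qed

text \<open>Elements of a generated ideal, built up by one multiple of one generator at a time; this
  supplies an induction principle for \<open>Idl\<close>.\<close>

inductive_set ispan :: "'a set \<Rightarrow> 'a set" for G :: "'a set" where
  ispan_zero: "\<zero> \<in> ispan G"
| ispan_step: "r \<in> carrier R \<Longrightarrow> g \<in> G \<Longrightarrow> x \<in> ispan G \<Longrightarrow> r \<otimes> g \<oplus> x \<in> ispan G"

lemma ispan_carr:
  assumes "G \<subseteq> carrier R" "x \<in> ispan G"
  shows "x \<in> carrier R"
  using assms(2) by (induction rule: ispan.induct) (use assms(1) in auto)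

lemma ispan_add:
  assumes G: "G \<subseteq> carrier R" and x: "x \<in> ispan G" and y: "y \<in> ispan G"
  shows "x \<oplus> y \<in> ispan G"
  using x
proof (induction rule: ispan.induct)
  case ispan_zero
  then show ?case using y ispan_carr[OF G y] by simp
next
  case (ispan_step r g x)
  have "r \<otimes> g \<oplus> x \<oplus> y = r \<otimes> g \<oplus> (x \<oplus> y)"
    using ispan_step G ispan_carr[OF G] y by (intro a_assoc) auto
  then show ?case using ispan.ispan_step ispan_step by metis
qed

lemma ispan_mult:
  assumes G: "G \<subseteq> carrier R" and x: "x \<in> ispan G" and r: "r \<in> carrier R"
  shows "r \<otimes> x \<in> ispan G"
  using x
proof (induction rule: ispan.induct)
  case ispan_zero
  then show ?case using r ispan.ispan_zero by simp
next
  case (ispan_step r' g x)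
  have "r \<otimes> (r' \<otimes> g \<oplus> x) = (r \<otimes> r') \<otimes> g \<oplus> r \<otimes> x"
    using ispan_step G ispan_carr[OF G] r by (simp add: r_distr m_assoc subset_iff)
  then show ?case using ispan.ispan_step[of "r \<otimes> r'" g] ispan_step r by auto
qed

lemma ispan_ideal: "G \<subseteq> carrier R \<Longrightarrow> ideal (ispan G) R"
proof (rule idealI)
  assume G: "G \<subseteq> carrier R"
  show "ring R" by (rule ring_axioms)
  show "subgroup (ispan G) (add_monoid R)"
  proof (rule add.subgroupI)
    show "ispan G \<subseteq> carrier R" using ispan_carr[OF G] by blast
    show "ispan G \<noteq> {}" using ispan_zero by blast
    show "\<ominus> a \<in> ispan G" if "a \<in> ispan G" for a
      using ispan_mult[OF G that, of "\<ominus> \<one>"] ispan_carr[OF G that] by (simp add: l_minus)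
    show "a \<oplus> b \<in> ispan G" if "a \<in> ispan G" "b \<in> ispan G" for a b using ispan_add[OF G that] .
  qed
  show "x \<otimes> a \<in> ispan G" if "a \<in> ispan G" "x \<in> carrier R" for a x using ispan_mult[OF G that] .
  show "a \<otimes> x \<in> ispan G" if "a \<in> ispan G" "x \<in> carrier R" for a x
    using ispan_mult[OF G that] ispan_carr[OF G that(1)] that(2) by (simp add: m_comm)
qed

lemma genideal_ispan: "G \<subseteq> carrier R \<Longrightarrow> Idl G \<subseteq> ispan G"
proof (rule genideal_minimal[OF ispan_ideal])
  assume G: "G \<subseteq> carrier R"
  show "G \<subseteq> ispan G"
  proof
    fix g assume g: "g \<in> G"
    then show "g \<in> ispan G" using ispan_step[OF one_closed g ispan_zero] G by auto
  qed
qed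

lemma genideal_list_comb:
  assumes fs: "set fs \<subseteq> carrier R" and y: "y \<in> Idl (set fs)"
  shows "\<exists>c. (\<forall>i<length fs. c i \<in> carrier R) \<and> y = (\<Oplus>i\<in>{..<length fs}. c i \<otimes> fs ! i)"
proof -
  have "y \<in> ispan (set fs)" using genideal_ispan[OF fs] y by blast
  then show ?thesis
  proof (induction rule: ispan.induct)
    case ispan_zero
    have "(\<Oplus>i\<in>{..<length fs}. \<zero> \<otimes> fs ! i) = \<zero>" using fs by (intro add.finprod_one_eqI) (auto simp: subset_iff)
    then show ?case by (intro exI[of _ "\<lambda>i. \<zero>"]) simp
  next
    case (ispan_step r g x)
    then obtain c where c: "\<And>i. i < length fs \<Longrightarrow> c i \<in> carrier R" "x = (\<Oplus>i\<in>{..<length fs}. c i \<otimes> fs ! i)" by blast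
    obtain j where j: "j < length fs" "g = fs ! j" using ispan_step(2) by (metis in_set_conv_nth)
    have fc: "fs ! i \<in> carrier R" if "i < length fs" for i using fs that by (auto simp: subset_iff)
    let ?c = "\<lambda>i. (if j = i then r else \<zero>) \<oplus> c i"
    have "(\<Oplus>i\<in>{..<length fs}. ?c i \<otimes> fs ! i) = (\<Oplus>i\<in>{..<length fs}. (if j = i then r \<otimes> fs ! i else \<zero>) \<oplus> c i \<otimes> fs ! i)"
      by (rule finsum_cong') (use c(1) fc ispan_step(1) in \<open>auto simp: l_distr\<close>)
    also have "\<dots> = (\<Oplus>i\<in>{..<length fs}. if j = i then r \<otimes> fs ! i else \<zero>) \<oplus> x"
      unfolding c(2) by (rule finsum_addf) (use c(1) fc ispan_step(1) in auto)
    also have "(\<Oplus>i\<in>{..<length fs}. if j = i then r \<otimes> fs ! i else \<zero>) = r \<otimes> fs ! j"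
      by (rule finsum_singleton) (use j fc ispan_step(1) in auto)
    finally show ?case using c(1) ispan_step(1) j(2) by (intro exI[of _ ?c]) simp
  qed
qed

end

section \<open>Cosets of an ideal\<close>

context ring
begin

lemma coset_hom: "ideal J R \<Longrightarrow> additive_map R (R Quot J) (\<lambda>x. J +> x)"
  using ideal.rcos_ring_hom[of J R] by (auto simp: additive_map_def ring_hom_def)

lemma coset_add: "ideal J R \<Longrightarrow> x \<in> carrier R \<Longrightarrow> y \<in> carrier R \<Longrightarrow> (J +> x) <+> (J +> y) = J +> (x \<oplus> y)"
  using additive_map_add[OF coset_hom] by (simp add: FactRing_def)

lemma quot_group: "ideal J R \<Longrightarrow> abelian_group (R Quot J)"
  using ideal.quotient_is_ring ring.is_abelian_group by blast

lemma quot_zero: "\<zero>\<^bsub>R Quot J\<^esub> = J" by (simp add: FactRing_def)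

lemma coset_zero: "ideal J R \<Longrightarrow> J +> \<zero> = J"
  using additive_map_zero[OF abelian_group_axioms quot_group coset_hom] by (simp add: quot_zero)

lemma coset_eq_zero: "ideal J R \<Longrightarrow> x \<in> carrier R \<Longrightarrow> J +> x = J \<longleftrightarrow> x \<in> J"
proof
  assume J: "ideal J R" and x: "x \<in> carrier R"
  interpret J: ideal J R by fact
  show "J +> x = J \<Longrightarrow> x \<in> J" using J.a_rcos_self[OF x] by simp
  show "x \<in> J \<Longrightarrow> J +> x = J" by (rule J.a_rcos_const)
qed

lemma coset_eq_iff:
  assumes J: "ideal J R" and x: "x \<in> carrier R" "y \<in> carrier R"
  shows "J +> x = J +> y \<longleftrightarrow> x \<ominus> y \<in> J"
proof -
  interpret J: ideal J R by fact
  interpret Q: abelian_group "R Quot J" by (rule quot_group[OF J])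
  note h = coset_hom[OF J]
  have c: "J +> x \<in> carrier (R Quot J)" "J +> y \<in> carrier (R Quot J)" using additive_map_closed[OF h] x by auto
  have m: "J +> (x \<ominus> y) = (J +> x) \<ominus>\<^bsub>R Quot J\<^esub> (J +> y)"
    by (rule additive_map_minus[OF abelian_group_axioms quot_group[OF J] h x])
  have "J +> x = J +> y \<longleftrightarrow> (J +> x) \<ominus>\<^bsub>R Quot J\<^esub> (J +> y) = \<zero>\<^bsub>R Quot J\<^esub>"
  proof
    assume "J +> x = J +> y"
    then show "(J +> x) \<ominus>\<^bsub>R Quot J\<^esub> (J +> y) = \<zero>\<^bsub>R Quot J\<^esub>"
      using c by (simp only: a_minus_def Q.r_neg)
  next
    assume "(J +> x) \<ominus>\<^bsub>R Quot J\<^esub> (J +> y) = \<zero>\<^bsub>R Quot J\<^esub>"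
    then show "J +> x = J +> y" by (rule Q.minus_eq_zeroD[OF _ c])
  qed
  also have "\<dots> \<longleftrightarrow> x \<ominus> y \<in> J" unfolding m[symmetric] quot_zero using coset_eq_zero[OF J] x by simp
  finally show ?thesis .
qed

lemma coset_mem:
  assumes J: "ideal J R" and x: "x \<in> carrier R" and z: "z \<in> J +> x"
  shows "z \<in> carrier R" "z \<ominus> x \<in> J"
proof -
  interpret J: ideal J R by fact
  show zc: "z \<in> carrier R" using J.a_elemrcos_carrier[OF x z] .
  show "z \<ominus> x \<in> J" using J.a_rcos_module_minus[OF ring_axioms x zc] z by simp
qed

lemma coset_self:
  assumes "ideal J R" "x \<in> carrier R"
  shows "x \<in> J +> x"
proof -
  interpret J: ideal J R by fact
  show ?thesis by (rule J.a_rcos_self[OF assms(2)])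
qed

end

section \<open>The associated graded group of a decreasing family of ideals\<close>

locale ideal_family = cring R for R :: "('a, 'b) ring_scheme" (structure) +
  fixes F :: "('s::finite \<Rightarrow> int) \<Rightarrow> 'a set"
  assumes F_id: "ideal (F n) R" and F_anti: "n \<le> m \<Longrightarrow> F m \<subseteq> F n"
begin

lemma Fc: "x \<in> F n \<Longrightarrow> x \<in> carrier R" using ideal.Icarr[OF F_id] .
lemma F_zero: "\<zero> \<in> F n" using additive_subgroup.zero_closed[OF ideal.axioms(1)[OF F_id]] .
lemma F_add: "x \<in> F n \<Longrightarrow> y \<in> F n \<Longrightarrow> x \<oplus> y \<in> F n"
  using additive_subgroup.a_closed[OF ideal.axioms(1)[OF F_id]] .
lemma F_neg: "x \<in> F n \<Longrightarrow> \<ominus> x \<in> F n"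
  using additive_subgroup.a_inv_closed[OF ideal.axioms(1)[OF F_id]] .
lemma F_finsum: "(\<And>i. i \<in> A \<Longrightarrow> f i \<in> F n) \<Longrightarrow> (\<Oplus>i\<in>A. f i) \<in> F n"
  by (rule subgroup_finsum_closed) (use F_zero F_add Fc in auto)
lemma F_mult: "r \<in> carrier R \<Longrightarrow> x \<in> F n \<Longrightarrow> r \<otimes> x \<in> F n" by (rule ideal.I_l_closed[OF F_id])
lemma F_suc: "x \<in> F (n + 1) \<Longrightarrow> x \<in> F n" using F_anti[of n "n + 1"] by (auto simp: le_fun_def)

abbreviation G where "G \<equiv> assoc_graded R F"

definition cls :: "(('s \<Rightarrow> int) \<Rightarrow> 'a) \<Rightarrow> ('s \<Rightarrow> int) \<Rightarrow> 'a set" where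
  "cls u = (\<lambda>n\<in>{0..}. F (n + 1) +> u n)"

text \<open>Families of representatives with finite support. Computing with them and applying
  \<open>cls\<close> avoids choices of representatives inside later proofs.\<close>

definition lifts :: "(('s \<Rightarrow> int) \<Rightarrow> 'a) set" where
  "lifts = {u. (\<forall>n. 0 \<le> n \<longrightarrow> u n \<in> F n) \<and> finite {n. 0 \<le> n \<and> u n \<noteq> \<zero>}}"

lemma liftsD: "u \<in> lifts \<Longrightarrow> 0 \<le> n \<Longrightarrow> u n \<in> F n" by (simp add: lifts_def)
lemma liftsc: "u \<in> lifts \<Longrightarrow> 0 \<le> n \<Longrightarrow> u n \<in> carrier R" by (rule Fc[OF liftsD])
lemma lifts_fin: "u \<in> lifts \<Longrightarrow> finite {n. 0 \<le> n \<and> u n \<noteq> \<zero>}" by (simp add: lifts_def)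

lemma cls_eval: "0 \<le> n \<Longrightarrow> cls u n = F (n + 1) +> u n" by (simp add: cls_def)

lemma cls_eqI: "(\<And>n. 0 \<le> n \<Longrightarrow> F (n + 1) +> u n = F (n + 1) +> v n) \<Longrightarrow> cls u = cls v"
  unfolding cls_def by (rule restrict_ext) simp

lemma G_carrier: "carrier G = cls ` lifts"
proof
  show "cls ` lifts \<subseteq> carrier G"
  proof (rule image_subsetI)
    fix u assume u: "u \<in> lifts"
    have "{n \<in> {0..}. cls u n \<noteq> F (n + 1)} \<subseteq> {n. 0 \<le> n \<and> u n \<noteq> \<zero>}"
      by (auto simp: cls_eval coset_zero[OF F_id])
    then have "finite {n \<in> {0..}. cls u n \<noteq> F (n + 1)}" by (rule finite_subset[OF _ lifts_fin[OF u]])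
    moreover have "cls u \<in> (\<Pi>\<^sub>E n\<in>{0..}. (\<lambda>x. F (n + 1) +> x) ` F n)"
      using liftsD[OF u] by (auto simp: cls_def)
    ultimately show "cls u \<in> carrier G" by (simp add: assoc_graded_def)
  qed
  show "carrier G \<subseteq> cls ` lifts"
  proof
    fix v assume "v \<in> carrier G"
    then have v: "v \<in> (\<Pi>\<^sub>E n\<in>{0..}. (\<lambda>x. F (n + 1) +> x) ` F n)" "finite {n \<in> {0..}. v n \<noteq> F (n + 1)}"
      by (simp_all add: assoc_graded_def)
    have "\<forall>n. \<exists>x. 0 \<le> n \<longrightarrow> x \<in> F n \<and> v n = F (n + 1) +> x"
      using PiE_mem[OF v(1)] by fastforce
    then obtain x where x: "\<And>n. 0 \<le> n \<Longrightarrow> x n \<in> F n \<and> v n = F (n + 1) +> x n" by metis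
    \<comment> \<open>Zero is chosen wherever the coset is trivial; an arbitrary representative
      could destroy the finite support.\<close>
    define u where "u = (\<lambda>n. if v n = F (n + 1) then \<zero> else x n)"
    have "{n. 0 \<le> n \<and> u n \<noteq> \<zero>} \<subseteq> {n \<in> {0..}. v n \<noteq> F (n + 1)}" by (auto simp: u_def)
    then have "finite {n. 0 \<le> n \<and> u n \<noteq> \<zero>}" by (rule finite_subset[OF _ v(2)])
    then have "u \<in> lifts" using x F_zero unfolding lifts_def by (simp add: u_def)
    moreover have "v = cls u"
    proof (rule PiE_ext[OF v(1)])
      show "cls u \<in> (\<Pi>\<^sub>E n\<in>{0..}. (\<lambda>x. F (n + 1) +> x) ` F n)"
        using liftsD[OF \<open>u \<in> lifts\<close>] by (auto simp: cls_def)
      fix n :: "'s \<Rightarrow> int" assume "n \<in> {0..}"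
      then show "v n = cls u n" using x[of n] by (simp add: cls_eval u_def coset_zero[OF F_id])
    qed
    ultimately show "v \<in> cls ` lifts" by blast
  qed
qed

lemma G_cases: assumes "v \<in> carrier G" obtains u where "u \<in> lifts" "v = cls u"
  using assms unfolding G_carrier by blast

lemma cls_closed: "u \<in> lifts \<Longrightarrow> cls u \<in> carrier G" unfolding G_carrier by blast

lemma G_zero: "\<zero>\<^bsub>G\<^esub> = cls (\<lambda>n. \<zero>)"
  unfolding assoc_graded_def cls_def by (auto simp: coset_zero[OF F_id] intro!: restrict_ext)

lemma lifts_zero: "(\<lambda>n. \<zero>) \<in> lifts" by (simp add: lifts_def F_zero)

lemma lifts_add: "u \<in> lifts \<Longrightarrow> v \<in> lifts \<Longrightarrow> (\<lambda>n. u n \<oplus> v n) \<in> lifts"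
proof -
  assume uv: "u \<in> lifts" "v \<in> lifts"
  have "{n. 0 \<le> n \<and> u n \<oplus> v n \<noteq> \<zero>} \<subseteq> {n. 0 \<le> n \<and> u n \<noteq> \<zero>} \<union> {n. 0 \<le> n \<and> v n \<noteq> \<zero>}" by auto
  then have "finite {n. 0 \<le> n \<and> u n \<oplus> v n \<noteq> \<zero>}"
    by (rule finite_subset) (rule finite_UnI[OF lifts_fin[OF uv(1)] lifts_fin[OF uv(2)]])
  then show ?thesis using uv by (simp add: lifts_def F_add)
qed

lemma lifts_neg: "u \<in> lifts \<Longrightarrow> (\<lambda>n. \<ominus> u n) \<in> lifts"
proof -
  assume u: "u \<in> lifts"
  have "\<ominus> \<zero> = \<zero>" by (rule minus_equality) auto
  then have "{n. 0 \<le> n \<and> \<ominus> u n \<noteq> \<zero>} \<subseteq> {n. 0 \<le> n \<and> u n \<noteq> \<zero>}" by auto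
  then have "finite {n. 0 \<le> n \<and> \<ominus> u n \<noteq> \<zero>}" by (rule finite_subset[OF _ lifts_fin[OF u]])
  then show ?thesis using u by (simp add: lifts_def F_neg)
qed

lemma G_add: "u \<in> lifts \<Longrightarrow> v \<in> lifts \<Longrightarrow> cls u \<oplus>\<^bsub>G\<^esub> cls v = cls (\<lambda>n. u n \<oplus> v n)"
proof -
  assume uv: "u \<in> lifts" "v \<in> lifts"
  have "cls u \<oplus>\<^bsub>G\<^esub> cls v = (\<lambda>n\<in>{0..}. cls u n <+> cls v n)" by (simp add: assoc_graded_def)
  also have "\<dots> = cls (\<lambda>n. u n \<oplus> v n)"
    unfolding cls_def[of "\<lambda>n. u n \<oplus> v n"]
    by (rule restrict_ext) (use uv in \<open>simp add: cls_eval coset_add[OF F_id] liftsc\<close>)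
  finally show ?thesis .
qed

lemma G_group: "abelian_group G"
proof (rule abelian_groupI)
  show "x \<oplus>\<^bsub>G\<^esub> y \<in> carrier G" if xy: "x \<in> carrier G" "y \<in> carrier G" for x y
  proof -
    obtain u v where "u \<in> lifts" "x = cls u" "v \<in> lifts" "y = cls v" using xy unfolding G_carrier by blast
    then show ?thesis by (simp add: G_add cls_closed lifts_add)
  qed
  show "\<zero>\<^bsub>G\<^esub> \<in> carrier G" unfolding G_zero by (rule cls_closed[OF lifts_zero])
  show "x \<oplus>\<^bsub>G\<^esub> y \<oplus>\<^bsub>G\<^esub> z = x \<oplus>\<^bsub>G\<^esub> (y \<oplus>\<^bsub>G\<^esub> z)"
    if xyz: "x \<in> carrier G" "y \<in> carrier G" "z \<in> carrier G" for x y z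
  proof -
    obtain u v w where u: "u \<in> lifts" "x = cls u" "v \<in> lifts" "y = cls v" "w \<in> lifts" "z = cls w"
      using xyz unfolding G_carrier by blast
    have "cls (\<lambda>n. u n \<oplus> v n \<oplus> w n) = cls (\<lambda>n. u n \<oplus> (v n \<oplus> w n))"
      by (rule cls_eqI) (use u liftsc in \<open>simp add: a_assoc\<close>)
    then show ?thesis using u by (simp add: G_add lifts_add)
  qed
  show "x \<oplus>\<^bsub>G\<^esub> y = y \<oplus>\<^bsub>G\<^esub> x" if xy: "x \<in> carrier G" "y \<in> carrier G" for x y
  proof -
    obtain u v where u: "u \<in> lifts" "x = cls u" "v \<in> lifts" "y = cls v" using xy unfolding G_carrier by blast
    have "cls (\<lambda>n. u n \<oplus> v n) = cls (\<lambda>n. v n \<oplus> u n)"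
      by (rule cls_eqI) (use u liftsc in \<open>simp add: a_comm\<close>)
    then show ?thesis using u by (simp add: G_add)
  qed
  show "\<zero>\<^bsub>G\<^esub> \<oplus>\<^bsub>G\<^esub> x = x" if x: "x \<in> carrier G" for x
  proof -
    obtain u where u: "u \<in> lifts" "x = cls u" using x by (rule G_cases)
    have "cls (\<lambda>n. \<zero> \<oplus> u n) = cls u" by (rule cls_eqI) (use u liftsc in simp)
    then show ?thesis using u by (simp add: G_zero G_add lifts_zero)
  qed
  show "\<exists>y\<in>carrier G. y \<oplus>\<^bsub>G\<^esub> x = \<zero>\<^bsub>G\<^esub>" if x: "x \<in> carrier G" for x
  proof -
    obtain u where u: "u \<in> lifts" "x = cls u" using x by (rule G_cases)
    have "cls (\<lambda>n. \<ominus> u n \<oplus> u n) = cls (\<lambda>n. \<zero>)" by (rule cls_eqI) (use u liftsc in \<open>simp add: l_neg\<close>)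
    then have "cls (\<lambda>n. \<ominus> u n) \<oplus>\<^bsub>G\<^esub> x = \<zero>\<^bsub>G\<^esub>" using u by (simp add: G_zero G_add lifts_neg)
    then show ?thesis using cls_closed[OF lifts_neg[OF u(1)]] by blast
  qed
qed

sublocale G: abelian_group G by (rule G_group)

lemma G_ev: assumes "0 \<le> n" shows "additive_map G (R Quot F (n + 1)) (\<lambda>v. v n)"
  unfolding additive_map_def
proof (intro conjI ballI funcsetI)
  fix x assume "x \<in> carrier G"
  then obtain u where "u \<in> lifts" "x = cls u" by (rule G_cases)
  then show "x n \<in> carrier (R Quot F (n + 1))"
    using assms additive_map_closed[OF coset_hom[OF F_id]] liftsc by (simp add: cls_eval)
  fix y assume "y \<in> carrier G"
  then obtain v where "v \<in> lifts" "y = cls v" by (rule G_cases)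
  then show "(x \<oplus>\<^bsub>G\<^esub> y) n = x n \<oplus>\<^bsub>R Quot F (n + 1)\<^esub> y n"
    using \<open>u \<in> lifts\<close> \<open>x = cls u\<close> assms liftsc
    by (simp add: G_add cls_eval additive_map_add[OF coset_hom[OF F_id]])
qed

lemma G_eqI:
  assumes "x \<in> carrier G" "y \<in> carrier G" "\<And>n. 0 \<le> n \<Longrightarrow> x n = y n"
  shows "x = y"
proof -
  obtain u v where u: "u \<in> lifts" "x = cls u" "v \<in> lifts" "y = cls v" using assms(1,2) unfolding G_carrier by blast
  then show ?thesis using assms(3) by (auto simp: cls_eval intro!: cls_eqI)
qed

lemma G_zero_eval: "0 \<le> n \<Longrightarrow> \<zero>\<^bsub>G\<^esub> n = F (n + 1)"
  unfolding G_zero by (simp add: cls_eval coset_zero[OF F_id])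

text \<open>The class of \<open>x\<close> in degree \<open>n\<close>. If \<open>n\<close> has a
  negative entry this is zero, since \<open>cls\<close> looks at nonnegative degrees only.\<close>

definition hm :: "('s \<Rightarrow> int) \<Rightarrow> 'a \<Rightarrow> ('s \<Rightarrow> int) \<Rightarrow> 'a set" where
  "hm n x = cls (\<lambda>k. if k = n then x else \<zero>)"

lemma delta_lifts: "x \<in> F n \<Longrightarrow> (\<lambda>k. if k = n then x else \<zero>) \<in> lifts"
proof -
  assume x: "x \<in> F n"
  have "{k. 0 \<le> k \<and> (if k = n then x else \<zero>) \<noteq> \<zero>} \<subseteq> {n}" by auto
  then have "finite {k. 0 \<le> k \<and> (if k = n then x else \<zero>) \<noteq> \<zero>}" by (rule finite_subset) simp
  then show ?thesis using x F_zero unfolding lifts_def by simp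
qed

lemma hm_eval: "0 \<le> k \<Longrightarrow> hm n x k = (if k = n then F (n + 1) +> x else F (k + 1))"
  unfolding hm_def by (simp add: cls_eval coset_zero[OF F_id])

lemma hm_closed: "x \<in> F n \<Longrightarrow> hm n x \<in> carrier G"
  unfolding hm_def by (rule cls_closed[OF delta_lifts])

lemma hm_add: "x \<in> F n \<Longrightarrow> y \<in> F n \<Longrightarrow> hm n x \<oplus>\<^bsub>G\<^esub> hm n y = hm n (x \<oplus> y)"
proof -
  assume xy: "x \<in> F n" "y \<in> F n"
  have "(\<lambda>k. (if k = n then x else \<zero>) \<oplus> (if k = n then y else \<zero>)) = (\<lambda>k. if k = n then x \<oplus> y else \<zero>)" by auto
  then show ?thesis unfolding hm_def using xy by (simp add: G_add delta_lifts)
qed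

lemma hm_zero: "hm n \<zero> = \<zero>\<^bsub>G\<^esub>"
  unfolding hm_def G_zero by simp

lemma hm_eqD:
  assumes "0 \<le> n" "x \<in> F n" "y \<in> F n" "hm n x = hm n y"
  shows "x \<ominus> y \<in> F (n + 1)"
proof -
  have "hm n x n = hm n y n" using assms(4) by simp
  then have "F (n + 1) +> x = F (n + 1) +> y" using assms(1) by (simp add: hm_eval)
  then show ?thesis using coset_eq_iff[OF F_id Fc[OF assms(2)] Fc[OF assms(3)]] by simp
qed

abbreviation gG where "gG \<equiv> gr_component R F"

lemma gG_I: "x \<in> F n \<Longrightarrow> hm n x \<in> gG n"
  unfolding gr_component_def by (simp add: hm_closed hm_eval)

lemma gG_eq: "0 \<le> n \<Longrightarrow> gG n = hm n ` F n"
proof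
  assume n: "0 \<le> n"
  show "hm n ` F n \<subseteq> gG n"
    by (rule image_subsetI) (rule gG_I)
  show "gG n \<subseteq> hm n ` F n"
  proof
    fix v assume "v \<in> gG n"
    then have v: "v \<in> carrier G" "\<And>k. 0 \<le> k \<Longrightarrow> k \<noteq> n \<Longrightarrow> v k = F (k + 1)" by (simp_all add: gr_component_def)
    obtain u where u: "u \<in> lifts" "v = cls u" using v(1) by (rule G_cases)
    have un: "u n \<in> F n" using liftsD[OF u(1) n] .
    have "v = hm n (u n)"
    proof (rule G_eqI[OF v(1) hm_closed[OF un]])
      fix k :: "'s \<Rightarrow> int" assume "0 \<le> k"
      then show "v k = hm n (u n) k" using v(2)[of k] u(2) by (cases "k = n") (simp_all add: hm_eval cls_eval)
    qed
    then show "v \<in> hm n ` F n" using un by blast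
  qed
qed

lemma gG_neg: "\<not> 0 \<le> n \<Longrightarrow> gG n = {\<zero>\<^bsub>G\<^esub>}"
proof
  assume n: "\<not> 0 \<le> n"
  show "gG n \<subseteq> {\<zero>\<^bsub>G\<^esub>}"
  proof
    fix v assume "v \<in> gG n"
    then have v: "v \<in> carrier G" "\<And>k. 0 \<le> k \<Longrightarrow> k \<noteq> n \<Longrightarrow> v k = F (k + 1)" by (simp_all add: gr_component_def)
    have "v = \<zero>\<^bsub>G\<^esub>"
    proof (rule G_eqI[OF v(1) G.zero_closed])
      fix k :: "'s \<Rightarrow> int" assume k: "0 \<le> k"
      then have "k \<noteq> n" using n by blast
      then show "v k = \<zero>\<^bsub>G\<^esub> k" using v(2) k by (simp add: G_zero_eval)
    qed
    then show "v \<in> {\<zero>\<^bsub>G\<^esub>}" by simp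
  qed
  show "{\<zero>\<^bsub>G\<^esub>} \<subseteq> gG n" by (simp add: gr_component_def G_zero_eval)
qed

lemma gG_closed: "v \<in> gG n \<Longrightarrow> v \<in> carrier G" by (simp add: gr_component_def)

lemma gG_cases:
  assumes "v \<in> gG n"
  obtains "v = \<zero>\<^bsub>G\<^esub>" | x where "0 \<le> n" "x \<in> F n" "v = hm n x"
proof (cases "0 \<le> n")
  case True
  then have "v \<in> hm n ` F n" using assms gG_eq by blast
  then show thesis using True that(2) by blast
next
  case False
  then show thesis using assms gG_neg that(1) by blast
qed

lemma gG_zero: "\<zero>\<^bsub>G\<^esub> \<in> gG n" by (simp add: gr_component_def G_zero_eval)

lemma gG_sub: "additive_subgroup (gG n) G"
proof (rule additive_subgroupI, rule G.add.subgroupI)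
  show "gG n \<subseteq> carrier G" using gG_closed by blast
  show "gG n \<noteq> {}" using gG_zero by blast
  show "v \<oplus>\<^bsub>G\<^esub> w \<in> gG n" if v: "v \<in> gG n" "w \<in> gG n" for v w
  proof (cases "0 \<le> n")
    case True
    then obtain x y where "x \<in> F n" "v = hm n x" "y \<in> F n" "w = hm n y" using v gG_eq by auto
    then show ?thesis using hm_add gG_I F_add by simp
  next
    case False
    then show ?thesis using v gG_neg by simp
  qed
  show "\<ominus>\<^bsub>G\<^esub> v \<in> gG n" if v: "v \<in> gG n" for v
  proof (cases "0 \<le> n")
    case True
    then obtain x where x: "x \<in> F n" "v = hm n x" using v gG_eq by auto
    have "hm n (\<ominus> x) \<oplus>\<^bsub>G\<^esub> v = \<zero>\<^bsub>G\<^esub>"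
      using x hm_add[OF F_neg[OF x(1)] x(1)] Fc[OF x(1)] by (simp add: l_neg hm_zero)
    then have "\<ominus>\<^bsub>G\<^esub> v = hm n (\<ominus> x)"
      using G.minus_equality[of "hm n (\<ominus> x)" v] gG_closed[OF v] hm_closed[OF F_neg[OF x(1)]] by simp
    then show ?thesis using gG_I[OF F_neg[OF x(1)]] by simp
  next
    case False
    then have "v = \<zero>\<^bsub>G\<^esub>" using v gG_neg by blast
    moreover have "\<ominus>\<^bsub>G\<^esub> \<zero>\<^bsub>G\<^esub> = \<zero>\<^bsub>G\<^esub>" by (rule G.minus_equality) auto
    ultimately show ?thesis using gG_zero by simp
  qed
qed

lemma gG_disj: "v \<in> gG a \<Longrightarrow> v \<in> gG b \<Longrightarrow> a \<noteq> b \<Longrightarrow> v = \<zero>\<^bsub>G\<^esub>"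
proof -
  assume v: "v \<in> gG a" "v \<in> gG b" and ab: "a \<noteq> b"
  show "v = \<zero>\<^bsub>G\<^esub>"
  proof (rule G_eqI[OF gG_closed[OF v(1)] G.zero_closed])
    fix n :: "'s \<Rightarrow> int" assume n: "0 \<le> n"
    have "n \<noteq> a \<or> n \<noteq> b" using ab by blast
    then have "v n = F (n + 1)" using v n unfolding gr_component_def by fastforce
    then show "v n = \<zero>\<^bsub>G\<^esub> n" unfolding G_zero_eval[OF n] .
  qed
qed

lemma G_hom_decomp:
  assumes u: "u \<in> lifts"
  shows "cls u = (\<Oplus>\<^bsub>G\<^esub>n\<in>{n. 0 \<le> n \<and> u n \<noteq> \<zero>}. hm n (u n))"
proof -
  let ?Q = "{n. 0 \<le> n \<and> u n \<noteq> \<zero>}"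
  have f: "(\<lambda>n. hm n (u n)) \<in> ?Q \<rightarrow> carrier G" using hm_closed liftsD[OF u] by auto
  have fin: "finite ?Q" by (rule lifts_fin[OF u])
  show ?thesis
  proof (rule G_eqI[OF cls_closed[OF u]])
    show "(\<Oplus>\<^bsub>G\<^esub>n\<in>?Q. hm n (u n)) \<in> carrier G" using f by (rule G.finsum_closed)
    fix k :: "'s \<Rightarrow> int" assume k: "0 \<le> k"
    let ?q = "R Quot F (k + 1)"
    interpret q: abelian_group ?q by (rule quot_group[OF F_id])
    have "(\<Oplus>\<^bsub>G\<^esub>n\<in>?Q. hm n (u n)) k = (\<Oplus>\<^bsub>?q\<^esub>n\<in>?Q. hm n (u n) k)"
      by (rule additive_map_finsum[OF G_group quot_group[OF F_id] G_ev[OF k] f])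
    also have "\<dots> = F (k + 1) +> u k"
    proof (cases "u k = \<zero>")
      case True
      then have "hm n (u n) k = \<zero>\<^bsub>?q\<^esub>" if "n \<in> ?Q" for n using that k by (auto simp: hm_eval quot_zero)
      then have "(\<Oplus>\<^bsub>?q\<^esub>n\<in>?Q. hm n (u n) k) = \<zero>\<^bsub>?q\<^esub>" by (rule q.add.finprod_one_eqI)
      then show ?thesis using True by (simp add: quot_zero coset_zero[OF F_id])
    next
      case False
      have "(\<Oplus>\<^bsub>?q\<^esub>n\<in>?Q. hm n (u n) k) = hm k (u k) k"
      proof (rule q.finsum_single[OF fin])
        show "hm k (u k) k \<in> carrier ?q"
          using additive_map_closed[OF G_ev[OF k] hm_closed[OF liftsD[OF u k]]] .
      qed (use False k in \<open>auto simp: hm_eval quot_zero\<close>)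
      then show ?thesis using k by (simp add: hm_eval)
    qed
    finally show "cls u k = (\<Oplus>\<^bsub>G\<^esub>n\<in>?Q. hm n (u n)) k" using k by (simp add: cls_eval)
  qed
qed

end

section \<open>One filtration acting on another\<close>

locale filtration_pair = cring R + E: ideal_family R E + F: ideal_family R F
  for R :: "('a, 'b) ring_scheme" (structure) and E F :: "('s::finite \<Rightarrow> int) \<Rightarrow> 'a set" +
  assumes EE: "x \<in> E n \<Longrightarrow> y \<in> E m \<Longrightarrow> x \<otimes> y \<in> E (n + m)"
    and EF: "x \<in> E n \<Longrightarrow> y \<in> F m \<Longrightarrow> x \<otimes> y \<in> F (n + m)"
    and E_one: "\<one> \<in> E 0"
begin

text \<open>The ring multiplication of $G(E)$ is its action on itself, so facts about the action
  yield the corresponding facts about the ring.\<close>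

lemma pair_EE: "filtration_pair R E E"
  by (intro filtration_pair.intro filtration_pair_axioms.intro E.ideal_family_axioms is_cring) (rule EE E_one; assumption)+

text \<open>The union in \<open>gr_mult\<close> is a single coset:
  \<open>xy - uv = (x - u) y + u (y - v)\<close>, and both summands lie in
  \<open>F (a + b + 1)\<close>. For the first one \<open>y \<in> F b\<close> is used, which holds as
  \<open>F (b + 1) \<subseteq> F b\<close>.\<close>

lemma coset_prod:
  assumes u: "u \<in> E a" and v: "v \<in> F b"
  shows "(\<Union>x\<in>E (a + 1) +> u. \<Union>y\<in>F (b + 1) +> v. F (a + b + 1) +> (x \<otimes> y)) = F (a + b + 1) +> (u \<otimes> v)"
proof -
  have uc: "u \<in> carrier R" and vc: "v \<in> carrier R" using E.Fc[OF u] F.Fc[OF v] .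
  have "F (a + b + 1) +> (x \<otimes> y) = F (a + b + 1) +> (u \<otimes> v)" if x: "x \<in> E (a + 1) +> u" and y: "y \<in> F (b + 1) +> v" for x y
  proof -
    have xc: "x \<in> carrier R" "x \<ominus> u \<in> E (a + 1)" by (rule coset_mem[OF E.F_id uc x])+
    have yc: "y \<in> carrier R" "y \<ominus> v \<in> F (b + 1)" by (rule coset_mem[OF F.F_id vc y])+
    have "y = (y \<ominus> v) \<oplus> v" using yc vc by (simp add: a_minus_def a_assoc l_neg)
    moreover have "(y \<ominus> v) \<oplus> v \<in> F b" by (rule F.F_add[OF F.F_suc[OF yc(2)] v])
    ultimately have yb: "y \<in> F b" by simp
    have "(x \<ominus> u) \<otimes> y \<in> F (a + b + 1)"
      using EF[OF xc(2) yb] by (simp add: add.assoc add.commute[of 1])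
    moreover have "u \<otimes> (y \<ominus> v) \<in> F (a + b + 1)" using EF[OF u yc(2)] by (simp add: add.assoc)
    moreover have "(x \<otimes> y) \<ominus> (u \<otimes> v) = (x \<ominus> u) \<otimes> y \<oplus> u \<otimes> (y \<ominus> v)"
    proof -
      have "(x \<ominus> u) \<otimes> y \<oplus> u \<otimes> (y \<ominus> v) = x \<otimes> y \<oplus> (\<ominus> (u \<otimes> y) \<oplus> u \<otimes> y) \<oplus> \<ominus> (u \<otimes> v)"
        using xc(1) yc(1) uc vc by (simp add: a_minus_def l_distr r_distr l_minus r_minus a_assoc)
      then show ?thesis using xc(1) yc(1) uc vc by (simp add: a_minus_def l_neg)
    qed
    ultimately have "(x \<otimes> y) \<ominus> (u \<otimes> v) \<in> F (a + b + 1)" using F.F_add by simp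
    then show ?thesis using coset_eq_iff[OF F.F_id, of "x \<otimes> y" "u \<otimes> v" "a + b + 1"] xc(1) yc(1) uc vc by simp
  qed
  then show ?thesis using coset_self[OF E.F_id uc, of "a + 1"] coset_self[OF F.F_id vc, of "b + 1"] by fast
qed

lemma gr_mult_cls:
  assumes u: "u \<in> E.lifts" and v: "v \<in> F.lifts"
  shows "gr_mult R F (E.cls u) (F.cls v) = F.cls (conv u v)"
  unfolding gr_mult_def F.cls_def[of "conv u v"]
proof (rule restrict_ext)
  fix n :: "'s \<Rightarrow> int" assume "n \<in> {0..}"
  then have n: "0 \<le> n" by simp
  let ?J = "F (n + 1)"
  interpret Q: abelian_group "R Quot ?J" by (rule quot_group[OF F.F_id])
  have c: "u a \<otimes> v (n - a) \<in> carrier R" if "a \<in> {0..n}" for a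
    using E.liftsc[OF u] F.liftsc[OF v] that by simp
  have "(\<Oplus>\<^bsub>R Quot ?J\<^esub>a\<in>{0..n}. \<Union>x\<in>E.cls u a. \<Union>y\<in>F.cls v (n - a). ?J +> (x \<otimes> y))
    = (\<Oplus>\<^bsub>R Quot ?J\<^esub>a\<in>{0..n}. ?J +> (u a \<otimes> v (n - a)))"
  proof (rule Q.finsum_cong')
    fix a assume a: "a \<in> {0..n}"
    then have a': "0 \<le> a" "0 \<le> n - a" by auto
    have e: "a + (n - a) + 1 = n + 1" by simp
    show "(\<Union>x\<in>E.cls u a. \<Union>y\<in>F.cls v (n - a). ?J +> (x \<otimes> y)) = ?J +> (u a \<otimes> v (n - a))"
      using coset_prod[OF E.liftsD[OF u a'(1)] F.liftsD[OF v a'(2)]]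
      unfolding E.cls_eval[OF a'(1)] F.cls_eval[OF a'(2)] e .
  qed (use c additive_map_closed[OF coset_hom[OF F.F_id]] in simp_all)
  also have "\<dots> = ?J +> conv u v n"
    unfolding conv_def using c
    by (intro additive_map_finsum[OF abelian_group_axioms quot_group[OF F.F_id] coset_hom[OF F.F_id], symmetric]) simp
  finally show "(\<Oplus>\<^bsub>R Quot ?J\<^esub>a\<in>{0..n}. \<Union>x\<in>E.cls u a. \<Union>y\<in>F.cls v (n - a). ?J +> (x \<otimes> y)) = ?J +> conv u v n" .
qed

text \<open>A nonzero value at \<open>n\<close> needs a nonzero product of values in degrees adding
  up to \<open>n\<close>, so the support lies in the sum of two finite sets.\<close>

lemma conv_lifts:
  assumes u: "u \<in> E.lifts" and v: "v \<in> F.lifts"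
  shows "conv u v \<in> F.lifts"
proof -
  let ?U = "{n. 0 \<le> n \<and> u n \<noteq> \<zero>}" and ?V = "{n. 0 \<le> n \<and> v n \<noteq> \<zero>}"
  have "{n. 0 \<le> n \<and> conv u v n \<noteq> \<zero>} \<subseteq> (\<lambda>(a, b). a + b) ` (?U \<times> ?V)"
  proof
    fix n assume "n \<in> {n. 0 \<le> n \<and> conv u v n \<noteq> \<zero>}"
    then have n: "0 \<le> n" "conv u v n \<noteq> \<zero>" by auto
    have "\<exists>a\<in>{0..n}. u a \<otimes> v (n - a) \<noteq> \<zero>"
    proof (rule ccontr)
      assume "\<not> (\<exists>a\<in>{0..n}. u a \<otimes> v (n - a) \<noteq> \<zero>)"
      then have "conv u v n = \<zero>" unfolding conv_def by (intro add.finprod_one_eqI) blast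
      then show False using n by blast
    qed
    then obtain a where a: "0 \<le> a" "a \<le> n" "u a \<otimes> v (n - a) \<noteq> \<zero>" by auto
    then have "u a \<noteq> \<zero>" "v (n - a) \<noteq> \<zero>"
      using E.liftsc[OF u, of a] F.liftsc[OF v, of "n - a"] by auto
    then show "n \<in> (\<lambda>(a, b). a + b) ` (?U \<times> ?V)" using a by (intro image_eqI[of _ _ "(a, n - a)"]) auto
  qed
  then have "finite {n. 0 \<le> n \<and> conv u v n \<noteq> \<zero>}"
    by (rule finite_subset) (intro finite_imageI finite_cartesian_product E.lifts_fin[OF u] F.lifts_fin[OF v])
  moreover have "conv u v n \<in> F n" if "0 \<le> n" for n
    unfolding conv_def
  proof (rule F.F_finsum)
    fix a assume "a \<in> {0..n}"
    then have "0 \<le> a" "0 \<le> n - a" by auto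
    then show "u a \<otimes> v (n - a) \<in> F n" using EF[OF E.liftsD[OF u] F.liftsD[OF v], of a "n - a"] by simp
  qed
  ultimately show ?thesis unfolding F.lifts_def by simp
qed

lemma G_smult: "u \<in> E.lifts \<Longrightarrow> v \<in> F.lifts \<Longrightarrow> E.cls u \<odot>\<^bsub>F.G\<^esub> F.cls v = F.cls (conv u v)"
  using gr_mult_cls by (simp add: assoc_graded_def)

lemma G_mult: "u \<in> E.lifts \<Longrightarrow> v \<in> E.lifts \<Longrightarrow> E.cls u \<otimes>\<^bsub>E.G\<^esub> E.cls v = E.cls (conv u v)"
  using filtration_pair.gr_mult_cls[OF pair_EE] by (simp add: assoc_graded_def)

lemmas conv_lifts_E = filtration_pair.conv_lifts[OF pair_EE]

definition unit_lift :: "('s \<Rightarrow> int) \<Rightarrow> 'a" where "unit_lift = (\<lambda>k. if k = 0 then \<one> else \<zero>)"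

lemma unit_lift: "unit_lift \<in> E.lifts" unfolding unit_lift_def by (rule E.delta_lifts[OF E_one])

lemma G_one: "\<one>\<^bsub>E.G\<^esub> = E.cls unit_lift"
  unfolding assoc_graded_def E.cls_def unit_lift_def by (auto intro!: restrict_ext simp: coset_zero[OF E.F_id])

lemma conv_unit: "(\<And>n. 0 \<le> n \<Longrightarrow> v n \<in> carrier R) \<Longrightarrow> 0 \<le> n \<Longrightarrow> conv unit_lift v n = v n"
  unfolding unit_lift_def by (subst conv_delta) auto

text \<open>Every element is the class of a lift and multiplication is convolution of lifts, so each
  law is an identity for \<open>conv\<close>.\<close>

lemma G_cring: "cring E.G"
proof (rule cringI)
  show "abelian_group E.G" by (rule E.G_group)
  show "comm_monoid E.G"
  proof (rule comm_monoidI)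
    show "x \<otimes>\<^bsub>E.G\<^esub> y \<in> carrier E.G" if xy: "x \<in> carrier E.G" "y \<in> carrier E.G" for x y
    proof -
      obtain u v where "u \<in> E.lifts" "x = E.cls u" "v \<in> E.lifts" "y = E.cls v" using xy unfolding E.G_carrier by blast
      then show ?thesis by (simp add: G_mult E.cls_closed conv_lifts_E)
    qed
    show "\<one>\<^bsub>E.G\<^esub> \<in> carrier E.G" unfolding G_one by (rule E.cls_closed[OF unit_lift])
    show "x \<otimes>\<^bsub>E.G\<^esub> y \<otimes>\<^bsub>E.G\<^esub> z = x \<otimes>\<^bsub>E.G\<^esub> (y \<otimes>\<^bsub>E.G\<^esub> z)"
      if xyz: "x \<in> carrier E.G" "y \<in> carrier E.G" "z \<in> carrier E.G" for x y z
    proof -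
      obtain u v w where u: "u \<in> E.lifts" "x = E.cls u" "v \<in> E.lifts" "y = E.cls v" "w \<in> E.lifts" "z = E.cls w"
        using xyz unfolding E.G_carrier by blast
      have "conv (conv u v) w = conv u (conv v w)"
        by (rule ext, rule conv_assoc) (use u E.liftsc in auto)
      then show ?thesis using u by (simp add: G_mult conv_lifts_E)
    qed
    show "x \<otimes>\<^bsub>E.G\<^esub> y = y \<otimes>\<^bsub>E.G\<^esub> x" if xy: "x \<in> carrier E.G" "y \<in> carrier E.G" for x y
    proof -
      obtain u v where u: "u \<in> E.lifts" "x = E.cls u" "v \<in> E.lifts" "y = E.cls v" using xy unfolding E.G_carrier by blast
      have "conv u v = conv v u" by (rule ext, rule conv_comm) (use u E.liftsc in auto)
      then show ?thesis using u by (simp add: G_mult)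
    qed
    show "\<one>\<^bsub>E.G\<^esub> \<otimes>\<^bsub>E.G\<^esub> x = x" if x: "x \<in> carrier E.G" for x
    proof -
      obtain u where u: "u \<in> E.lifts" "x = E.cls u" using x unfolding E.G_carrier by blast
      have "E.cls (conv unit_lift u) = E.cls u"
        by (rule E.cls_eqI) (simp add: conv_unit E.liftsc[OF u(1)])
      then show ?thesis using u unfolding G_one by (simp add: G_mult unit_lift)
    qed
  qed
  show "(x \<oplus>\<^bsub>E.G\<^esub> y) \<otimes>\<^bsub>E.G\<^esub> z = x \<otimes>\<^bsub>E.G\<^esub> z \<oplus>\<^bsub>E.G\<^esub> y \<otimes>\<^bsub>E.G\<^esub> z"
    if xyz: "x \<in> carrier E.G" "y \<in> carrier E.G" "z \<in> carrier E.G" for x y z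
  proof -
    obtain u v w where u: "u \<in> E.lifts" "x = E.cls u" "v \<in> E.lifts" "y = E.cls v" "w \<in> E.lifts" "z = E.cls w"
      using xyz unfolding E.G_carrier by blast
    have "conv (\<lambda>n. u n \<oplus> v n) w = (\<lambda>n. conv u w n \<oplus> conv v w n)"
      by (rule ext, rule conv_add) (use u E.liftsc in auto)
    then show ?thesis using u by (simp add: G_mult E.G_add E.lifts_add conv_lifts_E)
  qed
qed

lemma G_module: "module E.G F.G"
proof (rule moduleI)
  show "cring E.G" by (rule G_cring)
  show "abelian_group F.G" by (rule F.G_group)
  show "x \<odot>\<^bsub>F.G\<^esub> y \<in> carrier F.G" if xy: "x \<in> carrier E.G" "y \<in> carrier F.G" for x y
  proof -
    obtain u v where "u \<in> E.lifts" "x = E.cls u" "v \<in> F.lifts" "y = F.cls v"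
      using xy unfolding E.G_carrier F.G_carrier by blast
    then show ?thesis by (simp add: G_smult F.cls_closed conv_lifts)
  qed
  show "(x \<oplus>\<^bsub>E.G\<^esub> y) \<odot>\<^bsub>F.G\<^esub> z = x \<odot>\<^bsub>F.G\<^esub> z \<oplus>\<^bsub>F.G\<^esub> y \<odot>\<^bsub>F.G\<^esub> z"
    if xyz: "x \<in> carrier E.G" "y \<in> carrier E.G" "z \<in> carrier F.G" for x y z
  proof -
    obtain u v w where u: "u \<in> E.lifts" "x = E.cls u" "v \<in> E.lifts" "y = E.cls v" "w \<in> F.lifts" "z = F.cls w"
      using xyz unfolding E.G_carrier F.G_carrier by blast
    have "conv (\<lambda>n. u n \<oplus> v n) w = (\<lambda>n. conv u w n \<oplus> conv v w n)"
      by (rule ext, rule conv_add) (use u E.liftsc F.liftsc in auto)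
    then show ?thesis using u by (simp add: G_smult E.G_add F.G_add E.lifts_add conv_lifts)
  qed
  show "x \<odot>\<^bsub>F.G\<^esub> (y \<oplus>\<^bsub>F.G\<^esub> z) = x \<odot>\<^bsub>F.G\<^esub> y \<oplus>\<^bsub>F.G\<^esub> x \<odot>\<^bsub>F.G\<^esub> z"
    if xyz: "x \<in> carrier E.G" "y \<in> carrier F.G" "z \<in> carrier F.G" for x y z
  proof -
    obtain u v w where u: "u \<in> E.lifts" "x = E.cls u" "v \<in> F.lifts" "y = F.cls v" "w \<in> F.lifts" "z = F.cls w"
      using xyz unfolding E.G_carrier F.G_carrier by blast
    have "conv u (\<lambda>n. v n \<oplus> w n) n = conv u v n \<oplus> conv u w n" for n
    proof -
      have "conv u (\<lambda>n. v n \<oplus> w n) n = conv (\<lambda>n. v n \<oplus> w n) u n"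
        by (rule conv_comm) (use u E.liftsc F.liftsc in auto)
      also have "\<dots> = conv v u n \<oplus> conv w u n" by (rule conv_add) (use u E.liftsc F.liftsc in auto)
      also have "\<dots> = conv u v n \<oplus> conv u w n"
        using conv_comm[of v u n] conv_comm[of w u n] u E.liftsc F.liftsc by simp
      finally show ?thesis .
    qed
    then have "conv u (\<lambda>n. v n \<oplus> w n) = (\<lambda>n. conv u v n \<oplus> conv u w n)" by (rule ext)
    then show ?thesis using u by (simp add: G_smult F.G_add F.lifts_add conv_lifts)
  qed
  show "(x \<otimes>\<^bsub>E.G\<^esub> y) \<odot>\<^bsub>F.G\<^esub> z = x \<odot>\<^bsub>F.G\<^esub> (y \<odot>\<^bsub>F.G\<^esub> z)"
    if xyz: "x \<in> carrier E.G" "y \<in> carrier E.G" "z \<in> carrier F.G" for x y z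
  proof -
    obtain u v w where u: "u \<in> E.lifts" "x = E.cls u" "v \<in> E.lifts" "y = E.cls v" "w \<in> F.lifts" "z = F.cls w"
      using xyz unfolding E.G_carrier F.G_carrier by blast
    have "conv (conv u v) w = conv u (conv v w)"
      by (rule ext, rule conv_assoc) (use u E.liftsc F.liftsc in auto)
    then show ?thesis using u by (simp add: G_mult G_smult conv_lifts_E conv_lifts)
  qed
  show "\<one>\<^bsub>E.G\<^esub> \<odot>\<^bsub>F.G\<^esub> x = x" if x: "x \<in> carrier F.G" for x
  proof -
    obtain u where u: "u \<in> F.lifts" "x = F.cls u" using x unfolding F.G_carrier by blast
    have "F.cls (conv unit_lift u) = F.cls u"
      by (rule F.cls_eqI) (simp add: conv_unit F.liftsc[OF u(1)])
    then show ?thesis using u unfolding G_one by (simp add: G_smult unit_lift)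
  qed
qed

lemma hm_smult:
  assumes "0 \<le> a" "0 \<le> b" "x \<in> E a" "y \<in> F b"
  shows "E.hm a x \<odot>\<^bsub>F.G\<^esub> F.hm b y = F.hm (a + b) (x \<otimes> y)"
proof -
  have "conv (\<lambda>k. if k = a then x else \<zero>) (\<lambda>k. if k = b then y else \<zero>) n = (if n = a + b then x \<otimes> y else \<zero>)" for n
  proof -
    have "conv (\<lambda>k. if k = a then x else \<zero>) (\<lambda>k. if k = b then y else \<zero>) n
      = (if a \<le> n then x \<otimes> (if n - a = b then y else \<zero>) else \<zero>)"
      by (rule conv_delta) (use assms E.Fc F.Fc in auto)
    moreover have "n - a = b \<longleftrightarrow> n = a + b" by (auto simp: algebra_simps)
    moreover have "a \<le> a + b" using assms(2) by simp
    ultimately show ?thesis using E.Fc[OF assms(3)] by auto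
  qed
  then have "conv (\<lambda>k. if k = a then x else \<zero>) (\<lambda>k. if k = b then y else \<zero>) = (\<lambda>n. if n = a + b then x \<otimes> y else \<zero>)"
    by (rule ext)
  then show ?thesis
    unfolding E.hm_def F.hm_def using G_smult[OF E.delta_lifts[OF assms(3)] F.delta_lifts[OF assms(4)]] by simp
qed

lemma gG_smult: "s \<in> E.gG a \<Longrightarrow> v \<in> F.gG n \<Longrightarrow> s \<odot>\<^bsub>F.G\<^esub> v \<in> F.gG (n + a)"
proof -
  assume s: "s \<in> E.gG a" and v: "v \<in> F.gG n"
  interpret module E.G F.G by (rule G_module)
  show ?thesis
  proof (cases "0 \<le> a \<and> 0 \<le> n")
    case True
    then obtain x y where xy: "x \<in> E a" "s = E.hm a x" "y \<in> F n" "v = F.hm n y"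
      using s v E.gG_eq F.gG_eq by blast
    then have "s \<odot>\<^bsub>F.G\<^esub> v = F.hm (n + a) (x \<otimes> y)" using hm_smult True by (simp add: add.commute)
    then show ?thesis using F.gG_I EF[OF xy(1,3)] by (simp add: add.commute)
  next
    case False
    then have "s = \<zero>\<^bsub>E.G\<^esub> \<or> v = \<zero>\<^bsub>F.G\<^esub>" using s v E.gG_neg F.gG_neg by blast
    then show ?thesis using E.gG_closed[OF s] F.gG_closed[OF v] F.gG_zero by auto
  qed
qed

lemma G_graded: "graded_module E.G F.G E.gG F.gG"
proof (intro graded_module.intro graded_module_axioms.intro)
  show "module E.G F.G" by (rule G_module)
  show "additive_subgroup (E.gG a) E.G" for a by (rule E.gG_sub)
  show "\<one>\<^bsub>E.G\<^esub> \<in> E.gG 0" unfolding G_one unit_lift_def using E.gG_I[OF E_one] unfolding E.hm_def .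
  show "s \<otimes>\<^bsub>E.G\<^esub> t \<in> E.gG (a + b)" if "s \<in> E.gG a" "t \<in> E.gG b" for s t a b
    using filtration_pair.gG_smult[OF pair_EE that] by (simp add: assoc_graded_def add.commute)
  show "s = \<zero>\<^bsub>E.G\<^esub>" if "s \<in> E.gG a" "s \<in> E.gG b" "a \<noteq> b" for s a b by (rule E.gG_disj[OF that])
  show "additive_subgroup (F.gG a) F.G" for a by (rule F.gG_sub)
  show "s \<odot>\<^bsub>F.G\<^esub> x \<in> F.gG (n + a)" if "s \<in> E.gG a" "x \<in> F.gG n" for s x a n by (rule gG_smult[OF that])
qed

text \<open>
  Only the part of \<open>c\<close> in degree \<open>\<nu> - b\<close> contributes to degree \<open>\<nu>\<close> of \<open>c f\<close> when \<open>f\<close> has degree \<open>b\<close>, so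
  homogeneous elements of a homogeneous ideal have homogeneous coefficients.
\<close>

definition part :: "('s \<Rightarrow> int) \<Rightarrow> (('s \<Rightarrow> int) \<Rightarrow> 'a set) \<Rightarrow> ('s \<Rightarrow> int) \<Rightarrow> 'a set" where
  "part a c = (\<lambda>k\<in>{0..}. if k = a then c k else E (k + 1))"

lemma part_cls: "part a (E.cls w) = E.cls (\<lambda>k. if k = a then w k else \<zero>)"
  unfolding part_def E.cls_def[of "\<lambda>k. if k = a then w k else \<zero>"]
  by (rule restrict_ext) (simp add: E.cls_eval coset_zero[OF E.F_id])

lemma part_lifts: "w \<in> E.lifts \<Longrightarrow> (\<lambda>k. if k = a then w k else \<zero>) \<in> E.lifts"
proof -
  assume w: "w \<in> E.lifts"
  have "{k. 0 \<le> k \<and> (if k = a then w k else \<zero>) \<noteq> \<zero>} \<subseteq> {a}" by auto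
  then have "finite {k. 0 \<le> k \<and> (if k = a then w k else \<zero>) \<noteq> \<zero>}" by (rule finite_subset) simp
  then show ?thesis using E.liftsD[OF w] E.F_zero unfolding E.lifts_def by simp
qed

lemma part_gG: "c \<in> carrier E.G \<Longrightarrow> part a c \<in> E.gG a"
proof -
  assume "c \<in> carrier E.G"
  then obtain w where w: "w \<in> E.lifts" "c = E.cls w" by (rule E.G_cases)
  have "part a c \<in> carrier E.G" unfolding w(2) part_cls by (rule E.cls_closed[OF part_lifts[OF w(1)]])
  then show ?thesis unfolding gr_component_def by (simp add: part_def)
qed

lemma part_mult:
  assumes c: "c \<in> carrier E.G" and f: "f \<in> E.gG b" and n: "0 \<le> \<nu>"
  shows "(c \<otimes>\<^bsub>E.G\<^esub> f) \<nu> = (part (\<nu> - b) c \<otimes>\<^bsub>E.G\<^esub> f) \<nu>"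
proof -
  interpret S: cring E.G by (rule G_cring)
  obtain w where w: "w \<in> E.lifts" "c = E.cls w" using c by (rule E.G_cases)
  have pc: "part (\<nu> - b) c \<in> carrier E.G" by (rule E.gG_closed[OF part_gG[OF c]])
  from f show ?thesis
  proof (rule E.gG_cases)
    assume "f = \<zero>\<^bsub>E.G\<^esub>"
    then show ?thesis using c pc by simp
  next
    fix g assume g: "0 \<le> b" "g \<in> E b" "f = E.hm b g"
    have e: "(E.cls v \<otimes>\<^bsub>E.G\<^esub> f) \<nu> = E (\<nu> + 1) +> (if b \<le> \<nu> then g \<otimes> v (\<nu> - b) else \<zero>)" if v: "v \<in> E.lifts" for v
    proof -
      have "E.cls v \<otimes>\<^bsub>E.G\<^esub> f = E.cls (conv v (\<lambda>k. if k = b then g else \<zero>))"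
        unfolding g(3) E.hm_def by (rule G_mult[OF v E.delta_lifts[OF g(2)]])
      moreover have "conv v (\<lambda>k. if k = b then g else \<zero>) \<nu> = conv (\<lambda>k. if k = b then g else \<zero>) v \<nu>"
        by (rule conv_comm) (use E.liftsc[OF v] E.Fc[OF g(2)] in auto)
      moreover have "\<dots> = (if b \<le> \<nu> then g \<otimes> v (\<nu> - b) else \<zero>)"
        by (rule conv_delta) (use E.liftsc[OF v] E.Fc[OF g(2)] g(1) in auto)
      ultimately show ?thesis using n by (simp add: E.cls_eval)
    qed
    show ?thesis unfolding w(2) part_cls e[OF w(1)] e[OF part_lifts[OF w(1)]] by simp
  qed
qed

lemma homogeneous_comb:
  assumes fs: "\<And>i. i < length fs \<Longrightarrow> fs ! i \<in> E.gG (\<delta> i)" and y: "y \<in> E.gG \<nu>" "y \<in> Idl\<^bsub>E.G\<^esub> (set fs)"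
  shows "\<exists>c. (\<forall>i<length fs. c i \<in> E.gG (\<nu> - \<delta> i)) \<and> y = (\<Oplus>\<^bsub>E.G\<^esub>i\<in>{..<length fs}. c i \<otimes>\<^bsub>E.G\<^esub> fs ! i)"
proof -
  interpret S: cring E.G by (rule G_cring)
  interpret gm: graded_module E.G F.G E.gG F.gG by (rule G_graded)
  have fc: "fs ! i \<in> carrier E.G" if "i < length fs" for i by (rule E.gG_closed[OF fs[OF that]])
  have "set fs \<subseteq> carrier E.G" using fc by (auto simp: in_set_conv_nth)
  then obtain c where c: "\<And>i. i < length fs \<Longrightarrow> c i \<in> carrier E.G" "y = (\<Oplus>\<^bsub>E.G\<^esub>i\<in>{..<length fs}. c i \<otimes>\<^bsub>E.G\<^esub> fs ! i)"
    using S.genideal_list_comb y(2) by blast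
  let ?c = "\<lambda>i. part (\<nu> - \<delta> i) (c i)"
  have cg: "?c i \<in> E.gG (\<nu> - \<delta> i)" if "i < length fs" for i by (rule part_gG[OF c(1)[OF that]])
  have cf: "?c i \<otimes>\<^bsub>E.G\<^esub> fs ! i \<in> E.gG \<nu>" if "i < length fs" for i
    using gm.gS_mult[OF cg[OF that] fs[OF that]] by simp
  have sg: "(\<Oplus>\<^bsub>E.G\<^esub>i\<in>{..<length fs}. ?c i \<otimes>\<^bsub>E.G\<^esub> fs ! i) \<in> E.gG \<nu>"
    by (rule gm.gS_finsum) (use cf in simp)
  have "y = (\<Oplus>\<^bsub>E.G\<^esub>i\<in>{..<length fs}. ?c i \<otimes>\<^bsub>E.G\<^esub> fs ! i)"
  proof (rule E.G_eqI[OF E.gG_closed[OF y(1)] E.gG_closed[OF sg]])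
    fix n :: "'s \<Rightarrow> int" assume n: "0 \<le> n"
    show "y n = (\<Oplus>\<^bsub>E.G\<^esub>i\<in>{..<length fs}. ?c i \<otimes>\<^bsub>E.G\<^esub> fs ! i) n"
    \<comment> \<open>Away from \<open>\<nu>\<close> both sides are trivial by homogeneity; in
      degree \<open>\<nu>\<close> only the chosen parts of the coefficients contribute.\<close>
    proof (cases "n = \<nu>")
      case False
      then show ?thesis using y(1) sg n unfolding gr_component_def by simp
    next
      case True
      let ?q = "R Quot E (n + 1)"
      interpret q: abelian_group ?q by (rule quot_group[OF E.F_id])
      have "y n = (\<Oplus>\<^bsub>?q\<^esub>i\<in>{..<length fs}. (c i \<otimes>\<^bsub>E.G\<^esub> fs ! i) n)"
        unfolding c(2) by (rule additive_map_finsum[OF E.G_group quot_group[OF E.F_id] E.G_ev[OF n]]) (use c(1) fc in simp)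
      also have "\<dots> = (\<Oplus>\<^bsub>?q\<^esub>i\<in>{..<length fs}. (?c i \<otimes>\<^bsub>E.G\<^esub> fs ! i) n)"
      proof (rule q.finsum_cong')
        fix i assume "i \<in> {..<length fs}"
        then show "(c i \<otimes>\<^bsub>E.G\<^esub> fs ! i) n = (?c i \<otimes>\<^bsub>E.G\<^esub> fs ! i) n"
          using part_mult[OF c(1) fs n] True by simp
      qed (use additive_map_closed[OF E.G_ev[OF n]] E.gG_closed[OF cf] in auto)
      also have "\<dots> = (\<Oplus>\<^bsub>E.G\<^esub>i\<in>{..<length fs}. ?c i \<otimes>\<^bsub>E.G\<^esub> fs ! i) n"
        by (rule additive_map_finsum[OF E.G_group quot_group[OF E.F_id] E.G_ev[OF n], symmetric]) (use E.gG_closed[OF cf] in simp)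
      finally show ?thesis .
    qed
  qed
  moreover have "\<forall>i<length fs. ?c i \<in> E.gG (\<nu> - \<delta> i)" using cg by simp
  ultimately show ?thesis by (intro exI[of _ ?c] conjI)
qed

text \<open>Turns membership, given as existence of a finite homogeneous sum, into a condition on
  coordinates that can be checked degree by degree.\<close>

lemma irrelevant_eq: "irrelevant_ideal E.G E.gG = {v \<in> carrier E.G. \<forall>n. 0 \<le> n \<longrightarrow> \<not> 1 \<le> n \<longrightarrow> v n = E (n + 1)}"
proof (intro equalityI subsetI)
  interpret S: cring E.G by (rule G_cring)
  fix v assume "v \<in> irrelevant_ideal E.G E.gG"
  then obtain A u where A: "v = (\<Oplus>\<^bsub>E.G\<^esub>n\<in>A. u n)" "finite A" "A \<subseteq> {1..}" "\<And>n. n \<in> A \<Longrightarrow> u n \<in> E.gG n"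
    unfolding irrelevant_ideal_def by blast
  have uc: "u \<in> A \<rightarrow> carrier E.G" using E.gG_closed A(4) by (intro funcsetI) blast
  have "v k = E (k + 1)" if k: "0 \<le> k" "\<not> 1 \<le> k" for k
  proof -
    let ?q = "R Quot E (k + 1)"
    interpret q: abelian_group ?q by (rule quot_group[OF E.F_id])
    have "v k = (\<Oplus>\<^bsub>?q\<^esub>n\<in>A. u n k)"
      unfolding A(1) by (rule additive_map_finsum[OF E.G_group quot_group[OF E.F_id] E.G_ev[OF k(1)] uc])
    also have "\<dots> = \<zero>\<^bsub>?q\<^esub>"
    proof (rule q.add.finprod_one_eqI)
      fix n assume n: "n \<in> A"
      then have "n \<noteq> k" using A(3) k(2) by auto
      then show "u n k = \<zero>\<^bsub>?q\<^esub>" using A(4)[OF n] k(1) unfolding gr_component_def quot_zero by simp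
    qed
    finally show ?thesis unfolding quot_zero .
  qed
  then show "v \<in> {v \<in> carrier E.G. \<forall>n. 0 \<le> n \<longrightarrow> \<not> 1 \<le> n \<longrightarrow> v n = E (n + 1)}"
    using E.G.finsum_closed[OF uc] A(1) by simp
next
  interpret S: cring E.G by (rule G_cring)
  fix v assume "v \<in> {v \<in> carrier E.G. \<forall>n. 0 \<le> n \<longrightarrow> \<not> 1 \<le> n \<longrightarrow> v n = E (n + 1)}"
  then have v: "v \<in> carrier E.G" "\<And>n. 0 \<le> n \<Longrightarrow> \<not> 1 \<le> n \<Longrightarrow> v n = E (n + 1)" by auto
  obtain u where u: "u \<in> E.lifts" "v = E.cls u" using v(1) by (rule E.G_cases)
  let ?w = "\<lambda>n. if 1 \<le> n then u n else \<zero>"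
  have "{n. 0 \<le> n \<and> ?w n \<noteq> \<zero>} \<subseteq> {n. 0 \<le> n \<and> u n \<noteq> \<zero>}" by auto
  then have fin: "finite {n. 0 \<le> n \<and> ?w n \<noteq> \<zero>}" by (rule finite_subset[OF _ E.lifts_fin[OF u(1)]])
  then have w: "?w \<in> E.lifts" using E.liftsD[OF u(1)] E.F_zero unfolding E.lifts_def by simp
  have "E.cls u = E.cls ?w"
    by (rule E.cls_eqI) (use v(2) u(2) in \<open>simp add: E.cls_eval coset_zero[OF E.F_id]\<close>)
  then have "v = (\<Oplus>\<^bsub>E.G\<^esub>n\<in>{n. 0 \<le> n \<and> ?w n \<noteq> \<zero>}. E.hm n (?w n))"
    using E.G_hom_decomp[OF w] u(2) by simp
  moreover have "{n. 0 \<le> n \<and> ?w n \<noteq> \<zero>} \<subseteq> {1..}" by auto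
  moreover have "\<forall>n\<in>{n. 0 \<le> n \<and> ?w n \<noteq> \<zero>}. E.hm n (?w n) \<in> E.gG n"
    using E.gG_I[OF E.liftsD[OF w]] by simp
  ultimately show "v \<in> irrelevant_ideal E.G E.gG"
    unfolding irrelevant_ideal_def using fin by blast
qed

lemma irrelevant_is_ideal: "ideal (irrelevant_ideal E.G E.gG) E.G"
proof -
  interpret S: cring E.G by (rule G_cring)
  let ?I = "irrelevant_ideal E.G E.gG"
  define Z where "Z = {u \<in> E.lifts. \<forall>n. 0 \<le> n \<longrightarrow> \<not> 1 \<le> n \<longrightarrow> u n = \<zero>}"
  have I: "?I = E.cls ` Z"
  proof
    show "E.cls ` Z \<subseteq> ?I" unfolding irrelevant_eq Z_def
      by (rule image_subsetI) (simp add: E.cls_closed E.cls_eval coset_zero[OF E.F_id])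
    show "?I \<subseteq> E.cls ` Z"
    proof
      fix v assume "v \<in> ?I"
      then have v: "v \<in> carrier E.G" "\<And>n. 0 \<le> n \<Longrightarrow> \<not> 1 \<le> n \<Longrightarrow> v n = E (n + 1)" unfolding irrelevant_eq by auto
      obtain u where u: "u \<in> E.lifts" "v = E.cls u" using v(1) by (rule E.G_cases)
      let ?w = "\<lambda>n. if 1 \<le> n then u n else \<zero>"
      have "{n. 0 \<le> n \<and> ?w n \<noteq> \<zero>} \<subseteq> {n. 0 \<le> n \<and> u n \<noteq> \<zero>}" by auto
      then have "finite {n. 0 \<le> n \<and> ?w n \<noteq> \<zero>}" by (rule finite_subset[OF _ E.lifts_fin[OF u(1)]])
      then have "?w \<in> Z" using E.liftsD[OF u(1)] E.F_zero unfolding E.lifts_def Z_def by simp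
      moreover have "E.cls u = E.cls ?w"
        by (rule E.cls_eqI) (use v(2) u(2) in \<open>simp add: E.cls_eval coset_zero[OF E.F_id]\<close>)
      ultimately show "v \<in> E.cls ` Z" using u(2) by blast
    qed
  qed
  have mult: "a \<otimes>\<^bsub>E.G\<^esub> v \<in> ?I" if a: "a \<in> carrier E.G" and v: "v \<in> ?I" for a v
  proof -
    obtain c where c: "c \<in> E.lifts" "a = E.cls c" using a by (rule E.G_cases)
    obtain u where u: "u \<in> Z" "v = E.cls u" using v unfolding I by blast
    have ul: "u \<in> E.lifts" using u(1) unfolding Z_def by simp
    have "conv c u n = \<zero>" if n: "0 \<le> n" "\<not> 1 \<le> n" for n
      unfolding conv_def
    proof (rule add.finprod_one_eqI)
      fix b assume b: "b \<in> {0..n}"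
      \<comment> \<open>The ideal property: multiplying by degree \<open>b \<ge> 0\<close> cannot
        bring a degree that is at least 1 back to one that is not.\<close>
      have "\<not> 1 \<le> n - b"
      proof
        assume "1 \<le> n - b"
        moreover have "n - b \<le> n" using b by simp
        ultimately show False using n(2) order_trans by blast
      qed
      moreover have "0 \<le> n - b" using b by simp
      ultimately have "u (n - b) = \<zero>" using u(1) unfolding Z_def by blast
      then show "c b \<otimes> u (n - b) = \<zero>" using E.liftsc[OF c(1)] b by simp
    qed
    then have "conv c u \<in> Z" using conv_lifts_E[OF c(1) ul] unfolding Z_def by blast
    then show ?thesis unfolding I c(2) u(2) G_mult[OF c(1) ul] by blast
  qed
  show ?thesis
  proof (rule idealI)
    show "ring E.G" by (rule S.ring_axioms)
    show "x \<otimes>\<^bsub>E.G\<^esub> a \<in> ?I" if "a \<in> ?I" "x \<in> carrier E.G" for a x using mult that by blast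
    show "a \<otimes>\<^bsub>E.G\<^esub> x \<in> ?I" if "a \<in> ?I" "x \<in> carrier E.G" for a x
    proof -
      have "a \<in> carrier E.G" using that(1) unfolding irrelevant_eq by blast
      then have "a \<otimes>\<^bsub>E.G\<^esub> x = x \<otimes>\<^bsub>E.G\<^esub> a" using that(2) by (rule S.m_comm)
      then show ?thesis using mult[OF that(2,1)] by simp
    qed
    show "subgroup ?I (add_monoid E.G)"
    proof (rule E.G.add.subgroupI)
      show "?I \<subseteq> carrier E.G" unfolding irrelevant_eq by blast
      have "\<zero>\<^bsub>E.G\<^esub> \<in> ?I" unfolding irrelevant_eq by (simp add: E.G_zero_eval)
      then show "?I \<noteq> {}" by blast
      show "\<ominus>\<^bsub>E.G\<^esub> a \<in> ?I" if a: "a \<in> ?I" for a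
      proof -
        have ac: "a \<in> carrier E.G" using a unfolding irrelevant_eq by blast
        have "(\<ominus>\<^bsub>E.G\<^esub> \<one>\<^bsub>E.G\<^esub>) \<otimes>\<^bsub>E.G\<^esub> a \<in> ?I" by (rule mult[OF _ a]) simp
        then show ?thesis using ac by (simp add: S.l_minus)
      qed
      show "a \<oplus>\<^bsub>E.G\<^esub> b \<in> ?I" if ab: "a \<in> ?I" "b \<in> ?I" for a b
      proof -
        obtain u v where u: "u \<in> Z" "a = E.cls u" "v \<in> Z" "b = E.cls v" using ab unfolding I by blast
        have l: "u \<in> E.lifts" "v \<in> E.lifts" using u unfolding Z_def by auto
        have "(\<lambda>n. u n \<oplus> v n) \<in> Z" using u E.lifts_add[OF l] unfolding Z_def by simp
        then show ?thesis unfolding I u(2,4) E.G_add[OF l] by blast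
      qed
    qed
  qed
qed

lemma hm_irrelevant: "1 \<le> n \<Longrightarrow> x \<in> E n \<Longrightarrow> E.hm n x \<in> irrelevant_ideal E.G E.gG"
  unfolding irrelevant_eq by (auto simp: E.hm_closed E.hm_eval)

text \<open>A homogeneous element of the ideal whose given degree is not at least 1 must be zero,
  and zero is homogeneous of degree 1 as well. Thus every generator can be assigned a degree that is
  at least 1.\<close>

lemma irrelevant_degree:
  assumes f: "f \<in> irrelevant_ideal E.G E.gG" "f \<in> E.gG a"
  shows "\<exists>b\<ge>1. f \<in> E.gG b"
proof (cases "1 \<le> a")
  case True
  then show ?thesis using f(2) by blast
next
  case False
  have fc: "f \<in> carrier E.G" by (rule E.gG_closed[OF f(2)])
  have "f = \<zero>\<^bsub>E.G\<^esub>"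
  proof (rule E.G_eqI[OF fc E.G.zero_closed])
    fix n :: "'s \<Rightarrow> int" assume n: "0 \<le> n"
    have "f n = E (n + 1)"
    proof (cases "n = a")
      case True
      then show ?thesis using f(1) False n unfolding irrelevant_eq by blast
    next
      case False
      then show ?thesis using f(2) n unfolding gr_component_def by simp
    qed
    then show "f n = \<zero>\<^bsub>E.G\<^esub> n" using n by (simp add: E.G_zero_eval)
  qed
  then show ?thesis using E.gG_zero[of 1] by auto
qed

end

section \<open>Ideals of Noetherian local rings\<close>

context cring
begin

text \<open>Zorn's lemma; in a Noetherian ring the union of a chain of ideals is a member of the
  chain, so it stays proper.\<close>

lemma proper_ideal_in_maximal:
  assumes "noetherian_ring R" and J: "ideal J R" "J \<noteq> carrier R"
  shows "\<exists>M. maximalideal M R \<and> J \<subseteq> M"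
proof -
  interpret noetherian_ring R by fact
  let ?A = "{K. ideal K R \<and> J \<subseteq> K \<and> K \<noteq> carrier R}"
  have "\<exists>M\<in>?A. \<forall>K\<in>?A. M \<subseteq> K \<longrightarrow> K = M"
  proof (rule subset_Zorn_nonempty)
    show "?A \<noteq> {}" using J by blast
    fix C assume C: "C \<noteq> {}" "subset.chain ?A C"
    have "subset.chain {K. ideal K R} C" using C(2) unfolding subset.chain_def by blast
    then have "\<Union>C \<in> C" using C(1) by (intro ideal_chain_is_trivial)
    then show "\<Union>C \<in> ?A" using C(2) unfolding subset.chain_def by blast
  qed
  then obtain M where MA: "M \<in> ?A" "\<forall>K\<in>?A. M \<subseteq> K \<longrightarrow> K = M" by (rule bexE)
  then have M: "ideal M R" "J \<subseteq> M" "M \<noteq> carrier R" by simp_all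
  have max: "K = M" if "ideal K R" "J \<subseteq> K" "K \<noteq> carrier R" "M \<subseteq> K" for K
    using MA(2) that by simp
  have "maximalideal M R"
  proof (rule maximalidealI[OF M(1) M(3)[symmetric]])
    fix K assume K: "ideal K R" "M \<subseteq> K" "K \<subseteq> carrier R"
    have "J \<subseteq> K" using M(2) K(2) by (rule order_trans)
    then show "K = M \<or> K = carrier R" using max[OF K(1) _ _ K(2)] by blast
  qed
  then show ?thesis using M(2) by blast
qed

text \<open>If \<open>\<one> \<ominus> a\<close> generated a proper ideal, it would lie in the only
  maximal ideal together with \<open>a\<close>, and so would their sum
  \<open>\<one>\<close>.\<close>

lemma local_one_minus_invertible:
  assumes "noetherian_ring R" "local_ring R \<mm>" and a: "a \<in> \<mm>"
  shows "\<exists>v\<in>carrier R. v \<otimes> (\<one> \<ominus> a) = \<one>"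
proof -
  have mm: "maximalideal \<mm> R" "\<And>M. maximalideal M R \<Longrightarrow> M = \<mm>" using assms(2) unfolding local_ring_def by auto
  interpret m: maximalideal \<mm> R by (rule mm(1))
  have ac: "a \<in> carrier R" by (rule m.Icarr[OF a])
  let ?u = "\<one> \<ominus> a"
  have uc: "?u \<in> carrier R" using ac by simp
  have P: "PIdl ?u = carrier R"
  proof (rule ccontr)
    assume "PIdl ?u \<noteq> carrier R"
    then obtain M where "maximalideal M R" "PIdl ?u \<subseteq> M"
      using proper_ideal_in_maximal[OF assms(1) cgenideal_ideal[OF uc]] by blast
    then have "?u \<in> \<mm>" using mm(2) cgenideal_self[OF uc] by blast
    then have "?u \<oplus> a \<in> \<mm>" using a by (rule m.a_closed)
    moreover have "?u \<oplus> a = \<one>" using ac by (simp add: a_minus_def a_assoc l_neg)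
    ultimately have "\<mm> = carrier R" using m.one_imp_carrier by simp
    then show False using m.I_notcarr by simp
  qed
  then have "\<one> \<in> PIdl ?u" by simp
  then obtain v where \<open>v \<in> carrier R\<close> \<open>\<one> = v \<otimes> ?u\<close> unfolding cgenideal_def by blast
  then show ?thesis by (intro bexI[of _ v]) simp_all
qed

text \<open>Splits off one generator with its coefficient in \<open>\<mm>\<close>, the step that
  \<open>nakayama\<close> repeats.\<close>

lemma prod_genideal_insert:
  assumes m: "ideal \<mm> R" and G: "g \<in> carrier R" "G \<subseteq> carrier R" and x: "x \<in> \<mm> \<cdot> (Idl (insert g G))"
  shows "\<exists>a\<in>\<mm>. \<exists>b\<in>Idl G. x = a \<otimes> g \<oplus> b"
  using x
proof (induction rule: ideal_prod.induct)
  interpret m: ideal \<mm> R by (rule m)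
  interpret I: ideal "Idl G" R by (rule genideal_ideal[OF G(2)])
  {
    case (prod u v)
    have u: "u \<in> carrier R" by (rule m.Icarr[OF prod(1)])
    have "v \<in> ispan (insert g G)" using genideal_ispan[of "insert g G"] G prod(2) by blast
    then have "\<exists>c\<in>carrier R. \<exists>b\<in>Idl G. v = c \<otimes> g \<oplus> b"
    proof (induction rule: ispan.induct)
      case ispan_zero
      then show ?case using G I.zero_closed by (intro bexI[of _ \<zero>]) simp_all
    next
      case (ispan_step r h y)
      then obtain c b where cb: "c \<in> carrier R" "b \<in> Idl G" "y = c \<otimes> g \<oplus> b" by blast
      have bc: "b \<in> carrier R" by (rule I.Icarr[OF cb(2)])
      show ?case
      proof (cases "h = g")
        case True
        have "r \<otimes> h \<oplus> y = (r \<oplus> c) \<otimes> g \<oplus> b"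
          unfolding True cb(3) using ispan_step(1) cb(1) bc G(1) by (simp add: l_distr a_assoc)
        then show ?thesis using cb ispan_step(1) by blast
      next
        case False
        then have h: "h \<in> Idl G" using ispan_step(2) genideal_self[OF G(2)] by blast
        have hc: "h \<in> carrier R" by (rule I.Icarr[OF h])
        have "r \<otimes> h \<oplus> y = c \<otimes> g \<oplus> (r \<otimes> h \<oplus> b)"
          unfolding cb(3) using ispan_step(1) cb(1) bc hc G(1) by (simp add: a_ac)
        moreover have "r \<otimes> h \<oplus> b \<in> Idl G" using I.I_l_closed[OF h ispan_step(1)] cb(2) by (rule I.a_closed)
        ultimately show ?thesis using cb(1) by blast
      qed
    qed
    then obtain c b where cb: "c \<in> carrier R" "b \<in> Idl G" "v = c \<otimes> g \<oplus> b" by blast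
    have "u \<otimes> v = (u \<otimes> c) \<otimes> g \<oplus> u \<otimes> b"
      unfolding cb(3) using u cb(1) I.Icarr[OF cb(2)] G(1) by (simp add: r_distr m_assoc)
    then show ?case using m.I_r_closed[OF prod(1) cb(1)] I.I_l_closed[OF cb(2) u] by blast
  next
    case (sum s t)
    then obtain a b a' b' where s: "a \<in> \<mm>" "b \<in> Idl G" "s = a \<otimes> g \<oplus> b" and t: "a' \<in> \<mm>" "b' \<in> Idl G" "t = a' \<otimes> g \<oplus> b'"
      by blast
    have "s \<oplus> t = (a \<oplus> a') \<otimes> g \<oplus> (b \<oplus> b')"
      unfolding s(3) t(3) using m.Icarr[OF s(1)] m.Icarr[OF t(1)] I.Icarr[OF s(2)] I.Icarr[OF t(2)] G(1)
      by (simp add: l_distr a_ac)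
    then show ?case using m.a_closed[OF s(1) t(1)] I.a_closed[OF s(2) t(2)] by blast
  }
qed

lemma ideal_prod_mono: "A \<subseteq> A' \<Longrightarrow> B \<subseteq> B' \<Longrightarrow> A \<cdot> B \<subseteq> A' \<cdot> B'"
proof
  fix x assume AB: "A \<subseteq> A'" "B \<subseteq> B'" and "x \<in> A \<cdot> B"
  from this(3) show "x \<in> A' \<cdot> B'"
  proof (induction rule: ideal_prod.induct)
    case (prod i j)
    then show ?case using AB by (intro ideal_prod.prod) auto
  next
    case (sum s t)
    then show ?case by (intro ideal_prod.sum)
  qed
qed

text \<open>Induction on a finite generating set: \<open>g = a g + b\<close> with
  \<open>a \<in> \<mm>\<close> and \<open>b\<close> in the ideal of the other generators. Since
  \<open>\<one> \<ominus> a\<close> is invertible, \<open>g\<close> is redundant.\<close>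

theorem nakayama:
  assumes R: "noetherian_ring R" "local_ring R \<mm>" and J: "ideal J R" "J \<subseteq> \<mm> \<cdot> J"
  shows "J = {\<zero>}"
proof -
  have m: "ideal \<mm> R" using R(2) unfolding local_ring_def by (simp add: maximalideal.axioms(1))
  have main: "J = {\<zero>}" if "finite G" "G \<subseteq> carrier R" "J = Idl G" for G
    using that
  proof (induction G rule: finite_induct)
    case empty
    have "Idl {} \<subseteq> {\<zero>}" by (rule genideal_minimal[OF zeroideal]) simp
    then show ?case using empty(2) additive_subgroup.zero_closed[OF ideal.axioms(1)[OF J(1)]] by blast
  next
    case (insert g G)
    have gc: "g \<in> carrier R" "G \<subseteq> carrier R" using insert.prems(1) by auto
    interpret I: ideal "Idl G" R by (rule genideal_ideal[OF gc(2)])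
    have "g \<in> J" using genideal_self[OF insert.prems(1)] insert.prems(2) by blast
    then have "g \<in> \<mm> \<cdot> (Idl (insert g G))" using J(2) insert.prems(2) by blast
    then obtain a b where ab: "a \<in> \<mm>" "b \<in> Idl G" "g = a \<otimes> g \<oplus> b"
      using prod_genideal_insert[OF m gc] by blast
    have c: "a \<in> carrier R" "b \<in> carrier R" using ideal.Icarr[OF m ab(1)] I.Icarr[OF ab(2)] .
    obtain v where v: "v \<in> carrier R" "v \<otimes> (\<one> \<ominus> a) = \<one>" using local_one_minus_invertible[OF R ab(1)] by blast
    have "(\<one> \<ominus> a) \<otimes> g = g \<ominus> a \<otimes> g" using c gc by (simp add: a_minus_def l_distr l_minus)
    also have "\<dots> = (a \<otimes> g \<oplus> b) \<ominus> a \<otimes> g" using ab(3) by simp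
    also have "\<dots> = b"
    proof -
      have "(a \<otimes> g \<oplus> b) \<ominus> a \<otimes> g = b \<oplus> (a \<otimes> g \<oplus> \<ominus> (a \<otimes> g))" using c gc by (simp add: a_minus_def a_ac)
      then show ?thesis using c gc by (simp add: r_neg)
    qed
    finally have "(\<one> \<ominus> a) \<otimes> g = b" .
    then have "v \<otimes> b = v \<otimes> (\<one> \<ominus> a) \<otimes> g" using m_assoc[OF v(1) _ gc(1), of "\<one> \<ominus> a"] c by simp
    then have "g = v \<otimes> b" using v(2) gc by simp
    then have gI: "g \<in> Idl G" using I.I_l_closed[OF ab(2) v(1)] by simp
    have "Idl (insert g G) = Idl G"
    proof
      show "Idl (insert g G) \<subseteq> Idl G"
        by (rule genideal_minimal[OF I.is_ideal]) (use gI genideal_self[OF gc(2)] in blast)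
      show "Idl G \<subseteq> Idl (insert g G)"
        by (rule genideal_minimal[OF genideal_ideal[OF insert.prems(1)]]) (use genideal_self[OF insert.prems(1)] in blast)
    qed
    then show ?case using insert.IH[OF gc(2)] insert.prems(2) by simp
  qed
  obtain G where "G \<subseteq> carrier R" "finite G" "J = Idl G" using noetherian_ring.finetely_gen[OF R(1) J(1)] by blast
  then show ?thesis using main by blast
qed

lemma ideal_prod_list_comb:
  assumes fs: "set fs \<subseteq> carrier R" and J: "ideal J R" and z: "z \<in> (Idl (set fs)) \<cdot> J"
  shows "\<exists>w. (\<forall>i<length fs. w i \<in> J) \<and> z = (\<Oplus>i\<in>{..<length fs}. fs ! i \<otimes> w i)"
  using z
proof (induction rule: ideal_prod.induct)
  interpret J: ideal J R by (rule J)
  have fc: "fs ! i \<in> carrier R" if "i < length fs" for i using fs that by (auto simp: subset_iff)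
  {
    case (prod u v)
    obtain c where c: "\<And>i. i < length fs \<Longrightarrow> c i \<in> carrier R" "u = (\<Oplus>i\<in>{..<length fs}. c i \<otimes> fs ! i)"
      using genideal_list_comb[OF fs prod(1)] by blast
    have vc: "v \<in> carrier R" by (rule J.Icarr[OF prod(2)])
    have "u \<otimes> v = (\<Oplus>i\<in>{..<length fs}. (c i \<otimes> fs ! i) \<otimes> v)"
      unfolding c(2) by (rule finsum_ldistr) (use vc c(1) fc in auto)
    also have "\<dots> = (\<Oplus>i\<in>{..<length fs}. fs ! i \<otimes> (c i \<otimes> v))"
      by (rule finsum_cong') (use c(1) fc vc in \<open>auto simp: m_ac\<close>)
    finally have "u \<otimes> v = (\<Oplus>i\<in>{..<length fs}. fs ! i \<otimes> (c i \<otimes> v))" .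
    moreover have "\<forall>i<length fs. c i \<otimes> v \<in> J" using J.I_l_closed[OF prod(2) c(1)] by blast
    ultimately show ?case by (intro exI[of _ "\<lambda>i. c i \<otimes> v"]) simp
  next
    case (sum s t)
    then obtain w w' where w: "\<And>i. i < length fs \<Longrightarrow> w i \<in> J" "s = (\<Oplus>i\<in>{..<length fs}. fs ! i \<otimes> w i)"
      and w': "\<And>i. i < length fs \<Longrightarrow> w' i \<in> J" "t = (\<Oplus>i\<in>{..<length fs}. fs ! i \<otimes> w' i)" by blast
    have "(\<Oplus>i\<in>{..<length fs}. fs ! i \<otimes> (w i \<oplus> w' i)) = (\<Oplus>i\<in>{..<length fs}. fs ! i \<otimes> w i \<oplus> fs ! i \<otimes> w' i)"
      by (rule finsum_cong') (use J.Icarr[OF w(1)] J.Icarr[OF w'(1)] fc in \<open>auto simp: r_distr\<close>)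
    also have "\<dots> = s \<oplus> t" unfolding w(2) w'(2)
      by (rule finsum_addf) (use J.Icarr[OF w(1)] J.Icarr[OF w'(1)] fc in auto)
    finally have "s \<oplus> t = (\<Oplus>i\<in>{..<length fs}. fs ! i \<otimes> (w i \<oplus> w' i))" ..
    moreover have "\<forall>i<length fs. w i \<oplus> w' i \<in> J" using w(1) w'(1) J.a_closed by simp
    ultimately show ?case by (intro exI[of _ "\<lambda>i. w i \<oplus> w' i"]) simp
  }
qed

lemma finsum_ideal: "ideal J R \<Longrightarrow> (\<And>i. i \<in> A \<Longrightarrow> f i \<in> J) \<Longrightarrow> (\<Oplus>i\<in>A. f i) \<in> J"
proof -
  assume J: "ideal J R" and f: "\<And>i. i \<in> A \<Longrightarrow> f i \<in> J"
  interpret J: ideal J R by fact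
  show ?thesis by (rule subgroup_finsum_closed) (use f J.zero_closed J.a_closed J.Icarr in auto)
qed

end

section \<open>Products of powers of the given ideals\<close>

locale ideal_powers = cring R for R :: "('a, 'b) ring_scheme" (structure) +
  fixes I :: "'s::finite \<Rightarrow> 'a set"
  assumes I_ideal: "ideal (I i) R"
begin

sublocale P: comm_monoid "ideals_set R" by (rule ideals_set_is_comm_monoid)

abbreviation mp where "mp \<equiv> multi_power R I"

lemma P_simps: "K \<in> carrier (ideals_set R) \<longleftrightarrow> ideal K R" "K \<otimes>\<^bsub>ideals_set R\<^esub> L = K \<cdot> L" "\<one>\<^bsub>ideals_set R\<^esub> = carrier R"
  by (simp_all add: ideals_set_def)

lemma I_pow: "I i [^]\<^bsub>ideals_set R\<^esub> (k::nat) \<in> carrier (ideals_set R)"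
  by (rule P.nat_pow_closed) (simp add: P_simps I_ideal)

lemma mp_ideal: "ideal (mp n) R"
  unfolding P_simps(1)[symmetric] multi_power_def by (rule P.finprod_closed) (use I_pow in simp)

text \<open>\<open>sup n 0\<close> is the positive part of \<open>n\<close>. Exponents can be split
  additively only when they are nonnegative, so later arguments pass to it first.\<close>

lemma mp_nonneg: "mp n = mp (sup n 0)"
proof -
  have "nat (n i) = nat (sup n 0 i)" for i by (simp add: sup_fun_def sup_int_def max_def)
  then show ?thesis unfolding multi_power_def by simp
qed

lemma mp_mult: "0 \<le> a \<Longrightarrow> 0 \<le> b \<Longrightarrow> mp (a + b) = mp a \<cdot> mp b"
proof -
  assume ab: "0 \<le> a" "0 \<le> b"
  have n: "nat ((a + b) i) = nat (a i) + nat (b i)" for i using ab by (simp add: le_fun_def nat_add_distrib)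
  have "mp a \<otimes>\<^bsub>ideals_set R\<^esub> mp b = mp (a + b)"
    unfolding multi_power_def n P.nat_pow_mult[OF P_simps(1)[THEN iffD2, OF I_ideal], symmetric]
    by (rule P.finprod_multf[symmetric]) (use I_pow in simp_all)
  then show ?thesis unfolding P_simps ..
qed

lemma mp_anti: "n \<le> m \<Longrightarrow> mp m \<subseteq> mp n"
proof -
  assume nm: "n \<le> m"
  let ?a = "sup n 0" and ?b = "sup m 0 - sup n 0"
  have "sup n 0 \<le> sup m 0" using nm by (intro sup_mono) simp_all
  then have b: "0 \<le> ?b" by simp
  have "mp m = mp (?a + ?b)" using mp_nonneg[of m] by simp
  also have "\<dots> = mp ?a \<cdot> mp ?b" by (rule mp_mult) (use b in simp_all)
  also have "\<dots> \<subseteq> mp ?a" using ideal_prod_inter[OF mp_ideal mp_ideal] by blast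
  finally show ?thesis using mp_nonneg[of n] by simp
qed

text \<open>For positive parts the product rule is exact, and \<open>n + m\<close> lies below the
  sum of the positive parts.\<close>

lemma mp_closed: "x \<in> mp n \<Longrightarrow> y \<in> mp m \<Longrightarrow> x \<otimes> y \<in> mp (n + m)"
proof -
  assume xy: "x \<in> mp n" "y \<in> mp m"
  have "x \<otimes> y \<in> mp (sup n 0) \<cdot> mp (sup m 0)"
    using xy mp_nonneg[of n] mp_nonneg[of m] by (intro ideal_prod.prod) simp_all
  also have "\<dots> = mp (sup n 0 + sup m 0)" by (rule mp_mult[symmetric]) simp_all
  also have "\<dots> \<subseteq> mp (n + m)" by (rule mp_anti[OF add_mono]) simp_all
  finally show ?thesis .
qed

lemma mp_one: "\<one> \<in> mp 0"
proof -
  have "mp 0 = \<one>\<^bsub>ideals_set R\<^esub>" unfolding multi_power_def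
    by (rule P.finprod_one_eqI) simp
  then show ?thesis by (simp add: P_simps)
qed

lemma mp_one_eq: "mp 1 = (\<Otimes>\<^bsub>ideals_set R\<^esub> i\<in>UNIV. I i)"
  unfolding multi_power_def using P.nat_pow_eone[OF P_simps(1)[THEN iffD2, OF I_ideal]] by simp

lemma finprod_mem_mp: "(\<And>i. x i \<in> I i) \<Longrightarrow> (\<Otimes>i\<in>UNIV. x i) \<in> mp 1"
proof -
  assume x: "\<And>i. x i \<in> I i"
  have xc: "x i \<in> carrier R" for i by (rule ideal.Icarr[OF I_ideal x])
  have "(\<Otimes>i\<in>A. x i) \<in> (\<Otimes>\<^bsub>ideals_set R\<^esub> i\<in>A. I i)" if "finite A" for A
    using that
  proof (induction A rule: finite_induct)
    case empty
    then show ?case by (simp add: P_simps)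
  next
    case (insert a A)
    have "(\<Otimes>i\<in>insert a A. x i) = x a \<otimes> (\<Otimes>i\<in>A. x i)"
      by (rule finprod_insert[OF insert(1,2)]) (use xc in auto)
    moreover have "(\<Otimes>\<^bsub>ideals_set R\<^esub> i\<in>insert a A. I i) = I a \<cdot> (\<Otimes>\<^bsub>ideals_set R\<^esub> i\<in>A. I i)"
      unfolding P_simps(2)[symmetric] by (rule P.finprod_insert[OF insert(1,2)]) (simp_all add: P_simps I_ideal)
    ultimately show ?case using ideal_prod.prod[OF x insert.IH] by simp
  qed
  from this[OF finite] show ?thesis unfolding mp_one_eq .
qed

lemma mp_pow: "z \<in> mp 1 \<Longrightarrow> z [^] (k::nat) \<in> mp (of_nat k)"
proof (induction k)
  case 0
  show ?case using mp_one by (simp only: nat_pow_0 of_nat_0)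
next
  case (Suc k)
  then have "z [^] k \<otimes> z \<in> mp (of_nat k + 1)" by (intro mp_closed)
  then show ?case by (simp only: nat_pow_Suc of_nat_Suc add.commute)
qed

text \<open>Powers of ideals are generated in any box; for a general filtration the box must come
  from finiteness of the Rees module.\<close>

lemma mp_box:
  assumes "0 \<le> n" "0 \<le> N"
  shows "mp n = mp (n - inf n N) \<cdot> mp (inf n N)"
proof -
  have "mp n = mp ((n - inf n N) + inf n N)" by simp
  also have "\<dots> = mp (n - inf n N) \<cdot> mp (inf n N)" by (rule mp_mult) (use assms in simp_all)
  finally show ?thesis .
qed

end

section \<open>Finite generation over the Rees ring\<close>

context ideal_family
begin

lemma rees_carrier: "u \<in> carrier (ext_rees R F) \<longleftrightarrow> (\<forall>n. u n \<in> F n) \<and> finite {n. u n \<noteq> \<zero>}"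
  by (simp add: ext_rees_def)

lemma rees_add_eval: "(u \<oplus>\<^bsub>ext_rees R F\<^esub> v) n = u n \<oplus> v n"
  by (simp add: ext_rees_def)

lemma rees_zero_eval: "\<zero>\<^bsub>ext_rees R F\<^esub> n = \<zero>"
  by (simp add: ext_rees_def)

lemma rees_abelian_monoid: "abelian_monoid (ext_rees R F)"
proof (rule abelian_monoidI)
  fix u v assume uv: "u \<in> carrier (ext_rees R F)" "v \<in> carrier (ext_rees R F)"
  have c: "u n \<in> carrier R" "v n \<in> carrier R" for n using uv Fc unfolding rees_carrier by blast+
  have "{n. u n \<oplus> v n \<noteq> \<zero>} \<subseteq> {n. u n \<noteq> \<zero>} \<union> {n. v n \<noteq> \<zero>}" by auto
  then have "finite {n. u n \<oplus> v n \<noteq> \<zero>}"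
    by (rule finite_subset) (use uv in \<open>simp add: rees_carrier\<close>)
  then show "u \<oplus>\<^bsub>ext_rees R F\<^esub> v \<in> carrier (ext_rees R F)"
    using uv F_add by (simp add: rees_carrier rees_add_eval)
  show "u \<oplus>\<^bsub>ext_rees R F\<^esub> v = v \<oplus>\<^bsub>ext_rees R F\<^esub> u"
    by (rule ext) (simp add: rees_add_eval a_comm[OF c])
  show "\<zero>\<^bsub>ext_rees R F\<^esub> \<oplus>\<^bsub>ext_rees R F\<^esub> u = u"
    by (rule ext) (simp add: rees_add_eval rees_zero_eval c)
  fix w assume w: "w \<in> carrier (ext_rees R F)"
  have wc: "w n \<in> carrier R" for n using w Fc unfolding rees_carrier by blast
  show "u \<oplus>\<^bsub>ext_rees R F\<^esub> v \<oplus>\<^bsub>ext_rees R F\<^esub> w = u \<oplus>\<^bsub>ext_rees R F\<^esub> (v \<oplus>\<^bsub>ext_rees R F\<^esub> w)"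
    by (rule ext) (simp add: rees_add_eval a_assoc[OF c wc])
next
  show "\<zero>\<^bsub>ext_rees R F\<^esub> \<in> carrier (ext_rees R F)" using F_zero by (simp add: rees_carrier rees_zero_eval)
qed

lemma rees_finsum_eval:
  assumes "finite X" "\<And>x. x \<in> X \<Longrightarrow> f x \<in> carrier (ext_rees R F)"
  shows "(\<Oplus>\<^bsub>ext_rees R F\<^esub>x\<in>X. f x) n = (\<Oplus>x\<in>X. f x n)"
  using assms
proof (induction X rule: finite_induct)
  case empty
  interpret M: abelian_monoid "ext_rees R F" by (rule rees_abelian_monoid)
  show ?case by (simp add: rees_zero_eval)
next
  case (insert a X)
  interpret M: abelian_monoid "ext_rees R F" by (rule rees_abelian_monoid)
  have c: "f x n \<in> carrier R" if "x \<in> insert a X" for x using insert.prems[OF that] Fc unfolding rees_carrier by blast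
  have "(\<Oplus>\<^bsub>ext_rees R F\<^esub>x\<in>insert a X. f x) = f a \<oplus>\<^bsub>ext_rees R F\<^esub> (\<Oplus>\<^bsub>ext_rees R F\<^esub>x\<in>X. f x)"
    by (rule M.finsum_insert[OF insert(1,2)]) (use insert.prems in auto)
  then have "(\<Oplus>\<^bsub>ext_rees R F\<^esub>x\<in>insert a X. f x) n = f a n \<oplus> (\<Oplus>x\<in>X. f x n)"
    using insert.IH insert.prems by (simp add: rees_add_eval)
  also have "\<dots> = (\<Oplus>x\<in>insert a X. f x n)"
    by (rule finsum_insert[OF insert(1,2), symmetric]) (use c in auto)
  finally show ?case .
qed

lemma hm_finsum: "finite A \<Longrightarrow> (\<And>a. a \<in> A \<Longrightarrow> f a \<in> F n) \<Longrightarrow> hm n (\<Oplus>a\<in>A. f a) = (\<Oplus>\<^bsub>G\<^esub>a\<in>A. hm n (f a))"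
proof (induction A rule: finite_induct)
  case empty
  show ?case by (simp add: hm_zero)
next
  case (insert b A)
  have "(\<Oplus>a\<in>insert b A. f a) = f b \<oplus> (\<Oplus>a\<in>A. f a)"
    by (rule finsum_insert[OF insert(1,2)]) (use insert.prems Fc in auto)
  moreover have "(\<Oplus>\<^bsub>G\<^esub>a\<in>insert b A. hm n (f a)) = hm n (f b) \<oplus>\<^bsub>G\<^esub> (\<Oplus>\<^bsub>G\<^esub>a\<in>A. hm n (f a))"
    by (rule G.finsum_insert[OF insert(1,2)]) (use insert.prems hm_closed in auto)
  moreover have "hm n (\<Oplus>a\<in>A. f a) = (\<Oplus>\<^bsub>G\<^esub>a\<in>A. hm n (f a))" by (rule insert.IH) (use insert.prems in simp)
  moreover have "hm n (f b) \<oplus>\<^bsub>G\<^esub> hm n (\<Oplus>a\<in>A. f a) = hm n (f b \<oplus> (\<Oplus>a\<in>A. f a))"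
    by (rule hm_add) (use insert.prems F_finsum[of A f n] in simp_all)
  ultimately show ?case by simp
qed

text \<open>Generators of finitely many \<open>F b\<close> in one list with their degrees attached;
  a position in the list then serves as index of a homogeneous generator.\<close>

lemma generator_list:
  assumes "noetherian_ring R" "finite D"
  shows "\<exists>ps. (\<forall>p\<in>set ps. fst p \<in> D \<and> snd p \<in> F (fst p)) \<and> (\<forall>b\<in>D. F b = Idl {g. (b, g) \<in> set ps})"
proof -
  have "\<exists>K. K \<subseteq> carrier R \<and> finite K \<and> F b = Idl K" for b
    using noetherian_ring.finetely_gen[OF assms(1) F_id] by blast
  then obtain K where K: "\<And>b. K b \<subseteq> carrier R" "\<And>b. finite (K b)" "\<And>b. F b = Idl (K b)" by metis
  have "finite (SIGMA b:D. K b)" using assms(2) K(2) by (intro finite_SigmaI)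
  then obtain ps where ps: "set ps = (SIGMA b:D. K b)" using finite_list by blast
  have "snd p \<in> F (fst p)" if "p \<in> set ps" for p
    using that genideal_self[OF K(1), of "fst p"] unfolding ps K(3)[of "fst p"] by auto
  moreover have "fst p \<in> D" if "p \<in> set ps" for p using that unfolding ps by auto
  moreover have "F b = Idl {g. (b, g) \<in> set ps}" if "b \<in> D" for b unfolding ps using K(3)[of b] that by simp
  ultimately show ?thesis by (intro exI[of _ ps]) simp
qed

end

context filtration_pair
begin

lemma rees_smult_closed:
  assumes c: "c \<in> carrier (ext_rees R E)" and x: "x \<in> carrier (ext_rees R F)"
  shows "rees_mult R c x \<in> carrier (ext_rees R F)"
proof -
  have cE: "c a \<in> E a" "finite {a. c a \<noteq> \<zero>}" for a using c unfolding E.rees_carrier by blast+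
  have xF: "x a \<in> F a" "finite {a. x a \<noteq> \<zero>}" for a using x unfolding F.rees_carrier by blast+
  have "rees_mult R c x n \<in> F n" for n
    unfolding rees_mult_def
  proof (rule F.F_finsum)
    fix a
    show "c a \<otimes> x (n - a) \<in> F n" using EF[OF cE(1) xF(1), of a "n - a"] by simp
  qed
  moreover have "{n. rees_mult R c x n \<noteq> \<zero>} \<subseteq> (\<lambda>(a, b). a + b) ` ({a. c a \<noteq> \<zero>} \<times> {a. x a \<noteq> \<zero>})"
  proof
    fix n assume "n \<in> {n. rees_mult R c x n \<noteq> \<zero>}"
    then have n: "rees_mult R c x n \<noteq> \<zero>" by simp
    have "\<exists>a\<in>{a. c a \<noteq> \<zero>}. c a \<otimes> x (n - a) \<noteq> \<zero>"
    proof (rule ccontr)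
      assume "\<not> (\<exists>a\<in>{a. c a \<noteq> \<zero>}. c a \<otimes> x (n - a) \<noteq> \<zero>)"
      then have "rees_mult R c x n = \<zero>" unfolding rees_mult_def by (intro add.finprod_one_eqI) blast
      then show False using n by simp
    qed
    then obtain a where a: "c a \<noteq> \<zero>" "c a \<otimes> x (n - a) \<noteq> \<zero>" by auto
    then have "x (n - a) \<noteq> \<zero>" using E.Fc[OF cE(1)] by auto
    then show "n \<in> (\<lambda>(a, b). a + b) ` ({a. c a \<noteq> \<zero>} \<times> {a. x a \<noteq> \<zero>})"
      using a(1) by (intro image_eqI[of _ _ "(a, n - a)"]) simp_all
  qed
  then have "finite {n. rees_mult R c x n \<noteq> \<zero>}"
    by (rule finite_subset) (intro finite_imageI finite_cartesian_product cE(2) xF(2))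
  ultimately show ?thesis unfolding F.rees_carrier by simp
qed

lemma EF_prod: "E a \<cdot> F b \<subseteq> F (a + b)"
proof
  fix x assume "x \<in> E a \<cdot> F b"
  then show "x \<in> F (a + b)"
  proof (induction rule: ideal_prod.induct)
    case (prod i j)
    then show ?case by (rule EF)
  next
    case (sum s t)
    then show ?case by (intro F.F_add)
  qed
qed

lemma G_smult_self: "x \<odot>\<^bsub>E.G\<^esub> y = x \<otimes>\<^bsub>E.G\<^esub> y"
  by (simp add: assoc_graded_def)

text \<open>\<open>H\<close> is abstract because the argument is needed twice: for the ideal spanned
  by candidate generators in \<open>ex_generators\<close>, and for the closure principle
  \<open>gen_span\<close>.\<close>

lemma hm_prod_span:
  assumes x: "x \<in> E a \<cdot> F b" and ab: "0 \<le> a" "0 \<le> b" and K: "K \<subseteq> F b" "F b = Idl K"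
    and H: "\<zero>\<^bsub>F.G\<^esub> \<in> H" "\<And>y z. y \<in> H \<Longrightarrow> z \<in> H \<Longrightarrow> y \<oplus>\<^bsub>F.G\<^esub> z \<in> H"
    and step: "\<And>r g. r \<in> E a \<Longrightarrow> g \<in> K \<Longrightarrow> E.hm a r \<odot>\<^bsub>F.G\<^esub> F.hm b g \<in> H"
  shows "F.hm (a + b) x \<in> H"
  using x
proof (induction rule: ideal_prod.induct)
  case (prod p q)
  have Kc: "K \<subseteq> carrier R" using K(1) F.Fc by blast
  have pc: "p \<in> carrier R" by (rule E.Fc[OF prod(1)])
  have "q \<in> ispan K" using genideal_ispan[OF Kc] prod(2) K(2) by blast
  then have "q \<in> F b \<and> F.hm (a + b) (p \<otimes> q) \<in> H"
  proof (induction rule: ispan.induct)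
    case ispan_zero
    show ?case using F.F_zero pc H(1) by (simp add: F.hm_zero)
  next
    case (ispan_step r g y)
    have g: "g \<in> F b" using K(1) ispan_step(2) by blast
    note y = conjunct1[OF ispan_step.IH] conjunct2[OF ispan_step.IH]
    have pr: "p \<otimes> r \<in> E a" using E.F_mult[OF ispan_step(1) prod(1)] m_comm[OF pc ispan_step(1)] by simp
    have e: "p \<otimes> (r \<otimes> g \<oplus> y) = (p \<otimes> r) \<otimes> g \<oplus> p \<otimes> y"
      using pc ispan_step(1) F.Fc[OF g] F.Fc[OF y(1)] by (simp add: r_distr m_assoc)
    have "F.hm (a + b) (p \<otimes> (r \<otimes> g \<oplus> y)) = F.hm (a + b) ((p \<otimes> r) \<otimes> g) \<oplus>\<^bsub>F.G\<^esub> F.hm (a + b) (p \<otimes> y)"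
      unfolding e by (rule F.hm_add[OF EF[OF pr g] EF[OF prod(1) y(1)], symmetric])
    moreover have "F.hm (a + b) ((p \<otimes> r) \<otimes> g) \<in> H"
      using step[OF pr ispan_step(2)] hm_smult[OF ab pr g] by simp
    ultimately have "F.hm (a + b) (p \<otimes> (r \<otimes> g \<oplus> y)) \<in> H" using H(2)[OF _ y(2)] by metis
    then show ?case using F.F_add[OF F.F_mult[OF ispan_step(1) g] y(1)] by (intro conjI)
  qed
  then show ?case by (rule conjunct2)
next
  case (sum s t)
  have "s \<in> F (a + b)" "t \<in> F (a + b)" using sum.hyps EF_prod by blast+
  then show ?case using H(2)[OF sum.IH] F.hm_add by metis
qed

end

text \<open>Let \<open>t = inf n N\<close> and let \<open>e\<close> be the positive part of
  \<open>n - b\<close> minus \<open>n - t\<close>. Since \<open>b \<le> N\<close>, each entry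
  satisfies \<open>e \<ge> 0\<close> and \<open>t \<le> e + b\<close>. So the power containing
  \<open>c\<close> splits as \<open>mp (n - t) \<cdot> mp e\<close>, and \<open>mp e\<close> carries
  \<open>w\<close> from \<open>F b\<close> into \<open>F t\<close>.\<close>

lemma (in ideal_powers) prod_mem_box:
  assumes F: "filtration_pair R mp F" and c: "c \<in> mp (n - b)" and w: "w \<in> F b" and bN: "b \<le> N" and n: "0 \<le> n" and N: "0 \<le> N"
  shows "c \<otimes> w \<in> mp (n - inf n N) \<cdot> F (inf n N)"
proof -
  interpret fp: filtration_pair R mp F by (rule F)
  let ?t = "inf n N" and ?e = "sup (n - b) 0 - (n - inf n N)"
  have i: "0 \<le> ?e i \<and> ?t i \<le> ?e i + b i" for i
  proof -
    have "b i \<le> N i" "0 \<le> n i" using bN n by (simp_all add: le_fun_def)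
    then show ?thesis by (auto simp: inf_int_def sup_int_def min_def max_def)
  qed
  then have e: "0 \<le> ?e" "?t \<le> ?e + b" by (simp_all add: le_fun_def)
  have "mp (n - b) = mp ((n - ?t) + ?e)" using mp_nonneg[of "n - b"] by simp
  also have "\<dots> = mp (n - ?t) \<cdot> mp ?e" by (rule mp_mult) (use e in simp_all)
  finally have "c \<in> mp (n - ?t) \<cdot> mp ?e" using c by simp
  then show ?thesis
  proof (induction rule: ideal_prod.induct)
    case (prod p q)
    have "q \<otimes> w \<in> F ?t" using fp.EF[OF prod(2) w] fp.F.F_anti[OF e(2)] by blast
    then have "p \<otimes> (q \<otimes> w) \<in> mp (n - ?t) \<cdot> F ?t" by (rule ideal_prod.prod[OF prod(1)])
    then show ?case unfolding m_assoc[OF fp.E.Fc[OF prod(1)] fp.E.Fc[OF prod(2)] fp.F.Fc[OF w]] .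
  next
    case (sum s t)
    have "s \<in> carrier R" "t \<in> carrier R" using sum.hyps ideal_prod_in_carrier[OF mp_ideal mp_ideal] by blast+
    then show ?case using ideal_prod.sum[OF sum.IH] l_distr[OF _ _ fp.F.Fc[OF w]] by metis
  qed
qed

text \<open>The generators of the Rees module need not be homogeneous, but together their supports
  are finite; \<open>N\<close> bounds all degrees in them. Comparing coefficients at
  \<open>n\<close> of the monomial \<open>z t^n\<close> gives the claim.\<close>

lemma (in ideal_powers) box_of_finite_module:
  assumes F: "filtration_pair R mp F" and fin: "finite_module (ext_rees R mp) (ext_rees R F)"
  shows "\<exists>N\<ge>1. \<forall>n\<ge>0. F n \<subseteq> mp (n - inf n N) \<cdot> F (inf n N)"
proof -
  interpret fp: filtration_pair R mp F by (rule F)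
  obtain X where X: "finite X" "X \<subseteq> carrier (ext_rees R F)"
    and span: "\<forall>u\<in>carrier (ext_rees R F). \<exists>c\<in>X \<rightarrow> carrier (ext_rees R mp). u = (\<Oplus>\<^bsub>ext_rees R F\<^esub>x\<in>X. c x \<odot>\<^bsub>ext_rees R F\<^esub> x)"
    using fin unfolding finite_module_def by blast
  define D where "D = (\<Union>x\<in>X. {b. x b \<noteq> \<zero>})"
  have "finite {b. x b \<noteq> \<zero>}" if "x \<in> X" for x
    using fp.F.rees_carrier[THEN iffD1, OF subsetD[OF X(2) that]] by (rule conjunct2)
  then have finD: "finite D" unfolding D_def using X(1) by blast
  \<comment> \<open>The inserted 1 makes the maximum exist and gives \<open>1 \<le> N\<close>, which
    keeps \<open>inf n N\<close> at least 1 for \<open>n \<ge> 1\<close>.\<close>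
  define N where "N = (\<lambda>i. Max (insert 1 ((\<lambda>b. b i) ` D)))"
  have N1: "1 \<le> N" unfolding N_def le_fun_def using finD by simp
  have bN: "b \<le> N" if "b \<in> D" for b unfolding N_def le_fun_def using finD that by (auto intro!: Max_ge)
  have N0: "0 \<le> N" using N1 by (rule order_trans[rotated]) (simp add: le_fun_def)
  have "F n \<subseteq> mp (n - inf n N) \<cdot> F (inf n N)" if n: "0 \<le> n" for n
  proof
    fix z assume z: "z \<in> F n"
    let ?K = "mp (n - inf n N) \<cdot> F (inf n N)" and ?u = "\<lambda>k. if k = n then z else \<zero>"
    have K: "ideal ?K R" by (rule ideal_prod_is_ideal[OF mp_ideal fp.F.F_id])
    have "{k. ?u k \<noteq> \<zero>} \<subseteq> {n}" by auto
    then have "finite {k. ?u k \<noteq> \<zero>}" by (rule finite_subset) simp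
    then have "?u \<in> carrier (ext_rees R F)" unfolding fp.F.rees_carrier using z fp.F.F_zero by simp
    then obtain c where c: "c \<in> X \<rightarrow> carrier (ext_rees R mp)" "?u = (\<Oplus>\<^bsub>ext_rees R F\<^esub>x\<in>X. c x \<odot>\<^bsub>ext_rees R F\<^esub> x)"
      using span by blast
    have cx: "c x \<in> carrier (ext_rees R mp)" if "x \<in> X" for x using c(1) that by blast
    have sm: "c x \<odot>\<^bsub>ext_rees R F\<^esub> x = rees_mult R (c x) x" for x by (simp add: ext_rees_def)
    have xF: "x \<in> carrier (ext_rees R F)" if "x \<in> X" for x using X(2) that by blast
    have "z = (\<Oplus>\<^bsub>ext_rees R F\<^esub>x\<in>X. c x \<odot>\<^bsub>ext_rees R F\<^esub> x) n" using fun_cong[OF c(2), of n] by simp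
    also have "\<dots> = (\<Oplus>x\<in>X. rees_mult R (c x) x n)"
      unfolding sm by (rule fp.F.rees_finsum_eval[OF X(1)]) (use fp.rees_smult_closed cx xF in simp)
    also have "\<dots> \<in> ?K"
    proof (rule finsum_ideal[OF K])
      fix x assume x: "x \<in> X"
      show "rees_mult R (c x) x n \<in> ?K"
        unfolding rees_mult_def
      proof (rule finsum_ideal[OF K])
        fix a
        have ca: "c x a \<in> mp a" using cx[OF x] unfolding fp.E.rees_carrier by simp
        have xa: "x (n - a) \<in> F (n - a)" using xF[OF x] unfolding fp.F.rees_carrier by simp
        show "c x a \<otimes> x (n - a) \<in> ?K"
        \<comment> \<open>Only degrees \<open>n - a\<close> in the support of a generator matter,
          and these are bounded by \<open>N\<close>.\<close>
        proof (cases "x (n - a) = \<zero>")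
          case True
          then show ?thesis using fp.E.Fc[OF ca] additive_subgroup.zero_closed[OF ideal.axioms(1)[OF K]] by simp
        next
          case False
          then have D: "n - a \<in> D" unfolding D_def using x by blast
          have "c x a \<in> mp (n - (n - a))" using ca by (metis diff_diff_eq2 add_diff_cancel_left')
          then show ?thesis by (rule prod_mem_box[OF F _ xa bN[OF D] n N0])
        qed
      qed
    qed
    finally show "z \<in> ?K" .
  qed
  then show ?thesis using N1 by blast
qed

section \<open>Complete reductions and regularity\<close>

lemma (in abelian_group) finsum_shift:
  assumes "\<And>j. j < (d::nat) \<Longrightarrow> f j \<in> carrier G"
  shows "(\<Oplus>i\<in>{p..<p + d}. f (i - p)) = (\<Oplus>j\<in>{..<d}. f j)"
proof -
  have e: "{p..<p + d} = (\<lambda>j. j + p) ` {..<d}"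
    using image_add_atLeastLessThan'[of p 0 d] by (simp add: lessThan_atLeast0 add.commute)
  show ?thesis unfolding e by (subst add.finprod_reindex) (use assms in auto)
qed

lemma ex_of_nat_ge: "\<exists>k. (a :: 's::finite \<Rightarrow> int) \<le> of_nat k"
proof (intro exI le_funI)
  fix i
  have "a i \<le> Max (range a)" by simp
  also have "x \<le> int (nat x)" for x by simp
  finally show "a i \<le> of_nat (nat (Max (range a))) i" by simp
qed

text \<open>The two box conditions are the form in which finite generation is available:
  \<open>box_E\<close> gives generators of the irrelevant ideal, \<open>box_F\<close> gives
  generators of the module.\<close>

locale reduction_pair = filtration_pair R E F
  for R :: "('a, 'b) ring_scheme" (structure) and E F :: "('s::finite \<Rightarrow> int) \<Rightarrow> 'a set" +
  fixes N m0 :: "'s \<Rightarrow> int" and yl :: "'a list"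
  assumes noetherian: "noetherian_ring R" and N_pos: "1 \<le> N"
    and box_E: "0 \<le> n \<Longrightarrow> E n \<subseteq> E (n - inf n N) \<cdot> E (inf n N)"
    and box_F: "0 \<le> n \<Longrightarrow> F n \<subseteq> E (n - inf n N) \<cdot> F (inf n N)"
    and yl_E: "set yl \<subseteq> E 1" and m0_nonneg: "0 \<le> m0"
    and eventual_reduction: "m0 \<le> n \<Longrightarrow> F (n + 1) \<subseteq> (Idl (set yl)) \<cdot> F n"
begin

lemma N_nonneg: "0 \<le> N" using N_pos by (rule order_trans[rotated]) (simp add: le_fun_def)

text \<open>Without this, the \<open>SOME\<close> in \<open>local_cohomology\<close> would be an
  arbitrary list. The classes of generators of the \<open>E b\<close> with
  \<open>1 \<le> b \<le> N\<close> suffice: by \<open>box_E\<close> an element of \<open>E n\<close>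
  is a sum of products with one factor in \<open>E (inf n N)\<close>.\<close>

lemma ex_generators: "\<exists>fs. homogeneous_generators E.G E.gG (irrelevant_ideal E.G E.gG) fs"
proof -
  interpret S: cring E.G by (rule G_cring)
  obtain ps where ps: "\<forall>p\<in>set ps. fst p \<in> {1..N} \<and> snd p \<in> E (fst p)"
      "\<forall>b\<in>{1..N}. E b = Idl {g. (b, g) \<in> set ps}"
    using E.generator_list[OF noetherian finite_index_interval[of 1 N]] by blast
  let ?fs = "map (\<lambda>p. E.hm (fst p) (snd p)) ps" and ?I = "irrelevant_ideal E.G E.gG"
  have fI: "set ?fs \<subseteq> ?I" using ps(1) hm_irrelevant by auto
  have fc: "set ?fs \<subseteq> carrier E.G" using ps(1) E.hm_closed by auto
  interpret J: ideal "Idl\<^bsub>E.G\<^esub> (set ?fs)" E.G by (rule S.genideal_ideal[OF fc])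
  let ?J = "Idl\<^bsub>E.G\<^esub> (set ?fs)"
  have hm_J: "E.hm n x \<in> ?J" if n: "1 \<le> n" and x: "x \<in> E n" for n x
  proof -
    let ?t = "inf n N"
    have n0: "0 \<le> n" using n by (rule order_trans[rotated]) (simp add: le_fun_def)
    have t: "?t \<in> {1..N}" using n N_pos by simp
    then have t0: "0 \<le> ?t" using n0 N_nonneg by simp
    have x': "x \<in> E (n - ?t) \<cdot> E ?t" using box_E[OF n0] x by blast
    have "E.hm ((n - ?t) + ?t) x \<in> ?J"
    proof (rule filtration_pair.hm_prod_span[OF pair_EE x' _ t0])
      show "0 \<le> n - ?t" by simp
      show "{g. (?t, g) \<in> set ps} \<subseteq> E ?t" using ps(1) by auto
      show "E ?t = Idl {g. (?t, g) \<in> set ps}" using ps(2) t by blast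
      fix r g assume r: "r \<in> E (n - ?t)" and g: "g \<in> {g. (?t, g) \<in> set ps}"
      have "E.hm ?t g \<in> set ?fs" using g by force
      then have "E.hm ?t g \<in> ?J" using S.genideal_self[OF fc] by blast
      then show "E.hm (n - ?t) r \<odot>\<^bsub>E.G\<^esub> E.hm ?t g \<in> ?J"
        unfolding G_smult_self by (rule J.I_l_closed) (rule E.hm_closed[OF r])
    qed (rule J.zero_closed, rule J.a_closed)
    then show ?thesis by simp
  qed
  have "?I \<subseteq> ?J"
  proof
    fix v assume "v \<in> ?I"
    then obtain A u where A: "v = (\<Oplus>\<^bsub>E.G\<^esub>n\<in>A. u n)" "A \<subseteq> {1..}" "\<And>n. n \<in> A \<Longrightarrow> u n \<in> E.gG n"
      unfolding irrelevant_ideal_def by blast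
    show "v \<in> ?J" unfolding A(1)
    proof (rule E.G.subgroup_finsum_closed)
      fix n assume n: "n \<in> A"
      show "u n \<in> ?J" using A(3)[OF n]
      proof (rule E.gG_cases)
        assume "u n = \<zero>\<^bsub>E.G\<^esub>"
        then show ?thesis using J.zero_closed by simp
      next
        fix x assume "x \<in> E n" "u n = E.hm n x"
        then show ?thesis using hm_J[of n x] A(2) n by auto
      qed
    qed (use J.zero_closed J.a_closed J.Icarr in auto)
  qed
  moreover have "?J \<subseteq> ?I" by (rule S.genideal_minimal[OF irrelevant_is_ideal fI])
  moreover have "set ?fs \<subseteq> (\<Union>a. E.gG a)" using ps(1) E.gG_I by fastforce
  ultimately have "homogeneous_generators E.G E.gG ?I ?fs" unfolding homogeneous_generators_def by blast
  then show ?thesis by (rule exI)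
qed

definition gens :: "(('s \<Rightarrow> int) \<Rightarrow> 'a set) list" where
  "gens = (SOME fs. homogeneous_generators E.G E.gG (irrelevant_ideal E.G E.gG) fs)"

lemma gens: "homogeneous_generators E.G E.gG (irrelevant_ideal E.G E.gG) gens"
  unfolding gens_def by (rule someI_ex[OF ex_generators])

lemma lc_vanishes_gens:
  "lc_vanishes E.G E.gG F.G F.gG i n \<longleftrightarrow> (let H = cech_cohomology E.G E.gG F.G F.gG gens i n in carrier H = {\<one>\<^bsub>H\<^esub>})"
  unfolding lc_vanishes_def local_cohomology_def gens_def ..

text \<open>\<open>irrelevant_degree\<close> allows a degree at least 1 to be chosen for each
  generator, even for a zero one; the appended \<open>ys\<close> have degree 1.\<close>

definition \<delta> :: "nat \<Rightarrow> 's \<Rightarrow> int" where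
  "\<delta> i = (if i < length gens then SOME b. 1 \<le> b \<and> gens ! i \<in> E.gG b else 1)"

lemma gens_degree:
  assumes i: "i < length gens"
  shows "1 \<le> \<delta> i" "gens ! i \<in> E.gG (\<delta> i)"
proof -
  interpret S: cring E.G by (rule G_cring)
  have g: "gens ! i \<in> set gens" using i by simp
  have c: "set gens \<subseteq> (\<Union>a. E.gG a)" "Idl\<^bsub>E.G\<^esub> (set gens) = irrelevant_ideal E.G E.gG"
    using gens unfolding homogeneous_generators_def by auto
  have "set gens \<subseteq> carrier E.G" using c(1) E.gG_closed by blast
  then have J: "gens ! i \<in> irrelevant_ideal E.G E.gG" using S.genideal_self g c(2) by blast
  obtain a where "gens ! i \<in> E.gG a" using c(1) g by blast
  with J have "\<exists>b\<ge>1. gens ! i \<in> E.gG b" by (rule irrelevant_degree)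
  then have "1 \<le> \<delta> i \<and> gens ! i \<in> E.gG (\<delta> i)"
    using someI_ex[of "\<lambda>b. 1 \<le> b \<and> gens ! i \<in> E.gG b"] i by (simp only: \<delta>_def if_True)
  then show "1 \<le> \<delta> i" "gens ! i \<in> E.gG (\<delta> i)" by auto
qed

abbreviation ys where "ys \<equiv> map (E.hm 1) yl"
abbreviation A where "A \<equiv> {length gens..<length gens + length ys}"

lemma ys_nth: "i \<in> A \<Longrightarrow> (gens @ ys) ! i = E.hm 1 (yl ! (i - length gens))"
  by (auto simp: nth_append)

lemma yl_mem: "j < length yl \<Longrightarrow> yl ! j \<in> E 1" using yl_E nth_mem by blast

lemma one_nonneg: "0 \<le> (1 :: 's \<Rightarrow> int)" by (simp add: le_fun_def)

lemma hm_comb: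
  assumes n: "0 \<le> n" and v: "\<And>j. j < length yl \<Longrightarrow> v j \<in> F n"
  shows "(\<Oplus>\<^bsub>F.G\<^esub>i\<in>A. (gens @ ys) ! i \<odot>\<^bsub>F.G\<^esub> F.hm n (v (i - length gens)))
    = F.hm (n + 1) (\<Oplus>j\<in>{..<length yl}. yl ! j \<otimes> v j)"
proof -
  let ?p = "length gens"
  have e: "1 + n = n + 1" by (rule add.commute)
  have m: "yl ! j \<otimes> v j \<in> F (n + 1)" if "j < length yl" for j using EF[OF yl_mem[OF that] v[OF that]] unfolding e .
  have "(\<Oplus>\<^bsub>F.G\<^esub>i\<in>A. (gens @ ys) ! i \<odot>\<^bsub>F.G\<^esub> F.hm n (v (i - ?p)))
    = (\<Oplus>\<^bsub>F.G\<^esub>i\<in>A. F.hm (n + 1) (yl ! (i - ?p) \<otimes> v (i - ?p)))"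
  proof (rule F.G.finsum_cong')
    fix i assume i: "i \<in> A"
    then have j: "i - ?p < length yl" by auto
    show "(gens @ ys) ! i \<odot>\<^bsub>F.G\<^esub> F.hm n (v (i - ?p)) = F.hm (n + 1) (yl ! (i - ?p) \<otimes> v (i - ?p))"
      unfolding ys_nth[OF i] hm_smult[OF one_nonneg n yl_mem[OF j] v[OF j]] e ..
  next
    show "(\<lambda>i. F.hm (n + 1) (yl ! (i - ?p) \<otimes> v (i - ?p))) \<in> A \<rightarrow> carrier F.G"
      by (rule funcsetI, rule F.hm_closed, rule m) auto
  qed simp
  also have "\<dots> = (\<Oplus>\<^bsub>F.G\<^esub>j\<in>{..<length yl}. F.hm (n + 1) (yl ! j \<otimes> v j))"
    using F.G.finsum_shift[of "length yl" "\<lambda>j. F.hm (n + 1) (yl ! j \<otimes> v j)" ?p] F.hm_closed[OF m] by simp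
  also have "\<dots> = F.hm (n + 1) (\<Oplus>j\<in>{..<length yl}. yl ! j \<otimes> v j)"
    by (rule F.hm_finsum[symmetric]) (use m in simp_all)
  finally show ?thesis .
qed

text \<open>The property \<open>red_at\<close> of \<open>reduction_data\<close>, spelled out because
  that locale takes module generators which exist here only under a quantifier.\<close>

definition red :: "('s \<Rightarrow> int) \<Rightarrow> bool" where
  "red n \<longleftrightarrow> (\<forall>x\<in>F.gG (n + 1). \<exists>w. (\<forall>i\<in>A. w i \<in> F.gG n) \<and> x = (\<Oplus>\<^bsub>F.G\<^esub>i\<in>A. (gens @ ys) ! i \<odot>\<^bsub>F.G\<^esub> w i))"

lemma red_of_ideal:
  assumes n: "0 \<le> n" and r: "F (n + 1) \<subseteq> (Idl (set yl)) \<cdot> F n"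
  shows "red n"
  unfolding red_def
proof
  fix x assume x: "x \<in> F.gG (n + 1)"
  have n1: "0 \<le> n + 1" using n one_nonneg by (rule add_nonneg_nonneg)
  obtain z where z: "z \<in> F (n + 1)" "x = F.hm (n + 1) z" using x F.gG_eq[OF n1] by blast
  have yc: "set yl \<subseteq> carrier R" using yl_E E.Fc by blast
  obtain v where v: "\<And>j. j < length yl \<Longrightarrow> v j \<in> F n" "z = (\<Oplus>j\<in>{..<length yl}. yl ! j \<otimes> v j)"
    using ideal_prod_list_comb[OF yc F.F_id[of n], of z] r z(1) by blast
  show "\<exists>w. (\<forall>i\<in>A. w i \<in> F.gG n) \<and> x = (\<Oplus>\<^bsub>F.G\<^esub>i\<in>A. (gens @ ys) ! i \<odot>\<^bsub>F.G\<^esub> w i)"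
  proof (intro exI conjI ballI)
    show "F.hm n (v (i - length gens)) \<in> F.gG n" if "i \<in> A" for i
      by (rule F.gG_I, rule v(1)) (use that in auto)
    show "x = (\<Oplus>\<^bsub>F.G\<^esub>i\<in>A. (gens @ ys) ! i \<odot>\<^bsub>F.G\<^esub> F.hm n (v (i - length gens)))"
      using hm_comb[where v = v, OF n v(1)] z(2) v(2) by simp
  qed
qed

text \<open>Equality in the graded module is equality of cosets, so the combination of the
  \<open>yl\<close> matches \<open>z\<close> only up to the next step of the filtration.\<close>

lemma ideal_of_red:
  assumes n: "0 \<le> n" and r: "red n" and z: "z \<in> F (n + 1)"
  shows "\<exists>y\<in>(Idl (set yl)) \<cdot> F n. z \<ominus> y \<in> F (n + 1 + 1)"
proof -
  let ?p = "length gens"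
  have n1: "0 \<le> n + 1" using n one_nonneg by (rule add_nonneg_nonneg)
  have yc: "set yl \<subseteq> carrier R" using yl_E E.Fc by blast
  obtain w where w: "\<And>i. i \<in> A \<Longrightarrow> w i \<in> F.gG n"
      "F.hm (n + 1) z = (\<Oplus>\<^bsub>F.G\<^esub>i\<in>A. (gens @ ys) ! i \<odot>\<^bsub>F.G\<^esub> w i)"
    using r F.gG_I[OF z] unfolding red_def by meson
  have "\<exists>v. i \<in> A \<longrightarrow> v \<in> F n \<and> w i = F.hm n v" for i using w(1)[of i] F.gG_eq[OF n] by auto
  then obtain v where v: "\<And>i. i \<in> A \<Longrightarrow> v i \<in> F n \<and> w i = F.hm n (v i)" by metis
  let ?v = "\<lambda>j. v (j + ?p)"
  have vF: "?v j \<in> F n" if "j < length yl" for j using v[of "j + ?p"] that by simp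
  let ?y = "\<Oplus>j\<in>{..<length yl}. yl ! j \<otimes> ?v j"
  have "F.hm (n + 1) z = (\<Oplus>\<^bsub>F.G\<^esub>i\<in>A. (gens @ ys) ! i \<odot>\<^bsub>F.G\<^esub> F.hm n (?v (i - ?p)))"
    unfolding w(2)
  proof (rule F.G.finsum_cong')
    interpret module E.G F.G by (rule G_module)
    fix i assume i: "i \<in> A"
    then show "(gens @ ys) ! i \<odot>\<^bsub>F.G\<^esub> w i = (gens @ ys) ! i \<odot>\<^bsub>F.G\<^esub> F.hm n (?v (i - ?p))" using v[OF i] by simp
  next
    interpret M: module E.G F.G by (rule G_module)
    show "(\<lambda>i. (gens @ ys) ! i \<odot>\<^bsub>F.G\<^esub> F.hm n (?v (i - ?p))) \<in> A \<rightarrow> carrier F.G"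
    proof (rule funcsetI, rule M.smult_closed)
      fix i assume i: "i \<in> A"
      then have j: "i - ?p < length yl" by auto
      show "(gens @ ys) ! i \<in> carrier E.G" unfolding ys_nth[OF i] by (rule E.hm_closed[OF yl_mem[OF j]])
      show "F.hm n (?v (i - ?p)) \<in> carrier F.G" by (rule F.hm_closed[OF vF[OF j]])
    qed
  qed simp
  also have "\<dots> = F.hm (n + 1) ?y" by (rule hm_comb[where v = ?v, OF n vF])
  finally have e: "F.hm (n + 1) z = F.hm (n + 1) ?y" .
  have K: "ideal ((Idl (set yl)) \<cdot> F n) R" by (rule ideal_prod_is_ideal[OF genideal_ideal[OF yc] F.F_id])
  have y: "?y \<in> (Idl (set yl)) \<cdot> F n"
  proof (rule finsum_ideal[OF K])
    fix j assume "j \<in> {..<length yl}"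
    then have j: "j < length yl" by simp
    show "yl ! j \<otimes> ?v j \<in> (Idl (set yl)) \<cdot> F n"
      by (rule ideal_prod.prod[OF _ vF[OF j]]) (use genideal_self[OF yc] j nth_mem in blast)
  qed
  have "?y \<in> F (n + 1)"
  proof (rule F.F_finsum)
    fix j assume "j \<in> {..<length yl}"
    then have j: "j < length yl" by simp
    show "yl ! j \<otimes> ?v j \<in> F (n + 1)" using EF[OF yl_mem[OF j] vF[OF j]] unfolding add.commute[of 1 n] .
  qed
  then have "z \<ominus> ?y \<in> F (n + 1 + 1)" by (rule F.hm_eqD[OF n1 z _ e])
  then show ?thesis using y by blast
qed

lemma reduction_data: "\<exists>gen \<gamma> rk. reduction_data E.G F.G E.gG F.gG gens ys \<delta> gen \<gamma> rk m0"
proof -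
  interpret S: cring E.G by (rule G_cring)
  obtain ps where ps: "\<forall>p\<in>set ps. fst p \<in> {0..N} \<and> snd p \<in> F (fst p)"
      "\<forall>b\<in>{0..N}. F b = Idl {g. (b, g) \<in> set ps}"
    using F.generator_list[OF noetherian finite_index_interval[of 0 N]] by blast
  let ?gen = "\<lambda>i. F.hm (fst (ps ! i)) (snd (ps ! i))" and ?\<gamma> = "\<lambda>i. fst (ps ! i)"
  have gy: "(gens @ ys) ! i \<in> E.gG (\<delta> i)" if "i < length (gens @ ys)" for i
  proof (cases "i < length gens")
    case True
    then show ?thesis using gens_degree(2) by (simp add: nth_append)
  next
    case False
    then have "i \<in> A" "i - length gens < length yl" using that by auto
    then show ?thesis using E.gG_I[OF yl_mem] ys_nth False by (simp add: \<delta>_def)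
  qed
  have "reduction_data E.G F.G E.gG F.gG gens ys \<delta> ?gen ?\<gamma> (length ps) m0"
  proof (intro reduction_data.intro reduction_setup.intro cech_setup.intro
      cech_setup_axioms.intro reduction_setup_axioms.intro reduction_data_axioms.intro)
    show "graded_module E.G F.G E.gG F.gG" by (rule G_graded)
    show "(gens @ ys) ! i \<in> E.gG (\<delta> i)" if "i \<in> {..<length (gens @ ys)}" for i using gy that by simp
    show "\<delta> i = 1" if "i \<in> A" for i using that by (simp add: \<delta>_def)
    show "1 \<le> \<delta> i" if "i \<in> {..<length gens}" for i using gens_degree(1) that by simp
    show "F.gG n \<subseteq> {\<zero>\<^bsub>F.G\<^esub>}" if "\<not> 0 \<le> n" for n using F.gG_neg[OF that] by simp
  next
    fix j assume j: "j \<in> A"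
    then have j': "j - length gens < length yl" by auto
    have "E.hm 1 (yl ! (j - length gens)) \<in> Idl\<^bsub>E.G\<^esub> (set gens)"
      using hm_irrelevant[OF order_refl yl_mem[OF j']] gens unfolding homogeneous_generators_def by simp
    then obtain c where c: "\<forall>i<length gens. c i \<in> E.gG (1 - \<delta> i)"
        "E.hm 1 (yl ! (j - length gens)) = (\<Oplus>\<^bsub>E.G\<^esub>i\<in>{..<length gens}. c i \<otimes>\<^bsub>E.G\<^esub> gens ! i)"
      using homogeneous_comb[OF gens_degree(2) E.gG_I[OF yl_mem[OF j']]] by blast
    have "(\<Oplus>\<^bsub>E.G\<^esub>i\<in>{..<length gens}. c i \<otimes>\<^bsub>E.G\<^esub> gens ! i) = (\<Oplus>\<^bsub>E.G\<^esub>i\<in>{..<length gens}. c i \<otimes>\<^bsub>E.G\<^esub> (gens @ ys) ! i)"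
    proof (rule E.G.finsum_cong')
      show "(\<lambda>i. c i \<otimes>\<^bsub>E.G\<^esub> (gens @ ys) ! i) \<in> {..<length gens} \<rightarrow> carrier E.G"
      proof (rule funcsetI, rule S.m_closed)
        fix i assume i: "i \<in> {..<length gens}"
        show "c i \<in> carrier E.G" by (rule E.gG_closed[OF c(1)[rule_format]]) (use i in simp)
        show "(gens @ ys) ! i \<in> carrier E.G" using E.gG_closed[OF gy] i by simp
      qed
    qed (simp_all add: nth_append)
    then show "\<exists>c. (\<forall>i\<in>{..<length gens}. c i \<in> E.gG (1 - \<delta> i)) \<and>
        (gens @ ys) ! j = (\<Oplus>\<^bsub>E.G\<^esub>i\<in>{..<length gens}. c i \<otimes>\<^bsub>E.G\<^esub> (gens @ ys) ! i)"
      unfolding ys_nth[OF j] c(2) using c(1) by (intro exI[of _ c]) simp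
  next
    fix x assume "x \<in> carrier F.G"
    then obtain u where u: "u \<in> F.lifts" "x = F.cls u" by (rule F.G_cases)
    show "\<exists>Q u. finite Q \<and> (\<forall>n\<in>Q. u n \<in> F.gG n) \<and> x = (\<Oplus>\<^bsub>F.G\<^esub>n\<in>Q. u n)"
    proof (intro exI conjI ballI)
      show "finite {n. 0 \<le> n \<and> u n \<noteq> \<zero>}" by (rule F.lifts_fin[OF u(1)])
      show "F.hm n (u n) \<in> F.gG n" if "n \<in> {n. 0 \<le> n \<and> u n \<noteq> \<zero>}" for n
        by (rule F.gG_I, rule F.liftsD[OF u(1)]) (use that in simp)
      show "x = (\<Oplus>\<^bsub>F.G\<^esub>n\<in>{n. 0 \<le> n \<and> u n \<noteq> \<zero>}. F.hm n (u n))" unfolding u(2) by (rule F.G_hom_decomp[OF u(1)])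
    qed
  next
    fix i assume "i < length ps"
    then show "?gen i \<in> F.gG (?\<gamma> i)" using F.gG_I ps(1) nth_mem by blast
  next
    fix x \<nu> H
    assume x: "x \<in> F.gG \<nu>" and H: "\<zero>\<^bsub>F.G\<^esub> \<in> H" "\<And>y z. y \<in> H \<Longrightarrow> z \<in> H \<Longrightarrow> y \<oplus>\<^bsub>F.G\<^esub> z \<in> H"
      and step: "\<And>i s. i < length ps \<Longrightarrow> s \<in> E.gG (\<nu> - ?\<gamma> i) \<Longrightarrow> s \<odot>\<^bsub>F.G\<^esub> ?gen i \<in> H"
    show "x \<in> H" using x
    proof (rule F.gG_cases)
      assume "x = \<zero>\<^bsub>F.G\<^esub>"
      then show ?thesis using H(1) by simp
    next
      fix z assume n: "0 \<le> \<nu>" and z: "z \<in> F \<nu>" "x = F.hm \<nu> z"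
      \<comment> \<open>\<open>box_F\<close> writes elements of \<open>F \<nu>\<close> through
        \<open>F ?t\<close>, whose generators are in the list because \<open>?t\<close> lies in the
        box.\<close>
      let ?t = "inf \<nu> N"
      have t: "0 \<le> ?t" "?t \<in> {0..N}" using n N_nonneg by simp_all
      have z': "z \<in> E (\<nu> - ?t) \<cdot> F ?t" using box_F[OF n] z(1) by blast
      have "F.hm ((\<nu> - ?t) + ?t) z \<in> H"
      proof (rule hm_prod_span[OF z' _ t(1) _ _ H])
        show "0 \<le> \<nu> - ?t" by simp
        show "{g. (?t, g) \<in> set ps} \<subseteq> F ?t" using ps(1) by auto
        show "F ?t = Idl {g. (?t, g) \<in> set ps}" using ps(2) t(2) by blast
        fix r g assume r: "r \<in> E (\<nu> - ?t)" and "g \<in> {g. (?t, g) \<in> set ps}"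
        then obtain i where i: "i < length ps" "ps ! i = (?t, g)" by (auto simp: in_set_conv_nth)
        then show "E.hm (\<nu> - ?t) r \<odot>\<^bsub>F.G\<^esub> F.hm ?t g \<in> H" using step[OF i(1), of "E.hm (\<nu> - ?t) r"] E.gG_I[OF r] by simp
      qed
      then show ?thesis using z(2) by simp
    qed
  next
    fix n x assume n: "m0 \<le> n" and x: "x \<in> F.gG (n + 1)"
    have "0 \<le> n" using m0_nonneg n by (rule order_trans)
    then have "red n" by (rule red_of_ideal) (rule eventual_reduction[OF n])
    then show "\<exists>w. (\<forall>i\<in>A. w i \<in> F.gG n) \<and> x = (\<Oplus>\<^bsub>F.G\<^esub>i\<in>A. (gens @ ys) ! i \<odot>\<^bsub>F.G\<^esub> w i)"
      using x unfolding red_def by blast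
  qed
  then show ?thesis by blast
qed

theorem lc_vanishes_of_reduction:
  assumes r: "0 \<le> r" "\<And>n. r \<le> n \<Longrightarrow> F (n + 1) \<subseteq> (Idl (set yl)) \<cdot> F n" and d: "1 \<le> length yl"
    and i: "length yl < i \<or> length yl = i \<and> r \<le> n + of_nat (length yl - 1)"
  shows "lc_vanishes E.G E.gG F.G F.gG i n"
proof -
  obtain gen \<gamma> rk where D: "reduction_data E.G F.G E.gG F.gG gens ys \<delta> gen \<gamma> rk m0" using reduction_data by blast
  show ?thesis unfolding lc_vanishes_gens
  proof (rule reduction_data.vanishing_of_red[OF D])
    fix n :: "'s \<Rightarrow> int" assume n: "r \<le> n"
    have "red n" by (rule red_of_ideal[OF order_trans[OF r(1) n] r(2)[OF n]])
    then show "reduction_data.red_at F.G F.gG gens ys n" unfolding reduction_data.red_at_def[OF D] red_def .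
  qed (use d i in simp_all)
qed

lemma red_of_lc_vanishes:
  assumes "\<And>i. i \<le> length yl \<Longrightarrow> lc_vanishes E.G E.gG F.G F.gG i (n + 1 - of_nat i)"
  shows "red n"
  unfolding red_def
proof
  fix x assume x: "x \<in> F.gG (n + 1)"
  obtain gen \<gamma> rk where D: "reduction_data E.G F.G E.gG F.gG gens ys \<delta> gen \<gamma> rk m0" using reduction_data by blast
  have "\<exists>w. (\<forall>i\<in>A. w i \<in> F.gG (n + 1 - 1)) \<and> x = (\<Oplus>\<^bsub>F.G\<^esub>i\<in>A. (gens @ ys) ! i \<odot>\<^bsub>F.G\<^esub> w i)"
    by (rule reduction_data.red_of_vanishing[OF D assms[unfolded lc_vanishes_gens] x]) simp
  then show "\<exists>w. (\<forall>i\<in>A. w i \<in> F.gG n) \<and> x = (\<Oplus>\<^bsub>F.G\<^esub>i\<in>A. (gens @ ys) ! i \<odot>\<^bsub>F.G\<^esub> w i)" by simp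
qed

end

context reduction_pair
begin

text \<open>Successive approximation: each application of \<open>ideal_of_red\<close> pushes the
  error one step up the diagonal. The corrections come from smaller ideals
  \<open>F (n + k e)\<close>, so they all stay in the product with \<open>F n\<close>.\<close>

lemma ev_red_shift:
  assumes q: "0 \<le> n" "\<And>n'. n \<le> n' \<Longrightarrow> red n'" and z: "z \<in> F (n + 1)"
  shows "\<exists>y\<in>(Idl (set yl)) \<cdot> F n. z \<ominus> y \<in> F (n + 1 + of_nat k)"
proof (induction k)
  case 0
  have yc: "set yl \<subseteq> carrier R" using yl_E E.Fc by blast
  have K: "ideal ((Idl (set yl)) \<cdot> F n) R" by (rule ideal_prod_is_ideal[OF genideal_ideal[OF yc] F.F_id])
  have "z \<ominus> \<zero> = z" using F.Fc[OF z] by (simp add: minus_eq)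
  then have "z \<ominus> \<zero> \<in> F (n + 1 + of_nat 0)" using z by (simp only: of_nat_0 add_0_right)
  then show ?case using additive_subgroup.zero_closed[OF ideal.axioms(1)[OF K]] by (rule bexI)
next
  case (Suc k)
  have yc: "set yl \<subseteq> carrier R" using yl_E E.Fc by blast
  have K: "ideal ((Idl (set yl)) \<cdot> F n) R" by (rule ideal_prod_is_ideal[OF genideal_ideal[OF yc] F.F_id])
  let ?n = "n + of_nat k"
  have nn: "n \<le> ?n" using of_nat_fun_nonneg[of k] by simp
  obtain y where y: "y \<in> (Idl (set yl)) \<cdot> F n" "z \<ominus> y \<in> F (n + 1 + of_nat k)" using Suc by blast
  have e1: "n + 1 + of_nat k = ?n + 1" by (simp only: ac_simps)
  obtain y' where y': "y' \<in> (Idl (set yl)) \<cdot> F ?n" "(z \<ominus> y) \<ominus> y' \<in> F (?n + 1 + 1)"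
    using ideal_of_red[OF order_trans[OF q(1) nn] q(2)[OF nn]] y(2) unfolding e1 by blast
  have "y' \<in> (Idl (set yl)) \<cdot> F n" using y'(1) ideal_prod_mono[OF order_refl F.F_anti[OF nn]] by blast
  then have yy: "y \<oplus> y' \<in> (Idl (set yl)) \<cdot> F n" by (rule ideal_prod.sum[OF y(1)])
  have c: "y \<in> carrier R" "y' \<in> carrier R" "z \<in> carrier R"
    using ideal.Icarr[OF K y(1)] ideal.Icarr[OF K \<open>y' \<in> _ \<cdot> F n\<close>] F.Fc[OF z] by blast+
  have "z \<ominus> (y \<oplus> y') = (z \<ominus> y) \<ominus> y'" using c by (simp add: minus_eq minus_add a_ac)
  moreover have "?n + 1 + 1 = n + 1 + of_nat (Suc k)" by (simp only: of_nat_Suc ac_simps)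
  ultimately have "z \<ominus> (y \<oplus> y') \<in> F (n + 1 + of_nat (Suc k))" using y'(2) by metis
  then show ?case using yy by blast
qed

text \<open>The approximation is finite: once the error has passed \<open>m0\<close>,
  \<open>eventual_reduction\<close> places it in the product ideal.\<close>

lemma reduction_of_red:
  assumes q: "0 \<le> n" "\<And>n'. n \<le> n' \<Longrightarrow> red n'"
  shows "F (n + 1) \<subseteq> (Idl (set yl)) \<cdot> F n"
proof
  fix z assume z: "z \<in> F (n + 1)"
  have yc: "set yl \<subseteq> carrier R" using yl_E E.Fc by blast
  have K: "ideal ((Idl (set yl)) \<cdot> F n) R" by (rule ideal_prod_is_ideal[OF genideal_ideal[OF yc] F.F_id])
  interpret K: ideal "(Idl (set yl)) \<cdot> F n" R by (rule K)
  obtain k where k: "m0 \<le> of_nat k" using ex_of_nat_ge by blast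
  let ?n = "n + of_nat k"
  have nn: "n \<le> ?n" "m0 \<le> ?n" using of_nat_fun_nonneg[of k] q(1) k add_increasing[of n m0 "of_nat k"] by simp_all
  obtain y where y: "y \<in> (Idl (set yl)) \<cdot> F n" "z \<ominus> y \<in> F (n + 1 + of_nat k)" using ev_red_shift[OF q z] by blast
  have "n + 1 + of_nat k = ?n + 1" by (simp only: ac_simps)
  then have "z \<ominus> y \<in> (Idl (set yl)) \<cdot> F ?n" using y(2) eventual_reduction[OF nn(2)] by (metis subsetD)
  then have "z \<ominus> y \<in> (Idl (set yl)) \<cdot> F n" using ideal_prod_mono[OF order_refl F.F_anti[OF nn(1)]] by blast
  then have "(z \<ominus> y) \<oplus> y \<in> (Idl (set yl)) \<cdot> F n" using y(1) by (rule K.a_closed)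
  moreover have "(z \<ominus> y) \<oplus> y = z" using K.Icarr[OF y(1)] F.Fc[OF z] by (simp add: minus_eq a_assoc l_neg)
  ultimately show "z \<in> (Idl (set yl)) \<cdot> F n" by simp
qed

text \<open>
  If \<open>q\<close> had a negative entry, there would be some \<open>n \<ge> q\<close> with \<open>0 \<le> n + 1\<close> and zero component in
  degree \<open>n\<close>.  The reduction property propagates the zero component along the diagonal, so that
  \<open>F (n + 1) = F (n + 2) = \<dots>\<close>, and Nakayama's lemma gives \<open>F (n + 1) = 0\<close>.
\<close>

lemma red_bound_nonneg:
  assumes loc: "local_ring R \<mm>" "set yl \<subseteq> \<mm>" and nz: "\<And>n. F n \<noteq> {\<zero>}"
    and q: "\<And>n. q \<le> n \<Longrightarrow> red n"
  shows "0 \<le> q"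
proof (rule ccontr)
  assume "\<not> 0 \<le> q"
  then obtain j where j: "q j < 0" by (auto simp: le_fun_def not_le)
  \<comment> \<open>At \<open>j\<close> the value \<open>- 1\<close> is the largest negative one;
    elsewhere \<open>n\<close> is made nonnegative. So \<open>n\<close> lies above \<open>q\<close>,
    degree \<open>n\<close> is zero, and degree \<open>n + 1\<close> is nonnegative.\<close>
  define n where "n = (\<lambda>i. if i = j then - 1 else max 0 (q i))"
  have qn: "q \<le> n" using j by (simp add: n_def le_fun_def)
  have n1: "0 \<le> n + 1" by (simp add: n_def le_fun_def)
  have nneg: "\<not> 0 \<le> n" by (auto simp: n_def le_fun_def)
  interpret M: module E.G F.G by (rule G_module)
  have zero: "F.gG (n + of_nat k) = {\<zero>\<^bsub>F.G\<^esub>}" for k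
  proof (induction k)
    case 0
    have "n + of_nat 0 = n" by simp
    then show ?case using F.gG_neg[OF nneg] by metis
  next
    case (Suc k)
    have e: "n + of_nat (Suc k) = (n + of_nat k) + 1" by (simp only: of_nat_Suc ac_simps)
    have "q \<le> n + of_nat k" using qn of_nat_fun_nonneg[of k] by (rule add_increasing2[rotated])
    then have r: "red (n + of_nat k)" by (rule q)
    have "x = \<zero>\<^bsub>F.G\<^esub>" if xF: "x \<in> F.gG ((n + of_nat k) + 1)" for x
    proof -
      obtain w where w: "\<forall>i\<in>A. w i \<in> F.gG (n + of_nat k)" "x = (\<Oplus>\<^bsub>F.G\<^esub>i\<in>A. (gens @ ys) ! i \<odot>\<^bsub>F.G\<^esub> w i)"
        using bspec[OF r[unfolded red_def] xF] by (elim exE conjE)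
      show ?thesis unfolding w(2)
      proof (rule F.G.add.finprod_one_eqI)
        fix i assume i: "i \<in> A"
        then have "i - length gens < length yl" by auto
        then have "(gens @ ys) ! i \<in> carrier E.G" using E.hm_closed[OF yl_mem] ys_nth[OF i] by simp
        moreover have "w i = \<zero>\<^bsub>F.G\<^esub>" using bspec[OF w(1) i] Suc by simp
        ultimately show "(gens @ ys) ! i \<odot>\<^bsub>F.G\<^esub> w i = \<zero>\<^bsub>F.G\<^esub>" by simp
      qed
    qed
    then show ?case unfolding e using F.gG_zero by (intro equalityI subsetI) simp_all
  qed
  have stat: "F (n + 1) \<subseteq> F (n + 1 + of_nat k)" for k
  proof (induction k)
    case 0
    have "n + 1 + of_nat 0 = n + 1" by simp
    then show ?case by (metis order_refl)
  next
    case (Suc k)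
    let ?n = "n + 1 + of_nat k"
    have n0: "0 \<le> ?n" using n1 of_nat_fun_nonneg[of k] by (rule add_nonneg_nonneg)
    have e: "?n = n + of_nat (Suc k)" "n + 1 + of_nat (Suc k) = ?n + 1" by (simp_all only: of_nat_Suc ac_simps)
    have "F ?n \<subseteq> F (?n + 1)"
    proof
      fix x assume x: "x \<in> F ?n"
      have "F.hm ?n x \<in> F.gG ?n" by (rule F.gG_I[OF x])
      then have "F.hm ?n x = \<zero>\<^bsub>F.G\<^esub>" using zero[of "Suc k"] unfolding e(1) by blast
      then have "F.hm ?n x = F.hm ?n \<zero>" by (simp only: F.hm_zero)
      then have "x \<ominus> \<zero> \<in> F (?n + 1)" by (rule F.hm_eqD[OF n0 x F.F_zero])
      then show "x \<in> F (?n + 1)" using F.Fc[OF x] by (simp only: minus_eq minus_zero r_zero)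
    qed
    then show ?case using Suc unfolding e(2) by (rule order_trans[rotated])
  qed
  obtain k where k: "m0 \<le> of_nat k" using ex_of_nat_ge by blast
  let ?n = "n + 1 + of_nat k"
  have mn: "m0 \<le> ?n" using n1 k by (rule add_increasing)
  \<comment> \<open>Past \<open>m0\<close> one factor of the ideal of \<open>yl\<close>, hence of
    \<open>\<mm>\<close>, can be split off from the stationary ideal, which is the situation of
    \<open>nakayama\<close>.\<close>
  have "F (n + 1) \<subseteq> F (?n + 1)" using stat[of "Suc k"] by (simp only: of_nat_Suc ac_simps)
  also have "\<dots> \<subseteq> (Idl (set yl)) \<cdot> F ?n" by (rule eventual_reduction[OF mn])
  also have "\<dots> \<subseteq> \<mm> \<cdot> F (n + 1)"
  proof (rule ideal_prod_mono)
    have "ideal \<mm> R" using loc(1) unfolding local_ring_def by (simp add: maximalideal.axioms(1))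
    then show "Idl (set yl) \<subseteq> \<mm>" using loc(2) by (rule genideal_minimal)
    have "n + 1 \<le> ?n" using of_nat_fun_nonneg[of k] by simp
    then show "F ?n \<subseteq> F (n + 1)" by (rule F.F_anti)
  qed
  finally have "F (n + 1) = {\<zero>}" by (rule nakayama[OF noetherian loc(1) F.F_id])
  then show False using nz by blast
qed

text \<open>For \<open>n \<ge> q\<close> the vanishing wanted by \<open>red_of_lc_vanishes\<close>
  is in degrees \<open>n + 1 - i\<close> along the diagonal. Regularity supplies these, because
  \<open>n + 1 - m\<close> has all entries at least \<open>d\<close>.\<close>

theorem reduction_of_regularity:
  assumes loc: "local_ring R \<mm>" "set yl \<subseteq> \<mm>" and nz: "\<And>n. F n \<noteq> {\<zero>}" and d: "1 \<le> length yl"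
    and m: "m \<in> reg E.G E.gG F.G F.gG"
  defines "q \<equiv> m + of_nat (length yl - 1)"
  shows "0 \<le> q" "q \<le> n \<Longrightarrow> F (n + 1) \<subseteq> (Idl (set yl)) \<cdot> F n"
proof -
  have red: "red n" if n: "q \<le> n" for n
  proof (rule red_of_lc_vanishes)
    fix i assume i: "i \<le> length yl"
    have n': "m k + int (length yl) \<le> n k + 1" for k
      using n d le_funD[of q n k] by (simp add: q_def of_nat_diff)
    \<comment> \<open>An arbitrary coordinate, used below as the place that carries all of
      \<open>p\<close>.\<close>
    fix j :: 's
    show "lc_vanishes E.G E.gG F.G F.gG i (n + 1 - of_nat i)"
    proof (cases "i = 0")
      case True
      let ?k = "n + 1 - m - unit_index j"
      have "0 \<le> ?k l" for l using n'[of l] d by (auto simp: unit_index_def)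
      then have "0 \<le> ?k" by (simp add: le_fun_def)
      then have "lc_vanishes E.G E.gG F.G F.gG 0 (?k + m + unit_index j)" using m unfolding reg_def by blast
      moreover have "?k + m + unit_index j = n + 1 - of_nat i" using True by simp
      ultimately show ?thesis using True by metis
    next
      case False
      \<comment> \<open>All weight \<open>i - 1\<close> sits in coordinate \<open>j\<close>. Adding
        \<open>?p\<close> to the remaining distance keeps it nonnegative, as
        \<open>i \<le> d\<close>, and subtracting it again gives the diagonal degree.\<close>
      let ?p = "\<lambda>l. (int i - 1) * unit_index j l"
      let ?k = "n + 1 - of_nat i - m + ?p"
      have p: "0 \<le> ?p" using False by (simp add: le_fun_def unit_index_def)
      have "0 \<le> ?k l" for l using n'[of l] i le_funD[OF p, of l] by (auto simp: of_nat_diff)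
      then have k: "0 \<le> ?k" by (simp add: le_fun_def)
      have "(\<Sum>l\<in>UNIV. ?p l) = (\<Sum>l\<in>UNIV. if l = j then int i - 1 else 0)"
        by (rule sum.cong) (simp_all add: unit_index_def)
      then have s: "(\<Sum>l\<in>UNIV. ?p l) = int i - 1" by simp
      have i1: "1 \<le> i" using False by simp
      have "lc_vanishes E.G E.gG F.G F.gG i (?k + m - ?p)"
        using m k i1 p s unfolding reg_def mem_Collect_eq by blast
      moreover have "?k + m - ?p = n + 1 - of_nat i" by simp
      ultimately show ?thesis by metis
    qed
  qed
  show q0: "0 \<le> q" by (rule red_bound_nonneg[OF loc nz red])
  show "F (n + 1) \<subseteq> (Idl (set yl)) \<cdot> F n" if "q \<le> n"
    by (rule reduction_of_red[OF order_trans[OF q0 that]]) (use red that order_trans in blast)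
qed

text \<open>For \<open>i > d\<close> the cohomology vanishes in all degrees. For
  \<open>i = d\<close> each entry of \<open>p\<close> is at most \<open>d - 1\<close>, so
  \<open>n + r - p\<close> stays above \<open>r - (d - 1)\<close>.\<close>

theorem reg_from_of_reduction:
  assumes r: "0 \<le> r" "\<And>n. r \<le> n \<Longrightarrow> F (n + 1) \<subseteq> (Idl (set yl)) \<cdot> F n" and d: "1 \<le> length yl"
  shows "r \<in> reg_from (length yl) E.G E.gG F.G F.gG"
  unfolding reg_from_def
proof (intro CollectI allI impI)
  fix i n p
  assume i: "length yl \<le> i" and n: "0 \<le> (n :: 's \<Rightarrow> int)" and p: "0 \<le> (p :: 's \<Rightarrow> int)" "(\<Sum>l\<in>UNIV. p l) = int i - 1"
  show "lc_vanishes E.G E.gG F.G F.gG i (n + r - p)"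
  proof (rule lc_vanishes_of_reduction[OF r d])
    have "r \<le> n + r - p + of_nat (length yl - 1)" if "length yl = i"
    proof (rule le_funI)
      fix l
      have "p l \<le> (\<Sum>l\<in>UNIV. p l)" by (rule member_le_sum) (use p(1) in \<open>simp_all add: le_fun_def\<close>)
      then show "r l \<le> (n + r - p + of_nat (length yl - 1)) l"
        using p(2) n that d by (simp add: le_fun_def of_nat_diff)
    qed
    then show "length yl < i \<or> length yl = i \<and> r \<le> n + r - p + of_nat (length yl - 1)" using i by auto
  qed
qed

end

text \<open>The first element of a regular sequence is a nonzerodivisor, as the ideal of the empty
  sequence is zero. Its powers are then nonzero by induction from
  \<open>\<one> \<noteq> \<zero>\<close>; the latter holds because a regular sequence generates a
  proper ideal.\<close>

lemma (in cring) regular_element_of_grade: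
  assumes "1 \<le> grade R J"
  shows "\<exists>z\<in>J. z \<in> carrier R \<and> (\<forall>k::nat. z [^] k \<noteq> \<zero>)"
proof -
  have "\<exists>xs. regular_sequence R xs \<and> set xs \<subseteq> J \<and> xs \<noteq> []"
  proof (rule ccontr)
    assume "\<not> (\<exists>xs. regular_sequence R xs \<and> set xs \<subseteq> J \<and> xs \<noteq> [])"
    then have "grade R J \<le> 0" unfolding grade_def by (auto intro!: Sup_least simp: zero_enat_def)
    then show False using assms by simp
  qed
  then obtain xs where xs: "regular_sequence R xs" "set xs \<subseteq> J" "xs \<noteq> []" by blast
  then obtain z zs where z: "xs = z # zs" by (cases xs) auto
  have zc: "z \<in> carrier R" and proper: "Idl (set xs) \<noteq> carrier R"
    using xs(1) z unfolding regular_sequence_def by auto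
  have E: "Idl {} = {\<zero>}"
    using genideal_minimal[OF zeroideal, of "{}"] additive_subgroup.zero_closed[OF ideal.axioms(1)[OF genideal_ideal[of "{}"]]]
    by auto
  have reg: "a = \<zero>" if "a \<in> carrier R" "z \<otimes> a = \<zero>" for a
  proof -
    have "\<forall>a\<in>carrier R. xs ! 0 \<otimes> a \<in> Idl (set (take 0 xs)) \<longrightarrow> a \<in> Idl (set (take 0 xs))"
      using xs(1,3) unfolding regular_sequence_def by blast
    then show ?thesis using that unfolding z by (simp add: E)
  qed
  have "\<one> \<noteq> \<zero>"
  proof
    assume "\<one> = \<zero>"
    then have c: "carrier R = {\<zero>}" using one_zeroD by simp
    have I: "ideal (Idl (set xs)) R" using xs(1) unfolding regular_sequence_def by (intro genideal_ideal) simp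
    have "Idl (set xs) \<subseteq> carrier R" using ideal.Icarr[OF I] by blast
    moreover have "\<zero> \<in> Idl (set xs)" by (rule additive_subgroup.zero_closed[OF ideal.axioms(1)[OF I]])
    ultimately show False using proper c by auto
  qed
  have "z [^] k \<noteq> \<zero>" for k :: nat
  proof (induction k)
    case 0
    then show ?case using \<open>\<one> \<noteq> \<zero>\<close> by simp
  next
    case (Suc k)
    then show ?case using reg[of "z [^] k"] zc by (auto simp: m_comm)
  qed
  then show ?thesis using xs(2) z zc by auto
qed

theorem theorem3p6:
  fixes R :: "('a, 'b) ring_scheme"
    and \<mm> :: "'a set"
    and d :: nat
    and I :: "'s::finite \<Rightarrow> 'a set"
    and F :: "('s \<Rightarrow> int) \<Rightarrow> 'a set"
    and x :: "'s \<Rightarrow> nat \<Rightarrow> 'a"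
  assumes "noetherian_ring R"
    and "local_ring R \<mm>"
    and "krull_dim R = enat d"
    and "d \<ge> 1"
    and "infinite (carrier (R Quot \<mm>))"
    and "\<forall>i. primary_to R \<mm> (I i)"
    and "grade R (\<Otimes>\<^bsub>ideals_set R\<^esub> i\<in>UNIV. I i) \<ge> 1"
    and "admissible_filtration R I F"
    and "complete_reduction R I d x F"
  shows "let GI = assoc_graded R (multi_power R I); gI = gr_component R (multi_power R I);
             GF = assoc_graded R F; gF = gr_component R F
         in
           (\<forall>m \<in> reg GI gI GF gF. m + (\<lambda>_. int d - 1) \<in> reduction_vectors R d x F) \<and>
           (\<forall>r \<in> reduction_vectors R d x F.
              (\<forall>n \<ge> r - (\<lambda>_. int d - 1). lc_vanishes GF gF GF gF d n) \<and>
              r \<in> reg_from d GI gI GF gF)"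
proof -
  interpret cring R using assms(2) unfolding local_ring_def by blast
  have I: "ideal (I i) R" "ideal_radical R (I i) = \<mm>" for i using assms(6) unfolding primary_to_def by auto
  interpret ip: ideal_powers R I by (intro ideal_powers.intro ideal_powers_axioms.intro is_cring I(1))
  let ?E = "multi_power R I"
  have "multi_filtration R I F" and fin: "finite_module (ext_rees R ?E) (ext_rees R F)"
    using assms(8) unfolding admissible_filtration_def by auto
  then have F: "\<And>n. ideal (F n) R" "\<And>n. ?E n \<subseteq> F n" "\<And>n m. F n \<cdot>\<^bsub>R\<^esub> F m \<subseteq> F (n + m)" "\<And>n m. n \<le> m \<Longrightarrow> F m \<subseteq> F n"
    unfolding multi_filtration_def by auto
  have FF: "a \<otimes>\<^bsub>R\<^esub> b \<in> F (n + m)" if "a \<in> F n" "b \<in> F m" for a b n m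
    using subsetD[OF F(3) ideal_prod.prod[OF that]] .
  have fE: "ideal_family R ?E"
    by (intro ideal_family.intro ideal_family_axioms.intro is_cring ip.mp_ideal ip.mp_anti)
  have fF: "ideal_family R F"
    by (intro ideal_family.intro ideal_family_axioms.intro is_cring F(1,4))
  have pEF: "filtration_pair R ?E F"
  proof (intro filtration_pair.intro filtration_pair_axioms.intro is_cring fE fF)
    show "a \<otimes>\<^bsub>R\<^esub> b \<in> ?E (n + m)" if "a \<in> ?E n" "b \<in> ?E m" for a b n m using that by (rule ip.mp_closed)
    show "a \<otimes>\<^bsub>R\<^esub> b \<in> F (n + m)" if "a \<in> ?E n" "b \<in> F m" for a b n m by (rule FF[OF subsetD[OF F(2) that(1)] that(2)])
    show "\<one>\<^bsub>R\<^esub> \<in> ?E 0" by (rule ip.mp_one)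
  qed
  have pFF: "filtration_pair R F F"
  proof (intro filtration_pair.intro filtration_pair_axioms.intro is_cring fF)
    show "a \<otimes>\<^bsub>R\<^esub> b \<in> F (n + m)" if "a \<in> F n" "b \<in> F m" for a b n m using that by (rule FF)
    then show "a \<otimes>\<^bsub>R\<^esub> b \<in> F (n + m)" if "a \<in> F n" "b \<in> F m" for a b n m using that .
    show "\<one>\<^bsub>R\<^esub> \<in> F 0" by (rule subsetD[OF F(2) ip.mp_one])
  qed
  obtain N where N: "1 \<le> N" "\<And>n. 0 \<le> n \<Longrightarrow> F n \<subseteq> ?E (n - inf n N) \<cdot>\<^bsub>R\<^esub> F (inf n N)"
    using ip.box_of_finite_module[OF pEF fin] by blast
  have N0: "0 \<le> N" using N(1) by (rule order_trans[rotated]) (simp add: le_fun_def)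
  define yl where "yl = map (\<lambda>j. \<Otimes>\<^bsub>R\<^esub>i\<in>UNIV. x i j) [1..<Suc d]"
  have ly: "length yl = d" by (simp add: yl_def)
  have xI: "x i j \<in> I i" if "j \<in> {1..d}" for i j using assms(9) that unfolding complete_reduction_def by blast
  have RI: "reduction_ideal R d x = Idl\<^bsub>R\<^esub> (set yl)"
    unfolding reduction_ideal_def yl_def set_map set_upt atLeastLessThanSuc_atLeastAtMost ..
  have yE: "set yl \<subseteq> ?E 1"
  proof
    fix y assume "y \<in> set yl"
    then obtain j where "j \<in> {1..d}" "y = (\<Otimes>\<^bsub>R\<^esub>i\<in>UNIV. x i j)"
      unfolding yl_def set_map set_upt atLeastLessThanSuc_atLeastAtMost by (rule imageE)
    then show "y \<in> ?E 1" using ip.finprod_mem_mp[of "\<lambda>i. x i j"] xI by simp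
  qed
  have ym: "set yl \<subseteq> \<mm>"
  proof
    fix y assume "y \<in> set yl"
    then have y: "y \<in> ?E 1" using yE by blast
    fix i :: 's
    \<comment> \<open>A product of ideals lies in each of its factors, and \<open>I i\<close> lies
      in its radical \<open>\<mm>\<close>; any index \<open>i\<close> will do.\<close>
    have "?E 1 = I i \<cdot>\<^bsub>R\<^esub> (\<Otimes>\<^bsub>ideals_set R\<^esub> k\<in>UNIV - {i}. I k)"
      unfolding ip.mp_one_eq ip.P_simps(2)[symmetric]
      using ip.P.finprod_insert[of "UNIV - {i}" i I] by (simp add: ip.P_simps I(1) insert_absorb Pi_def)
    moreover have "ideal (\<Otimes>\<^bsub>ideals_set R\<^esub> k\<in>UNIV - {i}. I k) R"
      unfolding ip.P_simps(1)[symmetric] by (rule ip.P.finprod_closed) (simp add: ip.P_simps I(1))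
    ultimately have "y \<in> I i" using y ideal_prod_inter[OF I(1)] by blast
    then have "y \<in> ideal_radical R (I i)"
      unfolding ideal_radical_def using ideal.Icarr[OF I(1)] nat_pow_eone by (intro CollectI conjI exI[of _ 1]) auto
    then show "y \<in> \<mm>" unfolding I(2) .
  qed
  obtain m0 where m0: "0 \<le> m0" "\<And>n. m0 \<le> n \<Longrightarrow> (Idl\<^bsub>R\<^esub> (set yl)) \<cdot>\<^bsub>R\<^esub> F n = F (n + 1)"
    using assms(9) unfolding complete_reduction_def RI by blast
  interpret EF: reduction_pair R ?E F N m0 yl
  proof (intro reduction_pair.intro reduction_pair_axioms.intro pEF assms(1) N m0(1) yE)
    show "?E n \<subseteq> ?E (n - inf n N) \<cdot>\<^bsub>R\<^esub> ?E (inf n N)" if "0 \<le> n" for n using ip.mp_box[OF that N0] by simp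
    show "F (n + 1) \<subseteq> (Idl\<^bsub>R\<^esub> (set yl)) \<cdot>\<^bsub>R\<^esub> F n" if "m0 \<le> n" for n using m0(2)[OF that] by simp
  qed
  \<comment> \<open>The second instance, with $G(F)$ acting on itself. Its box condition follows
    from the one over the powers of \<open>I\<close>, since these powers are contained in
    \<open>F\<close>.\<close>
  interpret FF: reduction_pair R F F N m0 yl
  proof (intro reduction_pair.intro reduction_pair_axioms.intro pFF assms(1) N(1) m0(1))
    have FN: "F n \<subseteq> F (n - inf n N) \<cdot>\<^bsub>R\<^esub> F (inf n N)" if "0 \<le> n" for n
      using N(2)[OF that] ideal_prod_mono[OF F(2) order_refl] by (rule order_trans)
    show "F n \<subseteq> F (n - inf n N) \<cdot>\<^bsub>R\<^esub> F (inf n N)" if "0 \<le> n" for n using that by (rule FN)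
    show "F n \<subseteq> F (n - inf n N) \<cdot>\<^bsub>R\<^esub> F (inf n N)" if "0 \<le> n" for n using that by (rule FN)
    show "set yl \<subseteq> F 1" using yE F(2) by (rule order_trans)
    show "F (n + 1) \<subseteq> (Idl\<^bsub>R\<^esub> (set yl)) \<cdot>\<^bsub>R\<^esub> F n" if "m0 \<le> n" for n using m0(2)[OF that] by simp
  qed
  have incl: "(Idl\<^bsub>R\<^esub> (set yl)) \<cdot>\<^bsub>R\<^esub> F n \<subseteq> F (n + 1)" for n
  proof -
    have "Idl\<^bsub>R\<^esub> (set yl) \<subseteq> ?E 1" by (rule genideal_minimal[OF ip.mp_ideal yE])
    then have "(Idl\<^bsub>R\<^esub> (set yl)) \<cdot>\<^bsub>R\<^esub> F n \<subseteq> ?E 1 \<cdot>\<^bsub>R\<^esub> F n" by (rule ideal_prod_mono) simp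
    also have "\<dots> \<subseteq> F (1 + n)" by (rule filtration_pair.EF_prod[OF pEF])
    finally show ?thesis unfolding add.commute[of 1 n] .
  qed
  \<comment> \<open>The inclusion from left to right in the definition of a reduction vector is
    automatic by \<open>incl\<close>, so only the other one has to be tracked.\<close>
  have RV: "r \<in> reduction_vectors R d x F \<longleftrightarrow> 0 \<le> r \<and> (\<forall>n\<ge>r. F (n + 1) \<subseteq> (Idl\<^bsub>R\<^esub> (set yl)) \<cdot>\<^bsub>R\<^esub> F n)" for r
    unfolding reduction_vectors_def RI using incl by auto
  obtain z where z: "z \<in> ?E 1" "\<And>k::nat. z [^]\<^bsub>R\<^esub> k \<noteq> \<zero>\<^bsub>R\<^esub>"
    using regular_element_of_grade[OF assms(7)] unfolding ip.mp_one_eq by blast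
  \<comment> \<open>Every \<open>F n\<close> contains a product of powers of the \<open>I i\<close>,
    hence a high power of the nonzerodivisor \<open>z\<close>.\<close>
  have nz: "F n \<noteq> {\<zero>\<^bsub>R\<^esub>}" for n
  proof -
    obtain k where k: "n \<le> of_nat k" using ex_of_nat_ge by blast
    have "z [^]\<^bsub>R\<^esub> k \<in> F n" using ip.mp_pow[OF z(1)] ip.mp_anti[OF k] F(2) by blast
    then show ?thesis using z(2)[of k] by auto
  qed
  have dd: "(\<lambda>_::'s. int d - 1) = of_nat (length yl - 1)" using assms(4) by (auto simp: ly of_nat_diff)
  have d1: "1 \<le> length yl" using assms(4) by (simp add: ly)
  have "m + (\<lambda>_. int d - 1) \<in> reduction_vectors R d x F"
    if m: "m \<in> reg (assoc_graded R ?E) (gr_component R ?E) (assoc_graded R F) (gr_component R F)" for m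
    unfolding RV dd using EF.reduction_of_regularity[OF assms(2) ym nz d1 m] by simp
  moreover have "lc_vanishes (assoc_graded R F) (gr_component R F) (assoc_graded R F) (gr_component R F) d n"
    if r: "r \<in> reduction_vectors R d x F" and n: "r - (\<lambda>_. int d - 1) \<le> n" for r n
  proof (rule FF.lc_vanishes_of_reduction[OF _ _ d1])
    show "0 \<le> r" "\<And>n. r \<le> n \<Longrightarrow> F (n + 1) \<subseteq> (Idl\<^bsub>R\<^esub> (set yl)) \<cdot>\<^bsub>R\<^esub> F n" using r unfolding RV by auto
    show "length yl < d \<or> length yl = d \<and> r \<le> n + of_nat (length yl - 1)"
      using n ly unfolding dd by (simp add: diff_le_eq)
  qed
  moreover have "r \<in> reg_from d (assoc_graded R ?E) (gr_component R ?E) (assoc_graded R F) (gr_component R F)"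
    if r: "r \<in> reduction_vectors R d x F" for r
    using EF.reg_from_of_reduction[OF _ _ d1, of r] r unfolding RV ly by auto
  ultimately show ?thesis unfolding Let_def by blast
qed

end
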